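(* Let $h>0$ and $H\in(0,1/2)$, let $$a^H_0=h^{H}\kappa(H)2^{1/2-H},\qquad a^H_k=h^{H}\kappa(H)\left(\left(k+\tfrac12\right)^{H-1/2}-\left(k-\tfrac12\right)^{H-1/2}\right)\ (k\ge1),\qquad \kappa(H)=\frac{\sqrt{\sin(\pi H)\Gamma(2H+1)}}{\Gamma(H+1/2)},$$ and let $b^H_0=1/a^H_0$, $b^H_k=-\frac{1}{a^H_0}\sum_{l=1}^{k}a^H_l b^H_{k-l}$ for $k\ge1$. Then there exists $C''_{h,H}>0$ such that $$\forall k\geqslant0,\quad |b^H_k|\leqslant C''_{h,H}(k+1)^{-(H+1/2)}.$$ Moreover, let $(\Delta_n)_{n\in\mathbb{Z}}$ be the stationary Gaussian sequence $\Delta_n=\sum_{k=0}^{+\infty}a_k^H\xi_{n-k}$ with $(\xi_k)_{k\in\mathbb{Z}}$ i.i.d. $\mathcal{N}(0,I_d)$, and let $F:\mathbb{R}^d\times\mathbb{R}^d\to\mathbb{R}^d$ be continuous and satisfy the hypotheses $(\mathbf{H_1})$ and $(\mathbf{H_2})$ stated in the context. Then, for the dynamics $X_{n+1}=F(X_n,\Delta_{n+1})$, $n\ge0$, an invariant distribution $\mu_\star$ exists and is unique (in the sense of the context), and for every initial distribution $\mu_0$ with $\int_{\mathcal{X}}V(x)\,\Pi_{\mathcal{X}}^*\mu_0(dx)<+\infty$ and every $\varepsilon>0$ there exists $C_\varepsilon>0$ such that for all $n\ge1$ $$\|\mathcal{L}((X^{\mu_0}_{n+k})_{k\geqslant0})-\mathcal{S}\mu_\star\|_{TV}\leqslant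 C_\varepsilon\, n^{-(v_H-\varepsilon)},\qquad v_H=\begin{cases}H(1-2H)&\text{if }H\in(0,1/4],\\[2pt] \frac18&\text{if }H\in(1/4,1/2).\end{cases}$$ Here $v_H=v(\beta,\rho)$ with $\rho=3/2-H$ and $\beta=H+1/2$, where $v(\beta,\rho)=\sup_{\alpha\in(\frac12\vee(\frac32-\beta),\rho)}\min\{1,2(\rho-\alpha)\}(\min\{\alpha,\beta,\alpha+\beta-1\}-\frac12)$.
   Context: Notation. $d\ge1$ is fixed, $\mathcal{X}:=\mathbb{R}^d$, $\mathbb{Z}^-:=\{0,-1,-2,\dots\}$, $\mathcal{W}:=(\mathbb{R}^d)^{\mathbb{Z}^-}$; $\Gamma$ is the Gamma function; $|\cdot|$ is the Euclidean norm; $B(0,K)$ is the closed ball of $\mathbb{R}^d$ of radius $K$ centered at $0$; $f^*\mu$ is the pushforward of $\mu$ by $f$; $\Pi_{\mathcal{X}}$ is the projection of $\mathcal{X}\times\mathcal{W}$ onto $\mathcal{X}$; $J_f(x)$ is the Jacobian matrix; $\mathcal{L}$ denotes the law; $\|\mu-\nu\|_{TV}:=\sup_A|\mu(A)-\nu(A)|$ over measurable sets $A$. $\mathbb{P}_w$ denotes the law of $(\Delta_k)_{k\le0}$ on $\mathcal{W}$. Markovian structure. For $w\in\mathcal{W}$, $w'\in\mathbb{R}^d$, let $w\sqcup w'\in\mathcal{W}$ be given by $(w\sqcup w')_0=w'$ and $(w\sqcup w')_k=w_{k+1}$ for $k<0$, and let $\varphi((x,w),w'):=(F(x,w'),w\sqcup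 w')$. The process $(X_n,(\Delta_{n+k})_{k\le0})_{n\ge0}$ is realized through the (Feller) Markov transition kernel $\mathcal{Q}$ on $\mathcal{X}\times\mathcal{W}$ given by $\int g(x',w')\,\mathcal{Q}((x,w),(dx',dw'))=\int_{\mathbb{R}^d}g(\varphi((x,w),\delta))\,\mathcal{P}(w,d\delta)$, with $\mathcal{P}(w,d\delta):=\mathcal{L}(\Delta_{n+1}\mid(\Delta_{n+k})_{k\le0}=w)$. An initial distribution is the law on $\mathcal{X}\times\mathcal{W}$ of a couple $(X_0,(\Delta_k)_{k\le0})$; in particular its $\mathcal{W}$-marginal is $\mathbb{P}_w$. An invariant distribution is such a distribution $\mu$ with $\mathcal{Q}\mu=\mu$. For an initial distribution $\mu$, $(X^\mu_n)_{n\ge0}$ denotes the first component of the process realized through $\mathcal{Q}$ with initial distribution $\mu$, and $\mathcal{S}\mu$ denotes the law of $(X_n^\mu)_{n\ge0}$. Uniqueness of the invariant distribution is up to the equivalence relation $\mu\sim\nu\iff\mathcal{S}\mu=\mathcal{S}\nu$. Hypothesis $(\mathbf{H_1})$: there exist a continuous function $V:\mathcal{X}\to(0,+\infty)$ with $\lim_{|x|\to+\infty}V(x)=+\infty$, $\gamma\in(0,1)$ and $C>0$ such that $V(F(x,w))\le\gamma V(x)+C(1+|w|)$ for all $(x,w)\in\mathcal{X}\times\mathbb{R}^d$. The $V$ in the claim is this function. Hypothesis $(\mathbf{H_2})$: put $\tilde F(x,u,y):=F(x,u+y)$. For every $K>0$ there exist $\tilde K>0$, $C_{\tilde K}>0$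 and $M_K>0$ such that for every $\mathbf{x}=(x,x',y,y')\in B(0,K)^4$ there exists $\Lambda_{\mathbf{x}}:\mathbb{R}^d\to\mathbb{R}^d$ such that: (a) $\Lambda_{\mathbf{x}}$ is a bijection of $\mathbb{R}^d$ onto $\mathbb{R}^d$, and is a $\mathcal{C}^1$-diffeomorphism between two open sets $U$ and $D$ such that $\mathbb{R}^d\setminus U$ and $\mathbb{R}^d\setminus D$ are negligible; (b) for all $u\in B(0,\tilde K)$, $\tilde F(x,u,y)=\tilde F(x',\Lambda_{\mathbf{x}}(u),y')$ and $|\det(J_{\Lambda_{\mathbf{x}}}(u))|\ge C_{\tilde K}$; (c) for all $u\in\mathbb{R}^d$, $|\Lambda_{\mathbf{x}}(u)-u|\le M_K$. *)

theory Defs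
  imports "HOL-Probability.Probability"
begin

definition kappa :: "real \<Rightarrow> real" where
  "kappa H = sqrt (sin (pi * H) * Gamma (2 * H + 1)) / Gamma (H + 1/2)"

definition a_coeff :: "real \<Rightarrow> real \<Rightarrow> nat \<Rightarrow> real" where
  "a_coeff h H k =
     (if k = 0 then h powr H * kappa H * 2 powr (1/2 - H)
      else h powr H * kappa H * ((real k + 1/2) powr (H - 1/2) - (real k - 1/2) powr (H - 1/2)))"

fun b_coeff :: "real \<Rightarrow> real \<Rightarrow> nat \<Rightarrow> real" where
  "b_coeff h H 0 = 1 / a_coeff h H 0"
| "b_coeff h H (Suc k) =
     - (1 / a_coeff h H 0) * (\<Sum>l = 1..Suc k. a_coeff h H l * b_coeff h H (Suc k - l))"

definition v_exp :: "real \<Rightarrow> real \<Rightarrow> real" where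
  "v_exp \<beta> \<rho> =
     (SUP \<alpha> \<in> {max (1/2) (3/2 - \<beta>) <..< \<rho>}.
        min 1 (2 * (\<rho> - \<alpha>)) * (Min {\<alpha>, \<beta>, \<alpha> + \<beta> - 1} - 1/2))"

definition v_H :: "real \<Rightarrow> real" where
  "v_H H = (if H \<le> 1/4 then H * (1 - 2 * H) else 1/8)"

type_synonym 'd seq = "nat \<Rightarrow> (real, 'd) vec"
type_synonym 'd state = "(real, 'd) vec \<times> 'd seq"

definition std_gaussian :: "(real ^ 'd) measure" where
  "std_gaussian = density lborel
     (\<lambda>x. ennreal ((2 * pi) powr (- real CARD('d) / 2) * exp (- (norm x)\<^sup>2 / 2)))"

definition iid_std_gaussian :: "'w measure \<Rightarrow> (int \<Rightarrow> 'w \<Rightarrow> real ^ 'd) \<Rightarrow> bool" where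
  "iid_std_gaussian M \<xi> \<longleftrightarrow>
     prob_space.indep_vars M (\<lambda>_. borel) \<xi> UNIV \<and>
     (\<forall>k. distr M borel (\<xi> k) = std_gaussian)"

text \<open>
  The moving-average series is summed almost surely; \<open>\<Delta>\<close> may be any measurable version of its sum.
\<close>

definition moving_average ::
  "'w measure \<Rightarrow> (nat \<Rightarrow> real) \<Rightarrow> (int \<Rightarrow> 'w \<Rightarrow> real ^ 'd) \<Rightarrow> (int \<Rightarrow> 'w \<Rightarrow> real ^ 'd) \<Rightarrow> bool" where
  "moving_average M a \<xi> \<Delta> \<longleftrightarrow>
     (\<forall>n. \<Delta> n \<in> borel_measurable M \<and>
          (AE \<omega> in M. (\<lambda>k. a k *\<^sub>R \<xi> (n - int k) \<omega>) sums \<Delta> n \<omega>))"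

text \<open>
  A point \<open>w\<close> of the space of pasts, indexed by \<open>0, -1, -2, \<dots>\<close>, is encoded as a function on
  \<^typ>\<open>nat\<close> whose value at \<open>k\<close> is the coordinate of index \<open>-k\<close>. Trajectories, indexed
  by \<open>0, 1, 2, \<dots>\<close>, live in the same measurable space.
\<close>

abbreviation seq_space :: "('d::finite) seq measure" where
  "seq_space \<equiv> \<Pi>\<^sub>M k\<in>UNIV. borel"

abbreviation state_space :: "('d::finite) state measure" where
  "state_space \<equiv> borel \<Otimes>\<^sub>M seq_space"

definition past :: "(int \<Rightarrow> 'w \<Rightarrow> real ^ 'd) \<Rightarrow> int \<Rightarrow> 'w \<Rightarrow> 'd seq" where
  "past \<Delta> n \<omega> = (\<lambda>k. \<Delta> (n - int k) \<omega>)"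

definition past_law :: "'w measure \<Rightarrow> (int \<Rightarrow> 'w \<Rightarrow> real ^ 'd) \<Rightarrow> 'd seq measure" where
  "past_law M \<Delta> = distr M seq_space (past \<Delta> 0)"

text \<open>
  \<open>P\<close> is a version of the regular conditional law of \<open>Y\<close> (with values in \<open>T\<close>) given \<open>X\<close> (with
  values in \<open>S\<close>); such a kernel is determined only up to null sets of the law of \<open>X\<close>.
\<close>

definition regular_cond_law ::
  "'w measure \<Rightarrow> 's measure \<Rightarrow> 't measure \<Rightarrow> ('w \<Rightarrow> 's) \<Rightarrow> ('w \<Rightarrow> 't) \<Rightarrow> ('s \<Rightarrow> 't measure) \<Rightarrow> bool" where
  "regular_cond_law M S T X Y P \<longleftrightarrow>
     P \<in> S \<rightarrow>\<^sub>M prob_algebra T \<and>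
     (\<forall>A \<in> sets S. \<forall>B \<in> sets T.
        emeasure M {\<omega> \<in> space M. X \<omega> \<in> A \<and> Y \<omega> \<in> B} = (\<integral>\<^sup>+x\<in>A. emeasure (P x) B \<partial>distr M S X))"

text \<open>By stationarity the law of \<open>\<Delta> (n + 1)\<close> given its past does not depend on \<open>n\<close>; take \<open>n = 0\<close>.\<close>

definition noise_kernel ::
  "'w measure \<Rightarrow> (int \<Rightarrow> 'w \<Rightarrow> real ^ 'd) \<Rightarrow> ('d seq \<Rightarrow> (real ^ 'd) measure) \<Rightarrow> bool" where
  "noise_kernel M \<Delta> P \<longleftrightarrow> regular_cond_law M seq_space borel (past \<Delta> 0) (\<Delta> 1) P"

definition snoc_past :: "'d seq \<Rightarrow> real ^ 'd \<Rightarrow> 'd seq" (infixl "\<squnion>\<^sub>p" 65) where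
  "w \<squnion>\<^sub>p w' = case_nat w' w"

definition phi ::
  "((real ^ 'd) \<times> (real ^ 'd) \<Rightarrow> real ^ 'd) \<Rightarrow> 'd state \<Rightarrow> real ^ 'd \<Rightarrow> 'd state" where
  "phi F z w' = (F (fst z, w'), snd z \<squnion>\<^sub>p w')"

definition Q_kernel ::
  "((real ^ 'd) \<times> (real ^ 'd) \<Rightarrow> real ^ 'd) \<Rightarrow> ('d seq \<Rightarrow> (real ^ 'd) measure)
     \<Rightarrow> 'd state \<Rightarrow> 'd state measure" where
  "Q_kernel F P z = distr (P (snd z)) state_space (phi F z)"

definition initial_distribution ::
  "('d::finite) seq measure \<Rightarrow> 'd state measure \<Rightarrow> bool" where
  "initial_distribution P\<^sub>w \<mu> \<longleftrightarrow>
     prob_space \<mu> \<and> sets \<mu> = sets state_space \<and> distr \<mu> seq_space snd = P\<^sub>w"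

definition invariant_distribution ::
  "('d::finite) seq measure \<Rightarrow> ('d state \<Rightarrow> 'd state measure) \<Rightarrow> 'd state measure \<Rightarrow> bool" where
  "invariant_distribution P\<^sub>w Q \<mu> \<longleftrightarrow> initial_distribution P\<^sub>w \<mu> \<and> \<mu> \<bind> Q = \<mu>"

text \<open>
  The law on \<open>S\<^sup>\<nat>\<close> of the Markov chain with initial law \<open>\<mu>\<close> and transition kernel \<open>Q\<close>, obtained from
  the Ionescu-Tulcea theorem: coordinate \<open>0\<close> is drawn from \<open>\<mu>\<close>, and coordinate \<open>n + 1\<close> from \<open>Q\<close>
  evaluated at coordinate \<open>n\<close>.
\<close>

definition chain_step ::
  "'s measure \<Rightarrow> ('s \<Rightarrow> 's measure) \<Rightarrow> nat \<Rightarrow> (nat \<Rightarrow> 's) \<Rightarrow> 's measure" where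
  "chain_step \<mu> Q n z = (case n of 0 \<Rightarrow> \<mu> | Suc m \<Rightarrow> Q (z m))"

definition chain_law ::
  "'s measure \<Rightarrow> 's measure \<Rightarrow> ('s \<Rightarrow> 's measure) \<Rightarrow> (nat \<Rightarrow> 's) measure" where
  "chain_law S \<mu> Q =
     projective_family.lim UNIV (Ionescu_Tulcea.CI (chain_step \<mu> Q) (\<lambda>_. S)) (\<lambda>_. S)"

lemma Ionescu_Tulcea_chain_step:
  assumes \<mu>: "prob_space \<mu>" "sets \<mu> = sets S" and Q: "Q \<in> S \<rightarrow>\<^sub>M prob_algebra S"
  shows "Ionescu_Tulcea (chain_step \<mu> Q) (\<lambda>_. S)"
proof (rule Ionescu_Tulcea.intro)
  fix i
  show "chain_step \<mu> Q i \<in> (\<Pi>\<^sub>M j\<in>{0..<i}. S) \<rightarrow>\<^sub>M subprob_algebra S"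
  proof (cases i)
    case 0
    have "\<mu> \<in> space (subprob_algebra S)"
      using \<mu> by (simp add: space_subprob_algebra prob_space_imp_subprob_space)
    then show ?thesis
      using 0 by (simp add: chain_step_def[abs_def])
  next
    case (Suc m)
    have "(\<lambda>z. Q (z m)) \<in> (\<Pi>\<^sub>M j\<in>{0..<i}. S) \<rightarrow>\<^sub>M subprob_algebra S"
      using Suc by (intro measurable_compose[OF _ measurable_prob_algebraD[OF Q]]
          measurable_component_singleton) simp
    then show ?thesis
      using Suc by (simp add: chain_step_def[abs_def])
  qed
next
  fix i :: nat and z
  assume z: "z \<in> space (\<Pi>\<^sub>M j\<in>{0..<i}. S)"
  show "prob_space (chain_step \<mu> Q i z)"
  proof (cases i)
    case 0
    then show ?thesis using \<mu> by (simp add: chain_step_def)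
  next
    case (Suc m)
    then have "z m \<in> space S"
      using z by (auto simp: space_PiM PiE_iff)
    then have "Q (z m) \<in> space (prob_algebra S)"
      by (rule measurable_space[OF Q])
    then show ?thesis using Suc by (simp add: chain_step_def space_prob_algebra)
  qed
qed

definition trajectory_law ::
  "(('d::finite) state \<Rightarrow> 'd state measure) \<Rightarrow> 'd state measure \<Rightarrow> 'd seq measure" where
  "trajectory_law Q \<mu> = distr (chain_law state_space \<mu> Q) seq_space (\<lambda>z n. fst (z n))"

definition shifted_law :: "nat \<Rightarrow> ('d::finite) seq measure \<Rightarrow> 'd seq measure" where
  "shifted_law n L = distr L seq_space (\<lambda>x k. x (n + k))"

text \<open>Only meaningful for finite measures on the same measurable space.\<close>

definition tv_dist :: "'s measure \<Rightarrow> 's measure \<Rightarrow> real" where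
  "tv_dist \<mu> \<nu> = (SUP A\<in>sets \<mu>. \<bar>measure \<mu> A - measure \<nu> A\<bar>)"

definition hyp_H1 ::
  "((real ^ 'd) \<times> (real ^ 'd) \<Rightarrow> real ^ 'd) \<Rightarrow> (real ^ 'd \<Rightarrow> real) \<Rightarrow> bool" where
  "hyp_H1 F V \<longleftrightarrow>
     continuous_on UNIV V \<and> (\<forall>x. 0 < V x) \<and> filterlim V at_top at_infinity \<and>
     (\<exists>\<gamma> C. 0 < \<gamma> \<and> \<gamma> < 1 \<and> 0 < C \<and> (\<forall>x w. V (F (x, w)) \<le> \<gamma> * V x + C * (1 + norm w)))"

definition C1_on :: "(real ^ 'd) set \<Rightarrow> (real ^ 'd \<Rightarrow> real ^ 'd) \<Rightarrow> bool" where
  "C1_on U f \<longleftrightarrow>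
     (\<forall>x\<in>U. f differentiable at x) \<and> continuous_on U (\<lambda>x. jacobian f (at x))"

definition C1_diffeo ::
  "(real ^ 'd) set \<Rightarrow> (real ^ 'd) set \<Rightarrow> (real ^ 'd \<Rightarrow> real ^ 'd) \<Rightarrow> bool" where
  "C1_diffeo U D f \<longleftrightarrow>
     open U \<and> open D \<and> bij_betw f U D \<and> C1_on U f \<and> C1_on D (inv_into U f)"

text \<open>
  In the second clause the Jacobian at \<open>u\<close> is required to exist, as \<^const>\<open>jacobian\<close> is
  unspecified at points of non-differentiability.
\<close>

definition hyp_H2 :: "((real ^ 'd) \<times> (real ^ 'd) \<Rightarrow> real ^ 'd) \<Rightarrow> bool" where
  "hyp_H2 F \<longleftrightarrow>
     (\<forall>K>0. \<exists>K'>0. \<exists>C>0. \<exists>M>0.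
        \<forall>x \<in> cball 0 K. \<forall>x' \<in> cball 0 K. \<forall>y \<in> cball 0 K. \<forall>y' \<in> cball 0 K.
        \<exists>\<Lambda>. (bij \<Lambda> \<and> (\<exists>U D. C1_diffeo U D \<Lambda> \<and> negligible (- U) \<and> negligible (- D))) \<and>
            (\<forall>u \<in> cball 0 K'. F (x, u + y) = F (x', \<Lambda> u + y') \<and>
               \<Lambda> differentiable at u \<and> \<bar>det (jacobian \<Lambda> (at u))\<bar> \<ge> C) \<and>
            (\<forall>u. norm (\<Lambda> u - u) \<le> M))"

end

(*
  The inverse filter b of a is nonnegative, decreasing and square summable, because the partial sums
  of a are log-convex. Choose J sparse times s_j = jL + L - 1 with L about sqrt n and J a small power
  of n. The columns (b_(k - s_j))_k are then almost orthogonal, and by diagonal dominance the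
  innovations can be written, in law, as eta + sigma * (sum_j b_(. - s_j) zeta_j) with zeta standard
  Gaussian and independent of eta. Since a * b = delta, zeta_j moves the noise at the single time s_j.
  Given the past and eta, the chain observed every L steps is thus driven by independent noises, and
  (H1) and (H2) contract the oscillation of its transition operators in a V-weighted sense, at a rate
  which only an exceptionally energetic environment can spoil; exponential moments make such
  environments exponentially rare in J. So (X_n, noise after n) forgets X_0 at the rate exp (- c J),
  hence O(1/n), which is faster than n^-(v_H - eps).
  Two chains started from the same past are compared, so no coupling of the pasts is needed.
  For existence, the finite-dimensional laws of (X_n, past) started from X_0 = 0 are Cauchy in total
  variation, and Kolmogorov's theorem provides the limit law. It is invariant because the conditional
  mean of the next noise is a limit of functions of finitely many coordinates and Gaussian laws depend
  continuously on their mean in total variation. Invariant distributions integrate V, so uniqueness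
  follows from the same estimate.
*)

theory Submission
  imports Defs
begin

subsection \<open>The moving-average filter and its inverse\<close>

text \<open>The noise has unbounded memory: a change of one innovation moves all later noises. A
  change along a whole column of the inverse filter moves one noise only, and its cost stays bounded
  because \<open>b\<close> is square summable. Two columns at distance at least L have inner product
  at most C L^(-H/2), so J \<le> L^(H/2) of them can be handled with a \<sigma> independent of J and
  L; with L close to n^(1/2) this allows J close to n^(H/4) contraction steps within n. The law of
  \<eta> is not that of the innovations, so its energy is estimated indirectly, by removing the
  Gaussian shifts from the true noise. The comparison concerns X_n jointly with the noise after time
  n, and not X_n alone: later trajectories are functions of this pair, and so are, p steps later,
  the state and the p most recent noises. The splitting is finite dimensional, hence all estimates
  are made on events of finitely many coordinates, with constants that do not depend on their
  number. The kernel P is given only up to null sets; this is harmless because every law met along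
  the chain has the same marginal on the space of pasts.\<close>

lemma kappa_pos:
  assumes "0 < H" "H < 1"
  shows "kappa H > 0"
proof -
  have "sin (pi * H) > 0"
    using assms by (intro sin_gt_zero) auto
  moreover have "Gamma (2 * H + 1) > 0" "Gamma (H + 1/2) > 0"
    using assms by (auto intro!: Gamma_real_pos)
  ultimately show ?thesis
    unfolding kappa_def by (intro divide_pos_pos) auto
qed

declare b_coeff.simps(2)[simp del]

locale rough =
  fixes h H :: real
  assumes h_pos: "h > 0" and H_pos: "0 < H" and H_less: "H < 1/2"
begin

abbreviation a where "a \<equiv> a_coeff h H"
abbreviation b where "b \<equiv> b_coeff h H"

definition cst where "cst = h powr H * kappa H"

lemma cst_pos: "cst > 0"
  unfolding cst_def using h_pos H_pos H_less by (auto intro!: mult_pos_pos kappa_pos)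

text \<open>The coefficients are increments of \<open>cst * (real n + 1/2) powr (H - 1/2)\<close>,
  and \<open>a 0\<close> fits as the value at n = 0 because 2^(1/2 - H) = (1/2)^(H - 1/2). The
  bounds on \<open>a\<close> and \<open>b\<close> start from this closed form.\<close>

lemma sum_a: "(\<Sum>k\<le>n. a k) = cst * (real n + 1/2) powr (H - 1/2)"
proof (induction n)
  case 0
  have "2 powr (1/2 - H) = (1/2) powr (H - 1/2 :: real)"
    by (simp add: powr_divide flip: powr_minus_divide)
  then show ?case by (simp add: a_coeff_def cst_def mult.assoc)
next
  case (Suc n)
  then show ?case
    by (simp add: a_coeff_def cst_def algebra_simps)
qed

lemma a_0: "a 0 = cst * (1/2) powr (H - 1/2)"
  using sum_a[of 0] by simp

lemma a_0_pos: "a 0 > 0"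
  by (simp add: a_0 cst_pos)

lemma a_neg: "k > 0 \<Longrightarrow> a k < 0"
  unfolding a_coeff_def cst_def[symmetric] using cst_pos H_less
  by (auto simp: mult_less_0_iff intro!: powr_less_mono2_neg)

text \<open>Only \<open>a 0\<close> is positive, so the sum of absolute values is 2
  \<open>a 0\<close> minus a partial sum of \<open>a\<close>, and these partial sums are positive by
  \<open>sum_a\<close>. This summability later turns Gaussian moments of the innovations into
  moments of the noise.\<close>

lemma a_abs_sum: "(\<Sum>k\<le>n. \<bar>a k\<bar>) \<le> 2 * a 0"
proof -
  have "(\<Sum>k\<le>n. \<bar>a k\<bar>) = (\<Sum>k\<le>n. (if k = 0 then 2 * a 0 else 0) - a k)"
    using a_0_pos a_neg by (intro sum.cong) (auto simp: less_imp_le abs_if)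
  also have "\<dots> = 2 * a 0 - (\<Sum>k\<le>n. a k)"
    by (simp add: sum_subtractf)
  also have "\<dots> \<le> 2 * a 0"
    unfolding sum_a using cst_pos by simp
  finally show ?thesis .
qed

lemma a_abs_sum': "finite A \<Longrightarrow> (\<Sum>k\<in>A. \<bar>a k\<bar>) \<le> 2 * a 0"
  by (rule order_trans[OF sum_mono2[of "{..Max A}"] a_abs_sum]) auto

lemma b_nonneg: "b k \<ge> 0"
proof (induction k rule: less_induct)
  case (less k)
  show ?case
  proof (cases k)
    case 0
    then show ?thesis using a_0_pos by simp
  next
    case (Suc n)
    have "(\<Sum>l = 1..Suc n. a l * b (Suc n - l)) \<le> 0"
      using less Suc by (intro sum_nonpos mult_nonpos_nonneg) (auto intro!: less_imp_le[OF a_neg])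
    then show ?thesis unfolding Suc b_coeff.simps using a_0_pos
      by (simp add: mult_nonpos_nonpos divide_nonpos_pos)
  qed
qed

lemma a_b_conv: "(\<Sum>l\<le>k. a l * b (k - l)) = (if k = 0 then 1 else 0)"
proof (cases k)
  case 0
  then show ?thesis using a_0_pos by simp
next
  case (Suc n)
  have "(\<Sum>l\<le>k. a l * b (k - l)) = a 0 * b k + (\<Sum>l=1..Suc n. a l * b (k - l))"
    unfolding Suc atMost_atLeast0 by (subst sum.atLeast_Suc_atMost) auto
  also have "a 0 * b k = - (\<Sum>l=1..Suc n. a l * b (k - l))"
    unfolding Suc b_coeff.simps using a_0_pos by simp
  finally show ?thesis using Suc by simp
qed

lemma b_a_conv: "(\<Sum>l\<le>k. b l * a (k - l)) = (if k = 0 then 1 else 0)"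
  unfolding a_b_conv[symmetric]
  by (subst sum.nat_diff_reindex[of _ "Suc k", unfolded lessThan_Suc_atMost, symmetric])
     (auto intro!: sum.cong simp: mult.commute)

section \<open>Log-convex partial sums and monotonicity of the inverse filter\<close>

definition u where "u n = (real n + 1/2) powr (H - 1/2)"

lemma u_pos: "u n > 0" by (simp add: u_def)

text \<open>The base points satisfy (n + 1/2)(n + 5/2) \<le> (n + 3/2)^2, and the negative exponent
  H - 1/2 reverses the inequality.\<close>

lemma u_log_convex_step: "u (Suc n) * u (Suc n) \<le> u n * u (Suc (Suc n))"
proof -
  have "((real n + 1/2) * (real n + 2 + 1/2)) powr (1/2 - H) \<le> ((real n + 1 + 1/2)\<^sup>2) powr (1/2 - H)"
    using H_less by (intro powr_mono2) (auto simp: power2_eq_square field_simps)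
  then have "((real n + 1 + 1/2)\<^sup>2) powr - (1/2 - H) \<le> ((real n + 1/2) * (real n + 2 + 1/2)) powr - (1/2 - H)"
    by (simp only: powr_minus) (rule le_imp_inverse_le; simp)
  then show ?thesis
    by (simp add: u_def powr_mult power2_eq_square add_ac)
qed

lemma u_ratio: "m \<le> n \<Longrightarrow> u (Suc m) / u m \<le> u (Suc n) / u n"
proof (induction n rule: dec_induct)
  case (step n)
  have "u (Suc n) / u n \<le> u (Suc (Suc n)) / u (Suc n)"
    using u_log_convex_step[of n] u_pos by (simp add: divide_simps mult.commute)
  with step show ?case by linarith
qed simp

text \<open>For generating series, A B = 1 is multiplied by 1 / (1 - z): summing the convolution
  identity up to n replaces \<open>a\<close> by its partial sums, which are
  \<open>cst * u\<close>.\<close>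

lemma b_u_conv: "(\<Sum>k\<le>n. b k * (cst * u (n - k))) = 1"
proof -
  have "(\<Sum>k\<le>n. b k * (cst * u (n - k))) = (\<Sum>k\<le>n. \<Sum>j\<le>n - k. b k * a j)"
    by (simp only: u_def sum_a[symmetric] sum_distrib_left)
  also have "\<dots> = (\<Sum>(k, j) \<in> {(k, j). k + j \<le> n}. b k * a j)"
    by (subst sum.Sigma) (auto intro!: sum.cong)
  also have "\<dots> = (\<Sum>m\<le>n. \<Sum>k\<le>m. b k * a (m - k))"
    by (rule sum.triangle_reindex_eq)
  also have "\<dots> = 1"
    by (simp add: b_a_conv)
  finally show ?thesis .
qed

text \<open>Kaluza's argument: the reciprocal of a log-convex sequence has negative higher coefficients.\<close>

lemma b_antimono_step: "b (Suc k) \<le> b k"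
proof -
  define d where "d k = b k - b (Suc k)" for k
  \<comment> \<open>The difference of \<open>b_u_conv\<close> at n + 1 and at n: a renewal equation
    for the decrements d, with the explicit right-hand side \<open>b 0 * u (Suc n)\<close>.\<close>
  have d: "(\<Sum>k\<le>n. d k * u (n - k)) = b 0 * u (Suc n)" for n
  proof -
    have "(\<Sum>k\<le>Suc n. b k * u (Suc n - k)) = (\<Sum>k\<le>n. b k * u (n - k))"
      using b_u_conv[of n] b_u_conv[of "Suc n"] cst_pos
      by (simp add: mult.left_commute[of _ cst] sum_distrib_left[symmetric] del: sum.atMost_Suc)
         (metis mult_cancel_left less_irrefl)
    moreover have "(\<Sum>k\<le>Suc n. b k * u (Suc n - k)) = b 0 * u (Suc n) + (\<Sum>k\<le>n. b (Suc k) * u (n - k))"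
      by (subst sum.atMost_Suc_shift) simp
    ultimately show ?thesis
      by (simp add: d_def algebra_simps sum_subtractf)
  qed
  have "d k \<ge> 0" for k
  proof (induction k rule: less_induct)
    case (less k)
    show ?case
    proof (cases k)
      case 0
      have "d 0 * u 0 = b 0 * u 1" using d[of 0] by simp
      then have "0 \<le> d 0 * u 0" using b_nonneg u_pos by (metis less_imp_le mult_nonneg_nonneg)
      then show ?thesis using u_pos[of 0] 0 by (simp add: zero_le_mult_iff)
    next
      case (Suc n)
      \<comment> \<open>The earlier decrements being nonnegative, the ratio bound multiplies the
        equation at n by at most u (n + 2) / u (n + 1), which maps its right-hand side exactly to
        that at n + 1. What is left of the equation at n + 1 is the term with d (n + 1), which must
        then be nonnegative.\<close>
      have "(\<Sum>k\<le>n. d k * u (Suc n - k)) \<le> (\<Sum>k\<le>n. d k * u (n - k) * (u (Suc (Suc n)) / u (Suc n)))"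
      proof (rule sum_mono)
        fix i assume "i \<in> {..n}"
        then have "Suc n - i = Suc (n - i)" and "0 \<le> d i" using less Suc by auto
        moreover have "u (Suc (n - i)) / u (n - i) \<le> u (Suc (Suc n)) / u (Suc n)"
          by (rule u_ratio) auto
        ultimately show "d i * u (Suc n - i) \<le> d i * u (n - i) * (u (Suc (Suc n)) / u (Suc n))"
          using u_pos[of "n - i"] mult_left_mono[of "u (Suc (n - i)) / u (n - i)" _ "d i * u (n - i)"]
          by (simp add: less_imp_le mult.assoc)
             (metis (no_types, lifting) times_divide_eq_right)
      qed
      also have "\<dots> = b 0 * u (Suc n) * (u (Suc (Suc n)) / u (Suc n))"
        unfolding sum_distrib_right[symmetric] d ..
      also have "\<dots> = b 0 * u (Suc (Suc n))"
        using u_pos[of "Suc n"] by simp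
      finally have "(\<Sum>k\<le>n. d k * u (Suc n - k)) \<le> b 0 * u (Suc (Suc n))" .
      moreover have "(\<Sum>k\<le>n. d k * u (Suc n - k)) + d (Suc n) * u 0 = b 0 * u (Suc (Suc n))"
        using d[of "Suc n"] by simp
      ultimately have "0 \<le> d (Suc n) * u 0" by linarith
      then show ?thesis using u_pos[of 0] Suc by (simp add: zero_le_mult_iff)
    qed
  qed
  then show ?thesis by (simp add: d_def)
qed

lemma b_antimono: "m \<le> n \<Longrightarrow> b n \<le> b m"
  using lift_Suc_antimono_le[of b, OF b_antimono_step] by blast

text \<open>In \<open>b_u_conv\<close> each \<open>b i\<close> is at least \<open>b k\<close>, and
  each \<open>u (k - i)\<close> is at least (k + 1)^(H - 1/2) since k - i + 1/2 \<le> k + 1. The k +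
  1 terms together give \<open>b k\<close> cst (k + 1)^(H + 1/2) \<le> 1.\<close>

lemma b_bound: "b k \<le> (1 / cst) * (real k + 1) powr (- (H + 1/2))"
proof -
  have "b k * (cst * ((real k + 1) * (real k + 1) powr (H - 1/2))) = (\<Sum>i\<le>k. b k * (cst * (real k + 1) powr (H - 1/2)))"
    by (simp add: algebra_simps)
  also have "\<dots> \<le> (\<Sum>i\<le>k. b i * (cst * u (k - i)))"
  proof (intro sum_mono mult_mono mult_nonneg_nonneg)
    fix i assume "i \<in> {..k}"
    then show "b k \<le> b i" by (auto intro: b_antimono)
    show "(real k + 1) powr (H - 1/2) \<le> u (k - i)"
      unfolding u_def using H_less by (intro powr_mono2') auto
  qed (use cst_pos b_nonneg in auto)
  also have "\<dots> = 1" by (rule b_u_conv)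
  also have "(real k + 1) * (real k + 1) powr (H - 1/2) = (real k + 1) powr (H + 1/2)"
    using powr_add[of "real k + 1" 1 "H - 1/2"] by (simp add: add.commute)
  finally show ?thesis
    using cst_pos by (simp add: powr_minus divide_simps mult.commute mult.left_commute)
qed

lemma b_coeff_bound: "\<exists>C>0. \<forall>k. \<bar>b k\<bar> \<le> C * (real k + 1) powr (- (H + 1/2))"
  using cst_pos b_nonneg b_bound by (intro exI[of _ "1 / cst"]) auto

section \<open>Square summability and truncation of the inverse filter\<close>

lemma b_sq_bound: "(b k)\<^sup>2 \<le> (1 / cst)\<^sup>2 * (real k + 1) powr (- (1 + 2 * H))"
proof -
  have "(b k)\<^sup>2 \<le> ((1 / cst) * (real k + 1) powr (- (H + 1/2)))\<^sup>2"
    by (intro power_mono b_bound b_nonneg)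
  also have "\<dots> = (1 / cst)\<^sup>2 * (real k + 1) powr (- (1 + 2 * H))"
  proof -
    have "- (H + 1/2) + - (H + 1/2) = - (1 + 2 * H)" by simp
    then show ?thesis
      by (simp only: power_mult_distrib power2_eq_square[of "_ powr _"] powr_add[symmetric])
  qed
  finally show ?thesis .
qed

lemma summable_b_sq: "summable (\<lambda>k. (b k)\<^sup>2)"
proof (rule summable_comparison_test')
  have "summable (\<lambda>k. real k powr (- (1 + 2 * H)))"
    using H_pos by (subst summable_real_powr_iff) auto
  then have "summable (\<lambda>k. real (Suc k) powr (- (1 + 2 * H)))"
    by (subst summable_Suc_iff)
  then show "summable (\<lambda>k. (1 / cst)\<^sup>2 * real (Suc k) powr (- (1 + 2 * H)))"
    by (rule summable_mult)
  show "norm ((b k)\<^sup>2) \<le> (1 / cst)\<^sup>2 * real (Suc k) powr - (1 + 2 * H)" if "k \<ge> 0" for k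
    using b_sq_bound[of k] by (simp add: add.commute)
qed

text \<open>The exponent 1 + 2H is split: H is spent on decay in the shift r, and the remaining 1 +
  H still makes the sum over k converge, uniformly in its length.\<close>

lemma b_sq_tail: "\<exists>C>0. \<forall>r K. (\<Sum>k<K. (b (k + r))\<^sup>2) \<le> C * (real r + 1) powr (- H)"
proof -
  have "summable (\<lambda>k. real k powr (- (1 + H)))"
    using H_pos by (subst summable_real_powr_iff) auto
  then have s: "summable (\<lambda>k. real (Suc k) powr (- (1 + H)))"
    by (subst summable_Suc_iff)
  define S where "S = (\<Sum>k. real (Suc k) powr (- (1 + H)))"
  have "S > 0"
    unfolding S_def by (rule suminf_pos[OF s]) simp
  have "(\<Sum>k<K. (b (k + r))\<^sup>2) \<le> ((1 / cst)\<^sup>2 * S) * (real r + 1) powr (- H)" for r K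
  proof -
    have "(\<Sum>k<K. (b (k + r))\<^sup>2) \<le> (\<Sum>k<K. (1 / cst)\<^sup>2 * ((real r + 1) powr (- H) * real (Suc k) powr (- (1 + H))))"
    proof (rule sum_mono)
      fix k
      have "(b (k + r))\<^sup>2 \<le> (1 / cst)\<^sup>2 * (real (k + r) + 1) powr (- (1 + 2 * H))"
        by (rule b_sq_bound)
      also have "(real (k + r) + 1) powr (- (1 + 2 * H)) = (real (k + r) + 1) powr (- H) * (real (k + r) + 1) powr (- (1 + H))"
      proof -
        have "- (1 + 2 * H) = - H + - (1 + H)" by simp
        then show ?thesis by (simp only: powr_add[symmetric])
      qed
      also have "\<dots> \<le> (real r + 1) powr (- H) * real (Suc k) powr (- (1 + H))"
        using H_pos by (intro mult_mono powr_mono2') auto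
      finally show "(b (k + r))\<^sup>2 \<le> (1 / cst)\<^sup>2 * ((real r + 1) powr (- H) * real (Suc k) powr (- (1 + H)))"
        by (simp add: mult_left_mono)
    qed
    also have "\<dots> = (1 / cst)\<^sup>2 * (real r + 1) powr (- H) * (\<Sum>k<K. real (Suc k) powr (- (1 + H)))"
      by (simp add: sum_distrib_left mult.assoc)
    also have "\<dots> \<le> (1 / cst)\<^sup>2 * (real r + 1) powr (- H) * S"
      unfolding S_def by (intro mult_left_mono sum_le_suminf s) auto
    finally show ?thesis by (simp add: algebra_simps)
  qed
  with \<open>S > 0\<close> cst_pos show ?thesis
    by (intro exI[of _ "(1 / cst)\<^sup>2 * S"]) auto
qed

text \<open>In the full convolution at m, which vanishes, the only positive term is
  \<open>b m * a 0\<close>. Any group of the other terms therefore lies between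
  \<open>- (a 0 * b m)\<close> and 0. The bound controls the error made when an innovation is
  recovered from finitely many noises.\<close>

lemma trunc_conv_bound:
  assumes "n < m"
  shows "\<bar>\<Sum>k\<le>n. b k * a (m - k)\<bar> \<le> a 0 * b m"
proof -
  have "(\<Sum>k\<le>n. b k * a (m - k)) \<le> 0"
    using assms by (intro sum_nonpos mult_nonneg_nonpos b_nonneg less_imp_le[OF a_neg]) auto
  have m: "{..m} = insert m ({..n} \<union> {n<..<m})" using assms by auto
  have "(\<Sum>k\<le>m. b k * a (m - k)) = (\<Sum>k\<le>n. b k * a (m - k)) + (\<Sum>k\<in>{n<..<m}. b k * a (m - k)) + b m * a 0"
    unfolding m using assms
    by (subst sum.insert, simp, simp, subst sum.union_disjoint) auto
  moreover have "(\<Sum>k\<in>{n<..<m}. b k * a (m - k)) \<le> 0"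
    by (intro sum_nonpos mult_nonneg_nonpos b_nonneg less_imp_le[OF a_neg]) auto
  ultimately show ?thesis
    using b_a_conv[of m] assms \<open>(\<Sum>k\<le>n. b k * a (m - k)) \<le> 0\<close>
    by (simp add: mult.commute)
qed

end

section \<open>The exponent as an optimum\<close>

text \<open>On the admissible interval the outer minimum is 2(\<rho> - \<alpha>). With t = \<alpha>
  + H - 1 the objective is t (1 - 2t) as long as \<alpha> \<le> 1, that is t \<le> H, and it
  decreases afterwards. The vertex t = 1/4, i.e. \<alpha> = 5/4 - H, is reached when H \<ge> 1/4;
  otherwise the maximum is at \<alpha> = 1.\<close>

lemma v_H_eq_v_exp:
  assumes "0 < H" "H < 1/2"
  shows "v_H H = v_exp (H + 1/2) (3/2 - H)"
proof -
  define f where "f \<alpha> = min 1 (2 * (3/2 - H - \<alpha>)) * (Min {\<alpha>, H + 1/2, \<alpha> + (H + 1/2) - 1} - 1/2)" for \<alpha>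
  define I where "I = {max (1/2) (3/2 - (H + 1/2)) <..< 3/2 - H}"
  have I: "\<alpha> \<in> I \<longleftrightarrow> 1 - H < \<alpha> \<and> \<alpha> < 3/2 - H" for \<alpha>
    using assms by (auto simp: I_def)
  have f: "f \<alpha> = (3 - 2 * H - 2 * \<alpha>) * min H (\<alpha> + H - 1)" if "\<alpha> \<in> I" for \<alpha>
  proof -
    have "min 1 (2 * (3/2 - H - \<alpha>)) = 3 - 2 * H - 2 * \<alpha>"
      using that unfolding I by (simp add: min_def)
    moreover have "Min {\<alpha>, H + 1/2, \<alpha> + (H + 1/2) - 1} - 1/2 = min H (\<alpha> + H - 1)"
      using that assms unfolding I by (auto simp: min_def)
    ultimately show ?thesis by (simp only: f_def)
  qed
  have upper: "f \<alpha> \<le> v_H H" if "\<alpha> \<in> I" for \<alpha>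
  proof (cases "\<alpha> \<le> 1")
    case True
    define t where "t = \<alpha> + H - 1"
    have t: "0 < t" "t \<le> H" "f \<alpha> = (1 - 2 * t) * t"
      using f[OF that] that True min.absorb2[of H "\<alpha> + H - 1"] unfolding I t_def
      by (auto simp: algebra_simps)
    show ?thesis
    proof (cases "H \<le> 1/4")
      case True
      have "0 \<le> (H - t) * (1 - 2 * (H + t))"
        using t True by (intro mult_nonneg_nonneg) auto
      then show ?thesis using t True by (simp add: v_H_def algebra_simps)
    next
      case False
      have "0 \<le> 2 * (t - 1/4)\<^sup>2" by simp
      then show ?thesis using t False by (simp add: v_H_def power2_eq_square algebra_simps)
    qed
  next
    case False
    have "f \<alpha> = (3 - 2 * H - 2 * \<alpha>) * H"
      using f[OF that] False by (simp add: min_def)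
    also have "\<dots> \<le> (1 - 2 * H) * H"
      using False assms by (intro mult_right_mono) auto
    also have "\<dots> \<le> v_H H"
    proof -
      have "0 \<le> 2 * (H - 1/4)\<^sup>2" by simp
      then show ?thesis by (simp add: v_H_def power2_eq_square algebra_simps)
    qed
    finally show ?thesis .
  qed
  have "\<exists>\<alpha>\<in>I. f \<alpha> = v_H H"
  proof (cases "H \<le> 1/4")
    case True
    then show ?thesis using assms f[of 1] I[of 1]
      by (intro bexI[of _ 1]) (auto simp: v_H_def algebra_simps)
  next
    case False
    have "5/4 - H \<in> I" using I by simp
    then show ?thesis using assms f[of "5/4 - H"] False
      by (intro bexI[of _ "5/4 - H"]) (auto simp: v_H_def min_def)
  qed
  then have "v_H H \<in> f ` I" by force
  have "(SUP \<alpha>\<in>I. f \<alpha>) = v_H H"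
    by (rule cSup_eq_maximum) (use \<open>v_H H \<in> f ` I\<close> upper in auto)
  then show ?thesis
    by (simp add: v_exp_def f_def I_def)
qed

subsection \<open>The standard Gaussian measure\<close>

lemma power2_norm_eq_sum_Basis: "(norm x)\<^sup>2 = (\<Sum>b\<in>Basis. (x \<bullet> b)\<^sup>2)"
  by (subst power2_norm_eq_inner, subst euclidean_inner) (simp add: power2_eq_square)

lemma std_gaussian_density_prod:
  fixes x :: "real ^ 'd::finite"
  shows "(2 * pi) powr (- real CARD('d) / 2) * exp (- (norm x)\<^sup>2 / 2) = (\<Prod>b\<in>Basis. std_normal_density (x \<bullet> b))"
proof -
  have "(\<Prod>b\<in>Basis. std_normal_density (x \<bullet> b)) =
     (\<Prod>b\<in>(Basis :: (real ^ 'd) set). 1 / sqrt (2 * pi)) * (\<Prod>b\<in>Basis. exp (- (x \<bullet> b)\<^sup>2 / 2))"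
    unfolding std_normal_density_def prod.distrib by simp
  also have "(\<Prod>b\<in>Basis. exp (- (x \<bullet> b)\<^sup>2 / 2)) = exp (- (norm x)\<^sup>2 / 2)"
    by (simp add: exp_sum[symmetric] sum_divide_distrib[symmetric] sum_negf power2_norm_eq_sum_Basis)
  also have "(\<Prod>b\<in>(Basis :: (real ^ 'd) set). 1 / sqrt (2 * pi)) = (2 * pi) powr (- real CARD('d) / 2)"
  proof -
    have "1 / sqrt (2 * pi) = (2 * pi) powr (- 1 / 2)"
      by (simp add: powr_minus_divide powr_half_sqrt)
    then have "(\<Prod>b\<in>(Basis :: (real ^ 'd) set). 1 / sqrt (2 * pi)) = ((2 * pi) powr (- 1 / 2)) ^ CARD('d)"
      by simp
    also have "\<dots> = (2 * pi) powr (- real CARD('d) / 2)"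
      by (simp add: powr_realpow[symmetric] powr_powr)
    finally show ?thesis .
  qed
  finally show ?thesis ..
qed

lemma std_gaussian_eq:
  "(std_gaussian :: (real ^ 'd::finite) measure) = density lborel (\<lambda>x. ennreal (\<Prod>b\<in>Basis. std_normal_density (x \<bullet> b)))"
  unfolding std_gaussian_def std_gaussian_density_prod ..

lemma sets_std_gaussian[simp, measurable_cong]: "sets std_gaussian = sets borel"
  and space_std_gaussian[simp]: "space std_gaussian = UNIV"
  by (simp_all add: std_gaussian_def)

lemma nn_integral_std_gaussian_prod:
  assumes [measurable]: "\<And>b. f b \<in> borel_measurable borel"
  shows "(\<integral>\<^sup>+x. (\<Prod>b\<in>Basis. f b (x \<bullet> b)) \<partial>(std_gaussian :: (real ^ 'd::finite) measure))
    = (\<Prod>b\<in>Basis. \<integral>\<^sup>+x. f b x \<partial>std_normal_distribution)"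
proof -
  have "(\<integral>\<^sup>+x. (\<Prod>b\<in>Basis. f b (x \<bullet> b)) \<partial>(std_gaussian :: (real ^ 'd::finite) measure)) =
     (\<integral>\<^sup>+x. (\<Prod>b\<in>Basis. ennreal (std_normal_density (x \<bullet> b)) * f b (x \<bullet> b)) \<partial>lborel)"
    unfolding std_gaussian_eq by (subst nn_integral_density) (auto simp: prod.distrib prod_ennreal)
  also have "\<dots> = (\<Prod>b\<in>Basis. \<integral>\<^sup>+x. ennreal (std_normal_density x) * f b x \<partial>lborel)"
    by (rule nn_integral_lborel_prod) auto
  also have "\<dots> = (\<Prod>b\<in>Basis. \<integral>\<^sup>+x. f b x \<partial>std_normal_distribution)"
    by (intro prod.cong refl) (subst nn_integral_density, auto)
  finally show ?thesis .
qed

lemma prob_space_std_normal: "prob_space std_normal_distribution"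
  by (rule prob_space_normal_density) simp

lemma prob_space_std_gaussian: "prob_space (std_gaussian :: (real ^ 'd::finite) measure)"
proof
  have "emeasure std_gaussian (space (std_gaussian :: (real ^ 'd) measure)) = (\<integral>\<^sup>+x. (\<Prod>b\<in>(Basis :: (real ^ 'd) set). (\<lambda>_ _. 1) b (x \<bullet> b)) \<partial>(std_gaussian :: (real ^ 'd) measure))"
    by simp
  also have "\<dots> = (\<Prod>b\<in>(Basis :: (real ^ 'd) set). \<integral>\<^sup>+x. (\<lambda>_ _. 1) b x \<partial>std_normal_distribution)"
    by (rule nn_integral_std_gaussian_prod) simp
  also have "\<dots> = 1"
    using prob_space.emeasure_space_1[OF prob_space_std_normal] by simp
  finally show "emeasure std_gaussian (space (std_gaussian :: (real ^ 'd) measure)) = 1" .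
qed

interpretation std_gaussian: prob_space "std_gaussian :: (real ^ 'd::finite) measure"
  by (rule prob_space_std_gaussian)

interpretation std_normal: prob_space std_normal_distribution
  by (rule prob_space_std_normal)

text \<open>Transfers integrals over the vector space to a product measure indexed by the basis,
  where Fubini for products also covers complex integrands; \<open>char_std_gaussian\<close> depends
  on it.\<close>

lemma distr_std_gaussian_coords:
  "distr (std_gaussian :: (real ^ 'd::finite) measure) (PiM Basis (\<lambda>_. std_normal_distribution)) (\<lambda>x. \<lambda>b\<in>Basis. x \<bullet> b)
     = PiM Basis (\<lambda>_. std_normal_distribution)" (is "?D = _")
proof -
  interpret P: product_sigma_finite "\<lambda>_::real ^ 'd. std_normal_distribution"
    by standard
  show ?thesis
  proof (rule P.PiM_eqI)
    fix A :: "real ^ 'd \<Rightarrow> real set" assume A: "\<And>i. i \<in> Basis \<Longrightarrow> A i \<in> sets std_normal_distribution"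
    define A' where "A' b = (if b \<in> Basis then A b else {})" for b
    have A'[measurable]: "A' b \<in> sets borel" for b
      using \<open>\<And>i. i \<in> Basis \<Longrightarrow> A i \<in> _\<close> by (auto simp: A'_def)
    have AA: "Pi\<^sub>E Basis A = Pi\<^sub>E Basis A'"
      by (auto simp: A'_def PiE_iff)
    have "emeasure ?D (Pi\<^sub>E Basis A) = (\<integral>\<^sup>+x. indicator (Pi\<^sub>E Basis A') (\<lambda>b\<in>Basis. x \<bullet> b) \<partial>(std_gaussian :: (real ^ 'd::finite) measure))"
    proof -
      have [measurable]: "Pi\<^sub>E Basis A' \<in> sets (PiM Basis (\<lambda>_::real ^ 'd. std_normal_distribution))"
        by (intro sets_PiM_I_finite) auto
      have "emeasure ?D (Pi\<^sub>E Basis A') = (\<integral>\<^sup>+y. indicator (Pi\<^sub>E Basis A') y \<partial>?D)"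
        by (rule nn_integral_indicator[symmetric]) simp
      also have "\<dots> = (\<integral>\<^sup>+x. indicator (Pi\<^sub>E Basis A') (\<lambda>b\<in>Basis. x \<bullet> b) \<partial>(std_gaussian :: (real ^ 'd::finite) measure))"
        by (rule nn_integral_distr) (auto intro!: measurable_restrict)
      finally show ?thesis unfolding AA .
    qed
    also have "\<dots> = (\<integral>\<^sup>+x. (\<Prod>b\<in>Basis. indicator (A' b) (x \<bullet> b)) \<partial>(std_gaussian :: (real ^ 'd::finite) measure))"
      by (intro nn_integral_cong) (auto simp: indicator_def PiE_iff prod_zero_iff)
    also have "\<dots> = (\<Prod>b\<in>Basis. \<integral>\<^sup>+x. indicator (A' b) x \<partial>std_normal_distribution)"
      by (rule nn_integral_std_gaussian_prod) simp
    also have "\<dots> = (\<Prod>b\<in>Basis. emeasure std_normal_distribution (A b))"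
      using A by (intro prod.cong refl, subst nn_integral_indicator) (auto simp: A'_def split: if_splits)
    finally show "emeasure ?D (Pi\<^sub>E Basis A) = (\<Prod>b\<in>Basis. emeasure std_normal_distribution (A b))" .
  qed auto
qed

lemma char_std_gaussian:
  "(\<integral>x. iexp (v \<bullet> x) \<partial>(std_gaussian :: (real ^ 'd::finite) measure)) = exp (- (norm v)\<^sup>2 / 2)"
proof -
  interpret P: product_sigma_finite "\<lambda>_::real ^ 'd. std_normal_distribution"
    by standard
  have "(\<integral>x. iexp (v \<bullet> x) \<partial>(std_gaussian :: (real ^ 'd::finite) measure)) =
    (\<integral>x. (\<Prod>b\<in>Basis. iexp ((v \<bullet> b) * (\<lambda>b\<in>Basis. x \<bullet> b) b)) \<partial>std_gaussian)"
  proof (intro Bochner_Integration.integral_cong refl)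
    fix x :: "real ^ 'd"
    have "iexp (v \<bullet> x) = (\<Prod>b\<in>Basis. iexp ((v \<bullet> b) * (x \<bullet> b)))"
      by (subst euclidean_inner) (simp add: exp_sum sum_distrib_left)
    then show "iexp (v \<bullet> x) = (\<Prod>b\<in>Basis. iexp ((v \<bullet> b) * (\<lambda>b\<in>Basis. x \<bullet> b) b))"
      by simp
  qed
  also have "\<dots> = (\<integral>y. (\<Prod>b\<in>Basis. iexp ((v \<bullet> b) * y b)) \<partial>PiM Basis (\<lambda>_. std_normal_distribution))"
    by (subst distr_std_gaussian_coords[symmetric], subst integral_distr) simp_all
  also have "\<dots> = (\<Prod>b\<in>Basis. \<integral>y. iexp ((v \<bullet> b) * y) \<partial>std_normal_distribution)"
    by (intro P.product_integral_prod finite_Basis std_normal.integrable_const_bound[where B=1]) auto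
  also have "\<dots> = (\<Prod>b\<in>Basis. char std_normal_distribution (v \<bullet> b))"
    by (simp add: char_def)
  also have "\<dots> = (\<Prod>b\<in>Basis. complex_of_real (exp (- (v \<bullet> b)\<^sup>2 / 2)))"
    by (simp add: char_std_normal_distribution)
  also have "\<dots> = complex_of_real (exp (- (norm v)\<^sup>2 / 2))"
    unfolding of_real_prod[symmetric]
    by (simp add: exp_sum[symmetric] sum_divide_distrib[symmetric] sum_negf power2_norm_eq_sum_Basis)
  finally show ?thesis .
qed

text \<open>In each coordinate exp (t^2 / 4) turns the standard normal density into sqrt 2 times the
  density of variance 2. All later exponential moments are reduced to this one.\<close>

lemma std_gaussian_exp_sq:
  "(\<integral>\<^sup>+x. ennreal (exp ((norm x)\<^sup>2 / 4)) \<partial>(std_gaussian :: (real ^ 'd::finite) measure)) = ennreal (sqrt 2 ^ CARD('d))"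
proof -
  have 1: "(\<integral>\<^sup>+t. ennreal (exp (t\<^sup>2 / 4)) \<partial>std_normal_distribution) = ennreal (sqrt 2)"
  proof -
    have "(\<integral>\<^sup>+t. ennreal (exp (t\<^sup>2 / 4)) \<partial>std_normal_distribution) =
      (\<integral>\<^sup>+t. ennreal (std_normal_density t) * ennreal (exp (t\<^sup>2 / 4)) \<partial>lborel)"
      by (subst nn_integral_density) auto
    also have "\<dots> = (\<integral>\<^sup>+t. ennreal (sqrt 2) * ennreal (normal_density 0 (sqrt 2) t) \<partial>lborel)"
    proof (intro nn_integral_cong)
      fix t :: real
      have "std_normal_density t * exp (t\<^sup>2 / 4) = sqrt 2 * normal_density 0 (sqrt 2) t"
        by (simp add: std_normal_density_def normal_density_def exp_add[symmetric] real_sqrt_mult field_simps)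
      then show "ennreal (std_normal_density t) * ennreal (exp (t\<^sup>2 / 4)) = ennreal (sqrt 2) * ennreal (normal_density 0 (sqrt 2) t)"
        by (simp add: ennreal_mult[symmetric])
    qed
    also have "\<dots> = ennreal (sqrt 2) * emeasure (density lborel (normal_density 0 (sqrt 2))) UNIV"
      by (subst nn_integral_cmult) (auto simp: emeasure_density)
    also have "\<dots> = ennreal (sqrt 2)"
      using prob_space.emeasure_space_1[OF prob_space_normal_density[of "sqrt 2" 0]] by simp
    finally show ?thesis .
  qed
  have "(\<integral>\<^sup>+x. ennreal (exp ((norm x)\<^sup>2 / 4)) \<partial>(std_gaussian :: (real ^ 'd::finite) measure)) =
    (\<integral>\<^sup>+x. (\<Prod>b\<in>Basis. ennreal (exp ((x \<bullet> b)\<^sup>2 / 4))) \<partial>(std_gaussian :: (real ^ 'd::finite) measure))"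
  proof (intro nn_integral_cong)
    fix x :: "real ^ 'd"
    have "exp ((norm x)\<^sup>2 / 4) = (\<Prod>b\<in>Basis. exp ((x \<bullet> b)\<^sup>2 / 4))"
      by (simp add: exp_sum[symmetric] sum_divide_distrib[symmetric] power2_norm_eq_sum_Basis)
    then show "ennreal (exp ((norm x)\<^sup>2 / 4)) = (\<Prod>b\<in>Basis. ennreal (exp ((x \<bullet> b)\<^sup>2 / 4)))"
      by (simp add: prod_ennreal)
  qed
  also have "\<dots> = (\<Prod>b\<in>(Basis :: (real ^ 'd) set). ennreal (sqrt 2))"
    unfolding 1[symmetric] by (rule nn_integral_std_gaussian_prod) simp
  also have "\<dots> = ennreal (sqrt 2 ^ CARD('d))"
    by (simp add: ennreal_power)
  finally show ?thesis .
qed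

subsection \<open>Characteristic functions determine finite-dimensional laws\<close>

text \<open>Levy's uniqueness theorem is about probability laws, so the signed weight V is replaced
  by 2 + V, which is at least 1, and normalised. The shift is removed afterwards by the same
  statement with weight 0.\<close>

lemma char_weighted_real:
  fixes X :: "'a \<Rightarrow> real" and V :: "'a \<Rightarrow> real" and X' :: "'b \<Rightarrow> real" and V' :: "'b \<Rightarrow> real"
  assumes M: "prob_space M" "prob_space M'"
    and [measurable]: "X \<in> borel_measurable M" "X' \<in> borel_measurable M'"
      "V \<in> borel_measurable M" "V' \<in> borel_measurable M'"
    and bd: "\<And>x. \<bar>V x\<bar> \<le> 1" "\<And>x. \<bar>V' x\<bar> \<le> 1"
    and 1: "\<And>t. (\<integral>x. iexp (t * X x) \<partial>M) = (\<integral>x. iexp (t * X' x) \<partial>M')"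
    and 2: "\<And>t. (\<integral>x. V x * iexp (t * X x) \<partial>M) = (\<integral>x. V' x * iexp (t * X' x) \<partial>M')"
    and B[measurable]: "B \<in> sets borel"
  shows "(\<integral>x. V x * indicator B (X x) \<partial>M) = (\<integral>x. V' x * indicator B (X' x) \<partial>M')"
proof -
  interpret M: prob_space M by fact
  interpret M': prob_space M' by fact
  have key: "(\<integral>x. (2 + U x) * indicator B (X x) \<partial>M) = (\<integral>x. (2 + U' x) * indicator B (X' x) \<partial>M')"
    if [measurable]: "U \<in> borel_measurable M" "U' \<in> borel_measurable M'"
      and bd: "\<And>x. \<bar>U x\<bar> \<le> 1" "\<And>x. \<bar>U' x\<bar> \<le> 1"
      and 2: "\<And>t. (\<integral>x. U x * iexp (t * X x) \<partial>M) = (\<integral>x. U' x * iexp (t * X' x) \<partial>M')"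
    for U :: "'a \<Rightarrow> real" and U' :: "'b \<Rightarrow> real"
  proof -
    have iU: "integrable M U" "integrable M' U'"
      using bd by (auto intro!: M.integrable_const_bound[where B=1] M'.integrable_const_bound[where B=1] AE_I2)
    have "complex_of_real (\<integral>x. U x \<partial>M) = complex_of_real (\<integral>x. U' x \<partial>M')"
      using 2[of 0] by simp
    then have EU: "(\<integral>x. U x \<partial>M) = (\<integral>x. U' x \<partial>M')" using of_real_eq_iff by blast
    define m where "m = 2 + (\<integral>x. U x \<partial>M)"
    have "\<bar>\<integral>x. U x \<partial>M\<bar> \<le> 1"
    proof -
      have "\<bar>\<integral>x. U x \<partial>M\<bar> \<le> (\<integral>x. \<bar>U x\<bar> \<partial>M)" by (rule integral_abs_bound)
      also have "\<dots> \<le> (\<integral>x. 1 \<partial>M)" using iU bd by (intro integral_mono) auto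
      finally show ?thesis by (simp add: M.prob_space)
    qed
    then have m: "m \<ge> 1" by (simp add: m_def)
    define R where "R = distr (density M (\<lambda>x. ennreal ((2 + U x) / m))) borel X"
    define R' where "R' = distr (density M' (\<lambda>x. ennreal ((2 + U' x) / m))) borel X'"
    have pos: "0 \<le> (2 + U x) / m" "0 \<le> (2 + U' y) / m" for x y
      using bd(1)[of x] bd(2)[of y] m by (auto simp: abs_le_iff)
    have "prob_space (density M (\<lambda>x. ennreal ((2 + U x) / m)))"
    proof
      show "emeasure (density M (\<lambda>x. ennreal ((2 + U x) / m))) (space (density M (\<lambda>x. ennreal ((2 + U x) / m)))) = 1"
        using iU pos m
        by (simp add: emeasure_density nn_integral_eq_integral M.prob_space m_def[symmetric] cong: nn_integral_cong)
    qed
    then have R: "real_distribution R"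
      unfolding R_def by (intro prob_space.real_distribution_distr) auto
    have "prob_space (density M' (\<lambda>x. ennreal ((2 + U' x) / m)))"
    proof
      show "emeasure (density M' (\<lambda>x. ennreal ((2 + U' x) / m))) (space (density M' (\<lambda>x. ennreal ((2 + U' x) / m)))) = 1"
        using iU pos m
        by (simp add: emeasure_density nn_integral_eq_integral M'.prob_space m_def[unfolded EU, symmetric] cong: nn_integral_cong)
    qed
    then have R': "real_distribution R'"
      unfolding R'_def by (intro prob_space.real_distribution_distr) auto
    have "char R = char R'"
    proof
      fix t
      have i: "integrable M (\<lambda>x. iexp (t * X x))" "integrable M (\<lambda>x. U x * iexp (t * X x))"
        "integrable M' (\<lambda>x. iexp (t * X' x))" "integrable M' (\<lambda>x. U' x * iexp (t * X' x))"
        using bd by (auto intro!: M.integrable_const_bound[where B=1] M'.integrable_const_bound[where B=1] simp: norm_mult)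
      have "char R t = (\<integral>x. ((2 + U x) / m) *\<^sub>R iexp (t * X x) \<partial>M)"
        unfolding char_def R_def using pos
        by (subst integral_distr) (auto simp: integral_density)
      also have "\<dots> = (\<integral>x. (2 * iexp (t * X x) + U x * iexp (t * X x)) / m \<partial>M)"
        by (intro Bochner_Integration.integral_cong refl) (simp add: scaleR_conv_of_real field_simps)
      also have "\<dots> = (2 * (\<integral>x. iexp (t * X x) \<partial>M) + (\<integral>x. U x * iexp (t * X x) \<partial>M)) / m"
        using i by simp
      also have "\<dots> = (2 * (\<integral>x. iexp (t * X' x) \<partial>M') + (\<integral>x. U' x * iexp (t * X' x) \<partial>M')) / m"
        by (simp only: 1 2)
      also have "\<dots> = (\<integral>x. (2 * iexp (t * X' x) + U' x * iexp (t * X' x)) / m \<partial>M')"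
        using i by simp
      also have "\<dots> = (\<integral>x. ((2 + U' x) / m) *\<^sub>R iexp (t * X' x) \<partial>M')"
        by (intro Bochner_Integration.integral_cong refl) (simp add: scaleR_conv_of_real field_simps)
      also have "\<dots> = char R' t"
        unfolding char_def R'_def using pos
        by (subst integral_distr) (auto simp: integral_density)
      finally show "char R t = char R' t" .
    qed
    with R R' have RR: "R = R'" by (rule Levy_uniqueness)
    have "(\<integral>x. (2 + U x) * indicator B (X x) \<partial>M) = m * (\<integral>y. indicator B y \<partial>R)"
      unfolding R_def using pos m by (subst integral_distr) (auto simp: integral_density)
    also have "\<dots> = (\<integral>x. (2 + U' x) * indicator B (X' x) \<partial>M')"
      unfolding RR R'_def using pos m by (subst integral_distr) (auto simp: integral_density)
    finally show ?thesis .
  qed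
  have i: "integrable M (\<lambda>x. indicator B (X x) :: real)" "integrable M (\<lambda>x. V x * indicator B (X x))"
     "integrable M' (\<lambda>x. indicator B (X' x) :: real)" "integrable M' (\<lambda>x. V' x * indicator B (X' x))"
    using bd by (auto intro!: M.integrable_const_bound[where B=1] M'.integrable_const_bound[where B=1] simp: indicator_def)
  have "2 * (\<integral>x. indicator B (X x) \<partial>M) + (\<integral>x. V x * indicator B (X x) \<partial>M) =
     2 * (\<integral>x. indicator B (X' x) \<partial>M') + (\<integral>x. V' x * indicator B (X' x) \<partial>M')"
    using key[of V V'] bd 2 i by (simp add: distrib_right)
  moreover have "2 * (\<integral>x. indicator B (X x) \<partial>M) = (2 * (\<integral>x. indicator B (X' x) \<partial>M') :: real)"
  proof -
    have "(\<integral>x. (2 + (\<lambda>_. 0) x) * indicator B (X x) \<partial>M) = (\<integral>x. (2 + (\<lambda>_. 0) x) * indicator B (X' x) \<partial>M' :: real)"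
      by (rule key) simp_all
    then show ?thesis by simp
  qed
  ultimately show ?thesis by linarith
qed

text \<open>The real version is applied to Re W and Im W. Their transforms are combinations of those
  of W and of its conjugate, and the latter at t is the conjugate of the former at -t.\<close>

lemma char_weighted:
  fixes X :: "'a \<Rightarrow> real" and W :: "'a \<Rightarrow> complex" and X' :: "'b \<Rightarrow> real" and W' :: "'b \<Rightarrow> complex"
  assumes M: "prob_space M" "prob_space M'"
    and [measurable]: "X \<in> borel_measurable M" "X' \<in> borel_measurable M'"
      "W \<in> borel_measurable M" "W' \<in> borel_measurable M'"
    and bd: "\<And>x. norm (W x) \<le> 1" "\<And>x. norm (W' x) \<le> 1"
    and 1: "\<And>t. (\<integral>x. iexp (t * X x) \<partial>M) = (\<integral>x. iexp (t * X' x) \<partial>M')"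
    and 2: "\<And>t. (\<integral>x. W x * iexp (t * X x) \<partial>M) = (\<integral>x. W' x * iexp (t * X' x) \<partial>M')"
    and B[measurable]: "B \<in> sets borel"
  shows "(\<integral>x. W x * indicator B (X x) \<partial>M) = (\<integral>x. W' x * indicator B (X' x) \<partial>M')"
proof -
  interpret M: prob_space M by fact
  interpret M': prob_space M' by fact
  have [measurable]: "(\<lambda>x. cnj (W x)) \<in> borel_measurable M" "(\<lambda>x. cnj (W' x)) \<in> borel_measurable M'"
    using borel_measurable_continuous_onI[of cnj] by (auto intro!: measurable_compose[of _ _ borel cnj] continuous_intros)
  have i: "integrable M (\<lambda>x. W x * iexp (t * X x))" "integrable M' (\<lambda>x. W' x * iexp (t * X' x))"
    "integrable M (\<lambda>x. cnj (W x) * iexp (t * X x))" "integrable M' (\<lambda>x. cnj (W' x) * iexp (t * X' x))" for t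
    using bd by (auto intro!: M.integrable_const_bound[where B=1] M'.integrable_const_bound[where B=1] simp: norm_mult)
  have cnj: "(\<integral>x. cnj (W x) * iexp (t * X x) \<partial>M) = (\<integral>x. cnj (W' x) * iexp (t * X' x) \<partial>M')" for t
  proof -
    have "(\<integral>x. cnj (W x) * iexp (t * X x) \<partial>M) = (\<integral>x. cnj (W x * iexp ((-t) * X x)) \<partial>M)"
      by (intro Bochner_Integration.integral_cong) (auto simp: exp_cnj)
    also have "\<dots> = (\<integral>x. cnj (W' x * iexp ((-t) * X' x)) \<partial>M')"
      using 2[of "-t"] by (simp only: Bochner_Integration.integral_cnj)
    also have "\<dots> = (\<integral>x. cnj (W' x) * iexp (t * X' x) \<partial>M')"
      by (intro Bochner_Integration.integral_cong) (auto simp: exp_cnj)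
    finally show ?thesis .
  qed
  have Re: "(\<integral>x. Re (W x) * indicator B (X x) \<partial>M) = (\<integral>x. Re (W' x) * indicator B (X' x) \<partial>M')"
  proof (rule char_weighted_real[OF M _ _ _ _ _ _ 1])
    fix t
    have "(\<integral>x. Re (W x) * iexp (t * X x) \<partial>M) = (\<integral>x. (W x * iexp (t * X x) + cnj (W x) * iexp (t * X x)) / 2 \<partial>M)"
      by (intro Bochner_Integration.integral_cong refl) (simp only: distrib_right[symmetric] complex_add_cnj, simp)
    also have "\<dots> = (\<integral>x. (W' x * iexp (t * X' x) + cnj (W' x) * iexp (t * X' x)) / 2 \<partial>M')"
      using i[of t] 2[of t] cnj[of t] by simp
    also have "\<dots> = (\<integral>x. Re (W' x) * iexp (t * X' x) \<partial>M')"
      by (intro Bochner_Integration.integral_cong refl) (simp only: distrib_right[symmetric] complex_add_cnj, simp)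
    finally show "(\<integral>x. Re (W x) * iexp (t * X x) \<partial>M) = (\<integral>x. Re (W' x) * iexp (t * X' x) \<partial>M')" .
  qed (use bd abs_Re_le_cmod order_trans in \<open>auto, blast+\<close>)
  have Im: "(\<integral>x. Im (W x) * indicator B (X x) \<partial>M) = (\<integral>x. Im (W' x) * indicator B (X' x) \<partial>M')"
  proof (rule char_weighted_real[OF M _ _ _ _ _ _ 1])
    fix t
    have Im: "Im z * w = (z * w - cnj z * w) / (2 * \<i>)" for z w :: complex
      unfolding left_diff_distrib[symmetric] complex_diff_cnj by (simp add: field_simps)
    have "(\<integral>x. Im (W x) * iexp (t * X x) \<partial>M) = (\<integral>x. (W x * iexp (t * X x) - cnj (W x) * iexp (t * X x)) / (2 * \<i>) \<partial>M)"
      by (intro Bochner_Integration.integral_cong refl Im)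
    also have "\<dots> = (\<integral>x. (W' x * iexp (t * X' x) - cnj (W' x) * iexp (t * X' x)) / (2 * \<i>) \<partial>M')"
      using i[of t] 2[of t] cnj[of t] by simp
    also have "\<dots> = (\<integral>x. Im (W' x) * iexp (t * X' x) \<partial>M')"
      by (intro Bochner_Integration.integral_cong refl Im[symmetric])
    finally show "(\<integral>x. Im (W x) * iexp (t * X x) \<partial>M) = (\<integral>x. Im (W' x) * iexp (t * X' x) \<partial>M')" .
  qed (use bd abs_Im_le_cmod order_trans in \<open>auto, blast+\<close>)
  have i': "integrable M (\<lambda>x. W x * indicator B (X x))" "integrable M' (\<lambda>x. W' x * indicator B (X' x))"
    using bd by (auto intro!: M.integrable_const_bound[where B=1] M'.integrable_const_bound[where B=1] simp: norm_mult indicator_def)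
  show ?thesis
  proof (rule complex_eqI)
    show "Re (\<integral>x. W x * indicator B (X x) \<partial>M) = Re (\<integral>x. W' x * indicator B (X' x) \<partial>M')"
    proof -
      have *: "Re (w * indicator B x) = Re w * indicator B x" for w x
        by (simp add: indicator_def)
      show ?thesis
        unfolding integral_Re[OF i'(1), symmetric] integral_Re[OF i'(2), symmetric] * by (rule Re)
    qed
    show "Im (\<integral>x. W x * indicator B (X x) \<partial>M) = Im (\<integral>x. W' x * indicator B (X' x) \<partial>M')"
    proof -
      have *: "Im (w * indicator B x) = Im w * indicator B x" for w x
        by (simp add: indicator_def)
      show ?thesis
        unfolding integral_Im[OF i'(1), symmetric] integral_Im[OF i'(2), symmetric] * by (rule Im)
    qed
  qed
qed

text \<open>One coordinate at a time, exponentials are traded for indicators.\<close>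

lemma char_eq_imp_rect_eq:
  fixes M M' :: "('c \<Rightarrow> real) measure"
  assumes K: "finite K" and M: "prob_space M" "prob_space M'"
    and sets[measurable_cong]: "sets M = sets (PiM K (\<lambda>_. borel))" "sets M' = sets (PiM K (\<lambda>_. borel))"
    and char: "\<And>t. (\<integral>z. (\<Prod>c\<in>K. iexp (t c * z c)) \<partial>M) = (\<integral>z. (\<Prod>c\<in>K. iexp (t c * z c)) \<partial>M')"
    and B: "\<And>c. B c \<in> sets borel" and S: "S \<subseteq> K"
  shows "(\<integral>z. (\<Prod>c\<in>K. if c \<in> S then indicator (B c) (z c) else iexp (t c * z c)) \<partial>M)
    = (\<integral>z. (\<Prod>c\<in>K. if c \<in> S then indicator (B c) (z c) else iexp (t c * z c)) \<partial>M')"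
proof -
  have "finite S" using S K finite_subset by auto
  then show ?thesis using B S
  proof (induction S arbitrary: B t)
    case empty
    then show ?case using char by simp
  next
    case (insert s S)
    note [measurable] = insert.prems(1)
    \<comment> \<open>The factors of all coordinates other than s. Their modulus is at most 1, so
      they can serve as the weight in \<open>char_weighted\<close> while the frequency at s varies
      freely.\<close>
    define W where "W z = (\<Prod>c\<in>K - {s}. if c \<in> S then indicator (B c) (z c) else iexp (t c * z c))" for z
    have s: "s \<in> K" "s \<notin> S" using insert by auto
    have K': "K = insert s (K - {s})" using s by auto
    have split1: "(\<Prod>c\<in>K. if c \<in> insert s S then indicator (B c) (z c) else iexp (t c * z c)) = W z * indicator (B s) (z s)" for z
    proof -
      have "(\<Prod>c\<in>K - {s}. if c \<in> insert s S then indicator (B c) (z c) else iexp (t c * z c)) = W z"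
        unfolding W_def by (intro prod.cong) auto
      then show ?thesis using K s by (subst prod.remove[of _ s]) (auto simp: mult.commute)
    qed
    have split2: "(\<Prod>c\<in>K. if c \<in> S then indicator (B c) (z c) else iexp ((t(s := r)) c * z c)) = W z * iexp (r * z s)" for z r
    proof -
      have "(\<Prod>c\<in>K - {s}. if c \<in> S then indicator (B c) (z c) else iexp ((t(s := r)) c * z c)) = W z"
        unfolding W_def by (intro prod.cong) auto
      then show ?thesis using K s by (subst prod.remove[of _ s]) (auto simp: mult.commute)
    qed
    have split3: "(\<Prod>c\<in>K. iexp (((\<lambda>_. 0)(s := r)) c * z c)) = iexp (r * z s)" for z r
      using K s by (subst prod.remove[of _ s]) (auto simp: mult.commute)
    show ?case
      unfolding split1
    proof (rule char_weighted[OF M])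
      show "norm (W x) \<le> 1" for x
        unfolding W_def prod_norm[symmetric] by (intro prod_le_1) (auto simp: indicator_def)
      show "norm (W x) \<le> 1" for x
        unfolding W_def prod_norm[symmetric] by (intro prod_le_1) (auto simp: indicator_def)
      show "(\<integral>x. iexp (r * x s) \<partial>M) = (\<integral>x. iexp (r * x s) \<partial>M')" for r
        using char[of "(\<lambda>_. 0)(s := r)"] unfolding split3 .
      show "(\<integral>x. W x * iexp (r * x s) \<partial>M) = (\<integral>x. W x * iexp (r * x s) \<partial>M')" for r
        using insert.IH[of B "t(s := r)"] insert.prems unfolding split2 by auto
    qed (use s in \<open>auto simp: W_def\<close>)
  qed
qed

lemma PiM_real_char_eqI:
  fixes M M' :: "('c \<Rightarrow> real) measure"
  assumes K: "finite K" and M: "prob_space M" "prob_space M'"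
    and sets[measurable_cong]: "sets M = sets (PiM K (\<lambda>_. borel))" "sets M' = sets (PiM K (\<lambda>_. borel))"
    and char: "\<And>t. (\<integral>z. (\<Prod>c\<in>K. iexp (t c * z c)) \<partial>M) = (\<integral>z. (\<Prod>c\<in>K. iexp (t c * z c)) \<partial>M')"
  shows "M = M'"
proof -
  interpret M: prob_space M by fact
  interpret M': prob_space M' by fact
  have sp: "space M = space (PiM K (\<lambda>_. borel))" "space M' = space (PiM K (\<lambda>_. borel))"
    using sets by (auto dest: sets_eq_imp_space_eq)
  show ?thesis
  proof (rule measure_eqI_PiM_finite[OF K sets])
    fix A :: "'c \<Rightarrow> real set" assume A: "\<And>i. i \<in> K \<Longrightarrow> A i \<in> sets borel"
    define B where "B c = (if c \<in> K then A c else {})" for c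
    have B[measurable]: "B c \<in> sets borel" for c using A by (auto simp: B_def)
    have PiE: "Pi\<^sub>E K A = Pi\<^sub>E K B" by (auto simp: B_def PiE_iff)
    have S[measurable]: "Pi\<^sub>E K B \<in> sets M" "Pi\<^sub>E K B \<in> sets M'" using K by auto
    have *: "(\<Prod>c\<in>K. if c \<in> K then indicator (B c) (z c) else iexp (0 * z c)) = complex_of_real (indicator (Pi\<^sub>E K B) z)"
      if "z \<in> space (PiM K (\<lambda>_. borel :: real measure))" for z
      using that K by (auto simp: indicator_def PiE_iff space_PiM)
    have "complex_of_real (measure M (Pi\<^sub>E K B)) = (\<integral>z. complex_of_real (indicator (Pi\<^sub>E K B) z) \<partial>M)"
      using S by simp
    also have "\<dots> = (\<integral>z. (\<Prod>c\<in>K. if c \<in> K then indicator (B c) (z c) else iexp (0 * z c)) \<partial>M)"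
      by (intro Bochner_Integration.integral_cong refl) (simp only: sp *)
    also have "\<dots> = (\<integral>z. (\<Prod>c\<in>K. if c \<in> K then indicator (B c) (z c) else iexp (0 * z c)) \<partial>M')"
      by (rule char_eq_imp_rect_eq[OF K M sets char, of B K "\<lambda>_. 0", OF B subset_refl])
    also have "\<dots> = (\<integral>z. complex_of_real (indicator (Pi\<^sub>E K B) z) \<partial>M')"
      by (intro Bochner_Integration.integral_cong refl) (simp only: sp *)
    also have "\<dots> = complex_of_real (measure M' (Pi\<^sub>E K B))"
      using S by simp
    finally have "measure M (Pi\<^sub>E K B) = measure M' (Pi\<^sub>E K B)" by (simp only: of_real_eq_iff)
    then show "emeasure M (Pi\<^sub>E K A) = emeasure M' (Pi\<^sub>E K A)"
      unfolding PiE M.emeasure_eq_measure M'.emeasure_eq_measure by simp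
  next
    show "range (\<lambda>_::nat. space (PiM K (\<lambda>_. borel :: real measure))) \<subseteq> prod_algebra K (\<lambda>_. borel)"
      using K by (auto simp: space_PiM intro!: prod_algebraI_finite)
  qed auto
qed

text \<open>Vectors are flattened to scalars indexed by I \<times> Basis; a scalar frequency t on
  pairs corresponds to the vector frequency with coordinates t (i, b) at i.\<close>

lemma PiM_char_eqI:
  fixes M M' :: "('i \<Rightarrow> 'a::euclidean_space) measure"
  assumes I: "finite I" and M: "prob_space M" "prob_space M'"
    and sets[measurable_cong]: "sets M = sets (PiM I (\<lambda>_. borel))" "sets M' = sets (PiM I (\<lambda>_. borel))"
    and char: "\<And>v. (\<integral>z. iexp (\<Sum>i\<in>I. v i \<bullet> z i) \<partial>M) = (\<integral>z. iexp (\<Sum>i\<in>I. v i \<bullet> z i) \<partial>M')"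
  shows "M = M'"
proof -
  define K where "K = I \<times> (Basis :: 'a set)"
  have K: "finite K" using I by (simp add: K_def)
  define f where "f z = (\<lambda>c\<in>K. z (fst c) \<bullet> snd c)" for z :: "'i \<Rightarrow> 'a"
  define g where "g x = (\<lambda>i\<in>I. \<Sum>b\<in>Basis. x (i, b) *\<^sub>R b)" for x :: "'i \<times> 'a \<Rightarrow> real"
  have f[measurable]: "f \<in> PiM I (\<lambda>_. borel) \<rightarrow>\<^sub>M PiM K (\<lambda>_. borel)"
    unfolding f_def K_def by (intro measurable_restrict) auto
  have g[measurable]: "g \<in> PiM K (\<lambda>_. borel) \<rightarrow>\<^sub>M PiM I (\<lambda>_. borel)"
    unfolding g_def K_def by (intro measurable_restrict borel_measurable_sum borel_measurable_scaleR) auto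
  have gf: "g (f z) = z" if "z \<in> space (PiM I (\<lambda>_. borel))" for z
    using that by (auto simp: g_def f_def K_def fun_eq_iff space_PiM PiE_iff extensional_def euclidean_representation)
  have "distr M (PiM K (\<lambda>_. borel)) f = distr M' (PiM K (\<lambda>_. borel)) f"
  proof (rule PiM_real_char_eqI[OF K])
    show "prob_space (distr M (PiM K (\<lambda>_. borel)) f)" "prob_space (distr M' (PiM K (\<lambda>_. borel)) f)"
      using M by (auto intro!: prob_space.prob_space_distr)
    fix t :: "'i \<times> 'a \<Rightarrow> real"
    have *: "(\<Prod>c\<in>K. iexp (t c * f z c)) = iexp (\<Sum>i\<in>I. (\<Sum>b\<in>Basis. t (i, b) *\<^sub>R b) \<bullet> z i)" for z
    proof -
      have "(\<Sum>c\<in>K. t c * f z c) = (\<Sum>(i, b)\<in>I \<times> Basis. t (i, b) * (b \<bullet> z i))"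
        unfolding K_def by (intro sum.cong refl) (auto simp: f_def K_def inner_commute)
      also have "\<dots> = (\<Sum>i\<in>I. \<Sum>b\<in>Basis. t (i, b) * (b \<bullet> z i))"
        by (rule sum.cartesian_product[symmetric])
      finally have "(\<Sum>c\<in>K. t c * f z c) = (\<Sum>i\<in>I. (\<Sum>b\<in>Basis. t (i, b) *\<^sub>R b) \<bullet> z i)"
        by (simp add: inner_sum_left)
      then have "iexp (\<Sum>i\<in>I. (\<Sum>b\<in>Basis. t (i, b) *\<^sub>R b) \<bullet> z i) = exp (\<Sum>c\<in>K. \<i> * complex_of_real (t c * f z c))"
        by (simp only: sum_distrib_left[symmetric] of_real_sum[symmetric])
      then show ?thesis using K by (simp only: exp_sum)
    qed
    show "(\<integral>z. (\<Prod>c\<in>K. iexp (t c * z c)) \<partial>distr M (PiM K (\<lambda>_. borel)) f) =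
       (\<integral>z. (\<Prod>c\<in>K. iexp (t c * z c)) \<partial>distr M' (PiM K (\<lambda>_. borel)) f)"
    proof -
      have "(\<integral>z. (\<Prod>c\<in>K. iexp (t c * z c)) \<partial>distr N (PiM K (\<lambda>_. borel)) f) = (\<integral>z. (\<Prod>c\<in>K. iexp (t c * f z c)) \<partial>N)"
        if [measurable_cong]: "sets N = sets (PiM I (\<lambda>_. borel))" for N
        by (rule integral_distr) simp_all
      from this[OF sets(1)] this[OF sets(2)] show ?thesis unfolding * char by simp
    qed
  qed auto
  then have "distr (distr M (PiM K (\<lambda>_. borel)) f) (PiM I (\<lambda>_. borel)) g = distr (distr M' (PiM K (\<lambda>_. borel)) f) (PiM I (\<lambda>_. borel)) g"
    by simp
  moreover have "distr (distr N (PiM K (\<lambda>_. borel)) f) (PiM I (\<lambda>_. borel)) g = N"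
    if [measurable_cong]: "sets N = sets (PiM I (\<lambda>_. borel))" for N
  proof -
    have "distr (distr N (PiM K (\<lambda>_. borel)) f) (PiM I (\<lambda>_. borel)) g = distr N (PiM I (\<lambda>_. borel)) (g \<circ> f)"
      by (rule distr_distr) measurable
    also have "\<dots> = distr N N (\<lambda>x. x)"
      using sets_eq_imp_space_eq[OF that] that by (intro distr_cong) (auto simp: gf)
    finally have "distr (distr N (PiM K (\<lambda>_. borel)) f) (PiM I (\<lambda>_. borel)) g = distr N N (\<lambda>x. x)" .
    then show ?thesis by (simp add: distr_id)
  qed
  ultimately show ?thesis using sets by metis
qed

subsection \<open>Splitting independent noise off a Gaussian vector\<close>

abbreviation gauss_vec :: "'i set \<Rightarrow> ('i \<Rightarrow> real ^ 'd::finite) measure" where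
  "gauss_vec I \<equiv> PiM I (\<lambda>_. std_gaussian)"

lemma prob_space_gauss_vec: "prob_space (gauss_vec I)"
  by (intro prob_space_PiM prob_space_std_gaussian)

lemma sets_gauss_vec[measurable_cong]: "sets (gauss_vec I) = sets (PiM I (\<lambda>_. borel))"
  by (intro sets_PiM_cong) auto

lemma space_gauss_vec: "space (gauss_vec I) = space (PiM I (\<lambda>_. borel))"
  using sets_gauss_vec by (rule sets_eq_imp_space_eq)

lemma char_gauss_vec:
  fixes v :: "'i \<Rightarrow> real ^ 'd::finite"
  assumes I: "finite I"
  shows "(\<integral>z. iexp (\<Sum>i\<in>I. v i \<bullet> z i) \<partial>gauss_vec I) = exp (- (\<Sum>i\<in>I. (norm (v i))\<^sup>2) / 2)"
proof -
  interpret P: product_sigma_finite "\<lambda>_::'i. std_gaussian :: (real ^ 'd) measure"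
    by standard
  have "(\<integral>z. iexp (\<Sum>i\<in>I. v i \<bullet> z i) \<partial>gauss_vec I) = (\<integral>z. (\<Prod>i\<in>I. iexp (v i \<bullet> z i)) \<partial>gauss_vec I)"
    using I by (intro Bochner_Integration.integral_cong refl) (simp only: exp_sum of_real_sum sum_distrib_left)
  also have "\<dots> = (\<Prod>i\<in>I. \<integral>x. iexp (v i \<bullet> x) \<partial>std_gaussian)"
    by (intro P.product_integral_prod I std_gaussian.integrable_const_bound[where B=1]) auto
  also have "\<dots> = complex_of_real (\<Prod>i\<in>I. exp (- (norm (v i))\<^sup>2 / 2))"
    by (simp only: char_std_gaussian of_real_prod)
  also have "(\<Prod>i\<in>I. exp (- (norm (v i))\<^sup>2 / 2)) = exp (- (\<Sum>i\<in>I. (norm (v i))\<^sup>2) / 2)"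
    using I by (simp add: exp_sum[symmetric] sum_negf sum_divide_distrib)
  finally show ?thesis .
qed

lemma pair_char_mult:
  fixes f :: "'a \<Rightarrow> real" and g :: "'b \<Rightarrow> real"
  assumes "prob_space M" "prob_space N"
    and [measurable]: "f \<in> borel_measurable M" "g \<in> borel_measurable N"
  shows "(\<integral>z. iexp (f (fst z) + g (snd z)) \<partial>(M \<Otimes>\<^sub>M N)) = (\<integral>x. iexp (f x) \<partial>M) * (\<integral>y. iexp (g y) \<partial>N)"
proof -
  interpret M: prob_space M by fact
  interpret N: prob_space N by fact
  interpret MN: pair_prob_space M N ..
  have "(\<integral>z. iexp (f (fst z) + g (snd z)) \<partial>(M \<Otimes>\<^sub>M N)) = (\<integral>x. \<integral>y. iexp (f x + g y) \<partial>N \<partial>M)"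
    by (subst MN.integral_fst'[symmetric]) (auto intro!: MN.P.integrable_const_bound[where B=1])
  also have "\<dots> = (\<integral>x. iexp (f x) * (\<integral>y. iexp (g y) \<partial>N) \<partial>M)"
    by (intro Bochner_Integration.integral_cong refl) (simp add: distrib_left exp_add)
  also have "\<dots> = (\<integral>x. iexp (f x) \<partial>M) * (\<integral>y. iexp (g y) \<partial>N)"
    by simp
  finally show ?thesis .
qed

text \<open>
  With \<open>G = B\<^sup>T B\<close>, the vector \<open>\<sigma> B\<^sup>T \<xi> + \<rho>\<close> is made standard and independent of
  \<open>\<xi> - \<sigma> B (\<sigma> B\<^sup>T \<xi> + \<rho>)\<close> by a \<open>\<rho>\<close> of covariance \<open>I - \<sigma>\<^sup>2 G\<close>; diagonal dominance
  writes this matrix as a combination of squares of the forms \<open>\<mu>\<^sub>p - \<mu>\<^sub>q\<close> and \<open>\<mu>\<^sub>p\<close>.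
\<close>

lemma gaussian_split:
  fixes B :: "nat \<Rightarrow> nat \<Rightarrow> real" and N J :: nat and \<sigma> :: real
  defines "G p q \<equiv> (\<Sum>k<N. B k p * B k q)"
  assumes B: "\<And>k j. 0 \<le> B k j" and \<sigma>: "0 \<le> \<sigma>"
    and dom: "\<And>p. p < J \<Longrightarrow> \<sigma>\<^sup>2 * (\<Sum>q<J. G p q) \<le> 1"
  obtains E :: "('d::finite) seq measure"
  where "prob_space E" "sets E = sets (PiM {..<N} (\<lambda>_. borel))"
    "distr (E \<Otimes>\<^sub>M gauss_vec {..<J}) (PiM {..<N} (\<lambda>_. borel))
       (\<lambda>z. \<lambda>k\<in>{..<N}. fst z k + \<sigma> *\<^sub>R (\<Sum>j<J. B k j *\<^sub>R snd z j)) = gauss_vec {..<N}"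
proof -
  have G: "0 \<le> G p q" "G p q = G q p" for p q
    unfolding G_def using B by (auto intro!: sum_nonneg mult_nonneg_nonneg simp: mult.commute)
  \<comment> \<open>Weights of the squares. A pair occurs in both orders, hence the factor 1/2 in c;
    d takes what is left of the diagonal and is a real root by \<open>dom\<close>.\<close>
  define c where "c p q = \<sigma> * sqrt (G p q / 2)" for p q
  define d where "d j = sqrt (1 - \<sigma>\<^sup>2 * (\<Sum>q<J. G j q))" for j
  let ?P = "{..<J} \<times> {..<J}"
  \<comment> \<open>Paired with \<mu>, this vector has variance sum of (c p q)^2 |\<mu> p - \<mu>
    q|^2 plus sum of (d j)^2 |\<mu> j|^2, which is |\<mu>|^2 minus \<sigma>^2 times the Gram form of
    \<mu>.\<close>
  define \<rho> :: "(nat \<times> nat \<Rightarrow> real ^ 'd) \<Rightarrow> 'd seq \<Rightarrow> nat \<Rightarrow> real ^ 'd" where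
    "\<rho> g g' j = (\<Sum>pq\<in>?P. (c (fst pq) (snd pq) * (of_bool (j = fst pq) - of_bool (j = snd pq))) *\<^sub>R g pq) + d j *\<^sub>R g' j" for g g' j
  define \<eta> :: "'d seq \<times> (nat \<times> nat \<Rightarrow> real ^ 'd) \<times> 'd seq \<Rightarrow> nat \<Rightarrow> real ^ 'd" where
    "\<eta> z = (\<lambda>k\<in>{..<N}. fst z k - \<sigma> *\<^sub>R (\<Sum>j<J. B k j *\<^sub>R (\<sigma> *\<^sub>R (\<Sum>l<N. B l j *\<^sub>R fst z l) + \<rho> (fst (snd z)) (snd (snd z)) j)))" for z
  define E0 :: "('d seq \<times> (nat \<times> nat \<Rightarrow> real ^ 'd) \<times> 'd seq) measure" where
    "E0 = gauss_vec {..<N} \<Otimes>\<^sub>M (gauss_vec ?P \<Otimes>\<^sub>M gauss_vec {..<J})"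
  have \<eta>_meas[measurable]: "\<eta> \<in> E0 \<rightarrow>\<^sub>M PiM {..<N} (\<lambda>_. borel)"
    unfolding \<eta>_def E0_def \<rho>_def by (intro measurable_restrict) measurable
  define E where "E = distr E0 (PiM {..<N} (\<lambda>_. borel)) \<eta>"
  interpret P1: pair_prob_space "gauss_vec ?P :: (nat \<times> nat \<Rightarrow> real ^ 'd) measure" "gauss_vec {..<J} :: 'd seq measure"
    by (intro pair_prob_space.intro pair_sigma_finite.intro prob_space_imp_sigma_finite prob_space_gauss_vec)
  interpret P2: pair_prob_space "gauss_vec {..<N} :: 'd seq measure" "gauss_vec ?P \<Otimes>\<^sub>M gauss_vec {..<J} :: ((nat \<times> nat \<Rightarrow> real ^ 'd) \<times> 'd seq) measure"
    by (intro pair_prob_space.intro pair_sigma_finite.intro prob_space_imp_sigma_finite prob_space_gauss_vec P1.prob_space_axioms)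
  have E0: "prob_space E0" unfolding E0_def by (rule P2.prob_space_axioms)
  have E: "prob_space E" unfolding E_def by (rule prob_space.prob_space_distr[OF E0 \<eta>_meas])
  have sets_E[measurable_cong]: "sets E = sets (PiM {..<N} (\<lambda>_. borel))" by (simp add: E_def)
  \<comment> \<open>The vector \<eta> is Gaussian with covariance I - \<sigma>^2 B B^T, exactly what
    the independent shift \<sigma> B \<zeta> restores to I.\<close>
  have charE: "(\<integral>y. iexp (\<Sum>k<N. v k \<bullet> y k) \<partial>E) = complex_of_real (exp (- ((\<Sum>k<N. (norm (v k))\<^sup>2) - \<sigma>\<^sup>2 * (\<Sum>j<J. (norm (\<Sum>k<N. B k j *\<^sub>R v k))\<^sup>2)) / 2))"
    for v :: "'d seq"
  proof -
    define \<mu> where "\<mu> j = (\<Sum>k<N. B k j *\<^sub>R v k)" for j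
    define v1 where "v1 l = v l - \<sigma>\<^sup>2 *\<^sub>R (\<Sum>j<J. B l j *\<^sub>R \<mu> j)" for l
    define v2 where "v2 pq = - (\<sigma> * c (fst pq) (snd pq)) *\<^sub>R (\<mu> (fst pq) - \<mu> (snd pq))" for pq
    define v3 where "v3 j = - (\<sigma> * d j) *\<^sub>R \<mu> j" for j
    have lin: "(\<Sum>k<N. v k \<bullet> \<eta> z k) = (\<Sum>l<N. v1 l \<bullet> fst z l) + ((\<Sum>pq\<in>?P. v2 pq \<bullet> fst (snd z) pq) + (\<Sum>j<J. v3 j \<bullet> snd (snd z) j))" for z
    proof -
      define R where "R j = \<rho> (fst (snd z)) (snd (snd z)) j" for j
      define S where "S j = (\<Sum>l<N. B l j *\<^sub>R fst z l)" for j
      have R: "(\<Sum>j<J. \<mu> j \<bullet> R j) = (\<Sum>pq\<in>?P. c (fst pq) (snd pq) * ((\<mu> (fst pq) - \<mu> (snd pq)) \<bullet> fst (snd z) pq)) + (\<Sum>j<J. d j * (\<mu> j \<bullet> snd (snd z) j))"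
      proof -
        have "(\<Sum>j<J. \<mu> j \<bullet> R j) = (\<Sum>j<J. (\<Sum>pq\<in>?P. c (fst pq) (snd pq) * (of_bool (j = fst pq) - of_bool (j = snd pq)) * (\<mu> j \<bullet> fst (snd z) pq)) + d j * (\<mu> j \<bullet> snd (snd z) j))"
          by (simp add: R_def \<rho>_def inner_add_right inner_sum_right)
        also have "\<dots> = (\<Sum>pq\<in>?P. \<Sum>j<J. c (fst pq) (snd pq) * (of_bool (j = fst pq) - of_bool (j = snd pq)) * (\<mu> j \<bullet> fst (snd z) pq)) + (\<Sum>j<J. d j * (\<mu> j \<bullet> snd (snd z) j))"
          unfolding sum.distrib by (subst sum.swap) simp
        also have "(\<Sum>pq\<in>?P. \<Sum>j<J. c (fst pq) (snd pq) * (of_bool (j = fst pq) - of_bool (j = snd pq)) * (\<mu> j \<bullet> fst (snd z) pq)) =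
           (\<Sum>pq\<in>?P. c (fst pq) (snd pq) * ((\<mu> (fst pq) - \<mu> (snd pq)) \<bullet> fst (snd z) pq))"
        proof (intro sum.cong refl)
          fix pq assume pq: "pq \<in> ?P"
          have del: "(\<Sum>j<J. of_bool (j = p) * (\<mu> j \<bullet> y)) = \<mu> p \<bullet> y" if "p < J" for p y
          proof -
            have "(\<Sum>j<J. of_bool (j = p) * (\<mu> j \<bullet> y)) = (\<Sum>j<J. if j = p then \<mu> j \<bullet> y else 0)"
              by (intro sum.cong) auto
            then show ?thesis using that by simp
          qed
          have "(\<Sum>j<J. c (fst pq) (snd pq) * (of_bool (j = fst pq) - of_bool (j = snd pq)) * (\<mu> j \<bullet> fst (snd z) pq)) =
            c (fst pq) (snd pq) * ((\<Sum>j<J. of_bool (j = fst pq) * (\<mu> j \<bullet> fst (snd z) pq)) - (\<Sum>j<J. of_bool (j = snd pq) * (\<mu> j \<bullet> fst (snd z) pq)))"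
            by (simp only: left_diff_distrib right_diff_distrib sum_subtractf sum_distrib_left mult.assoc)
          then show "(\<Sum>j<J. c (fst pq) (snd pq) * (of_bool (j = fst pq) - of_bool (j = snd pq)) * (\<mu> j \<bullet> fst (snd z) pq)) =
            c (fst pq) (snd pq) * ((\<mu> (fst pq) - \<mu> (snd pq)) \<bullet> fst (snd z) pq)"
            using pq del by (auto simp: inner_diff_left)
        qed
        finally show ?thesis .
      qed
      have S: "(\<Sum>j<J. \<mu> j \<bullet> S j) = (\<Sum>l<N. (\<Sum>j<J. B l j *\<^sub>R \<mu> j) \<bullet> fst z l)"
        unfolding S_def inner_sum_left inner_sum_right by (subst sum.swap) simp
      have "(\<Sum>k<N. v k \<bullet> \<eta> z k) = (\<Sum>k<N. v k \<bullet> fst z k - \<sigma> * (\<Sum>j<J. B k j * (v k \<bullet> (\<sigma> *\<^sub>R S j + R j))))"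
        by (intro sum.cong refl) (simp add: \<eta>_def S_def R_def inner_diff_right inner_sum_right)
      also have "\<dots> = (\<Sum>k<N. v k \<bullet> fst z k) - \<sigma> * (\<Sum>k<N. \<Sum>j<J. B k j * (v k \<bullet> (\<sigma> *\<^sub>R S j + R j)))"
        by (simp add: sum_subtractf sum_distrib_left)
      also have "(\<Sum>k<N. \<Sum>j<J. B k j * (v k \<bullet> (\<sigma> *\<^sub>R S j + R j))) = (\<Sum>j<J. \<mu> j \<bullet> (\<sigma> *\<^sub>R S j + R j))"
        unfolding \<mu>_def inner_sum_left by (subst sum.swap) simp
      also have "\<dots> = \<sigma> * (\<Sum>j<J. \<mu> j \<bullet> S j) + (\<Sum>j<J. \<mu> j \<bullet> R j)"
        by (simp add: inner_add_right sum.distrib sum_distrib_left)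
      finally have "(\<Sum>k<N. v k \<bullet> \<eta> z k) = ((\<Sum>k<N. v k \<bullet> fst z k) - \<sigma>\<^sup>2 * (\<Sum>l<N. (\<Sum>j<J. B l j *\<^sub>R \<mu> j) \<bullet> fst z l)) - \<sigma> * (\<Sum>j<J. \<mu> j \<bullet> R j)"
        unfolding S by (simp add: algebra_simps power2_eq_square)
      moreover have "(\<Sum>l<N. v1 l \<bullet> fst z l) = (\<Sum>k<N. v k \<bullet> fst z k) - \<sigma>\<^sup>2 * (\<Sum>l<N. (\<Sum>j<J. B l j *\<^sub>R \<mu> j) \<bullet> fst z l)"
        by (simp add: v1_def inner_diff_left sum_subtractf sum_distrib_left)
      moreover have "(\<Sum>pq\<in>?P. v2 pq \<bullet> fst (snd z) pq) + (\<Sum>j<J. v3 j \<bullet> snd (snd z) j) = - \<sigma> * (\<Sum>j<J. \<mu> j \<bullet> R j)"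
        unfolding R distrib_left sum_distrib_left by (simp add: v2_def v3_def mult.assoc sum_negf)
      ultimately show ?thesis by simp
    qed
    \<comment> \<open>With \<mu> = B^T v, let U = |\<mu>|^2, let X = |B \<mu>|^2 be the Gram form
      and Y its majorant by row sums. The three sources contribute - 2 \<sigma>^2 U + \<sigma>^4 X,
      \<sigma>^4 (Y - X) and \<sigma>^2 U - \<sigma>^4 Y, so all terms of order \<sigma>^4
      cancel.\<close>
    have quad: "(\<Sum>l<N. (norm (v1 l))\<^sup>2) + ((\<Sum>pq\<in>?P. (norm (v2 pq))\<^sup>2) + (\<Sum>j<J. (norm (v3 j))\<^sup>2))
       = (\<Sum>k<N. (norm (v k))\<^sup>2) - \<sigma>\<^sup>2 * (\<Sum>j<J. (norm (\<mu> j))\<^sup>2)"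
    proof -
      define b where "b l = (\<Sum>j<J. B l j *\<^sub>R \<mu> j)" for l
      define X where "X = (\<Sum>p<J. \<Sum>q<J. G p q * (\<mu> p \<bullet> \<mu> q))"
      define Y where "Y = (\<Sum>p<J. (norm (\<mu> p))\<^sup>2 * (\<Sum>q<J. G p q))"
      define U where "U = (\<Sum>j<J. (norm (\<mu> j))\<^sup>2)"
      have b1: "(\<Sum>l<N. v l \<bullet> b l) = U"
      proof -
        have "(\<Sum>l<N. v l \<bullet> b l) = (\<Sum>j<J. \<Sum>l<N. B l j * (v l \<bullet> \<mu> j))"
          unfolding b_def inner_sum_right by (subst sum.swap) simp
        also have "\<dots> = (\<Sum>j<J. \<mu> j \<bullet> \<mu> j)"
          unfolding \<mu>_def inner_sum_left by simp
        finally show ?thesis by (simp add: U_def power2_norm_eq_inner)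
      qed
      have b2: "(\<Sum>l<N. (norm (b l))\<^sup>2) = X"
      proof -
        have "(\<Sum>l<N. (norm (b l))\<^sup>2) = (\<Sum>l<N. \<Sum>p<J. \<Sum>q<J. B l p * B l q * (\<mu> p \<bullet> \<mu> q))"
          unfolding b_def power2_norm_eq_inner by (simp add: inner_sum_left inner_sum_right sum_distrib_left mult.assoc mult.left_commute)
             (simp add: inner_commute)
        also have "\<dots> = (\<Sum>p<J. \<Sum>l<N. \<Sum>q<J. B l p * B l q * (\<mu> p \<bullet> \<mu> q))"
          by (rule sum.swap)
        also have "\<dots> = (\<Sum>p<J. \<Sum>q<J. \<Sum>l<N. B l p * B l q * (\<mu> p \<bullet> \<mu> q))"
          by (intro sum.cong refl sum.swap)
        also have "\<dots> = X"
          unfolding X_def G_def by (simp add: sum_distrib_right)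
        finally show ?thesis .
      qed
      have q1: "(\<Sum>l<N. (norm (v1 l))\<^sup>2) = (\<Sum>k<N. (norm (v k))\<^sup>2) - 2 * \<sigma>\<^sup>2 * U + \<sigma>^4 * X"
      proof -
        have "(\<Sum>l<N. (norm (v1 l))\<^sup>2) = (\<Sum>l<N. (norm (v l))\<^sup>2 - 2 * \<sigma>\<^sup>2 * (v l \<bullet> b l) + \<sigma>^4 * (norm (b l))\<^sup>2)"
          unfolding v1_def b_def[symmetric] power2_norm_eq_inner
          by (intro sum.cong refl) (simp add: inner_diff_left inner_diff_right inner_commute algebra_simps power2_eq_square power4_eq_xxxx)
        also have "\<dots> = (\<Sum>k<N. (norm (v k))\<^sup>2) - 2 * \<sigma>\<^sup>2 * U + \<sigma>^4 * X"
          unfolding b1[symmetric] b2[symmetric] by (simp add: sum.distrib sum_subtractf sum_distrib_left)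
        finally show ?thesis .
      qed
      have q2: "(\<Sum>pq\<in>?P. (norm (v2 pq))\<^sup>2) = \<sigma>^4 * (Y - X)"
      proof -
        have c2: "(c p q)\<^sup>2 = \<sigma>\<^sup>2 * (G p q / 2)" for p q
          unfolding c_def power_mult_distrib using G(1)[of p q] by simp
        have "(\<Sum>pq\<in>?P. (norm (v2 pq))\<^sup>2) = (\<Sum>(p, q)\<in>?P. \<sigma>^4 * (G p q / 2 * (norm (\<mu> p))\<^sup>2 + G p q / 2 * (norm (\<mu> q))\<^sup>2 - G p q * (\<mu> p \<bullet> \<mu> q)))"
        proof (intro sum.cong refl, clarify)
          fix p q
          have "(norm (v2 (p, q)))\<^sup>2 = \<sigma>\<^sup>2 * (c p q)\<^sup>2 * (norm (\<mu> p - \<mu> q))\<^sup>2"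
            by (simp add: v2_def power_mult_distrib)
          also have "\<dots> = \<sigma>^4 * (G p q / 2 * (norm (\<mu> p))\<^sup>2 + G p q / 2 * (norm (\<mu> q))\<^sup>2 - G p q * (\<mu> p \<bullet> \<mu> q))"
            unfolding c2 power2_norm_eq_inner
            by (simp add: inner_diff_left inner_diff_right inner_commute algebra_simps power2_eq_square power4_eq_xxxx)
          finally show "(norm (v2 (p, q)))\<^sup>2 = \<sigma>^4 * (G p q / 2 * (norm (\<mu> p))\<^sup>2 + G p q / 2 * (norm (\<mu> q))\<^sup>2 - G p q * (\<mu> p \<bullet> \<mu> q))" .
        qed
        also have "\<dots> = (\<Sum>p<J. \<Sum>q<J. \<sigma>^4 * (G p q / 2 * (norm (\<mu> p))\<^sup>2 + G p q / 2 * (norm (\<mu> q))\<^sup>2 - G p q * (\<mu> p \<bullet> \<mu> q)))"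
          by (rule sum.cartesian_product[symmetric])
        also have "\<dots> = \<sigma>^4 * ((\<Sum>p<J. \<Sum>q<J. G p q / 2 * (norm (\<mu> p))\<^sup>2) + (\<Sum>p<J. \<Sum>q<J. G p q / 2 * (norm (\<mu> q))\<^sup>2) - X)"
          unfolding X_def by (simp only: sum.distrib sum_subtractf sum_distrib_left[symmetric])
        also have "(\<Sum>p<J. \<Sum>q<J. G p q / 2 * (norm (\<mu> q))\<^sup>2) = (\<Sum>p<J. \<Sum>q<J. G p q / 2 * (norm (\<mu> p))\<^sup>2)"
          by (subst sum.swap) (simp add: G(2))
        also have "(\<Sum>p<J. \<Sum>q<J. G p q / 2 * (norm (\<mu> p))\<^sup>2) + (\<Sum>p<J. \<Sum>q<J. G p q / 2 * (norm (\<mu> p))\<^sup>2) = Y"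
          unfolding Y_def sum.distrib[symmetric] by (simp add: sum_distrib_right mult.commute)
        finally show ?thesis .
      qed
      have q3: "(\<Sum>j<J. (norm (v3 j))\<^sup>2) = \<sigma>\<^sup>2 * U - \<sigma>^4 * Y"
      proof -
        have "(\<Sum>j<J. (norm (v3 j))\<^sup>2) = (\<Sum>j<J. \<sigma>\<^sup>2 * (norm (\<mu> j))\<^sup>2 - \<sigma>^4 * ((norm (\<mu> j))\<^sup>2 * (\<Sum>q<J. G j q)))"
        proof (intro sum.cong refl)
          fix j assume "j \<in> {..<J}"
          then have "(d j)\<^sup>2 = 1 - \<sigma>\<^sup>2 * (\<Sum>q<J. G j q)"
            unfolding d_def using dom[of j] by simp
          then show "(norm (v3 j))\<^sup>2 = \<sigma>\<^sup>2 * (norm (\<mu> j))\<^sup>2 - \<sigma>^4 * ((norm (\<mu> j))\<^sup>2 * (\<Sum>q<J. G j q))"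
            by (simp add: v3_def power_mult_distrib) (simp add: algebra_simps power2_eq_square power4_eq_xxxx)
        qed
        then show ?thesis unfolding U_def Y_def by (simp add: sum_subtractf sum_distrib_left)
      qed
      show ?thesis
        unfolding q1 q2 q3 U_def[symmetric] by (simp add: algebra_simps)
    qed
    have "(\<integral>y. iexp (\<Sum>k<N. v k \<bullet> y k) \<partial>E) = (\<integral>z. iexp (\<Sum>k<N. v k \<bullet> \<eta> z k) \<partial>E0)"
      unfolding E_def by (rule integral_distr) simp_all
    also have "\<dots> = (\<integral>z. iexp ((\<Sum>l<N. v1 l \<bullet> fst z l) + (\<lambda>y. (\<Sum>pq\<in>?P. v2 pq \<bullet> fst y pq) + (\<Sum>j<J. v3 j \<bullet> snd y j)) (snd z)) \<partial>E0)"
      unfolding lin ..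
    also have "\<dots> = (\<integral>x. iexp (\<Sum>l<N. v1 l \<bullet> x l) \<partial>gauss_vec {..<N}) *
        (\<integral>y. iexp ((\<Sum>pq\<in>?P. v2 pq \<bullet> fst y pq) + (\<Sum>j<J. v3 j \<bullet> snd y j)) \<partial>(gauss_vec ?P \<Otimes>\<^sub>M gauss_vec {..<J}))"
      unfolding E0_def by (rule pair_char_mult) (use P1.prob_space_axioms in \<open>auto intro: prob_space_gauss_vec\<close>)
    also have "(\<integral>y. iexp ((\<Sum>pq\<in>?P. v2 pq \<bullet> fst y pq) + (\<Sum>j<J. v3 j \<bullet> snd y j)) \<partial>(gauss_vec ?P \<Otimes>\<^sub>M gauss_vec {..<J}))
        = (\<integral>x. iexp (\<Sum>pq\<in>?P. v2 pq \<bullet> x pq) \<partial>gauss_vec ?P) * (\<integral>x. iexp (\<Sum>j<J. v3 j \<bullet> x j) \<partial>gauss_vec {..<J})"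
      by (rule pair_char_mult) (auto intro: prob_space_gauss_vec)
    also have "(\<integral>x. iexp (\<Sum>l<N. v1 l \<bullet> x l) \<partial>gauss_vec {..<N}) * \<dots> =
      complex_of_real (exp (- ((\<Sum>l<N. (norm (v1 l))\<^sup>2) + ((\<Sum>pq\<in>?P. (norm (v2 pq))\<^sup>2) + (\<Sum>j<J. (norm (v3 j))\<^sup>2))) / 2))"
      by (simp only: char_gauss_vec[OF finite_lessThan] char_gauss_vec[OF finite_cartesian_product[OF finite_lessThan finite_lessThan]]
           of_real_mult[symmetric] exp_add[symmetric] add_divide_distrib minus_add_distrib)
    finally show ?thesis unfolding quad \<mu>_def .
  qed
  let ?f = "\<lambda>z. \<lambda>k\<in>{..<N}. fst z k + \<sigma> *\<^sub>R (\<Sum>j<J. B k j *\<^sub>R snd z j)"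
  have f_meas[measurable]: "?f \<in> E \<Otimes>\<^sub>M (gauss_vec {..<J} :: 'd seq measure) \<rightarrow>\<^sub>M PiM {..<N} (\<lambda>_. borel)"
    by (intro measurable_restrict) measurable
  interpret PE: pair_prob_space E "gauss_vec {..<J} :: 'd seq measure"
    by (intro pair_prob_space.intro pair_sigma_finite.intro prob_space_imp_sigma_finite prob_space_gauss_vec E)
  have "distr (E \<Otimes>\<^sub>M (gauss_vec {..<J} :: 'd seq measure)) (PiM {..<N} (\<lambda>_. borel)) ?f = gauss_vec {..<N}"
  proof (rule PiM_char_eqI[OF finite_lessThan])
    show "prob_space (distr (E \<Otimes>\<^sub>M (gauss_vec {..<J} :: 'd seq measure)) (PiM {..<N} (\<lambda>_. borel)) ?f)"
      by (rule PE.prob_space_distr[OF f_meas])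
    fix v :: "'d seq"
    have "(\<Sum>k<N. v k \<bullet> ?f z k) = (\<Sum>k<N. v k \<bullet> fst z k) + (\<Sum>j<J. (\<sigma> *\<^sub>R (\<Sum>k<N. B k j *\<^sub>R v k)) \<bullet> snd z j)" for z
    proof -
      have "(\<Sum>k<N. v k \<bullet> ?f z k) = (\<Sum>k<N. v k \<bullet> fst z k) + \<sigma> * (\<Sum>k<N. \<Sum>j<J. B k j * (v k \<bullet> snd z j))"
        by (simp add: inner_add_right sum.distrib inner_sum_right sum_distrib_left)
      also have "(\<Sum>k<N. \<Sum>j<J. B k j * (v k \<bullet> snd z j)) = (\<Sum>j<J. (\<Sum>k<N. B k j *\<^sub>R v k) \<bullet> snd z j)"
        unfolding inner_sum_left by (subst sum.swap) simp
      finally show ?thesis by (simp add: sum_distrib_left)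
    qed
    then have "(\<integral>z. iexp (\<Sum>k<N. v k \<bullet> z k) \<partial>distr (E \<Otimes>\<^sub>M (gauss_vec {..<J} :: 'd seq measure)) (PiM {..<N} (\<lambda>_. borel)) ?f) =
       (\<integral>z. iexp ((\<lambda>x. \<Sum>k<N. v k \<bullet> x k) (fst z) + (\<Sum>j<J. (\<sigma> *\<^sub>R (\<Sum>k<N. B k j *\<^sub>R v k)) \<bullet> snd z j)) \<partial>(E \<Otimes>\<^sub>M gauss_vec {..<J}))"
      by (subst integral_distr[OF f_meas]) simp_all
    also have "\<dots> = (\<integral>x. iexp (\<Sum>k<N. v k \<bullet> x k) \<partial>E) * (\<integral>x. iexp (\<Sum>j<J. (\<sigma> *\<^sub>R (\<Sum>k<N. B k j *\<^sub>R v k)) \<bullet> x j) \<partial>gauss_vec {..<J})"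
      by (rule pair_char_mult) (auto intro: prob_space_gauss_vec E)
    also have "\<dots> = complex_of_real (exp (- (\<Sum>k<N. (norm (v k))\<^sup>2) / 2))"
      unfolding charE char_gauss_vec[OF finite_lessThan] of_real_mult[symmetric] exp_add[symmetric]
      by (simp add: power_mult_distrib sum_distrib_left[symmetric] field_simps)
    finally show "(\<integral>z. iexp (\<Sum>k<N. v k \<bullet> z k) \<partial>distr (E \<Otimes>\<^sub>M (gauss_vec {..<J} :: 'd seq measure)) (PiM {..<N} (\<lambda>_. borel)) ?f) =
       (\<integral>z. iexp (\<Sum>k<N. v k \<bullet> z k) \<partial>gauss_vec {..<N})"
      unfolding char_gauss_vec[OF finite_lessThan] .
  qed (auto simp: sets_gauss_vec intro: prob_space_gauss_vec)
  with E sets_E that show thesis by blast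
qed

subsection \<open>Change of variables over an arbitrary finite index type\<close>

text \<open>
  The change of variables theorem of the library asks for a well-ordered index type, so the
  coordinates are renamed by a bijection onto the following copy of an initial segment of \<open>nat\<close>.
\<close>

typedef ('d::finite) ord_index = "{..<CARD('d)}"
  by (rule exI[of _ 0]) simp

lemma card_ord_index: "card (UNIV :: 'd::finite ord_index set) = CARD('d)"
  using type_definition.card[OF type_definition_ord_index] by simp

instantiation ord_index :: (finite) wellorder
begin

definition less_eq_ord_index :: "'a ord_index \<Rightarrow> 'a ord_index \<Rightarrow> bool" where
  "less_eq_ord_index x y \<longleftrightarrow> Rep_ord_index x \<le> Rep_ord_index y"

definition less_ord_index :: "'a ord_index \<Rightarrow> 'a ord_index \<Rightarrow> bool" where
  "less_ord_index x y \<longleftrightarrow> Rep_ord_index x < Rep_ord_index y"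

instance
proof
  fix P :: "'a ord_index \<Rightarrow> bool" and a
  assume step: "\<And>x. (\<And>y. y < x \<Longrightarrow> P y) \<Longrightarrow> P x"
  show "P a"
    by (induction a rule: measure_induct_rule[of Rep_ord_index]) (auto intro: step simp: less_ord_index_def)
qed (auto simp: less_eq_ord_index_def less_ord_index_def Rep_ord_index_inject)

end

instance ord_index :: (finite) finite
proof
  have "card (UNIV :: 'a ord_index set) > 0"
    by (simp add: card_ord_index)
  then show "finite (UNIV :: 'a ord_index set)"
    by (rule card_ge_0_finite)
qed

text \<open>Induction over transpositions: conjugation by an injective f is a homomorphism and maps
  a transposition to a transposition.\<close>

lemma sign_map_permutation:
  assumes f: "inj_on f A" and A: "finite A" and p: "p permutes A"
  shows "sign (map_permutation A f p) = sign p"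
  using p A
proof (induction p rule: permutes_induct)
  case id
  then show ?case using f by (simp add: map_permutation_ident')
next
  case (swap a b p)
  let ?t = "Transposition.transpose a b" and ?t' = "Transposition.transpose (f a) (f b)"
  have "map_permutation A f (?t \<circ> p) = ?t' \<circ> map_permutation A f p"
    using swap f A by (subst map_permutation_compose') (auto simp: map_permutation_transpose intro: permutes_swap_id)
  moreover have "permutation (map_permutation A f p)"
    using f swap A by (intro permutation_permutes[THEN iffD2] exI[of _ "f ` A"] conjI map_permutation_permutes)
      (auto simp: bij_betw_def)
  moreover have "permutation p"
    using swap A by (auto simp: permutation_permutes)
  moreover have "f a = f b \<longleftrightarrow> a = b" using f swap by (auto dest: inj_onD)
  ultimately show ?case
    using swap sign_compose[of ?t p] sign_compose[of ?t' "map_permutation A f p"]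
    by (simp add: permutation_swap_id sign_swap_id del: o_apply comp_apply)
qed

text \<open>Conjugation by f is a sign-preserving bijection between the two permutation groups, so
  the Leibniz sums agree term by term. It guarantees that renaming the coordinates leaves Jacobian
  determinants unchanged.\<close>

lemma det_reindex:
  fixes A :: "real ^ 'm::finite ^ 'm" and f :: "'n::finite \<Rightarrow> 'm"
  assumes f: "bij f"
  shows "det (\<chi> i j. A $ f i $ f j :: real ^ 'n ^ 'n) = det A"
proof -
  have inj: "inj f" using f by (rule bij_is_inj)
  have bij: "bij_betw (map_permutation UNIV f) {p. p permutes UNIV} {p. p permutes UNIV}"
  proof (rule bij_betw_byWitness[where f' = "map_permutation UNIV (inv f)"])
    show "\<forall>p\<in>{p. p permutes UNIV}. map_permutation UNIV (inv f) (map_permutation UNIV f p) = p"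
      using f by (auto intro!: map_permutation_compose_inv bij_imp_bij_inv simp: bij_is_inj)
    show "\<forall>p\<in>{p. p permutes UNIV}. map_permutation UNIV f (map_permutation UNIV (inv f) p) = p"
      using f by (auto intro!: map_permutation_compose_inv bij_imp_bij_inv simp: bij_is_surj surj_f_inv_f)
    show "map_permutation UNIV f ` {p. p permutes UNIV} \<subseteq> {p. p permutes UNIV}"
      using f by (auto intro!: map_permutation_permutes)
    show "map_permutation UNIV (inv f) ` {p. p permutes UNIV} \<subseteq> {p. p permutes UNIV}"
      using bij_imp_bij_inv[OF f] by (auto intro!: map_permutation_permutes)
  qed
  have "det A = (\<Sum>p | p permutes UNIV. of_int (sign (map_permutation UNIV f p)) * (\<Prod>k\<in>UNIV. A $ k $ map_permutation UNIV f p k))"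
    unfolding det_def by (rule sum.reindex_bij_betw[OF bij, symmetric])
  also have "\<dots> = (\<Sum>p | p permutes UNIV. of_int (sign p) * (\<Prod>i\<in>UNIV. A $ f i $ f (p i)))"
  proof (intro sum.cong refl arg_cong2[where f="(*)"])
    fix p :: "'n \<Rightarrow> 'n" assume p: "p \<in> {p. p permutes UNIV}"
    show "real_of_int (sign (map_permutation UNIV f p)) = of_int (sign p)"
      using p inj by (simp add: sign_map_permutation)
    show "(\<Prod>k\<in>UNIV. A $ k $ map_permutation UNIV f p k) = (\<Prod>i\<in>UNIV. A $ f i $ f (p i))"
      by (subst prod.reindex_bij_betw[OF f, symmetric]) (simp add: map_permutation_apply inj)
  qed
  finally show ?thesis unfolding det_def by simp
qed

lemma vimage_continuous_on_borel:
  fixes g :: "'a::topological_space \<Rightarrow> 'b::topological_space"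
  assumes "continuous_on S g" "S \<in> sets borel" "A \<in> sets borel"
  shows "S \<inter> g -` A \<in> sets borel"
proof -
  have "g -` A \<inter> space (restrict_space borel S) \<in> sets (restrict_space borel S)"
    by (rule measurable_sets[OF borel_measurable_continuous_on_restrict[OF assms(1)] assms(3)])
  moreover have "g -` A \<inter> space (restrict_space borel S) = S \<inter> g -` A"
    by (auto simp: space_restrict_space)
  ultimately show ?thesis
    using assms(2) by (simp add: sets_restrict_space_iff)
qed

text \<open>The change of variables formula is applied to the indicator of A on g
  \<open>S: the measure of A \<inter> g\<close> S is the integral of the Jacobian over the part of S
  mapped into A, where the Jacobian is at least C.\<close>

lemma emeasure_image_ge_wellorder:
  fixes g :: "real ^ 'm::{finite,wellorder} \<Rightarrow> real ^ 'm::_"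
  assumes S: "compact S" and der: "\<And>x. x \<in> S \<Longrightarrow> (g has_derivative g' x) (at x within S)"
    and inj: "inj_on g S" and C: "0 \<le> C" "\<And>x. x \<in> S \<Longrightarrow> C \<le> \<bar>det (matrix (g' x))\<bar>"
    and A: "A \<in> sets borel"
  shows "ennreal C * emeasure lborel (S \<inter> g -` A) \<le> emeasure lborel A"
proof -
  have cont: "continuous_on S g"
    by (rule has_derivative_continuous_on) (rule der)
  have gS: "compact (g ` S)" by (rule compact_continuous_image[OF cont S])
  have [measurable]: "S \<in> sets borel" "g ` S \<in> sets borel"
    using S gS by (auto intro: borel_compact)
  have SA: "S \<inter> g -` A \<in> sets borel"
    by (rule vimage_continuous_on_borel[OF cont _ A]) simp
  have gSA: "A \<inter> g ` S \<in> sets borel" using A by measurable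
  have fin1: "emeasure lborel (A \<inter> g ` S) < \<infinity>"
    using emeasure_bounded_finite[OF compact_imp_bounded[OF gS]]
    by (rule order.strict_trans1[rotated]) (auto intro!: emeasure_mono)
  have fin2: "emeasure lborel (S \<inter> g -` A) < \<infinity>"
    using emeasure_bounded_finite[OF compact_imp_bounded[OF S]]
    by (rule order.strict_trans1[rotated]) (auto intro!: emeasure_mono)
  \<comment> \<open>The change of variables theorem takes vector-valued integrands, so the indicator
    is placed in dimension one.\<close>
  define f :: "real ^ 'm::_ \<Rightarrow> real ^ 1" where "f v = vec (indicator A v)" for v
  have ind: "((\<lambda>v. indicator A v :: real) has_integral measure lborel (A \<inter> g ` S)) (g ` S)"
  proof -
    have "((\<lambda>v. if v \<in> A \<inter> g ` S then 1 else 0 :: real) has_integral measure lborel (A \<inter> g ` S)) (g ` S)"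
      using has_integral_measure_lborel[OF gSA fin1] by (subst has_integral_restrict) auto
    then show ?thesis
      by (rule has_integral_eq[rotated]) (auto simp: indicator_def)
  qed
  have "f absolutely_integrable_on (g ` S)"
  proof (rule absolutely_integrable_componentwise)
    fix b :: "real ^ 1" assume "b \<in> Basis"
    then have b: "b = axis 1 1" by (auto simp: Basis_vec_def)
    have "(\<lambda>v. indicator A v :: real) absolutely_integrable_on (g ` S)"
      using ind by (intro nonnegative_absolutely_integrable_1) (auto simp: integrable_on_def)
    then show "(\<lambda>x. f x \<bullet> b) absolutely_integrable_on g ` S"
      by (simp add: f_def b inner_axis)
  qed
  then have "(\<lambda>x. \<bar>det (matrix (g' x))\<bar> *\<^sub>R f (g x)) absolutely_integrable_on S \<and>
     integral S (\<lambda>x. \<bar>det (matrix (g' x))\<bar> *\<^sub>R f (g x)) = integral (g ` S) f"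
    by (subst has_absolute_integral_change_of_variables_compact[OF S der inj]) auto
  then have i1: "(\<lambda>x. \<bar>det (matrix (g' x))\<bar> *\<^sub>R f (g x)) integrable_on S"
    and i2: "integral S (\<lambda>x. \<bar>det (matrix (g' x))\<bar> *\<^sub>R f (g x)) = integral (g ` S) f"
    by (auto intro: set_lebesgue_integral_eq_integral(1))
  have comp: "((\<lambda>x. F x \<bullet> b) has_integral (y \<bullet> b)) S" if "(F has_integral y) S" for F :: "real ^ 'm::_ \<Rightarrow> real ^ 1" and y b S
    using has_integral_linear[OF that bounded_linear_inner_left[of b]] by (simp add: o_def)
  have fi: "f integrable_on (g ` S)"
    using \<open>f absolutely_integrable_on (g ` S)\<close> by (rule set_lebesgue_integral_eq_integral(1))
  have "((\<lambda>x. (\<bar>det (matrix (g' x))\<bar> *\<^sub>R f (g x)) \<bullet> axis 1 1) has_integral (integral (g ` S) f) \<bullet> axis 1 1) S"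
    using comp[OF integrable_integral[OF i1]] unfolding i2 .
  moreover have "integral (g ` S) f \<bullet> axis 1 1 = measure lborel (A \<inter> g ` S)"
  proof -
    have "((\<lambda>v. f v \<bullet> axis 1 1) has_integral (integral (g ` S) f \<bullet> axis 1 1)) (g ` S)"
      using fi by (intro comp integrable_integral)
    then have "((\<lambda>v. indicator A v) has_integral (integral (g ` S) f \<bullet> axis 1 1)) (g ` S)"
      by (simp add: f_def inner_axis)
    then show ?thesis using ind by (rule has_integral_unique)
  qed
  ultimately have 1: "((\<lambda>x. \<bar>det (matrix (g' x))\<bar> * indicator A (g x)) has_integral measure lborel (A \<inter> g ` S)) S"
    by (simp add: f_def inner_axis)
  have 2: "((\<lambda>x. C * indicator (S \<inter> g -` A) x) has_integral C * measure lborel (S \<inter> g -` A)) S"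
  proof -
    have "((\<lambda>v. if v \<in> S \<inter> g -` A then 1 else 0 :: real) has_integral measure lborel (S \<inter> g -` A)) S"
      using has_integral_measure_lborel[OF SA fin2] by (subst has_integral_restrict) auto
    then have "((\<lambda>v. indicator (S \<inter> g -` A) v :: real) has_integral measure lborel (S \<inter> g -` A)) S"
      by (rule has_integral_eq[rotated]) (auto simp: indicator_def)
    then show ?thesis by (rule has_integral_mult_right)
  qed
  have "C * measure lborel (S \<inter> g -` A) \<le> measure lborel (A \<inter> g ` S)"
    by (rule has_integral_le[OF 2 1]) (use C in \<open>auto simp: indicator_def\<close>)
  then have "ennreal C * emeasure lborel (S \<inter> g -` A) \<le> emeasure lborel (A \<inter> g ` S)"
    using C(1) fin1 fin2 by (simp add: emeasure_eq_ennreal_measure ennreal_mult'[symmetric])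
  also have "\<dots> \<le> emeasure lborel A"
    using A by (intro emeasure_mono) auto
  finally show ?thesis .
qed

lemma prod_Basis_vec: "(\<Prod>b\<in>Basis. (v :: real ^ 'n::finite) \<bullet> b) = (\<Prod>i\<in>UNIV. v $ i)"
proof -
  have B: "(Basis :: (real ^ 'n) set) = range (\<lambda>i. axis i 1)"
    by (auto simp: Basis_vec_def)
  have "inj (\<lambda>i::'n. axis i (1 :: real))"
    by (auto simp: inj_on_def axis_eq_axis)
  then show ?thesis
    unfolding B by (subst prod.reindex) (auto simp: inner_axis)
qed

text \<open>The coordinates are renamed by the linear bijection T with inverse U; Lebesgue measure,
  injectivity and the determinant of the derivative are all preserved.\<close>

lemma emeasure_image_ge:
  fixes g :: "real ^ 'd::finite \<Rightarrow> real ^ 'd"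
  assumes S: "compact S" and der: "\<And>x. x \<in> S \<Longrightarrow> (g has_derivative g' x) (at x within S)"
    and inj: "inj_on g S" and C: "0 \<le> C" "\<And>x. x \<in> S \<Longrightarrow> C \<le> \<bar>det (matrix (g' x))\<bar>"
    and A: "A \<in> sets borel"
  shows "ennreal C * emeasure lborel (S \<inter> g -` A) \<le> emeasure lborel A"
proof -
  obtain f :: "'d ord_index \<Rightarrow> 'd" where f: "bij f"
    using finite_same_card_bij[of "UNIV :: 'd ord_index set" "UNIV :: 'd set"] by (auto simp: card_ord_index)
  define T where "T x = (\<chi> i. x $ f i)" for x :: "real ^ 'd"
  define U where "U y = (\<chi> j. y $ inv f j)" for y :: "real ^ 'd ord_index"
  have TU: "T (U y) = y" "U (T x) = x" for x y
    using f by (auto simp: T_def U_def vec_eq_iff bij_is_inj bij_is_surj surj_f_inv_f)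
  have linT: "linear T" and linU: "linear U"
    by (auto simp: T_def U_def linear_iff vec_eq_iff)
  have blT: "bounded_linear T" and blU: "bounded_linear U"
    using linT linU linear_conv_bounded_linear by blast+
  have [measurable]: "T \<in> borel_measurable borel" "U \<in> borel_measurable borel"
    by (rule borel_measurable_continuous_onI[OF linear_continuous_on[OF blT]])
       (rule borel_measurable_continuous_onI[OF linear_continuous_on[OF blU]])
  \<comment> \<open>Boxes correspond to boxes with the same product of side lengths, which
    characterises Lebesgue measure.\<close>
  have lb: "lborel = distr (lborel :: (real ^ 'd) measure) borel T"
  proof (rule lborel_eqI)
    fix l u :: "real ^ 'd ord_index"
    assume le: "\<And>b. b \<in> Basis \<Longrightarrow> l \<bullet> b \<le> u \<bullet> b"
    have le': "l $ i \<le> u $ i" for i using le[of "axis i 1"] by (auto simp: inner_axis Basis_vec_def)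
    have "T -` box l u = box (U l) (U u)"
      using f by (auto simp: mem_box_cart T_def U_def) (metis bij_inv_eq_iff)+
    moreover have "emeasure lborel (box (U l) (U u)) = ennreal (\<Prod>b\<in>Basis. (U u - U l) \<bullet> b)"
      by (rule emeasure_lborel_box) (auto simp: Basis_vec_def inner_axis U_def le')
    moreover have "(\<Prod>b\<in>Basis. (U u - U l) \<bullet> b) = (\<Prod>b\<in>Basis. (u - l) \<bullet> b)"
      unfolding prod_Basis_vec by (subst prod.reindex_bij_betw[OF f, symmetric]) (simp add: U_def f bij_is_inj)
    ultimately show "emeasure (distr lborel borel T) (box l u) = ennreal (\<Prod>b\<in>Basis. (u - l) \<bullet> b)"
      by (subst emeasure_distr) auto
  qed simp
  define g2 where "g2 = T \<circ> g \<circ> U"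
  define g2' where "g2' y = T \<circ> g' (U y) \<circ> U" for y
  have cT: "compact (T ` S)"
    using S by (intro compact_continuous_image linear_continuous_on[OF blT])
  have der2: "(g2 has_derivative g2' y) (at y within T ` S)" if "y \<in> T ` S" for y
  proof -
    have "U ` T ` S = S" by (auto simp: TU image_image)
    have 1: "(U has_derivative U) (at y within T ` S)"
      by (rule bounded_linear_imp_has_derivative[OF blU])
    have "U y \<in> S" using that by (auto simp: TU)
    from der[OF this] have 2: "(g has_derivative g' (U y)) (at (U y) within U ` T ` S)"
      by (simp add: \<open>U ` T ` S = S\<close>)
    have 3: "((g \<circ> U) has_derivative (g' (U y) \<circ> U)) (at y within T ` S)"
      by (rule diff_chain_within[OF 1 2])
    show ?thesis
      unfolding g2_def g2'_def comp_assoc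
      by (rule diff_chain_within[OF 3 bounded_linear_imp_has_derivative[OF blT]])
  qed
  have inj2: "inj_on g2 (T ` S)"
  proof (rule inj_onI)
    fix y y' assume "y \<in> T ` S" "y' \<in> T ` S" "g2 y = g2 y'"
    then show "y = y'"
      using inj unfolding g2_def by (auto simp: TU dest!: arg_cong[of "T _" _ U] dest: inj_onD)
  qed
  have det2: "det (matrix (g2' y)) = det (matrix (g' (U y)))" for y
  proof -
    have "matrix (g2' y) = (\<chi> i j. matrix (g' (U y)) $ f i $ f j)"
    proof -
      have UA: "U (axis j 1) = axis (f j) 1" for j :: "'d ord_index"
        using f by (auto simp: U_def vec_eq_iff axis_def) (metis bij_inv_eq_iff)+
      show ?thesis
        by (subst vec_eq_iff, intro allI, subst vec_eq_iff) (simp add: matrix_def g2'_def T_def UA)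
    qed
    then show ?thesis using det_reindex[OF f] by simp
  qed
  have A2: "U -` A \<in> sets borel"
    using measurable_sets[of U borel borel A] A by simp
  have "ennreal C * emeasure lborel (T ` S \<inter> g2 -` (U -` A)) \<le> emeasure lborel (U -` A)"
    by (rule emeasure_image_ge_wellorder[OF cT der2 inj2 C(1) _ A2]) (auto simp: det2 TU C(2))
  also have "emeasure lborel (U -` A) = emeasure lborel A"
    using A2 by (subst lb, subst emeasure_distr) (auto simp: TU vimage_def)
  also have "T ` S \<inter> g2 -` (U -` A) = U -` (S \<inter> g -` A)"
    by (auto simp: g2_def TU) (metis TU(1) imageI)
  also have "emeasure lborel (U -` (S \<inter> g -` A)) = emeasure lborel (S \<inter> g -` A)"
  proof -
    have "continuous_on S g" by (rule has_derivative_continuous_on) (rule der)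
    then have "S \<inter> g -` A \<in> sets borel"
      using S A by (intro vimage_continuous_on_borel) (auto intro: borel_compact)
    then have "U -` (S \<inter> g -` A) \<in> sets borel"
      using measurable_sets[of U borel borel "S \<inter> g -` A"] by simp
    then show ?thesis
      by (subst lb, subst emeasure_distr) (auto simp: TU vimage_def Int_def)
  qed
  finally show ?thesis .
qed

subsection \<open>Contraction in a frozen environment\<close>

lemma hyp_H2_overlap:
  fixes F :: "(real ^ 'd::finite) \<times> (real ^ 'd) \<Rightarrow> real ^ 'd"
  assumes H2: "hyp_H2 F" and F[measurable]: "F \<in> borel_measurable borel"
    and \<sigma>: "0 < \<sigma>" and K: "0 < K"
  obtains \<delta> :: real where "0 < \<delta>"
    "\<And>x x' y y'. x \<in> cball 0 K \<Longrightarrow> x' \<in> cball 0 K \<Longrightarrow> y \<in> cball 0 K \<Longrightarrow> y' \<in> cball 0 K \<Longrightarrow>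
       \<exists>\<rho>. sets \<rho> = sets borel \<and> emeasure \<rho> UNIV = ennreal \<delta> \<and>
          \<rho> \<le> distr std_gaussian borel (\<lambda>u. F (x, y + \<sigma> *\<^sub>R u)) \<and>
          \<rho> \<le> distr std_gaussian borel (\<lambda>u. F (x', y' + \<sigma> *\<^sub>R u))"
proof -
  obtain K' C M where K': "K' > 0" and C: "C > 0" and M: "M > 0" and
    \<Lambda>: "\<And>x x' y y'. x \<in> cball 0 K \<Longrightarrow> x' \<in> cball 0 K \<Longrightarrow> y \<in> cball 0 K \<Longrightarrow> y' \<in> cball 0 K \<Longrightarrow>
      \<exists>\<Lambda>. bij \<Lambda> \<and> (\<forall>u \<in> cball 0 K'. F (x, u + y) = F (x', \<Lambda> u + y') \<and>
               \<Lambda> differentiable at u \<and> \<bar>det (jacobian \<Lambda> (at u))\<bar> \<ge> C) \<and>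
            (\<forall>u. norm (\<Lambda> u - u) \<le> M)"
    using H2 K unfolding hyp_H2_def by metis
  define S :: "(real ^ 'd) set" where "S = cball 0 (K' / \<sigma>)"
  \<comment> \<open>A ball of this radius contains both S and its image under g, since g moves
    points by at most M / \<sigma>.\<close>
  define r where "r = K' / \<sigma> + M / \<sigma>"
  define \<phi> :: "real ^ 'd \<Rightarrow> real" where "\<phi> x = (2 * pi) powr (- real CARD('d) / 2) * exp (- (norm x)\<^sup>2 / 2)" for x
  define m where "m = (2 * pi) powr (- real CARD('d) / 2) * exp (- r\<^sup>2 / 2)"
  \<comment> \<open>Both requirements at once: p \<le> m for the first law, p / C \<le> m for the
    second.\<close>
  define p where "p = min m (C * m)"
  have m: "m > 0" by (simp add: m_def)
  have p: "p > 0" "p \<le> m" "p \<le> C * m" using m C by (auto simp: p_def)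
  have \<phi>: "m \<le> \<phi> u" if "u \<in> cball 0 r" for u
  proof -
    have "(norm u)\<^sup>2 \<le> r\<^sup>2" using that by (intro power_mono) auto
    then show ?thesis by (simp add: m_def \<phi>_def)
  qed
  have gauss: "emeasure std_gaussian A = (\<integral>\<^sup>+u. ennreal (\<phi> u) * indicator A u \<partial>lborel)" if "A \<in> sets borel" for A
    unfolding std_gaussian_def \<phi>_def[symmetric] using that by (subst emeasure_density) (auto simp: \<phi>_def[abs_def])
  have lower: "ennreal m * emeasure lborel A \<le> emeasure std_gaussian A" if [measurable]: "A \<in> sets borel" and A: "A \<subseteq> cball 0 r" for A :: "(real ^ 'd) set"
  proof -
    have "ennreal m * emeasure lborel A = (\<integral>\<^sup>+u. ennreal m * indicator A u \<partial>lborel)"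
      by (simp add: nn_integral_cmult_indicator)
    also have "\<dots> \<le> emeasure std_gaussian A"
      unfolding gauss[OF that(1)] using A \<phi> m by (intro nn_integral_mono) (auto simp: indicator_def intro!: ennreal_leI)
    finally show ?thesis .
  qed
  have Sr: "S \<subseteq> cball 0 r" using divide_pos_pos[OF M \<sigma>] by (auto simp: S_def r_def)
  have S[measurable]: "S \<in> sets borel" by (simp add: S_def)
  have Sfin: "emeasure lborel S < \<infinity>" unfolding S_def by (rule emeasure_lborel_cball_finite)
  define \<delta> where "\<delta> = p * measure lborel S"
  have Spos: "measure lborel S > 0"
    unfolding S_def using K' \<sigma> by (simp add: content_cball_pos)
  have \<delta>: "0 < \<delta>" using p Spos by (simp add: \<delta>_def)
  show thesis
  proof (rule that[OF \<delta>])
    fix x x' y y' :: "real ^ 'd"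
    assume xs: "x \<in> cball 0 K" "x' \<in> cball 0 K" "y \<in> cball 0 K" "y' \<in> cball 0 K"
    obtain \<Lambda> where bij: "bij \<Lambda>" and
      \<Lambda>: "\<And>u. u \<in> cball 0 K' \<Longrightarrow> F (x, u + y) = F (x', \<Lambda> u + y')"
      "\<And>u. u \<in> cball 0 K' \<Longrightarrow> \<Lambda> differentiable at u"
      "\<And>u. u \<in> cball 0 K' \<Longrightarrow> C \<le> \<bar>det (jacobian \<Lambda> (at u))\<bar>"
      "\<And>u. norm (\<Lambda> u - u) \<le> M"
      using \<Lambda>[OF xs] by blast
    \<comment> \<open>\<Lambda> in the scale of the standard Gaussian. The two scalings cancel in
      the derivative, so the Jacobian bound of \<Lambda> at \<sigma> u is also that of g at
      u.\<close>
    define g where "g u = (1 / \<sigma>) *\<^sub>R \<Lambda> (\<sigma> *\<^sub>R u)" for u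
    have Su: "\<sigma> *\<^sub>R u \<in> cball 0 K'" if "u \<in> S" for u
      using that \<sigma> by (simp add: S_def field_simps)
    have der: "(g has_derivative (\<lambda>h. jacobian \<Lambda> (at (\<sigma> *\<^sub>R u)) *v h)) (at u within S)" if "u \<in> S" for u
    proof -
      have "(\<Lambda> has_derivative (\<lambda>h. jacobian \<Lambda> (at (\<sigma> *\<^sub>R u)) *v h)) (at (\<sigma> *\<^sub>R u))"
        using \<Lambda>(2)[OF Su[OF that]] by (simp add: jacobian_works)
      moreover have "((\<lambda>u. \<sigma> *\<^sub>R u) has_derivative (\<lambda>h. \<sigma> *\<^sub>R h)) (at u within S)"
        by (auto intro!: derivative_eq_intros)
      ultimately have "((\<lambda>u. \<Lambda> (\<sigma> *\<^sub>R u)) has_derivative (\<lambda>h. jacobian \<Lambda> (at (\<sigma> *\<^sub>R u)) *v (\<sigma> *\<^sub>R h))) (at u within S)"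
        by (rule has_derivative_compose[rotated])
      then have "(g has_derivative (\<lambda>h. (1 / \<sigma>) *\<^sub>R (jacobian \<Lambda> (at (\<sigma> *\<^sub>R u)) *v (\<sigma> *\<^sub>R h)))) (at u within S)"
        unfolding g_def by (rule has_derivative_scaleR_right)
      then show ?thesis using \<sigma> by (simp add: matrix_vector_mult_scaleR)
    qed
    have inj: "inj_on g S"
      using bij \<sigma> by (auto simp: inj_on_def g_def dest!: bij_is_inj injD)
    have det: "C \<le> \<bar>det (matrix (\<lambda>h. jacobian \<Lambda> (at (\<sigma> *\<^sub>R u)) *v h))\<bar>" if "u \<in> S" for u
      using \<Lambda>(3)[OF Su[OF that]] by simp
    have compS: "compact S" by (simp add: S_def)
    have expand: "ennreal C * emeasure lborel (S \<inter> g -` A) \<le> emeasure lborel A" if "A \<in> sets borel" for A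
      by (rule emeasure_image_ge[OF compS der inj less_imp_le[OF C] det that])
    have gr: "g u \<in> cball 0 r" if "u \<in> S" for u
    proof -
      have "norm (g u) \<le> norm u + norm (g u - u)"
        by norm
      also have "g u - u = (1 / \<sigma>) *\<^sub>R (\<Lambda> (\<sigma> *\<^sub>R u) - \<sigma> *\<^sub>R u)"
        using \<sigma> by (simp add: g_def algebra_simps)
      also have "norm u + norm \<dots> \<le> K' / \<sigma> + M / \<sigma>"
        using that \<sigma> \<Lambda>(4)[of "\<sigma> *\<^sub>R u"] by (intro add_mono) (auto simp: S_def divide_right_mono)
      finally show ?thesis by (simp add: r_def)
    qed
    have Fg: "F (x, y + \<sigma> *\<^sub>R u) = F (x', y' + \<sigma> *\<^sub>R g u)" if "u \<in> S" for u
      using \<Lambda>(1)[OF Su[OF that]] \<sigma> by (simp add: g_def add.commute)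
    define \<rho> where "\<rho> = distr (density lborel (\<lambda>u. ennreal p * indicator S u)) borel (\<lambda>u. F (x, y + \<sigma> *\<^sub>R u))"
    have F1[measurable]: "(\<lambda>u. F (z, w + \<sigma> *\<^sub>R u)) \<in> borel_measurable borel" for z w
      by measurable
    have \<rho>: "emeasure \<rho> A = ennreal p * emeasure lborel (S \<inter> (\<lambda>u. F (x, y + \<sigma> *\<^sub>R u)) -` A)" if [measurable]: "A \<in> sets borel" for A
    proof -
      have [measurable]: "(\<lambda>u. F (x, y + \<sigma> *\<^sub>R u)) -` A \<in> sets borel"
        using measurable_sets[OF F1 that] by simp
      have "emeasure \<rho> A = (\<integral>\<^sup>+u. ennreal p * indicator S u * indicator ((\<lambda>u. F (x, y + \<sigma> *\<^sub>R u)) -` A) u \<partial>lborel)"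
        unfolding \<rho>_def by (simp add: emeasure_distr emeasure_density)
      also have "\<dots> = (\<integral>\<^sup>+u. ennreal p * indicator (S \<inter> (\<lambda>u. F (x, y + \<sigma> *\<^sub>R u)) -` A) u \<partial>lborel)"
        by (intro nn_integral_cong) (auto simp: indicator_def)
      finally show ?thesis by (simp add: nn_integral_cmult_indicator)
    qed
    show "\<exists>\<rho>. sets \<rho> = sets borel \<and> emeasure \<rho> UNIV = ennreal \<delta> \<and>
          \<rho> \<le> distr std_gaussian borel (\<lambda>u. F (x, y + \<sigma> *\<^sub>R u)) \<and>
          \<rho> \<le> distr std_gaussian borel (\<lambda>u. F (x', y' + \<sigma> *\<^sub>R u))"
    proof (intro exI[of _ \<rho>] conjI)
      show sets: "sets \<rho> = sets borel" by (simp add: \<rho>_def)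
      show "emeasure \<rho> UNIV = ennreal \<delta>"
        using Sfin p by (simp add: \<rho> \<delta>_def emeasure_eq_ennreal_measure ennreal_mult'')
      show "\<rho> \<le> distr std_gaussian borel (\<lambda>u. F (x, y + \<sigma> *\<^sub>R u))"
      proof (subst le_measure, simp add: sets, safe)
        fix A assume "A \<in> sets \<rho>"
        then have A[measurable]: "A \<in> sets borel" by (simp add: sets)
        have V[measurable]: "(\<lambda>u. F (x, y + \<sigma> *\<^sub>R u)) -` A \<in> sets borel"
          using measurable_sets[OF F1 A] by simp
        have "emeasure \<rho> A \<le> ennreal m * emeasure lborel (S \<inter> (\<lambda>u. F (x, y + \<sigma> *\<^sub>R u)) -` A)"
          unfolding \<rho>[OF A] using p by (intro mult_right_mono ennreal_leI) auto
        also have "\<dots> \<le> emeasure std_gaussian (S \<inter> (\<lambda>u. F (x, y + \<sigma> *\<^sub>R u)) -` A)"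
          using Sr by (intro lower) auto
        also have "\<dots> \<le> emeasure (distr std_gaussian borel (\<lambda>u. F (x, y + \<sigma> *\<^sub>R u))) A"
          by (subst emeasure_distr) (auto intro!: emeasure_mono)
        finally show "emeasure \<rho> A \<le> emeasure (distr std_gaussian borel (\<lambda>u. F (x, y + \<sigma> *\<^sub>R u))) A" .
      qed
      show "\<rho> \<le> distr std_gaussian borel (\<lambda>u. F (x', y' + \<sigma> *\<^sub>R u))"
      proof (subst le_measure, simp add: sets, safe)
        fix A assume "A \<in> sets \<rho>"
        then have A[measurable]: "A \<in> sets borel" by (simp add: sets)
        define A2 where "A2 = (\<lambda>v. F (x', y' + \<sigma> *\<^sub>R v)) -` A \<inter> cball 0 r"
        have V[measurable]: "(\<lambda>v. F (x', y' + \<sigma> *\<^sub>R v)) -` A \<in> sets borel"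
          using measurable_sets[OF F1 A] by simp
        then have A2[measurable]: "A2 \<in> sets borel" by (simp add: A2_def)
        have "S \<inter> (\<lambda>u. F (x, y + \<sigma> *\<^sub>R u)) -` A = S \<inter> g -` A2"
          using Fg gr by (auto simp: A2_def)
        then have "emeasure \<rho> A = ennreal p * emeasure lborel (S \<inter> g -` A2)"
          by (simp add: \<rho>)
        also have "\<dots> \<le> ennreal (m * C) * emeasure lborel (S \<inter> g -` A2)"
          using p by (intro mult_right_mono ennreal_leI) (auto simp: mult.commute)
        also have "\<dots> = ennreal m * (ennreal C * emeasure lborel (S \<inter> g -` A2))"
          using m C by (simp add: ennreal_mult mult.assoc)
        also have "\<dots> \<le> ennreal m * emeasure lborel A2"
          by (intro mult_left_mono expand A2) simp
        also have "\<dots> \<le> emeasure std_gaussian A2"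
          by (intro lower A2) (auto simp: A2_def)
        also have "\<dots> \<le> emeasure (distr std_gaussian borel (\<lambda>u. F (x', y' + \<sigma> *\<^sub>R u))) A"
          by (subst emeasure_distr) (auto intro!: emeasure_mono simp: A2_def)
        finally show "emeasure \<rho> A \<le> emeasure (distr std_gaussian borel (\<lambda>u. F (x', y' + \<sigma> *\<^sub>R u))) A" .
      qed
    qed
  qed
qed

section \<open>Weighted contraction by overlap and drift\<close>

text \<open>The weighted oscillation bound means that, after subtraction of a suitable constant, |h|
  is at most W = c (1 + \<beta> V). The functions W - f and W + f are then nonnegative, so their
  integrals against \<alpha> and \<alpha>' dominate those against the common part \<rho>, which
  gains 2 c \<delta>. The case \<delta> = 0 retains only the drift.\<close>

lemma overlap_contraction:
  fixes \<alpha> \<alpha>' \<rho> :: "'a::topological_space measure" and h V :: "'a \<Rightarrow> real"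
  assumes \<alpha>: "prob_space \<alpha>" "prob_space \<alpha>'" and sets: "sets \<alpha> = sets borel" "sets \<alpha>' = sets borel"
    and h[measurable]: "h \<in> borel_measurable borel" and h01: "\<And>x. 0 \<le> h x" "\<And>x. h x \<le> 1"
    and V[measurable]: "V \<in> borel_measurable borel" and V0: "\<And>x. 0 \<le> V x"
    and c: "0 \<le> c" and \<beta>: "0 \<le> \<beta>"
    and osc: "\<And>x y. \<bar>h x - h y\<bar> \<le> c * (2 + \<beta> * V x + \<beta> * V y)"
    and v: "integrable \<alpha> V" "(\<integral>x. V x \<partial>\<alpha>) \<le> v" "integrable \<alpha>' V" "(\<integral>x. V x \<partial>\<alpha>') \<le> v'"
    and \<rho>: "sets \<rho> = sets borel" "emeasure \<rho> UNIV = ennreal \<delta>" "\<rho> \<le> \<alpha>" "\<rho> \<le> \<alpha>'" "0 \<le> \<delta>"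
  shows "(\<integral>x. h x \<partial>\<alpha>) - (\<integral>x. h x \<partial>\<alpha>') \<le> c * (2 * (1 - \<delta>) + \<beta> * v + \<beta> * v')"
proof -
  note [measurable_cong] = sets \<rho>(1)
  interpret \<alpha>: prob_space \<alpha> by fact
  interpret \<alpha>': prob_space \<alpha>' by fact
  have sp: "space \<alpha> = UNIV" "space \<alpha>' = UNIV" "space \<rho> = UNIV"
    using sets \<rho>(1) by (auto dest: sets_eq_imp_space_eq)
  interpret \<rho>: finite_measure \<rho>
    by standard (simp add: sp \<rho>)
  define W where "W x = c * (1 + \<beta> * V x)" for x
  have W0: "0 \<le> W x" for x using c \<beta> V0 by (simp add: W_def)
  \<comment> \<open>Any number between sup (h - W) and inf (h + W) would do; the oscillation
    hypothesis says exactly that the former does not exceed the latter.\<close>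
  define \<kappa> where "\<kappa> = (SUP x. h x - W x)"
  have bdd: "bdd_above (range (\<lambda>x. h x - W x))"
  proof (rule bdd_aboveI2)
    show "h x - W x \<le> 1" for x using h01(2)[of x] W0[of x] by linarith
  qed
  have \<kappa>1: "h x - W x \<le> \<kappa>" for x
    unfolding \<kappa>_def by (rule cSUP_upper[OF _ bdd]) simp
  have \<kappa>2: "\<kappa> \<le> h y + W y" for y
    unfolding \<kappa>_def
  proof (rule cSUP_least)
    fix x show "h x - W x \<le> h y + W y"
      using osc[of x y] by (simp add: W_def algebra_simps)
  qed simp
  define f where "f x = h x - \<kappa>" for x
  have fW: "0 \<le> W x - f x" "0 \<le> W x + f x" for x
    using \<kappa>1[of x] \<kappa>2[of x] by (auto simp: f_def)
  have [measurable]: "f \<in> borel_measurable borel" "W \<in> borel_measurable borel"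
    by (auto simp: f_def[abs_def] W_def[abs_def])
  have ih: "integrable \<alpha> h" "integrable \<alpha>' h"
    using h01 by (auto intro!: \<alpha>.integrable_const_bound[where B=1] \<alpha>'.integrable_const_bound[where B=1] simp: measurable_cong_sets[OF sets(1) refl] measurable_cong_sets[OF sets(2) refl])
  have iW: "integrable \<alpha> W" "integrable \<alpha>' W" and i_f: "integrable \<alpha> f" "integrable \<alpha>' f"
    unfolding W_def f_def using v ih by auto
  have low: "(\<integral>\<^sup>+x. ennreal (g x) \<partial>\<rho>) \<le> ennreal (\<integral>x. g x \<partial>\<mu>)"
    if "\<rho> \<le> \<mu>" "sets \<mu> = sets borel" "integrable \<mu> g" "\<And>x. 0 \<le> g x" for g \<mu>
  proof -
    have "(\<integral>\<^sup>+x. ennreal (g x) \<partial>\<rho>) \<le> (\<integral>\<^sup>+x. ennreal (g x) \<partial>\<mu>)"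
      using that \<rho>(1) by (intro nn_integral_mono_measure) auto
    also have "\<dots> = ennreal (\<integral>x. g x \<partial>\<mu>)"
      using that by (intro nn_integral_eq_integral) auto
    finally show ?thesis .
  qed
  \<comment> \<open>The total mass of \<rho> is \<delta>, and (W - f) + (W + f) = 2 W is at least 2
    c.\<close>
  have "ennreal (2 * c * \<delta>) = (\<integral>\<^sup>+x. ennreal (2 * c) \<partial>\<rho>)"
    using c \<rho> by (simp add: sp ennreal_mult)
  also have "\<dots> \<le> (\<integral>\<^sup>+x. ennreal (W x - f x) + ennreal (W x + f x) \<partial>\<rho>)"
  proof (intro nn_integral_mono)
    fix x
    have "2 * c \<le> (W x - f x) + (W x + f x)"
      using c \<beta> V0[of x] by (simp add: W_def distrib_left)
    then show "ennreal (2 * c) \<le> ennreal (W x - f x) + ennreal (W x + f x)"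
      using fW[of x] by (simp add: ennreal_plus[symmetric] ennreal_leI del: ennreal_plus)
  qed
  also have "\<dots> = (\<integral>\<^sup>+x. ennreal (W x - f x) \<partial>\<rho>) + (\<integral>\<^sup>+x. ennreal (W x + f x) \<partial>\<rho>)"
    by (rule nn_integral_add) auto
  also have "\<dots> \<le> ennreal (\<integral>x. W x - f x \<partial>\<alpha>) + ennreal (\<integral>x. W x + f x \<partial>\<alpha>')"
    using \<rho> sets iW i_f fW by (intro add_mono low) auto
  also have "\<dots> = ennreal ((\<integral>x. W x - f x \<partial>\<alpha>) + (\<integral>x. W x + f x \<partial>\<alpha>'))"
    using fW by (intro ennreal_plus[symmetric] integral_nonneg) auto
  finally have "2 * c * \<delta> \<le> (\<integral>x. W x - f x \<partial>\<alpha>) + (\<integral>x. W x + f x \<partial>\<alpha>')"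
    by (subst (asm) ennreal_le_iff) (use fW in \<open>auto intro!: add_nonneg_nonneg integral_nonneg\<close>)
  also have "\<dots> = (\<integral>x. W x \<partial>\<alpha>) + (\<integral>x. W x \<partial>\<alpha>') - ((\<integral>x. f x \<partial>\<alpha>) - (\<integral>x. f x \<partial>\<alpha>'))"
    using iW i_f by simp
  also have "(\<integral>x. f x \<partial>\<alpha>) - (\<integral>x. f x \<partial>\<alpha>') = (\<integral>x. h x \<partial>\<alpha>) - (\<integral>x. h x \<partial>\<alpha>')"
    unfolding f_def using ih by (simp add: \<alpha>.prob_space \<alpha>'.prob_space)
  also have "(\<integral>x. W x \<partial>\<alpha>) = c * (1 + \<beta> * (\<integral>x. V x \<partial>\<alpha>))"
    unfolding W_def using v by (simp add: \<alpha>.prob_space)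
  also have "(\<integral>x. W x \<partial>\<alpha>') = c * (1 + \<beta> * (\<integral>x. V x \<partial>\<alpha>'))"
    unfolding W_def using v by (simp add: \<alpha>'.prob_space)
  finally have "(\<integral>x. h x \<partial>\<alpha>) - (\<integral>x. h x \<partial>\<alpha>') \<le> c * (2 * (1 - \<delta>) + \<beta> * (\<integral>x. V x \<partial>\<alpha>) + \<beta> * (\<integral>x. V x \<partial>\<alpha>'))"
    by (simp add: algebra_simps)
  also have "\<dots> \<le> c * (2 * (1 - \<delta>) + \<beta> * v + \<beta> * v')"
    using v \<beta> c by (intro mult_left_mono add_mono) auto
  finally show ?thesis .
qed

primrec traj :: "('s \<times> 'w \<Rightarrow> 's) \<Rightarrow> 's \<Rightarrow> (nat \<Rightarrow> 'w) \<Rightarrow> nat \<Rightarrow> 's" where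
  "traj F x r 0 = x"
| "traj F x r (Suc n) = F (traj F x r n, r n)"

lemma traj_cong: "(\<And>k. k < n \<Longrightarrow> r k = r' k) \<Longrightarrow> traj F x r n = traj F x r' n"
  by (induction n) auto

lemma traj_add: "traj F x r (m + n) = traj F (traj F x r m) (\<lambda>k. r (m + k)) n"
  by (induction n) auto

lemma measurable_traj[measurable]:
  fixes F :: "'s::second_countable_topology \<times> 'w::second_countable_topology \<Rightarrow> 's"
  assumes [measurable]: "F \<in> borel_measurable borel" "x \<in> borel_measurable M" "\<And>k. k < n \<Longrightarrow> (\<lambda>\<omega>. r \<omega> k) \<in> borel_measurable M"
  shows "(\<lambda>\<omega>. traj F (x \<omega>) (r \<omega>) n) \<in> borel_measurable M"
  using assms(3)
proof (induction n)
  case (Suc n)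
  then have [measurable]: "(\<lambda>\<omega>. traj F (x \<omega>) (r \<omega>) n) \<in> borel_measurable M" "(\<lambda>\<omega>. r \<omega> n) \<in> borel_measurable M"
    by auto
  show ?case by simp
qed simp

locale drift =
  fixes F :: "(real ^ 'd::finite) \<times> (real ^ 'd) \<Rightarrow> real ^ 'd" and V :: "real ^ 'd \<Rightarrow> real" and g C1 :: real
  assumes contF: "continuous_on UNIV F" and contV: "continuous_on UNIV V"
    and V_pos: "\<And>x. 0 < V x" and V_lim: "filterlim V at_top at_infinity"
    and g: "0 < g" "g < 1" and C1: "0 < C1"
    and V_F: "\<And>x w. V (F (x, w)) \<le> g * V x + C1 * (1 + norm w)"
    and H2: "hyp_H2 F"
begin

lemma F_meas[measurable]: "F \<in> borel_measurable borel"
  and V_meas[measurable]: "V \<in> borel_measurable borel"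
  using contF contV by (auto intro: borel_measurable_continuous_onI)

lemma V_nonneg: "0 \<le> V x" using V_pos[of x] by simp

lemma V_traj: "V (traj F x r n) \<le> g ^ n * V x + C1 * (\<Sum>k<n. g ^ k * (1 + norm (r (n - 1 - k))))"
proof (induction n)
  case (Suc n)
  have "V (traj F x r (Suc n)) \<le> g * V (traj F x r n) + C1 * (1 + norm (r n))"
    using V_F by simp
  also have "\<dots> \<le> g * (g ^ n * V x + C1 * (\<Sum>k<n. g ^ k * (1 + norm (r (n - 1 - k))))) + C1 * (1 + norm (r n))"
    using Suc g by (intro add_right_mono mult_left_mono) auto
  also have "\<dots> = g ^ Suc n * V x + C1 * (\<Sum>k<Suc n. g ^ k * (1 + norm (r (Suc n - 1 - k))))"
    unfolding sum.lessThan_Suc_shift by (simp add: algebra_simps sum_distrib_left)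
  finally show ?case .
qed simp

text \<open>The geometric weights of \<open>V_traj\<close> with squares instead of norms: Gaussian
  exponential moments are available for squares with small coefficients, and Cauchy-Schwarz passes
  from one to the other. The last noise of the block has weight 1.\<close>

definition energy :: "nat \<Rightarrow> 'd seq \<Rightarrow> real" where
  "energy L r = (\<Sum>k<L. g ^ k * (norm (r (L - 1 - k)))\<^sup>2)"

lemma energy_nonneg: "0 \<le> energy L r"
  unfolding energy_def using g by (intro sum_nonneg) auto

lemma sum_powers_le: "(\<Sum>k<n. g ^ k) \<le> 1 / (1 - g)"
  using sum_gp_strict[of g n] g by (simp add: divide_right_mono)

lemma integrable_norm_std_gaussian: "integrable (std_gaussian :: (real ^ 'd) measure) norm"
proof (rule integrableI_bounded)
  have "norm x \<le> 2 * exp ((norm x)\<^sup>2 / 4)" for x :: "real ^ 'd"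
  proof -
    have "norm x \<le> 2 * (1 + (norm x)\<^sup>2 / 4)"
      using zero_le_power2[of "norm x - 1"] by (simp add: power2_eq_square algebra_simps)
    also have "\<dots> \<le> 2 * exp ((norm x)\<^sup>2 / 4)"
      by (intro mult_left_mono exp_ge_add_one_self) auto
    finally show ?thesis .
  qed
  then have "(\<integral>\<^sup>+x. ennreal (norm (norm x)) \<partial>(std_gaussian :: (real ^ 'd) measure)) \<le> (\<integral>\<^sup>+x. ennreal 2 * ennreal (exp ((norm x)\<^sup>2 / 4)) \<partial>(std_gaussian :: (real ^ 'd) measure))"
    by (intro nn_integral_mono, subst ennreal_mult'[symmetric]) (auto intro: ennreal_leI)
  also have "\<dots> = 2 * ennreal (sqrt 2 ^ CARD('d))"
    by (subst nn_integral_cmult) (auto simp: std_gaussian_exp_sq)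
  also have "\<dots> < \<infinity>" by (simp add: ennreal_mult_less_top)
  finally show "(\<integral>\<^sup>+x. ennreal (norm (norm x)) \<partial>(std_gaussian :: (real ^ 'd) measure)) < \<infinity>" .
qed simp

definition "gauss_norm = (\<integral>x. norm x \<partial>(std_gaussian :: (real ^ 'd) measure))"

lemma gauss_norm_nonneg: "0 \<le> gauss_norm"
  unfolding gauss_norm_def by simp

definition block_op :: "real \<Rightarrow> nat \<Rightarrow> 'd seq \<Rightarrow> (real ^ 'd \<Rightarrow> real) \<Rightarrow> real ^ 'd \<Rightarrow> real" where
  "block_op \<sigma> L r h z = (\<integral>u. h (F (traj F z r (L - 1), r (L - 1) + \<sigma> *\<^sub>R u)) \<partial>std_gaussian)"

text \<open>
  Following Hairer and Mattingly, the seminorm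
  \<open>sup \<bar>h x - h y\<bar> / (2 + \<beta> V x + \<beta> V y)\<close> is contracted by the drift where \<open>V\<close> is large and by
  the overlap of the transition laws elsewhere.
\<close>

lemma block_contraction:
  assumes \<sigma>: "0 < \<sigma>" and \<epsilon>: "0 < \<epsilon>"
  obtains \<beta> where "0 < \<beta>" "\<And>L r h c z z'. \<lbrakk>0 < L; h \<in> borel_measurable borel; \<And>x. 0 \<le> h x; \<And>x. h x \<le> 1; 0 \<le> c;
     \<And>x y. \<bar>h x - h y\<bar> \<le> c * (2 + \<beta> * V x + \<beta> * V y)\<rbrakk> \<Longrightarrow>
     \<bar>block_op \<sigma> L r h z - block_op \<sigma> L r h z'\<bar> \<le> c * exp (\<beta> * (\<epsilon> * (1 + energy L r) - 1)) * (2 + \<beta> * V z + \<beta> * V z')"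
proof -
  define Sg where "Sg = 1 / (1 - g)"
  have Sg: "Sg > 0" using g by (simp add: Sg_def)
  define s where "s = \<sigma> * gauss_norm"
  have s: "0 \<le> s" using \<sigma> gauss_norm_nonneg by (simp add: s_def)
  \<comment> \<open>The additive constant of the drift over one block: the mean of V at its end is
    at most g V z + b, where s accounts for the Gaussian shift. It depends on the environment and is
    unbounded.\<close>
  define b where "b L r = C1 * ((\<Sum>k<L. g ^ k * (1 + norm (r (L - 1 - k)))) + s)" for L and r :: "'d seq"
  have b_nonneg: "0 \<le> b L r" for L r
    unfolding b_def using C1 s g by (intro mult_nonneg_nonneg add_nonneg_nonneg sum_nonneg) auto
  define D where "D = 2 * C1\<^sup>2 * ((Sg + s)\<^sup>2 + Sg)"
  have D: "0 < D" unfolding D_def using C1 Sg by (intro mult_pos_pos add_nonneg_pos) auto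
  have b_sq: "(b L r)\<^sup>2 \<le> D * (1 + energy L r)" for L r
  proof -
    define q where "q = (\<Sum>k<L. g ^ k * norm (r (L - 1 - k)))"
    have q0: "0 \<le> q" unfolding q_def using g by (intro sum_nonneg) auto
    have "q\<^sup>2 = (\<Sum>k<L. sqrt (g ^ k) * (sqrt (g ^ k) * norm (r (L - 1 - k))))\<^sup>2"
      unfolding q_def using g by (simp add: mult.assoc[symmetric])
    also have "\<dots> \<le> (\<Sum>k<L. (sqrt (g ^ k))\<^sup>2) * (\<Sum>k<L. (sqrt (g ^ k) * norm (r (L - 1 - k)))\<^sup>2)"
      by (rule Cauchy_Schwarz_ineq_sum)
    also have "\<dots> = (\<Sum>k<L. g ^ k) * energy L r"
      using g by (simp add: energy_def power_mult_distrib)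
    also have "\<dots> \<le> Sg * energy L r"
      unfolding Sg_def by (intro mult_right_mono sum_powers_le energy_nonneg)
    finally have q2: "q\<^sup>2 \<le> Sg * energy L r" .
    have "b L r = C1 * ((\<Sum>k<L. g ^ k) + q + s)"
      by (simp add: b_def q_def algebra_simps sum.distrib)
    also have "\<dots> \<le> C1 * ((Sg + s) + q)"
      using C1 sum_powers_le[of L] by (intro mult_left_mono) (auto simp: Sg_def)
    finally have "(b L r)\<^sup>2 \<le> (C1 * ((Sg + s) + q))\<^sup>2"
      using b_nonneg by (intro power_mono) auto
    also have "\<dots> = C1\<^sup>2 * ((Sg + s) + q)\<^sup>2"
      by (simp add: power_mult_distrib)
    also have "\<dots> \<le> C1\<^sup>2 * (2 * (Sg + s)\<^sup>2 + 2 * q\<^sup>2)"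
      using zero_le_power2[of "(Sg + s) - q"] by (intro mult_left_mono) (auto simp: power2_eq_square algebra_simps)
    also have "\<dots> \<le> C1\<^sup>2 * (2 * (Sg + s)\<^sup>2 + 2 * (Sg * energy L r))"
      using q2 by (intro mult_left_mono) auto
    also have "\<dots> \<le> D * (1 + energy L r)"
      unfolding D_def using Sg energy_nonneg[of L r]
      by (simp add: algebra_simps)
    finally show ?thesis .
  qed
  \<comment> \<open>Threshold between ordinary and exceptional blocks. Above it, b^2 \<le> D (1 +
    energy) and b \<ge> 1 yield b \<le> \<epsilon> (1 + energy) - 1, the growth permitted by the
    claimed factor.\<close>
  define bb where "bb = max 1 (2 * D / \<epsilon>)"
  have bb: "1 \<le> bb" "2 * D \<le> \<epsilon> * bb" using \<epsilon> by (auto simp: bb_def max_def field_simps)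
  \<comment> \<open>For V z + V z' \<ge> R the drift alone contracts, as 2 (1 + bb) = R (1 - g) /
    2.\<close>
  define R where "R = 4 * (1 + bb) / (1 - g)"
  have "eventually (\<lambda>x. V x \<ge> R + bb / g + 1) at_infinity"
    using V_lim by (simp add: filterlim_at_top)
  then obtain K0 where K0: "\<And>x. norm x \<ge> K0 \<Longrightarrow> V x \<ge> R + bb / g + 1"
    by (auto simp: eventually_at_infinity)
  \<comment> \<open>In an ordinary block with V z + V z' < R, the ball of this radius contains the
    last noise and both positions just before the last step; there V is at most R + bb / g.\<close>
  define K where "K = max (max 1 K0) (bb / C1)"
  have K: "0 < K" "bb / C1 \<le> K" by (auto simp: K_def)
  have VK: "x \<in> cball 0 K" if "V x \<le> R + bb / g" for x
    using K0[of x] that by (force simp: K_def)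
  obtain \<delta> where \<delta>: "0 < \<delta>" and ov:
    "\<And>x x' y y'. x \<in> cball 0 K \<Longrightarrow> x' \<in> cball 0 K \<Longrightarrow> y \<in> cball 0 K \<Longrightarrow> y' \<in> cball 0 K \<Longrightarrow>
       \<exists>\<rho>. sets \<rho> = sets borel \<and> emeasure \<rho> UNIV = ennreal \<delta> \<and>
          \<rho> \<le> distr std_gaussian borel (\<lambda>u. F (x, y + \<sigma> *\<^sub>R u)) \<and>
          \<rho> \<le> distr std_gaussian borel (\<lambda>u. F (x', y' + \<sigma> *\<^sub>R u))"
    by (rule hyp_H2_overlap[OF H2 F_meas \<sigma> K(1)]) blast
  \<comment> \<open>The first bound leaves room for the drift when V is large; the second makes the
    loss \<beta> (1 + bb) at most the overlap \<delta> when V is small.\<close>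
  define \<beta> where "\<beta> = min ((1 - g) / 2) (\<delta> / (1 + bb))"
  have \<beta>: "0 < \<beta>" "\<beta> \<le> (1 - g) / 2" "\<beta> * (1 + bb) \<le> \<delta>"
  proof -
    show "0 < \<beta>" using g \<delta> bb by (auto simp: \<beta>_def)
    show "\<beta> \<le> (1 - g) / 2" unfolding \<beta>_def by (rule min.cobounded1)
    have "\<beta> * (1 + bb) \<le> \<delta> / (1 + bb) * (1 + bb)"
      using bb by (intro mult_right_mono) (auto simp: \<beta>_def)
    then show "\<beta> * (1 + bb) \<le> \<delta>" using bb by simp
  qed
  have one: "block_op \<sigma> L r h z - block_op \<sigma> L r h z' \<le> c * exp (\<beta> * (\<epsilon> * (1 + energy L r) - 1)) * (2 + \<beta> * V z + \<beta> * V z')"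
    if L: "0 < L" and h[measurable]: "h \<in> borel_measurable borel" and h01: "\<And>x. 0 \<le> h x" "\<And>x. h x \<le> 1" and c: "0 \<le> c"
      and osc: "\<And>x y. \<bar>h x - h y\<bar> \<le> c * (2 + \<beta> * V x + \<beta> * V y)" for L r h c z z'
  proof -
    define \<psi> where "\<psi> z = traj F z r (L - 1)" for z
    define m where "m = r (L - 1)"
    define \<alpha> where "\<alpha> z = distr std_gaussian borel (\<lambda>u. F (\<psi> z, m + \<sigma> *\<^sub>R u))" for z
    have \<alpha>: "prob_space (\<alpha> z)" "sets (\<alpha> z) = sets borel" for z
      unfolding \<alpha>_def by (auto intro!: std_gaussian.prob_space_distr)
    have blk: "block_op \<sigma> L r h z = (\<integral>y. h y \<partial>\<alpha> z)" for z
      unfolding block_op_def \<alpha>_def \<psi>_def m_def by (subst integral_distr) auto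
    obtain L' where L': "L = Suc L'" using L by (cases L) auto
    have sumL: "(\<Sum>k<L. g ^ k * (1 + norm (r (L - 1 - k)))) = (1 + norm m) + g * (\<Sum>k<L'. g ^ k * (1 + norm (r (L' - 1 - k))))"
      unfolding L' sum.lessThan_Suc_shift by (simp add: m_def L' sum_distrib_left mult.assoc)
    define Q where "Q = (\<Sum>k<L'. g ^ k * (1 + norm (r (L' - 1 - k))))"
    have Q0: "0 \<le> Q" unfolding Q_def using g by (intro sum_nonneg) auto
    have b_eq: "b L r = C1 * ((1 + norm m) + g * Q + s)"
      unfolding b_def sumL Q_def ..
    have V\<psi>: "V (\<psi> z) \<le> g ^ L' * V z + C1 * Q" for z
      using V_traj[of z r L'] by (simp add: \<psi>_def L' Q_def)
    have V\<psi>': "V (\<psi> z) \<le> V z + b L r / g" for z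
    proof -
      have "g ^ L' * V z \<le> 1 * V z"
        using g V_nonneg by (intro mult_right_mono power_le_one) auto
      moreover have "g * (C1 * Q) \<le> b L r"
        unfolding b_eq using C1 s by (simp add: algebra_simps)
      then have "C1 * Q \<le> b L r / g" using g by (simp add: field_simps)
      ultimately show ?thesis using V\<psi>[of z] by linarith
    qed
    have m_le: "norm m \<le> b L r / C1"
      unfolding b_eq using C1 s Q0 g by simp
    have iV: "integrable (\<alpha> z) V \<and> (\<integral>x. V x \<partial>\<alpha> z) \<le> g * V z + b L r" for z
    proof -
      have bd: "V (F (\<psi> z, m + \<sigma> *\<^sub>R u)) \<le> (g * V (\<psi> z) + C1 * (1 + norm m)) + C1 * \<sigma> * norm u" for u
      proof -
        have "V (F (\<psi> z, m + \<sigma> *\<^sub>R u)) \<le> g * V (\<psi> z) + C1 * (1 + norm (m + \<sigma> *\<^sub>R u))" by (rule V_F)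
        also have "norm (m + \<sigma> *\<^sub>R u) \<le> norm m + \<sigma> * norm u"
          using norm_triangle_ineq[of m "\<sigma> *\<^sub>R u"] \<sigma> by simp
        finally show ?thesis using C1 by (simp add: algebra_simps)
      qed
      have i0: "integrable std_gaussian (\<lambda>u :: real ^ 'd. (g * V (\<psi> z) + C1 * (1 + norm m)) + C1 * \<sigma> * norm u)"
        using integrable_norm_std_gaussian by auto
      have i1: "integrable std_gaussian (\<lambda>u. V (F (\<psi> z, m + \<sigma> *\<^sub>R u)))"
        by (rule Bochner_Integration.integrable_bound[OF i0])
           (use bd V_nonneg in \<open>auto intro!: order_trans[OF bd]\<close>)
      have "(\<integral>u. V (F (\<psi> z, m + \<sigma> *\<^sub>R u)) \<partial>std_gaussian) \<le> (\<integral>u. (g * V (\<psi> z) + C1 * (1 + norm m)) + C1 * \<sigma> * norm u \<partial>(std_gaussian :: (real ^ 'd) measure))"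
        by (rule integral_mono[OF i1 i0 bd])
      also have "\<dots> = g * V (\<psi> z) + C1 * (1 + norm m) + C1 * s"
        using integrable_norm_std_gaussian by (simp add: std_gaussian.prob_space[simplified] gauss_norm_def s_def)
      also have "\<dots> \<le> g * (g ^ L' * V z + C1 * Q) + C1 * (1 + norm m) + C1 * s"
        using V\<psi> g by (intro add_right_mono mult_left_mono) auto
      also have "\<dots> = g * (g ^ L' * V z) + b L r"
        unfolding b_eq by (simp add: algebra_simps)
      also have "\<dots> \<le> g * (1 * V z) + b L r"
        using g V_nonneg by (intro add_mono mult_left_mono mult_right_mono power_le_one) auto
      finally show ?thesis
        using i1 unfolding \<alpha>_def by (auto simp: integrable_distr_eq integral_distr)
    qed
    define S where "S = V z + V z'"
    have S0: "0 \<le> S" using V_nonneg[of z] V_nonneg[of z'] by (simp add: S_def)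
    \<comment> \<open>The null measure as common part: an estimate by drift alone, valid in every
      environment.\<close>
    have noov: "block_op \<sigma> L r h z - block_op \<sigma> L r h z' \<le> c * (2 + \<beta> * (g * S + 2 * b L r))"
    proof -
      have "(\<integral>x. h x \<partial>\<alpha> z) - (\<integral>x. h x \<partial>\<alpha> z') \<le> c * (2 * (1 - 0) + \<beta> * (g * V z + b L r) + \<beta> * (g * V z' + b L r))"
        by (rule overlap_contraction[where \<rho> = "null_measure borel" and V = V, OF \<alpha>(1) \<alpha>(1) \<alpha>(2) \<alpha>(2) h h01 V_meas V_nonneg c less_imp_le[OF \<beta>(1)] osc])
           (use iV \<alpha> in \<open>auto simp: le_measure\<close>)
      then show ?thesis unfolding blk by (simp add: S_def algebra_simps)
    qed
    \<comment> \<open>Since 1 - \<beta> \<le> exp (- \<beta>), a factor 1 - \<beta> is sufficient in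
      ordinary blocks, whatever the energy.\<close>
    have target: "c * (1 - \<beta>) * (2 + \<beta> * S) \<le> c * exp (\<beta> * (\<epsilon> * (1 + energy L r) - 1)) * (2 + \<beta> * V z + \<beta> * V z')"
    proof -
      have "1 - \<beta> \<le> exp (- \<beta>)" using exp_ge_add_one_self[of "- \<beta>"] by simp
      also have "\<dots> \<le> exp (\<beta> * (\<epsilon> * (1 + energy L r) - 1))"
        using \<beta> \<epsilon> energy_nonneg[of L r] by (simp add: algebra_simps)
      finally have "c * (1 - \<beta>) * (2 + \<beta> * S) \<le> c * exp (\<beta> * (\<epsilon> * (1 + energy L r) - 1)) * (2 + \<beta> * S)"
        using c S0 \<beta> by (intro mult_left_mono mult_right_mono) auto
      then show ?thesis by (simp add: S_def algebra_simps)
    qed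
    \<comment> \<open>Three regimes: an exceptional block may expand, but by no more than exp
      (\<beta> b); in an ordinary block the drift contracts where V is large and the overlap
      contracts where V is small.\<close>
    consider "b L r > bb" | "b L r \<le> bb" "S \<ge> R" | "b L r \<le> bb" "S < R" by linarith
    then show ?thesis
    proof cases
      case 1
      have "b L r \<le> \<epsilon> * (1 + energy L r) - 1"
      proof -
        have "2 * b L r * bb \<le> 2 * (b L r)\<^sup>2"
          using 1 b_nonneg[of L r] by (simp add: power2_eq_square mult_left_mono)
        also have "\<dots> \<le> 2 * D * (1 + energy L r)" using b_sq[of L r] by simp
        also have "\<dots> \<le> \<epsilon> * bb * (1 + energy L r)"
          using bb energy_nonneg[of L r] by (intro mult_right_mono) auto
        finally have "(2 * b L r) * bb \<le> (\<epsilon> * (1 + energy L r)) * bb" by (simp add: algebra_simps)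
        then have "2 * b L r \<le> \<epsilon> * (1 + energy L r)" using bb by (simp add: mult_le_cancel_right)
        then show ?thesis using 1 bb by linarith
      qed
      then have e: "1 + \<beta> * b L r \<le> exp (\<beta> * (\<epsilon> * (1 + energy L r) - 1))"
        using exp_ge_add_one_self[of "\<beta> * b L r"] \<beta>
        by (intro order_trans[OF exp_ge_add_one_self]) auto
      have "2 + \<beta> * (g * S + 2 * b L r) \<le> (1 + \<beta> * b L r) * (2 + \<beta> * S)"
      proof -
        have "\<beta> * (g * S) \<le> \<beta> * (1 * S)" using \<beta> g S0 by (intro mult_left_mono mult_right_mono) auto
        moreover have "0 \<le> \<beta> * b L r * (\<beta> * S)" using \<beta> b_nonneg[of L r] S0 by simp
        ultimately show ?thesis by (simp add: algebra_simps)
      qed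
      also have "\<dots> \<le> exp (\<beta> * (\<epsilon> * (1 + energy L r) - 1)) * (2 + \<beta> * S)"
        using e S0 \<beta> by (intro mult_right_mono) auto
      finally have "c * (2 + \<beta> * (g * S + 2 * b L r)) \<le> c * (exp (\<beta> * (\<epsilon> * (1 + energy L r) - 1)) * (2 + \<beta> * S))"
        using c by (rule mult_left_mono)
      then show ?thesis using noov by (simp add: S_def algebra_simps)
    next
      case 2
      have "2 + \<beta> * (g * S + 2 * b L r) \<le> (1 - \<beta>) * (2 + \<beta> * S)"
      proof -
        have "2 * (1 + bb) = R * ((1 - g) / 2)" using g by (simp add: R_def)
        also have "\<dots> \<le> S * (1 - g - \<beta>)"
          using 2 \<beta> g S0 by (intro mult_mono) auto
        finally have "\<beta> * (2 * (1 + bb)) \<le> \<beta> * (S * (1 - g - \<beta>))"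
          using \<beta> by (intro mult_left_mono) auto
        moreover have "\<beta> * b L r \<le> \<beta> * bb" using 2 \<beta> by simp
        ultimately show ?thesis by (simp add: algebra_simps)
      qed
      then have "c * (2 + \<beta> * (g * S + 2 * b L r)) \<le> c * ((1 - \<beta>) * (2 + \<beta> * S))"
        using c by (rule mult_left_mono)
      then show ?thesis using noov target by (simp add: mult.assoc)
    next
      case 3
      have "V z \<le> S" "V z' \<le> S" using V_nonneg[of z] V_nonneg[of z'] by (auto simp: S_def)
      moreover have "b L r / g \<le> bb / g" using 3 g by (simp add: divide_right_mono)
      ultimately have "V (\<psi> z) \<le> R + bb / g" "V (\<psi> z') \<le> R + bb / g"
        using V\<psi>'[of z] V\<psi>'[of z'] 3 by linarith+
      then have "\<psi> z \<in> cball 0 K" "\<psi> z' \<in> cball 0 K"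
        using VK by blast+
      moreover have "m \<in> cball 0 K"
      proof -
        have "b L r / C1 \<le> bb / C1" using 3 C1 by (simp add: divide_right_mono)
        then show ?thesis using m_le K by simp
      qed
      ultimately obtain \<rho> where \<rho>: "sets \<rho> = sets borel" "emeasure \<rho> UNIV = ennreal \<delta>" "\<rho> \<le> \<alpha> z" "\<rho> \<le> \<alpha> z'"
        using ov[of "\<psi> z" "\<psi> z'" m m] unfolding \<alpha>_def by blast
      have "(\<integral>x. h x \<partial>\<alpha> z) - (\<integral>x. h x \<partial>\<alpha> z') \<le> c * (2 * (1 - \<delta>) + \<beta> * (g * V z + b L r) + \<beta> * (g * V z' + b L r))"
        by (rule overlap_contraction[where V = V, OF \<alpha>(1) \<alpha>(1) \<alpha>(2) \<alpha>(2) h h01 V_meas V_nonneg c less_imp_le[OF \<beta>(1)] osc])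
           (use iV \<rho> \<delta> in auto)
      also have "\<dots> = c * (2 * (1 - \<delta>) + \<beta> * (g * S + 2 * b L r))"
        by (simp add: S_def algebra_simps)
      also have "\<dots> \<le> c * ((1 - \<beta>) * (2 + \<beta> * S))"
      proof (intro mult_left_mono c)
        have "0 \<le> \<beta> * S * (1 - \<beta> - g)" using \<beta> S0 g by (intro mult_nonneg_nonneg) auto
        moreover have "\<beta> * b L r \<le> \<beta> * bb" using 3 \<beta> by simp
        ultimately show "2 * (1 - \<delta>) + \<beta> * (g * S + 2 * b L r) \<le> (1 - \<beta>) * (2 + \<beta> * S)"
          using \<beta>(3) by (simp add: algebra_simps)
      qed
      finally show ?thesis using target unfolding blk by (simp add: mult.assoc)
    qed
  qed
  show thesis
  proof (rule that[OF \<beta>(1)])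
    fix L :: nat and r and h :: "real ^ 'd \<Rightarrow> real" and c z z'
    assume *: "0 < L" "h \<in> borel_measurable borel" "\<And>x. 0 \<le> h x" "\<And>x. h x \<le> 1" "0 \<le> c"
      "\<And>x y. \<bar>h x - h y\<bar> \<le> c * (2 + \<beta> * V x + \<beta> * V y)"
    show "\<bar>block_op \<sigma> L r h z - block_op \<sigma> L r h z'\<bar> \<le> c * exp (\<beta> * (\<epsilon> * (1 + energy L r) - 1)) * (2 + \<beta> * V z + \<beta> * V z')"
      using one[OF *, where z=z and z'=z'] one[OF *, where z=z' and z'=z]
      by (simp add: abs_le_iff algebra_simps)
  qed
qed

section \<open>Composition over successive blocks\<close>

definition perturb :: "real \<Rightarrow> nat \<Rightarrow> nat \<Rightarrow> 'd seq \<Rightarrow> 'd seq \<Rightarrow> nat \<Rightarrow> real ^ 'd" where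
  "perturb \<sigma> L J r \<zeta> k = r k + (if k mod L = L - 1 \<and> k div L < J then \<sigma> *\<^sub>R \<zeta> (k div L) else 0)"

lemma measurable_perturb[measurable]:
  "(\<lambda>\<zeta>. perturb \<sigma> L J r \<zeta> k) \<in> borel_measurable (PiM {..<J} (\<lambda>_. borel))"
  unfolding perturb_def by (cases "k div L < J") auto

text \<open>The newest shift enters only the last step of block J, and the steps before it within
  that block see the unperturbed environment. This makes the integral over that coordinate a
  \<open>block_op\<close> applied at time J L.\<close>

lemma traj_perturb_Suc:
  assumes L: "0 < L"
  shows "traj F x (perturb \<sigma> L (Suc J) r (\<zeta>(J := u))) (Suc J * L) =
    F (traj F (traj F x (perturb \<sigma> L J r \<zeta>) (J * L)) (\<lambda>k. r (J * L + k)) (L - 1), r (J * L + (L - 1)) + \<sigma> *\<^sub>R u)"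
proof -
  obtain L' where L': "L = Suc L'" using L by (cases L) auto
  let ?p = "perturb \<sigma> L (Suc J) r (\<zeta>(J := u))"
  have 1: "traj F x ?p (J * L) = traj F x (perturb \<sigma> L J r \<zeta>) (J * L)"
  proof (rule traj_cong)
    fix k assume "k < J * L"
    then have "k div L < J" by (simp add: less_mult_imp_div_less)
    then show "?p k = perturb \<sigma> L J r \<zeta> k" by (auto simp: perturb_def)
  qed
  have dm: "(J * L + k) div L = J" "(J * L + k) mod L = k" if "k < L" for k
    using that by simp_all
  have 2: "?p (J * L + k) = r (J * L + k)" if "k < L'" for k
    using that L' unfolding perturb_def by (subst (1 2) dm) auto
  have 3: "?p (J * L + L') = r (J * L + L') + \<sigma> *\<^sub>R u"
    using dm[of L'] L' unfolding perturb_def by simp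
  have "Suc J * L = J * L + Suc L'"
    by (simp add: L')
  then have "traj F x ?p (Suc J * L) = traj F x ?p (J * L + Suc L')"
    by (simp only:)
  also have "\<dots> = F (traj F (traj F x ?p (J * L)) (\<lambda>k. ?p (J * L + k)) L', ?p (J * L + L'))"
    unfolding traj_add by simp
  also have "traj F (traj F x ?p (J * L)) (\<lambda>k. ?p (J * L + k)) L' = traj F (traj F x ?p (J * L)) (\<lambda>k. r (J * L + k)) L'"
    by (rule traj_cong) (rule 2)
  finally show ?thesis unfolding 1 3 using L' by (simp only: diff_Suc_1)
qed

text \<open>The last block is integrated out first, which replaces h by its image under
  \<open>block_op\<close> and multiplies the constant c by the factor of that block; hence the
  induction over J keeps h and c arbitrary. A function with values in [0, 1] starts with c =
  1.\<close>

lemma iterated_contraction: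
  assumes \<sigma>: "0 < \<sigma>" and \<epsilon>: "0 < \<epsilon>"
  obtains \<beta> where "0 < \<beta>" "\<And>L J r h x x'. \<lbrakk>0 < L; h \<in> borel_measurable borel; \<And>x. 0 \<le> h x; \<And>x. h x \<le> 1\<rbrakk> \<Longrightarrow>
     \<bar>(\<integral>\<zeta>. h (traj F x (perturb \<sigma> L J r \<zeta>) (J * L)) \<partial>gauss_vec {..<J}) - (\<integral>\<zeta>. h (traj F x' (perturb \<sigma> L J r \<zeta>) (J * L)) \<partial>gauss_vec {..<J})\<bar>
      \<le> exp (\<beta> * (\<epsilon> * (real J + (\<Sum>j<J. energy L (\<lambda>k. r (j * L + k)))) - real J)) * (2 + \<beta> * V x + \<beta> * V x')"
proof -
  obtain \<beta> where \<beta>: "0 < \<beta>" and step: "\<And>L r h c z z'. \<lbrakk>0 < L; h \<in> borel_measurable borel; \<And>x. 0 \<le> h x; \<And>x. h x \<le> 1; 0 \<le> c;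
     \<And>x y. \<bar>h x - h y\<bar> \<le> c * (2 + \<beta> * V x + \<beta> * V y)\<rbrakk> \<Longrightarrow>
     \<bar>block_op \<sigma> L r h z - block_op \<sigma> L r h z'\<bar> \<le> c * exp (\<beta> * (\<epsilon> * (1 + energy L r) - 1)) * (2 + \<beta> * V z + \<beta> * V z')"
    using block_contraction[OF \<sigma> \<epsilon>] by blast
  have main: "\<bar>(\<integral>\<zeta>. h (traj F x (perturb \<sigma> L J r \<zeta>) (J * L)) \<partial>gauss_vec {..<J}) - (\<integral>\<zeta>. h (traj F x' (perturb \<sigma> L J r \<zeta>) (J * L)) \<partial>gauss_vec {..<J})\<bar>
      \<le> c * exp (\<beta> * (\<epsilon> * (real J + (\<Sum>j<J. energy L (\<lambda>k. r (j * L + k)))) - real J)) * (2 + \<beta> * V x + \<beta> * V x')"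
    if L: "0 < L" and "h \<in> borel_measurable borel" "\<And>x. 0 \<le> h x" "\<And>x. h x \<le> 1" "0 \<le> c"
      "\<And>x y. \<bar>h x - h y\<bar> \<le> c * (2 + \<beta> * V x + \<beta> * V y)" for L J r h c x x'
    using that(2-)
  proof (induction J arbitrary: h c)
    case 0
    interpret P: prob_space "gauss_vec {} :: 'd seq measure" by (rule prob_space_gauss_vec)
    show ?case using 0 by (simp add: P.prob_space)
  next
    case (Suc J)
    note h[measurable] = Suc.prems(1)
    interpret P: product_sigma_finite "\<lambda>_::nat. std_gaussian :: (real ^ 'd) measure" by standard
    interpret PJ: prob_space "gauss_vec (insert J {..<J}) :: 'd seq measure" by (rule prob_space_gauss_vec)
    define R where "R k = r (J * L + k)" for k
    have [measurable]: "block_op \<sigma> L R h \<in> borel_measurable borel"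
      unfolding block_op_def by measurable
    have bo: "0 \<le> block_op \<sigma> L R h z" "block_op \<sigma> L R h z \<le> 1" for z
    proof -
      show "0 \<le> block_op \<sigma> L R h z" unfolding block_op_def using Suc.prems by (intro Bochner_Integration.integral_nonneg) auto
      have "block_op \<sigma> L R h z \<le> (\<integral>u. 1 \<partial>(std_gaussian :: (real ^ 'd) measure))"
        unfolding block_op_def using Suc.prems
        by (intro integral_mono std_gaussian.integrable_const_bound[where B=1]) auto
      then show "block_op \<sigma> L R h z \<le> 1" using std_gaussian.prob_space[where 'd='d] by simp
    qed
    have peel: "(\<integral>\<zeta>. h (traj F x (perturb \<sigma> L (Suc J) r \<zeta>) (Suc J * L)) \<partial>gauss_vec {..<Suc J}) =
       (\<integral>\<zeta>. block_op \<sigma> L R h (traj F x (perturb \<sigma> L J r \<zeta>) (J * L)) \<partial>gauss_vec {..<J})" for x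
    proof -
      have [measurable]: "(\<lambda>\<zeta>. perturb \<sigma> L (Suc J) r \<zeta> k) \<in> borel_measurable (gauss_vec (insert J {..<J}))" for k
        using measurable_perturb[of \<sigma> L "Suc J" r k] unfolding lessThan_Suc by (simp add: measurable_cong_sets[OF sets_gauss_vec refl])
      have "(\<integral>\<zeta>. h (traj F x (perturb \<sigma> L (Suc J) r \<zeta>) (Suc J * L)) \<partial>gauss_vec (insert J {..<J})) =
        (\<integral>\<zeta>. \<integral>u. h (traj F x (perturb \<sigma> L (Suc J) r (\<zeta>(J := u))) (Suc J * L)) \<partial>std_gaussian \<partial>gauss_vec {..<J})"
        by (rule P.product_integral_insert) (use Suc.prems in \<open>auto intro!: PJ.integrable_const_bound[where B=1]\<close>)
      then show ?thesis
        unfolding traj_perturb_Suc[OF L] lessThan_Suc block_op_def R_def .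
    qed
    have "\<bar>block_op \<sigma> L R h y - block_op \<sigma> L R h z\<bar> \<le> (c * exp (\<beta> * (\<epsilon> * (1 + energy L R) - 1))) * (2 + \<beta> * V y + \<beta> * V z)" for y z
      using step[OF L Suc.prems(1-5)] by blast
    from Suc.IH[OF _ bo _ this]
    have "\<bar>(\<integral>\<zeta>. block_op \<sigma> L R h (traj F x (perturb \<sigma> L J r \<zeta>) (J * L)) \<partial>gauss_vec {..<J}) - (\<integral>\<zeta>. block_op \<sigma> L R h (traj F x' (perturb \<sigma> L J r \<zeta>) (J * L)) \<partial>gauss_vec {..<J})\<bar>
      \<le> c * exp (\<beta> * (\<epsilon> * (1 + energy L R) - 1)) * exp (\<beta> * (\<epsilon> * (real J + (\<Sum>j<J. energy L (\<lambda>k. r (j * L + k)))) - real J)) * (2 + \<beta> * V x + \<beta> * V x')"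
      using Suc.prems by simp
    also have "c * exp (\<beta> * (\<epsilon> * (1 + energy L R) - 1)) * exp (\<beta> * (\<epsilon> * (real J + (\<Sum>j<J. energy L (\<lambda>k. r (j * L + k)))) - real J))
      = c * exp (\<beta> * (\<epsilon> * (real (Suc J) + (\<Sum>j<Suc J. energy L (\<lambda>k. r (j * L + k)))) - real (Suc J)))"
      unfolding mult.assoc exp_add[symmetric] by (simp add: R_def[abs_def] algebra_simps)
    finally show ?case unfolding peel .
  qed
  show thesis
  proof (rule that[OF \<beta>])
    fix L J :: nat and r and h :: "real ^ 'd \<Rightarrow> real" and x x'
    assume *: "0 < L" "h \<in> borel_measurable borel" "\<And>x. 0 \<le> h x" "\<And>x. h x \<le> 1"
    have "\<bar>h x - h y\<bar> \<le> 1 * (2 + \<beta> * V x + \<beta> * V y)" for x y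
    proof -
      have "0 \<le> \<beta> * V x" "0 \<le> \<beta> * V y" using \<beta> V_nonneg by auto
      then show ?thesis using *(3,4)[of x] *(3,4)[of y] by (simp add: abs_le_iff)
    qed
    from main[OF *, where c=1, OF _ this] show "\<bar>(\<integral>\<zeta>. h (traj F x (perturb \<sigma> L J r \<zeta>) (J * L)) \<partial>gauss_vec {..<J}) - (\<integral>\<zeta>. h (traj F x' (perturb \<sigma> L J r \<zeta>) (J * L)) \<partial>gauss_vec {..<J})\<bar>
      \<le> exp (\<beta> * (\<epsilon> * (real J + (\<Sum>j<J. energy L (\<lambda>k. r (j * L + k)))) - real J)) * (2 + \<beta> * V x + \<beta> * V x')"
      by simp
  qed
qed

end

subsection \<open>The stationary noise and its innovations\<close>

lemma borel_char_eqI: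
  fixes M M' :: "'a::euclidean_space measure"
  assumes M: "prob_space M" "prob_space M'" and sets[measurable_cong]: "sets M = sets borel" "sets M' = sets borel"
    and char: "\<And>v. (\<integral>x. iexp (v \<bullet> x) \<partial>M) = (\<integral>x. iexp (v \<bullet> x) \<partial>M')"
  shows "M = M'"
proof -
  let ?S = "PiM {()} (\<lambda>_. borel :: 'a measure)"
  let ?f = "\<lambda>x::'a. \<lambda>_\<in>{()}. x"
  have f[measurable]: "?f \<in> borel \<rightarrow>\<^sub>M ?S" by (intro measurable_restrict) simp
  have "distr M ?S ?f = distr M' ?S ?f"
  proof (rule PiM_char_eqI)
    show "prob_space (distr M ?S ?f)" "prob_space (distr M' ?S ?f)"
      using M by (auto intro!: prob_space.prob_space_distr)
    fix v :: "unit \<Rightarrow> 'a"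
    have "(\<integral>z. iexp (\<Sum>i\<in>{()}. v i \<bullet> z i) \<partial>distr N ?S ?f) = (\<integral>x. iexp (v () \<bullet> x) \<partial>N)"
      if [measurable_cong]: "sets N = sets borel" for N
      by (subst integral_distr) simp_all
    from this[OF sets(1)] this[OF sets(2)]
    show "(\<integral>z. iexp (\<Sum>i\<in>{()}. v i \<bullet> z i) \<partial>distr M ?S ?f) = (\<integral>z. iexp (\<Sum>i\<in>{()}. v i \<bullet> z i) \<partial>distr M' ?S ?f)"
      using char by simp
  qed auto
  then have "distr (distr M ?S ?f) borel (\<lambda>z. z ()) = distr (distr M' ?S ?f) borel (\<lambda>z. z ())"
    by simp
  moreover have "distr (distr N ?S ?f) borel (\<lambda>z. z ()) = N" if [measurable_cong]: "sets N = sets borel" for N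
  proof -
    have "distr (distr N ?S ?f) borel (\<lambda>z. z ()) = distr N borel ((\<lambda>z. z ()) \<circ> ?f)"
      by (rule distr_distr) measurable
    also have "\<dots> = distr N N (\<lambda>x. x)"
      using that by (intro distr_cong) auto
    finally show ?thesis by (simp add: distr_id)
  qed
  ultimately show ?thesis using sets by metis
qed

lemma gauss_vec_lin_comb:
  assumes I: "finite I"
  shows "distr (gauss_vec I) borel (\<lambda>z. \<Sum>i\<in>I. c i *\<^sub>R z i)
    = distr (std_gaussian :: (real ^ 'd::finite) measure) borel (\<lambda>u. sqrt (\<Sum>i\<in>I. (c i)\<^sup>2) *\<^sub>R u)"
    (is "?L = ?R")
proof (rule borel_char_eqI)
  show "prob_space ?L"
    by (rule prob_space.prob_space_distr[OF prob_space_gauss_vec]) simp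
  show "prob_space ?R"
    by (rule std_gaussian.prob_space_distr) simp
  fix v :: "real ^ 'd"
  have "(\<integral>x. iexp (v \<bullet> x) \<partial>?L) = (\<integral>z. iexp (\<Sum>i\<in>I. (c i *\<^sub>R v) \<bullet> z i) \<partial>gauss_vec I)"
    by (subst integral_distr) (simp_all add: inner_sum_right)
  also have "\<dots> = exp (- ((\<Sum>i\<in>I. (c i)\<^sup>2) * (norm v)\<^sup>2) / 2)"
    unfolding char_gauss_vec[OF I] by (simp add: power_mult_distrib sum_distrib_right)
  also have "\<dots> = (\<integral>u. iexp ((sqrt (\<Sum>i\<in>I. (c i)\<^sup>2) *\<^sub>R v) \<bullet> u) \<partial>std_gaussian)"
    unfolding char_std_gaussian by (simp add: power_mult_distrib sum_nonneg)
  also have "\<dots> = (\<integral>x. iexp (v \<bullet> x) \<partial>?R)"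
    by (subst integral_distr) simp_all
  finally show "(\<integral>x. iexp (v \<bullet> x) \<partial>?L) = (\<integral>x. iexp (v \<bullet> x) \<partial>?R)" .
qed auto

text \<open>Convexity of exp interpolates between the exponents 0 and 1/4. The logarithm of the
  bound is linear in \<theta>, so in a product over many innovations only the sum of the
  coefficients matters.\<close>

lemma nn_integral_exp_sq_le:
  assumes "0 \<le> \<theta>" "\<theta> \<le> 1/4"
  shows "(\<integral>\<^sup>+x. ennreal (exp (\<theta> * (norm x)\<^sup>2)) \<partial>(std_gaussian :: (real ^ 'd::finite) measure)) \<le> ennreal (exp (4 * \<theta> * (sqrt 2 ^ CARD('d) - 1)))"
proof -
  define A where "A = sqrt 2 ^ CARD('d)"
  have A1: "1 \<le> A" unfolding A_def by (intro one_le_power) simp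
  have "(\<integral>\<^sup>+x. ennreal (exp (\<theta> * (norm x)\<^sup>2)) \<partial>(std_gaussian :: (real ^ 'd) measure))
     \<le> (\<integral>\<^sup>+x. ennreal (1 - 4 * \<theta>) + ennreal (4 * \<theta>) * ennreal (exp ((norm x)\<^sup>2 / 4)) \<partial>(std_gaussian :: (real ^ 'd) measure))"
  proof (intro nn_integral_mono)
    fix x :: "real ^ 'd"
    define y where "y = (norm x)\<^sup>2 / 4"
    have "exp ((1 - 4 * \<theta>) *\<^sub>R 0 + (4 * \<theta>) *\<^sub>R y) \<le> (1 - 4 * \<theta>) * exp 0 + (4 * \<theta>) * exp y"
      using convex_onD[OF exp_convex, of "4 * \<theta>" 0 y] assms by simp
    then have "exp (\<theta> * (norm x)\<^sup>2) \<le> (1 - 4 * \<theta>) + 4 * \<theta> * exp ((norm x)\<^sup>2 / 4)"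
      by (simp add: y_def)
    then show "ennreal (exp (\<theta> * (norm x)\<^sup>2)) \<le> ennreal (1 - 4 * \<theta>) + ennreal (4 * \<theta>) * ennreal (exp ((norm x)\<^sup>2 / 4))"
      using assms by (simp add: ennreal_mult'[symmetric] ennreal_plus[symmetric] ennreal_leI del: ennreal_plus)
  qed
  also have "\<dots> = ennreal (1 - 4 * \<theta>) + ennreal (4 * \<theta>) * ennreal A"
    using std_gaussian.emeasure_space_1[where 'd='d] unfolding A_def
    by (subst nn_integral_add) (auto simp: nn_integral_cmult std_gaussian_exp_sq)
  also have "\<dots> = ennreal (1 + 4 * \<theta> * (A - 1))"
    using assms A1 by (simp add: ennreal_mult'[symmetric] ennreal_plus[symmetric] algebra_simps del: ennreal_plus)
  also have "\<dots> \<le> ennreal (exp (4 * \<theta> * (A - 1)))"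
    by (intro ennreal_leI exp_ge_add_one_self)
  finally show ?thesis unfolding A_def .
qed

section \<open>Prediction of the noise from its past\<close>

locale noise = rough h H + prob_space M
  for h H :: real and M :: "'w measure" +
  fixes \<xi> \<Delta> :: "int \<Rightarrow> 'w \<Rightarrow> real ^ 'd::finite"
  assumes iid: "iid_std_gaussian M \<xi>" and ma: "moving_average M (a_coeff h H) \<xi> \<Delta>"
begin

lemma indep: "indep_vars (\<lambda>_. borel) \<xi> UNIV"
  and distr_\<xi>: "distr M borel (\<xi> k) = std_gaussian"
  using iid by (auto simp: iid_std_gaussian_def)

lemma \<xi>_meas[measurable]: "\<xi> k \<in> borel_measurable M"
  using indep by (auto simp: indep_vars_def)

lemma \<Delta>_meas[measurable]: "\<Delta> n \<in> borel_measurable M"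
  and \<Delta>_sums: "AE \<omega> in M. (\<lambda>k. a k *\<^sub>R \<xi> (n - int k) \<omega>) sums \<Delta> n \<omega>"
  using ma by (auto simp: moving_average_def)

lemma past_meas[measurable]: "past \<Delta> n \<in> M \<rightarrow>\<^sub>M seq_space"
  unfolding past_def by (rule measurable_PiM_single') auto

lemma distr_\<xi>_family:
  fixes f :: "'i \<Rightarrow> int"
  assumes f: "inj_on f I"
  shows "distr M (PiM I (\<lambda>_. borel)) (\<lambda>\<omega>. \<lambda>i\<in>I. \<xi> (f i) \<omega>) = gauss_vec I"
proof -
  have 1: "distr M (PiM UNIV (\<lambda>_. borel)) (\<lambda>\<omega> i. \<xi> i \<omega>) = gauss_vec UNIV"
    using indep indep_vars_iff_distr_eq_PiM'[where I = UNIV and M' = "\<lambda>_. borel" and X = \<xi>] by (simp add: distr_\<xi> restrict_UNIV)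
  have "(gauss_vec I :: ('i \<Rightarrow> real ^ 'd) measure) = distr (gauss_vec UNIV) (gauss_vec I) (\<lambda>\<omega>. \<lambda>i\<in>I. \<omega> (f i))"
    using distr_PiM_reindex[of UNIV "\<lambda>_. std_gaussian :: (real ^ 'd) measure" f I] f by (simp add: prob_space_std_gaussian)
  also have "\<dots> = distr (gauss_vec UNIV) (PiM I (\<lambda>_. borel)) (\<lambda>\<omega>. \<lambda>i\<in>I. \<omega> (f i))"
    by (intro distr_cong refl sets_gauss_vec)
  also have "\<dots> = distr M (PiM I (\<lambda>_. borel)) ((\<lambda>\<omega>. \<lambda>i\<in>I. \<omega> (f i)) \<circ> (\<lambda>\<omega> i. \<xi> i \<omega>))"
    unfolding 1[symmetric] by (rule distr_distr) (auto intro!: measurable_restrict measurable_PiM_single')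
  finally show ?thesis by (simp add: comp_def)
qed

lemma \<xi>_lin_comb_norm:
  fixes f :: "'i \<Rightarrow> int"
  assumes I: "finite I" and f: "inj_on f I"
  shows "(\<integral>\<^sup>+\<omega>. norm (\<Sum>i\<in>I. c i *\<^sub>R \<xi> (f i) \<omega>) \<partial>M) = ennreal (sqrt (\<Sum>i\<in>I. (c i)\<^sup>2)) * (\<integral>\<^sup>+u. norm u \<partial>(std_gaussian :: (real ^ 'd) measure))"
proof -
  have [measurable]: "(\<lambda>\<omega>. \<lambda>i\<in>I. \<xi> (f i) \<omega>) \<in> M \<rightarrow>\<^sub>M PiM I (\<lambda>_. borel)"
    by (intro measurable_restrict) auto
  have "(\<integral>\<^sup>+\<omega>. norm (\<Sum>i\<in>I. c i *\<^sub>R \<xi> (f i) \<omega>) \<partial>M) = (\<integral>\<^sup>+\<omega>. norm (\<Sum>i\<in>I. c i *\<^sub>R (\<lambda>i\<in>I. \<xi> (f i) \<omega>) i) \<partial>M)"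
    by simp
  also have "\<dots> = (\<integral>\<^sup>+z. norm (\<Sum>i\<in>I. c i *\<^sub>R z i) \<partial>distr M (PiM I (\<lambda>_. borel)) (\<lambda>\<omega>. \<lambda>i\<in>I. \<xi> (f i) \<omega>))"
    by (rule nn_integral_distr[symmetric]) measurable
  also have "\<dots> = (\<integral>\<^sup>+z. norm (\<Sum>i\<in>I. c i *\<^sub>R (z i :: real ^ 'd)) \<partial>gauss_vec I)"
    unfolding distr_\<xi>_family[OF f] ..
  also have "\<dots> = (\<integral>\<^sup>+x. norm x \<partial>distr (gauss_vec I) borel (\<lambda>z. \<Sum>i\<in>I. c i *\<^sub>R z i :: real ^ 'd))"
    by (subst nn_integral_distr) simp_all
  also have "\<dots> = (\<integral>\<^sup>+u. norm (sqrt (\<Sum>i\<in>I. (c i)\<^sup>2) *\<^sub>R u) \<partial>(std_gaussian :: (real ^ 'd) measure))"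
    unfolding gauss_vec_lin_comb[OF I] by (subst nn_integral_distr) simp_all
  also have "\<dots> = (\<integral>\<^sup>+u. ennreal (sqrt (\<Sum>i\<in>I. (c i)\<^sup>2)) * norm u \<partial>(std_gaussian :: (real ^ 'd) measure))"
    by (intro nn_integral_cong) (simp add: ennreal_mult'[symmetric] sum_nonneg)
  finally show ?thesis by (simp add: nn_integral_cmult)
qed

definition tail_b :: "nat \<Rightarrow> real" where "tail_b n = (\<Sum>m. (b (m + Suc n))\<^sup>2)"

lemma tail_b_nonneg: "0 \<le> tail_b n"
  unfolding tail_b_def using summable_ignore_initial_segment[OF summable_b_sq, of "Suc n"] by (intro suminf_nonneg) auto

lemma tail_b_lim: "tail_b \<longlonglongrightarrow> 0"
proof -
  have "(\<lambda>n. \<Sum>m. (b (m + n))\<^sup>2) \<longlonglongrightarrow> 0"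
    by (rule suminf_exist_split2[OF summable_b_sq])
  then show ?thesis unfolding tail_b_def by (rule LIMSEQ_Suc)
qed

definition "gn = (\<integral>\<^sup>+u. norm u \<partial>(std_gaussian :: (real ^ 'd) measure))"

lemma gn_finite: "gn < \<infinity>"
proof -
  have "gn \<le> (\<integral>\<^sup>+x. ennreal 2 * ennreal (exp ((norm x)\<^sup>2 / 4)) \<partial>(std_gaussian :: (real ^ 'd) measure))"
    unfolding gn_def
  proof (intro nn_integral_mono)
    fix x :: "real ^ 'd"
    have "norm x \<le> 2 * (1 + (norm x)\<^sup>2 / 4)"
      using zero_le_power2[of "norm x - 1"] by (simp add: power2_eq_square algebra_simps)
    also have "\<dots> \<le> 2 * exp ((norm x)\<^sup>2 / 4)"
      by (intro mult_left_mono exp_ge_add_one_self) auto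
    finally show "ennreal (norm x) \<le> ennreal 2 * ennreal (exp ((norm x)\<^sup>2 / 4))"
      by (subst ennreal_mult'[symmetric]) (auto intro: ennreal_leI)
  qed
  also have "\<dots> = 2 * ennreal (sqrt 2 ^ CARD('d))"
    by (subst nn_integral_cmult) (auto simp: std_gaussian_exp_sq)
  also have "\<dots> < \<infinity>" by (simp add: ennreal_mult_less_top)
  finally show ?thesis .
qed

text \<open>For moving averages cut at lag m, the truncated inverse returns the innovation plus a
  combination of the innovations at lags between n and m, whose coefficients are at most
  \<open>a 0 * b l\<close> by \<open>trunc_conv_bound\<close>. Its mean norm is that of one Gaussian
  times the l^2 norm of the coefficients, and Fatou's lemma lets m tend to infinity.\<close>

lemma truncated_inverse_error:
  "(\<integral>\<^sup>+\<omega>. norm ((\<Sum>k\<le>n. b k *\<^sub>R \<Delta> (s - int k) \<omega>) - \<xi> s \<omega>) \<partial>M) \<le> ennreal (a 0 * sqrt (tail_b n)) * gn"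
proof -
  define X where "X m \<omega> = (\<Sum>k\<le>n. b k *\<^sub>R (\<Sum>i\<le>m - k. a i *\<^sub>R \<xi> (s - int k - int i) \<omega>)) - \<xi> s \<omega>" for m \<omega>
  define c where "c m = (\<Sum>k\<le>n. b k * a (m - k))" for m
  have [measurable]: "X m \<in> borel_measurable M" for m
    unfolding X_def by measurable
  \<comment> \<open>At lags up to n the truncated convolution is complete, hence equal to 1 at lag 0
    and to 0 elsewhere; only later lags survive.\<close>
  have Xeq: "X m \<omega> = (\<Sum>l\<in>{n<..m}. c l *\<^sub>R \<xi> (s - int l) \<omega>)" if "n \<le> m" for m \<omega>
  proof -
    have "(\<Sum>k\<le>n. b k *\<^sub>R (\<Sum>i\<le>m - k. a i *\<^sub>R \<xi> (s - int k - int i) \<omega>)) =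
       (\<Sum>k\<le>n. \<Sum>l\<in>{k..m}. (b k * a (l - k)) *\<^sub>R \<xi> (s - int l) \<omega>)"
    proof (intro sum.cong refl)
      fix k assume k: "k \<in> {..n}"
      have "(\<Sum>l\<in>{k..m}. (b k * a (l - k)) *\<^sub>R \<xi> (s - int l) \<omega>) = (\<Sum>i\<le>m - k. (b k * a i) *\<^sub>R \<xi> (s - int (k + i)) \<omega>)"
        by (rule sum.reindex_bij_witness[of _ "\<lambda>i. k + i" "\<lambda>l. l - k"]) (use k that in auto)
      then show "b k *\<^sub>R (\<Sum>i\<le>m - k. a i *\<^sub>R \<xi> (s - int k - int i) \<omega>) = (\<Sum>l\<in>{k..m}. (b k * a (l - k)) *\<^sub>R \<xi> (s - int l) \<omega>)"
        by (simp add: scaleR_sum_right algebra_simps)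
    qed
    also have "\<dots> = (\<Sum>k\<le>n. \<Sum>l\<le>m. if k \<le> l then (b k * a (l - k)) *\<^sub>R \<xi> (s - int l) \<omega> else 0)"
      by (intro sum.cong refl sum.mono_neutral_cong_left) auto
    also have "\<dots> = (\<Sum>l\<le>m. \<Sum>k\<le>n. if k \<le> l then (b k * a (l - k)) *\<^sub>R \<xi> (s - int l) \<omega> else 0)"
      by (rule sum.swap)
    also have "\<dots> = (\<Sum>l\<le>m. (if l \<le> n then (if l = 0 then 1 else 0) else c l) *\<^sub>R \<xi> (s - int l) \<omega>)"
    proof (intro sum.cong refl)
      fix l assume "l \<in> {..m}"
      show "(\<Sum>k\<le>n. if k \<le> l then (b k * a (l - k)) *\<^sub>R \<xi> (s - int l) \<omega> else 0) =
        (if l \<le> n then (if l = 0 then 1 else 0) else c l) *\<^sub>R \<xi> (s - int l) \<omega>"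
      proof (cases "l \<le> n")
        case True
        have "(\<Sum>k\<le>n. if k \<le> l then (b k * a (l - k)) *\<^sub>R \<xi> (s - int l) \<omega> else 0) = (\<Sum>k\<le>l. (b k * a (l - k)) *\<^sub>R \<xi> (s - int l) \<omega>)"
          using True by (intro sum.mono_neutral_cong_right) auto
        then show ?thesis using True b_a_conv[of l] by (simp add: scaleR_sum_left[symmetric])
      next
        case False
        have "(\<Sum>k\<le>n. if k \<le> l then (b k * a (l - k)) *\<^sub>R \<xi> (s - int l) \<omega> else 0) = (\<Sum>k\<le>n. (b k * a (l - k)) *\<^sub>R \<xi> (s - int l) \<omega>)"
          using False by (intro sum.cong) auto
        then show ?thesis using False by (simp add: c_def scaleR_sum_left[symmetric])
      qed
    qed
    also have "\<dots> = (\<Sum>l\<le>n. (if l = 0 then 1 else 0) *\<^sub>R \<xi> (s - int l) \<omega>) + (\<Sum>l\<in>{n<..m}. c l *\<^sub>R \<xi> (s - int l) \<omega>)"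
    proof -
      have *: "{..m} = {..n} \<union> {n<..m}" using that by auto
      show ?thesis unfolding * by (subst sum.union_disjoint) (auto intro!: arg_cong2[where f="(+)"] sum.cong)
    qed
    also have "(\<Sum>l\<le>n. (if l = 0 then 1 else 0) *\<^sub>R \<xi> (s - int l) \<omega>) = \<xi> s \<omega>"
    proof -
      have "(\<Sum>l\<le>n. (if l = 0 then 1 else 0) *\<^sub>R \<xi> (s - int l) \<omega>) = (\<Sum>l\<le>n. if l = 0 then \<xi> (s - int l) \<omega> else 0)"
        by (intro sum.cong) auto
      then show ?thesis by simp
    qed
    finally show ?thesis by (simp add: X_def)
  qed
  have bound: "(\<integral>\<^sup>+\<omega>. norm (X m \<omega>) \<partial>M) \<le> ennreal (a 0 * sqrt (tail_b n)) * gn" if "n \<le> m" for m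
  proof -
    have "(\<integral>\<^sup>+\<omega>. norm (X m \<omega>) \<partial>M) = ennreal (sqrt (\<Sum>l\<in>{n<..m}. (c l)\<^sup>2)) * gn"
      unfolding Xeq[OF that] gn_def by (rule \<xi>_lin_comb_norm) (auto simp: inj_on_def)
    also have "\<dots> \<le> ennreal (a 0 * sqrt (tail_b n)) * gn"
    proof (intro mult_right_mono ennreal_leI)
      have "(\<Sum>l\<in>{n<..m}. (c l)\<^sup>2) \<le> (\<Sum>l\<in>{n<..m}. (a 0)\<^sup>2 * (b l)\<^sup>2)"
      proof (rule sum_mono)
        fix l assume "l \<in> {n<..m}"
        then have "\<bar>c l\<bar> \<le> a 0 * b l" unfolding c_def by (intro trunc_conv_bound) auto
        then have "\<bar>c l\<bar>\<^sup>2 \<le> (a 0 * b l)\<^sup>2" by (intro power_mono) auto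
        then show "(c l)\<^sup>2 \<le> (a 0)\<^sup>2 * (b l)\<^sup>2" by (simp add: power_mult_distrib)
      qed
      also have "\<dots> = (a 0)\<^sup>2 * (\<Sum>l\<in>{n<..m}. (b l)\<^sup>2)" by (simp add: sum_distrib_left)
      also have "(\<Sum>l\<in>{n<..m}. (b l)\<^sup>2) = (\<Sum>i<m - n. (b (i + Suc n))\<^sup>2)"
        by (rule sum.reindex_bij_witness[of _ "\<lambda>i. i + Suc n" "\<lambda>l. l - Suc n"]) auto
      also have "\<dots> \<le> tail_b n"
        unfolding tail_b_def by (intro sum_le_suminf summable_ignore_initial_segment[OF summable_b_sq]) auto
      finally have "sqrt (\<Sum>l\<in>{n<..m}. (c l)\<^sup>2) \<le> sqrt ((a 0)\<^sup>2 * tail_b n)"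
        by (intro real_sqrt_le_mono) (simp add: mult_left_mono)
      then show "sqrt (\<Sum>l\<in>{n<..m}. (c l)\<^sup>2) \<le> a 0 * sqrt (tail_b n)"
        using a_0_pos by (simp add: real_sqrt_mult)
    qed simp
    finally show ?thesis .
  qed
  have lim: "AE \<omega> in M. (\<lambda>m. X m \<omega>) \<longlonglongrightarrow> (\<Sum>k\<le>n. b k *\<^sub>R \<Delta> (s - int k) \<omega>) - \<xi> s \<omega>"
  proof -
    have "AE \<omega> in M. \<forall>k\<in>{..n}. (\<lambda>i. a i *\<^sub>R \<xi> (s - int k - int i) \<omega>) sums \<Delta> (s - int k) \<omega>"
      by (intro AE_finite_allI \<Delta>_sums) auto
    then show ?thesis
    proof (rule AE_mp, intro AE_I2 impI)
      fix \<omega> assume *: "\<forall>k\<in>{..n}. (\<lambda>i. a i *\<^sub>R \<xi> (s - int k - int i) \<omega>) sums \<Delta> (s - int k) \<omega>"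
      have "(\<lambda>m. \<Sum>i\<le>m - k. a i *\<^sub>R \<xi> (s - int k - int i) \<omega>) \<longlonglongrightarrow> \<Delta> (s - int k) \<omega>" if "k \<le> n" for k
      proof -
        have "(\<lambda>m. \<Sum>i\<le>m. a i *\<^sub>R \<xi> (s - int k - int i) \<omega>) \<longlonglongrightarrow> \<Delta> (s - int k) \<omega>"
          using * that by (simp add: sums_def_le)
        moreover have "filterlim (\<lambda>m. m - k) at_top at_top"
          by (rule filterlim_minus_const_nat_at_top)
        ultimately show ?thesis by (rule filterlim_compose)
      qed
      then show "(\<lambda>m. X m \<omega>) \<longlonglongrightarrow> (\<Sum>k\<le>n. b k *\<^sub>R \<Delta> (s - int k) \<omega>) - \<xi> s \<omega>"
        unfolding X_def by (intro tendsto_diff tendsto_sum tendsto_scaleR tendsto_const) auto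
    qed
  qed
  have "(\<integral>\<^sup>+\<omega>. norm ((\<Sum>k\<le>n. b k *\<^sub>R \<Delta> (s - int k) \<omega>) - \<xi> s \<omega>) \<partial>M) = (\<integral>\<^sup>+\<omega>. liminf (\<lambda>m. ennreal (norm (X m \<omega>))) \<partial>M)"
    using lim by (intro nn_integral_cong_AE, eventually_elim)
      (auto intro!: lim_imp_Liminf[symmetric] tendsto_ennrealI tendsto_norm)
  also have "\<dots> \<le> liminf (\<lambda>m. \<integral>\<^sup>+\<omega>. norm (X m \<omega>) \<partial>M)"
    by (rule nn_integral_liminf) simp
  also have "\<dots> \<le> ennreal (a 0 * sqrt (tail_b n)) * gn"
  proof (rule Liminf_le)
    show "\<forall>\<^sub>F m in sequentially. (\<integral>\<^sup>+\<omega>. norm (X m \<omega>) \<partial>M) \<le> ennreal (a 0 * sqrt (tail_b n)) * gn"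
      using eventually_ge_at_top[of n] by eventually_elim (rule bound)
  qed simp
  finally show ?thesis .
qed

text \<open>Truncation levels with mean error at most 2^-j. The errors become summable, which
  upgrades convergence in mean to almost sure convergence.\<close>

definition subseq_b :: "nat \<Rightarrow> nat" where
  "subseq_b j = (SOME n. ennreal (a 0 * sqrt (tail_b n)) * gn \<le> ennreal ((1/2) ^ j))"

lemma subseq_b: "ennreal (a 0 * sqrt (tail_b (subseq_b j))) * gn \<le> ennreal ((1/2) ^ j)"
proof -
  obtain G where G: "gn = ennreal G" "0 \<le> G" using gn_finite by (cases gn) auto
  have "(\<lambda>n. a 0 * sqrt (tail_b n) * G) \<longlonglongrightarrow> a 0 * sqrt 0 * G"
    by (intro tendsto_intros tail_b_lim)
  then have "\<forall>\<^sub>F n in sequentially. a 0 * sqrt (tail_b n) * G < (1/2) ^ j"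
    by (rule order_tendstoD) simp
  then obtain n where "a 0 * sqrt (tail_b n) * G < (1/2) ^ j"
    by (auto simp: eventually_sequentially)
  then have "ennreal (a 0 * sqrt (tail_b n)) * gn \<le> ennreal ((1/2) ^ j)"
    unfolding G using G(2) a_0_pos tail_b_nonneg by (subst ennreal_mult[symmetric]) (auto intro: ennreal_leI)
  then show ?thesis unfolding subseq_b_def by (rule someI)
qed

text \<open>\<open>predictor\<close> is the conditional mean of the next noise given the past.\<close>

definition approx_predictor :: "nat \<Rightarrow> 'd seq \<Rightarrow> real ^ 'd" where
  "approx_predictor j w = - (a 0 *\<^sub>R (\<Sum>k<subseq_b j. b (Suc k) *\<^sub>R w k))"

definition predictor :: "'d seq \<Rightarrow> real ^ 'd" where
  "predictor w = lim (\<lambda>j. approx_predictor j w)"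

lemma approx_predictor_meas[measurable]: "approx_predictor j \<in> borel_measurable seq_space"
  unfolding approx_predictor_def by measurable

lemma predictor_meas[measurable]: "predictor \<in> borel_measurable seq_space"
  unfolding predictor_def by measurable

text \<open>As a 0 b 0 = 1, the approximate predictor equals the next noise minus a 0 times its
  innovation, up to a 0 times the truncation error u j. The means of the |u j| are summable, so u j
  tends to 0 almost surely.\<close>

lemma approx_predictor_lim:
  "AE \<omega> in M. (\<lambda>j. approx_predictor j (past \<Delta> t \<omega>)) \<longlonglongrightarrow> \<Delta> (t + 1) \<omega> - a 0 *\<^sub>R \<xi> (t + 1) \<omega>"
proof -
  define u where "u j \<omega> = (\<Sum>k\<le>subseq_b j. b k *\<^sub>R \<Delta> (t + 1 - int k) \<omega>) - \<xi> (t + 1) \<omega>" for j \<omega>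
  have [measurable]: "u j \<in> borel_measurable M" for j unfolding u_def by measurable
  have "(\<integral>\<^sup>+\<omega>. (\<Sum>j. ennreal (norm (u j \<omega>))) \<partial>M) = (\<Sum>j. \<integral>\<^sup>+\<omega>. ennreal (norm (u j \<omega>)) \<partial>M)"
    by (rule nn_integral_suminf) simp
  also have "\<dots> \<le> (\<Sum>j. ennreal ((1/2) ^ j))"
    unfolding u_def by (intro suminf_le order_trans[OF truncated_inverse_error subseq_b]) auto
  also have "\<dots> = ennreal (\<Sum>j. (1/2) ^ j)"
    by (rule suminf_ennreal2) (auto intro: summable_geometric)
  also have "\<dots> < \<infinity>" by simp
  finally have "AE \<omega> in M. (\<Sum>j. ennreal (norm (u j \<omega>))) \<noteq> \<infinity>"
    by (intro nn_integral_PInf_AE) auto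
  then show ?thesis
  proof (rule AE_mp, intro AE_I2 impI)
    fix \<omega> assume "(\<Sum>j. ennreal (norm (u j \<omega>))) \<noteq> \<infinity>"
    then have "summable (\<lambda>j. norm (u j \<omega>))"
      by (intro summable_suminf_not_top) auto
    then have "(\<lambda>j. u j \<omega>) \<longlonglongrightarrow> 0"
      using summable_LIMSEQ_zero tendsto_norm_zero_iff by blast
    then have "(\<lambda>j. (\<Delta> (t + 1) \<omega> - a 0 *\<^sub>R \<xi> (t + 1) \<omega>) - a 0 *\<^sub>R u j \<omega>) \<longlonglongrightarrow> (\<Delta> (t + 1) \<omega> - a 0 *\<^sub>R \<xi> (t + 1) \<omega>) - a 0 *\<^sub>R 0"
      by (intro tendsto_intros)
    moreover have "(\<Delta> (t + 1) \<omega> - a 0 *\<^sub>R \<xi> (t + 1) \<omega>) - a 0 *\<^sub>R u j \<omega> = approx_predictor j (past \<Delta> t \<omega>)" for j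
    proof -
      have "(\<Sum>k\<le>subseq_b j. b k *\<^sub>R \<Delta> (t + 1 - int k) \<omega>) = b 0 *\<^sub>R \<Delta> (t + 1) \<omega> + (\<Sum>k<subseq_b j. b (Suc k) *\<^sub>R \<Delta> (t - int k) \<omega>)"
        unfolding lessThan_Suc_atMost[symmetric] sum.lessThan_Suc_shift by simp
      moreover have "a 0 * b 0 = 1" using a_0_pos by simp
      ultimately show ?thesis
        unfolding u_def approx_predictor_def past_def by (simp add: scaleR_right_diff_distrib scaleR_right_distrib)
    qed
    ultimately show "(\<lambda>j. approx_predictor j (past \<Delta> t \<omega>)) \<longlonglongrightarrow> \<Delta> (t + 1) \<omega> - a 0 *\<^sub>R \<xi> (t + 1) \<omega>"
      by simp
  qed
qed

lemma predictor_past: "AE \<omega> in M. \<forall>t. \<Delta> (t + 1) \<omega> = predictor (past \<Delta> t \<omega>) + a 0 *\<^sub>R \<xi> (t + 1) \<omega>"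
proof (subst AE_all_countable, intro allI)
  fix t
  show "AE \<omega> in M. \<Delta> (t + 1) \<omega> = predictor (past \<Delta> t \<omega>) + a 0 *\<^sub>R \<xi> (t + 1) \<omega>"
    using approx_predictor_lim[of t] unfolding predictor_def by eventually_elim (simp add: limI)
qed

section \<open>Innovations and future noise as functions of the past\<close>

text \<open>The coordinates beyond j are the past of coordinate j; its prediction error, divided by
  \<open>a 0\<close>, is the innovation at time -j.\<close>

definition innovation :: "nat \<Rightarrow> 'd seq \<Rightarrow> real ^ 'd" where
  "innovation j w = (1 / a 0) *\<^sub>R (w j - predictor (\<lambda>k. w (k + Suc j)))"

text \<open>The part of the noise at time k + 1 due to innovations up to time 0: the innovation at
  time -i has lag i + k + 1.\<close>

definition drift_past :: "nat \<Rightarrow> 'd seq \<Rightarrow> real ^ 'd" where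
  "drift_past k w = lim (\<lambda>m. \<Sum>i<m. a (i + Suc k) *\<^sub>R innovation i w)"

lemma innovation_meas[measurable]: "innovation j \<in> borel_measurable seq_space"
proof -
  have [measurable]: "(\<lambda>w k. w (k + Suc j)) \<in> seq_space \<rightarrow>\<^sub>M (seq_space :: 'd seq measure)"
    by (rule measurable_PiM_single') auto
  show ?thesis unfolding innovation_def by measurable
qed

lemma drift_past_meas[measurable]: "drift_past k \<in> borel_measurable seq_space"
  unfolding drift_past_def by measurable

text \<open>The future noise as a function of the past w and of the future innovations;
  \<open>e i\<close> is the innovation at time i + 1 and index k stands for time k + 1. It is affine
  in e, which makes shifts of the innovations tractable.\<close>

definition response :: "'d seq \<Rightarrow> ('d seq) \<Rightarrow> 'd seq" where
  "response w e k = drift_past k w + (\<Sum>i\<le>k. a (k - i) *\<^sub>R e i)"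

lemma innovation_past: "AE \<omega> in M. \<forall>t j. innovation j (past \<Delta> t \<omega>) = \<xi> (t - int j) \<omega>"
  using predictor_past
proof (rule AE_mp, intro AE_I2 impI allI)
  fix \<omega> t j assume "\<forall>t. \<Delta> (t + 1) \<omega> = predictor (past \<Delta> t \<omega>) + a 0 *\<^sub>R \<xi> (t + 1) \<omega>"
  from spec[OF this, of "t - int j - 1"]
  have "\<Delta> (t - int j) \<omega> = predictor (past \<Delta> (t - int j - 1) \<omega>) + a 0 *\<^sub>R \<xi> (t - int j) \<omega>" by simp
  moreover have "(\<lambda>k. past \<Delta> t \<omega> (k + Suc j)) = past \<Delta> (t - int j - 1) \<omega>"
    by (auto simp: past_def fun_eq_iff algebra_simps)
  moreover have "past \<Delta> t \<omega> j = \<Delta> (t - int j) \<omega>" by (simp add: past_def)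
  ultimately show "innovation j (past \<Delta> t \<omega>) = \<xi> (t - int j) \<omega>"
    using a_0_pos by (simp add: innovation_def)
qed

text \<open>The moving average is split at lag k: the lags beyond it meet innovations that are
  almost surely functions of the past, the others meet future innovations.\<close>

lemma response_past:
  "AE \<omega> in M. \<forall>t k. response (past \<Delta> t \<omega>) (\<lambda>i. \<xi> (t + 1 + int i) \<omega>) k = \<Delta> (t + 1 + int k) \<omega>"
proof -
  have "AE \<omega> in M. \<forall>n. (\<lambda>k. a k *\<^sub>R \<xi> (n - int k) \<omega>) sums \<Delta> n \<omega>"
    using \<Delta>_sums by (simp add: AE_all_countable)
  with innovation_past show ?thesis
  proof (eventually_elim, intro allI)
    fix \<omega> t k assume inn: "\<forall>t j. innovation j (past \<Delta> t \<omega>) = \<xi> (t - int j) \<omega>"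
      and "\<forall>n. (\<lambda>k. a k *\<^sub>R \<xi> (n - int k) \<omega>) sums \<Delta> n \<omega>"
    then have "(\<lambda>i. a i *\<^sub>R \<xi> (t + 1 + int k - int i) \<omega>) sums \<Delta> (t + 1 + int k) \<omega>" by blast
    then have "(\<lambda>i. a (i + Suc k) *\<^sub>R \<xi> (t + 1 + int k - int (i + Suc k)) \<omega>) sums
      (\<Delta> (t + 1 + int k) \<omega> - (\<Sum>i<Suc k. a i *\<^sub>R \<xi> (t + 1 + int k - int i) \<omega>))"
      by (rule sums_split_initial_segment)
    then have "(\<lambda>m. \<Sum>i<m. a (i + Suc k) *\<^sub>R innovation i (past \<Delta> t \<omega>)) \<longlonglongrightarrow>
      (\<Delta> (t + 1 + int k) \<omega> - (\<Sum>i<Suc k. a i *\<^sub>R \<xi> (t + 1 + int k - int i) \<omega>))"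
      by (simp add: sums_def inn algebra_simps)
    then have "drift_past k (past \<Delta> t \<omega>) = \<Delta> (t + 1 + int k) \<omega> - (\<Sum>i<Suc k. a i *\<^sub>R \<xi> (t + 1 + int k - int i) \<omega>)"
      unfolding drift_past_def by (rule limI)
    moreover have "(\<Sum>i<Suc k. a i *\<^sub>R \<xi> (t + 1 + int k - int i) \<omega>) = (\<Sum>i\<le>k. a (k - i) *\<^sub>R \<xi> (t + 1 + int i) \<omega>)"
      by (rule sum.reindex_bij_witness[of _ "\<lambda>i. k - i" "\<lambda>i. k - i"]) (auto simp: of_nat_diff algebra_simps)
    ultimately show "response (past \<Delta> t \<omega>) (\<lambda>i. \<xi> (t + 1 + int i) \<omega>) k = \<Delta> (t + 1 + int k) \<omega>"
      by (simp add: response_def)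
  qed
qed

text \<open>The past as a measurable function of the innovations alone. Stationarity
  (\<open>past_law_eq\<close>) and independence of past and future innovations
  (\<open>joint_law\<close>) are derived from it.\<close>

definition past_of :: "('d seq) \<Rightarrow> 'd seq" where
  "past_of x = (\<lambda>j. lim (\<lambda>m. \<Sum>k<m. a k *\<^sub>R x (j + k)))"

lemma past_of_meas[measurable]: "past_of \<in> gauss_vec UNIV \<rightarrow>\<^sub>M seq_space"
  unfolding past_of_def by (rule measurable_PiM_single') auto

lemma past_eq_past_of: "AE \<omega> in M. past \<Delta> t \<omega> = past_of (\<lambda>k. \<xi> (t - int k) \<omega>)"
proof -
  have "AE \<omega> in M. \<forall>n. (\<lambda>k. a k *\<^sub>R \<xi> (n - int k) \<omega>) sums \<Delta> n \<omega>"
    using \<Delta>_sums by (simp add: AE_all_countable)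
  then show ?thesis
  proof (rule AE_mp, intro AE_I2 impI ext)
    fix \<omega> j assume "\<forall>n. (\<lambda>k. a k *\<^sub>R \<xi> (n - int k) \<omega>) sums \<Delta> n \<omega>"
    then have "(\<lambda>m. \<Sum>k<m. a k *\<^sub>R \<xi> (t - int j - int k) \<omega>) \<longlonglongrightarrow> \<Delta> (t - int j) \<omega>"
      by (simp add: sums_def)
    then show "past \<Delta> t \<omega> j = past_of (\<lambda>k. \<xi> (t - int k) \<omega>) j"
      by (simp add: past_of_def past_def limI[symmetric] algebra_simps)
  qed
qed

lemma past_law_eq: "distr M seq_space (past \<Delta> t) = past_law M \<Delta>"
proof -
  have "distr M seq_space (past \<Delta> t) = distr (gauss_vec UNIV) seq_space past_of" for t
  proof -
    have 1: "distr M seq_space (\<lambda>\<omega> k. \<xi> (t - int k) \<omega>) = gauss_vec UNIV"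
      using distr_\<xi>_family[of "\<lambda>k. t - int k" UNIV] by (simp add: inj_on_def restrict_UNIV)
    have m: "(\<lambda>\<omega> k. \<xi> (t - int k) \<omega>) \<in> M \<rightarrow>\<^sub>M gauss_vec (UNIV :: nat set)"
      unfolding measurable_cong_sets[OF refl sets_gauss_vec] by (rule measurable_PiM_single') auto
    have "distr M seq_space (past \<Delta> t) = distr M seq_space (past_of \<circ> (\<lambda>\<omega> k. \<xi> (t - int k) \<omega>))"
      using past_eq_past_of[of t] measurable_comp[OF m past_of_meas]
      by (intro distr_cong_AE) (auto simp: comp_def)
    also have "\<dots> = distr (distr M (gauss_vec UNIV) (\<lambda>\<omega> k. \<xi> (t - int k) \<omega>)) seq_space past_of"
      by (rule distr_distr[symmetric, OF past_of_meas m])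
    also have "distr M (gauss_vec UNIV) (\<lambda>\<omega> k. \<xi> (t - int k) \<omega>) = gauss_vec (UNIV :: nat set)"
      by (rule trans[OF distr_cong[OF refl sets_gauss_vec refl] 1])
    finally show ?thesis .
  qed
  then show ?thesis unfolding past_law_def by simp
qed

lemma prob_space_past_law: "prob_space (past_law M \<Delta>)"
  unfolding past_law_def by (rule prob_space_distr) simp

lemma sets_past_law[measurable_cong]: "sets (past_law M \<Delta>) = sets seq_space"
  by (simp add: past_law_def)

lemma past_future_meas:
  "(\<lambda>\<omega>. (past \<Delta> t \<omega>, \<lambda>i. \<xi> (t + 1 + int i) \<omega>)) \<in> M \<rightarrow>\<^sub>M seq_space \<Otimes>\<^sub>M seq_space"
  by (intro measurable_Pair past_meas measurable_PiM_single') auto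

lemma joint_law:
  "distr M (seq_space \<Otimes>\<^sub>M seq_space) (\<lambda>\<omega>. (past \<Delta> t \<omega>, \<lambda>i. \<xi> (t + 1 + int i) \<omega>)) = past_law M \<Delta> \<Otimes>\<^sub>M gauss_vec UNIV"
proof -
  define X where "X \<omega> = (\<lambda>k. \<xi> (t - int k) \<omega>)" for \<omega>
  define Y where "Y \<omega> = (\<lambda>i. \<xi> (t + 1 + int i) \<omega>)" for \<omega>
  have X[measurable]: "X \<in> M \<rightarrow>\<^sub>M seq_space" and Y[measurable]: "Y \<in> M \<rightarrow>\<^sub>M seq_space"
    unfolding X_def Y_def by (rule measurable_PiM_single'; auto)+
  have past_of[measurable]: "past_of \<in> seq_space \<rightarrow>\<^sub>M seq_space"
    using past_of_meas by (simp add: measurable_cong_sets[OF sets_gauss_vec refl])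
  have ind: "indep_var (PiM {..t} (\<lambda>_. borel)) (\<lambda>\<omega>. restrict (\<lambda>i. \<xi> i \<omega>) {..t}) (PiM {t<..} (\<lambda>_. borel)) (\<lambda>\<omega>. restrict (\<lambda>i. \<xi> i \<omega>) {t<..})"
    by (rule indep_var_restrict[OF indep]) auto
  define f where "f x = (\<lambda>k. x (t - int k))" for x :: "int \<Rightarrow> real ^ 'd"
  define g where "g x = (\<lambda>i. x (t + 1 + int i))" for x :: "int \<Rightarrow> real ^ 'd"
  have f: "f \<in> PiM {..t} (\<lambda>_. borel) \<rightarrow>\<^sub>M seq_space"
    unfolding f_def by (rule measurable_PiM_single') auto
  have g: "g \<in> PiM {t<..} (\<lambda>_. borel) \<rightarrow>\<^sub>M seq_space"
    unfolding g_def by (rule measurable_PiM_single') auto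
  have "indep_var seq_space ((past_of \<circ> f) \<circ> (\<lambda>\<omega>. restrict (\<lambda>i. \<xi> i \<omega>) {..t})) seq_space (g \<circ> (\<lambda>\<omega>. restrict (\<lambda>i. \<xi> i \<omega>) {t<..}))"
    by (rule indep_var_compose[OF ind measurable_comp[OF f past_of] g])
  moreover have "(past_of \<circ> f) \<circ> (\<lambda>\<omega>. restrict (\<lambda>i. \<xi> i \<omega>) {..t}) = past_of \<circ> X"
    by (simp add: f_def X_def fun_eq_iff)
  moreover have "g \<circ> (\<lambda>\<omega>. restrict (\<lambda>i. \<xi> i \<omega>) {t<..}) = Y"
    by (simp add: g_def Y_def fun_eq_iff)
  ultimately have iv: "indep_var seq_space (past_of \<circ> X) seq_space Y"
    by simp
  have AE: "AE \<omega> in M. past \<Delta> t \<omega> = (past_of \<circ> X) \<omega>"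
    using past_eq_past_of[of t] by (simp add: X_def)
  have "distr M seq_space (past_of \<circ> X) = past_law M \<Delta>"
    unfolding past_law_eq[of t, symmetric] using AE by (intro distr_cong_AE) (auto simp: comp_def)
  moreover have "distr M seq_space Y = gauss_vec UNIV"
    unfolding Y_def using distr_\<xi>_family[of "\<lambda>i. t + 1 + int i" UNIV] by (simp add: inj_on_def restrict_UNIV)
  moreover have "distr M (seq_space \<Otimes>\<^sub>M seq_space) (\<lambda>\<omega>. (past \<Delta> t \<omega>, Y \<omega>)) = distr M (seq_space \<Otimes>\<^sub>M seq_space) (\<lambda>\<omega>. ((past_of \<circ> X) \<omega>, Y \<omega>))"
    using AE by (intro distr_cong_AE) (auto simp: comp_def)
  ultimately show ?thesis
    using iv unfolding indep_var_distribution_eq Y_def[symmetric] by simp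
qed

end

lemma nn_integral_fst_prob:
  "prob_space N \<Longrightarrow> f \<in> borel_measurable (M \<Otimes>\<^sub>M N) \<Longrightarrow> (\<integral>\<^sup>+x. \<integral>\<^sup>+y. f (x, y) \<partial>N \<partial>M) = (\<integral>\<^sup>+z. f z \<partial>(M \<Otimes>\<^sub>M N))"
  by (rule sigma_finite_measure.nn_integral_fst[OF prob_space_imp_sigma_finite])

text \<open>\<open>comb_seq n\<close> splices two independent sequences at index n without changing
  the law, so coordinate n comes from the second sequence while a function of the coordinates below
  n sees only the first.\<close>

lemma nn_integral_fresh_coordinate:
  fixes g :: "(nat \<Rightarrow> real ^ 'd::finite) \<times> (real ^ 'd) \<Rightarrow> ennreal"
  assumes [measurable]: "g \<in> borel_measurable (PiM UNIV (\<lambda>_. borel) \<Otimes>\<^sub>M borel)"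
    and local: "\<And>e e' u. (\<And>i. i < n \<Longrightarrow> e i = e' i) \<Longrightarrow> g (e, u) = g (e', u)"
  shows "(\<integral>\<^sup>+e. g (e, e n) \<partial>gauss_vec UNIV) = (\<integral>\<^sup>+e. \<integral>\<^sup>+u. g (e, u) \<partial>std_gaussian \<partial>gauss_vec UNIV)"
proof -
  interpret G: sequence_space "std_gaussian :: (real ^ 'd) measure"
    by standard
  let ?S = "gauss_vec UNIV :: (nat \<Rightarrow> real ^ 'd) measure"
  interpret GG: pair_sigma_finite ?S ?S ..
  have [measurable]: "g \<in> borel_measurable (?S \<Otimes>\<^sub>M std_gaussian)"
    by simp
  have c[measurable]: "(\<lambda>(\<omega>, \<omega>'). comb_seq n \<omega> \<omega>') \<in> ?S \<Otimes>\<^sub>M ?S \<rightarrow>\<^sub>M ?S"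
    by (rule measurable_comb_seq)
  have "(\<integral>\<^sup>+e. g (e, e n) \<partial>?S) = (\<integral>\<^sup>+e. g (e, e n) \<partial>distr (?S \<Otimes>\<^sub>M ?S) ?S (\<lambda>(\<omega>, \<omega>'). comb_seq n \<omega> \<omega>'))"
    unfolding G.PiM_comb_seq ..
  also have "\<dots> = (\<integral>\<^sup>+z. g ((\<lambda>(\<omega>, \<omega>'). comb_seq n \<omega> \<omega>') z, (\<lambda>(\<omega>, \<omega>'). comb_seq n \<omega> \<omega>') z n) \<partial>(?S \<Otimes>\<^sub>M ?S))"
    by (rule nn_integral_distr) measurable
  also have "\<dots> = (\<integral>\<^sup>+z. g (fst z, snd z 0) \<partial>(?S \<Otimes>\<^sub>M ?S))"
  proof (intro nn_integral_cong)
    fix z :: "(nat \<Rightarrow> real ^ 'd) \<times> (nat \<Rightarrow> real ^ 'd)"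
    obtain \<omega> \<omega>' where z: "z = (\<omega>, \<omega>')" by (cases z)
    have "comb_seq n \<omega> \<omega>' n = \<omega>' 0" using comb_seq_add[of n \<omega> \<omega>' 0] by simp
    moreover have "g (comb_seq n \<omega> \<omega>', \<omega>' 0) = g (\<omega>, \<omega>' 0)"
      by (rule local) (simp add: comb_seq_less)
    ultimately show "g ((\<lambda>(\<omega>, \<omega>'). comb_seq n \<omega> \<omega>') z, (\<lambda>(\<omega>, \<omega>'). comb_seq n \<omega> \<omega>') z n) = g (fst z, snd z 0)"
      by (simp add: z)
  qed
  also have "\<dots> = (\<integral>\<^sup>+\<omega>. \<integral>\<^sup>+\<omega>'. g (\<omega>, \<omega>' 0) \<partial>?S \<partial>?S)"
    by (subst nn_integral_fst_prob[OF prob_space_gauss_vec, symmetric]) auto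
  also have "\<dots> = (\<integral>\<^sup>+\<omega>. \<integral>\<^sup>+u. g (\<omega>, u) \<partial>std_gaussian \<partial>?S)"
  proof (intro nn_integral_cong)
    fix \<omega> :: "nat \<Rightarrow> real ^ 'd"
    have g\<omega>[measurable]: "(\<lambda>u. g (\<omega>, u)) \<in> borel_measurable std_gaussian"
    proof (rule measurable_compose[OF measurable_Pair1'])
      show "\<omega> \<in> space (PiM UNIV (\<lambda>_. borel))" by (simp add: space_PiM)
      show "g \<in> borel_measurable (PiM UNIV (\<lambda>_. borel) \<Otimes>\<^sub>M std_gaussian)" by simp
    qed
    have "(\<integral>\<^sup>+u. g (\<omega>, u) \<partial>std_gaussian) = (\<integral>\<^sup>+u. g (\<omega>, u) \<partial>distr ?S std_gaussian (\<lambda>\<omega>'. \<omega>' 0))"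
      by (subst G.PiM_component) auto
    also have "\<dots> = (\<integral>\<^sup>+\<omega>'. g (\<omega>, \<omega>' 0) \<partial>?S)"
      by (rule nn_integral_distr) measurable
    finally show "(\<integral>\<^sup>+\<omega>'. g (\<omega>, \<omega>' 0) \<partial>?S) = (\<integral>\<^sup>+u. g (\<omega>, u) \<partial>std_gaussian)" ..
  qed
  finally show ?thesis .
qed

subsection \<open>Characterisation of the law of a Markov chain\<close>

text \<open>By induction, the Ionescu-Tulcea kernels started from the empty history are the laws of
  the first n variables Z, and these determine the law on the infinite product. The Markov property
  is required in integrated form only, so that a kernel known almost everywhere along Z can be
  handled.\<close>

lemma chain_law_eqI:
  fixes Z :: "nat \<Rightarrow> 'w \<Rightarrow> 's"
  assumes \<Omega>: "prob_space \<Omega>" and Q[measurable]: "Q \<in> S \<rightarrow>\<^sub>M prob_algebra S"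
    and Z[measurable]: "\<And>n. Z n \<in> \<Omega> \<rightarrow>\<^sub>M S" and Z0: "distr \<Omega> S (Z 0) = \<mu>"
    and Markov: "\<And>n f. f \<in> borel_measurable (PiM {0..<Suc n} (\<lambda>_. S) \<Otimes>\<^sub>M S) \<Longrightarrow>
      (\<integral>\<^sup>+\<omega>. f (\<lambda>i\<in>{0..<Suc n}. Z i \<omega>, Z (Suc n) \<omega>) \<partial>\<Omega>) =
      (\<integral>\<^sup>+\<omega>. \<integral>\<^sup>+y. f (\<lambda>i\<in>{0..<Suc n}. Z i \<omega>, y) \<partial>Q (Z n \<omega>) \<partial>\<Omega>)"
  shows "chain_law S \<mu> Q = distr \<Omega> (PiM UNIV (\<lambda>_. S)) (\<lambda>\<omega> n. Z n \<omega>)"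
proof -
  interpret \<Omega>: prob_space \<Omega> by fact
  have \<mu>: "prob_space \<mu>" "sets \<mu> = sets S"
    unfolding Z0[symmetric] by (auto intro: \<Omega>.prob_space_distr)
  interpret IT: Ionescu_Tulcea "chain_step \<mu> Q" "\<lambda>_. S"
    by (rule Ionescu_Tulcea_chain_step[OF \<mu> Q])
  define R where "R n \<omega> = (\<lambda>i\<in>{0..<n}. Z i \<omega>)" for n \<omega>
  have R[measurable]: "R n \<in> \<Omega> \<rightarrow>\<^sub>M PiM {0..<n} (\<lambda>_. S)" for n
    unfolding R_def by (intro measurable_restrict) auto
  have R_Suc: "R (Suc n) \<omega> = (R n \<omega>)(n := Z n \<omega>)" for n \<omega>
    by (auto simp: R_def fun_eq_iff)
  have ZS: "Z n \<omega> \<in> space S" if "\<omega> \<in> space \<Omega>" for n \<omega>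
    using measurable_space[OF Z that] .
  have und: "(\<lambda>_::nat. undefined) \<in> space (PiM {0..<0} (\<lambda>_. S))"
    by (auto simp: space_PiM PiE_def extensional_def)
  have C: "IT.C 0 n (\<lambda>_. undefined) = distr \<Omega> (PiM {0..<n} (\<lambda>_. S)) (R n)" for n
  proof (induction n)
    case 0
    have "distr \<Omega> (PiM {0..<0} (\<lambda>_. S)) (R 0) = distr \<Omega> (PiM {0..<0} (\<lambda>_. S)) (\<lambda>_. \<lambda>_. undefined)"
      by (intro distr_cong) (auto simp: R_def)
    also have "\<dots> = return (PiM {0..<0} (\<lambda>_. S)) (\<lambda>_. undefined)"
      using und by (intro \<Omega>.distr_const) simp
    finally show ?case by simp
  next
    case (Suc n)
    have sp: "space (distr \<Omega> (PiM {0..<n} (\<lambda>_. S)) (R n)) \<noteq> {}"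
      using \<Omega>.prob_space_distr[OF R, THEN prob_space.not_empty] .
    have ePn: "IT.eP n \<in> PiM {0..<n} (\<lambda>_. S) \<rightarrow>\<^sub>M subprob_algebra (PiM {0..<Suc n} (\<lambda>_. S))"
      by simp
    show ?case
    proof (rule measure_eqI)
      show "sets (IT.C 0 (Suc n) (\<lambda>_. undefined)) = sets (distr \<Omega> (PiM {0..<Suc n} (\<lambda>_. S)) (R (Suc n)))"
        using IT.sets_C[OF und, of "Suc n"] by simp
      fix X assume "X \<in> sets (IT.C 0 (Suc n) (\<lambda>_. undefined))"
      then have X[measurable]: "X \<in> sets (PiM {0..<Suc n} (\<lambda>_. S))"
        using IT.sets_C[OF und, of "Suc n"] by simp
      have upd: "(\<lambda>z. (fst z)(n := snd z)) \<in> PiM {0..<n} (\<lambda>_. S) \<Otimes>\<^sub>M S \<rightarrow>\<^sub>M PiM {0..<Suc n} (\<lambda>_. S)"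
        by (rule measurable_fun_upd[where J="{0..<n}"]) auto
      define f where "f z = (indicator X ((fst z)(n := snd z)) :: ennreal)" for z
      have f[measurable]: "f \<in> borel_measurable (PiM {0..<n} (\<lambda>_. S) \<Otimes>\<^sub>M S)"
        unfolding f_def using measurable_compose[OF upd borel_measurable_indicator[OF X]] .
      have RS: "R n \<omega> \<in> space (PiM {0..<n} (\<lambda>_. S))" if "\<omega> \<in> space \<Omega>" for \<omega>
        using measurable_space[OF R that] .
      have "emeasure (IT.C 0 (Suc n) (\<lambda>_. undefined)) X = emeasure (distr \<Omega> (PiM {0..<n} (\<lambda>_. S)) (R n) \<bind> IT.eP n) X"
        by (simp add: Suc)
      also have "\<dots> = (\<integral>\<^sup>+z. emeasure (IT.eP n z) X \<partial>distr \<Omega> (PiM {0..<n} (\<lambda>_. S)) (R n))"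
        by (rule emeasure_bind[OF sp _ X]) simp
      also have "\<dots> = (\<integral>\<^sup>+\<omega>. emeasure (IT.eP n (R n \<omega>)) X \<partial>\<Omega>)"
        by (rule nn_integral_distr[OF R]) (use measurable_emeasure_kernel[OF ePn X] in simp)
      also have "\<dots> = (\<integral>\<^sup>+\<omega>. \<integral>\<^sup>+y. f (R n \<omega>, y) \<partial>chain_step \<mu> Q n (R n \<omega>) \<partial>\<Omega>)"
      proof (intro nn_integral_cong)
        fix \<omega> assume \<omega>: "\<omega> \<in> space \<Omega>"
        have "emeasure (IT.eP n (R n \<omega>)) X = (\<integral>\<^sup>+x. indicator X x \<partial>IT.eP n (R n \<omega>))"
          using IT.sets_eP[OF RS[OF \<omega>]] X by simp
        also have "\<dots> = (\<integral>\<^sup>+y. f (R n \<omega>, y) \<partial>chain_step \<mu> Q n (R n \<omega>))"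
          unfolding f_def by (subst IT.nn_integral_eP[OF RS[OF \<omega>]]) auto
        finally show "emeasure (IT.eP n (R n \<omega>)) X = (\<integral>\<^sup>+y. f (R n \<omega>, y) \<partial>chain_step \<mu> Q n (R n \<omega>))" .
      qed
      also have "\<dots> = (\<integral>\<^sup>+\<omega>. f (R n \<omega>, Z n \<omega>) \<partial>\<Omega>)"
      proof (cases n)
        case 0
        have R0: "R n \<omega> = (\<lambda>_. undefined)" for \<omega> by (simp add: R_def 0 fun_eq_iff)
        have [measurable]: "(\<lambda>y. f (\<lambda>_. undefined, y)) \<in> borel_measurable S"
          using measurable_compose[OF measurable_Pair1'[of "\<lambda>_. undefined" "PiM {0..<n} (\<lambda>_. S)" S] f] und 0 by simp
        have "(\<integral>\<^sup>+\<omega>. \<integral>\<^sup>+y. f (R n \<omega>, y) \<partial>chain_step \<mu> Q n (R n \<omega>) \<partial>\<Omega>) = (\<integral>\<^sup>+y. f (\<lambda>_. undefined, y) \<partial>\<mu>)"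
          unfolding R0 by (simp add: chain_step_def 0 \<Omega>.emeasure_space_1)
        also have "\<dots> = (\<integral>\<^sup>+\<omega>. f (\<lambda>_. undefined, Z 0 \<omega>) \<partial>\<Omega>)"
          unfolding Z0[symmetric] by (rule nn_integral_distr) measurable
        finally show ?thesis unfolding R0 by (simp only: 0)
      next
        case (Suc m)
        have "(\<integral>\<^sup>+\<omega>. \<integral>\<^sup>+y. f (R n \<omega>, y) \<partial>chain_step \<mu> Q n (R n \<omega>) \<partial>\<Omega>) = (\<integral>\<^sup>+\<omega>. \<integral>\<^sup>+y. f (R n \<omega>, y) \<partial>Q (Z m \<omega>) \<partial>\<Omega>)"
          by (simp add: chain_step_def Suc R_def)
        also have "\<dots> = (\<integral>\<^sup>+\<omega>. f (R n \<omega>, Z n \<omega>) \<partial>\<Omega>)"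
          using Markov[of f m] f unfolding Suc R_def by simp
        finally show ?thesis .
      qed
      also have "\<dots> = (\<integral>\<^sup>+\<omega>. indicator X (R (Suc n) \<omega>) \<partial>\<Omega>)"
        by (simp add: f_def R_Suc)
      also have "\<dots> = (\<integral>\<^sup>+x. indicator X x \<partial>distr \<Omega> (PiM {0..<Suc n} (\<lambda>_. S)) (R (Suc n)))"
        by (rule nn_integral_distr[symmetric]) measurable
      also have "\<dots> = emeasure (distr \<Omega> (PiM {0..<Suc n} (\<lambda>_. S)) (R (Suc n))) X"
        by simp
      finally show "emeasure (IT.C 0 (Suc n) (\<lambda>_. undefined)) X = emeasure (distr \<Omega> (PiM {0..<Suc n} (\<lambda>_. S)) (R (Suc n))) X" .
    qed
  qed
  have Zm[measurable]: "(\<lambda>\<omega> n. Z n \<omega>) \<in> \<Omega> \<rightarrow>\<^sub>M PiM UNIV (\<lambda>_. S)"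
    by (rule measurable_PiM_single') (use ZS in \<open>auto simp: space_PiM PiE_iff\<close>)
  have "distr \<Omega> (PiM UNIV (\<lambda>_. S)) (\<lambda>\<omega> n. Z n \<omega>) = IT.PF.lim"
  proof (rule measure_eqI_PiM_infinite)
    fix A and J :: "nat set" assume J: "finite J" and A: "\<And>i. i \<in> J \<Longrightarrow> A i \<in> sets S"
    let ?X = "Pi\<^sub>E J A"
    have X: "?X \<in> sets (PiM J (\<lambda>_. S))" using J A by (rule sets_PiM_I_finite)
    have "emeasure IT.PF.lim (IT.PF.emb UNIV J ?X) = emeasure (IT.CI J) ?X"
      by (rule IT.lim[OF J X])
    also have "\<dots> = emeasure (distr (distr \<Omega> (PiM {0..<IT.up_to J} (\<lambda>_. S)) (R (IT.up_to J))) (PiM J (\<lambda>_. S)) (\<lambda>f. restrict f J)) ?X"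
      by (simp add: IT.CI_def C)
    also have "distr (distr \<Omega> (PiM {0..<IT.up_to J} (\<lambda>_. S)) (R (IT.up_to J))) (PiM J (\<lambda>_. S)) (\<lambda>f. restrict f J) =
       distr \<Omega> (PiM J (\<lambda>_. S)) (\<lambda>\<omega>. restrict (\<lambda>n. Z n \<omega>) J)"
      using IT.up_to_less[OF J] by (subst distr_distr)
        (auto intro!: distr_cong measurable_restrict measurable_component_singleton simp: R_def fun_eq_iff)
    also have "emeasure \<dots> ?X = emeasure \<Omega> ((\<lambda>\<omega>. restrict (\<lambda>n. Z n \<omega>) J) -` ?X \<inter> space \<Omega>)"
      by (rule emeasure_distr[OF _ X]) (intro measurable_restrict, simp)
    also have "(\<lambda>\<omega>. restrict (\<lambda>n. Z n \<omega>) J) -` ?X \<inter> space \<Omega> = (\<lambda>\<omega> n. Z n \<omega>) -` IT.PF.emb UNIV J ?X \<inter> space \<Omega>"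
      using ZS by (auto simp: prod_emb_def space_PiM PiE_iff)
    also have "emeasure \<Omega> \<dots> = emeasure (distr \<Omega> (PiM UNIV (\<lambda>_. S)) (\<lambda>\<omega> n. Z n \<omega>)) (IT.PF.emb UNIV J ?X)"
      using X by (intro emeasure_distr[symmetric] Zm) (auto intro: measurable_prod_emb)
    finally show "emeasure (distr \<Omega> (PiM UNIV (\<lambda>_. S)) (\<lambda>\<omega> n. Z n \<omega>)) (prod_emb UNIV (\<lambda>_. S) J ?X) = emeasure IT.PF.lim (prod_emb UNIV (\<lambda>_. S) J ?X)" ..
  qed (auto intro!: prob_space.finite_measure \<Omega>.prob_space_distr)
  then show ?thesis by (simp add: chain_law_def)
qed

text \<open>For each fixed B the hypothesis identifies two densities almost everywhere. Finite
  intersections of a countable basis form a countable intersection-stable generator, so one null set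
  serves for all Borel sets.\<close>

lemma kernel_AE_eqI:
  fixes P K :: "'s \<Rightarrow> ('a::second_countable_topology) measure"
  assumes N: "prob_space N" and P[measurable]: "P \<in> N \<rightarrow>\<^sub>M prob_algebra borel" and K[measurable]: "K \<in> N \<rightarrow>\<^sub>M prob_algebra borel"
    and eq: "\<And>A B. A \<in> sets N \<Longrightarrow> B \<in> sets borel \<Longrightarrow>
      (\<integral>\<^sup>+x. emeasure (P x) B * indicator A x \<partial>N) = (\<integral>\<^sup>+x. emeasure (K x) B * indicator A x \<partial>N)"
  shows "AE x in N. P x = K x"
proof -
  interpret N: prob_space N by fact
  obtain \<B> :: "'a set set" where \<B>: "countable \<B>" "topological_basis \<B>"
    using ex_countable_basis by blast
  define \<F> where "\<F> = Inter ` {F. finite F \<and> F \<subseteq> \<B>}"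
  have F_count: "countable \<F>"
    unfolding \<F>_def using countable_Collect_finite_subset[OF \<B>(1)] by (rule countable_image)
  have F_open: "B \<in> sets borel" if "B \<in> \<F>" for B
    using that \<B>(2) unfolding \<F>_def by (auto intro!: borel_open open_Inter intro: topological_basis_open)
  have F_Int: "Int_stable \<F>"
  proof (rule Int_stableI)
    fix A B assume "A \<in> \<F>" "B \<in> \<F>"
    then obtain F G where "finite F" "F \<subseteq> \<B>" "A = \<Inter>F" "finite G" "G \<subseteq> \<B>" "B = \<Inter>G"
      by (auto simp: \<F>_def)
    then show "A \<inter> B \<in> \<F>"
      unfolding \<F>_def by (intro image_eqI[of _ _ "F \<union> G"]) auto
  qed
  have BF: "\<B> \<subseteq> \<F>"
  proof
    fix B assume "B \<in> \<B>"
    then show "B \<in> \<F>" unfolding \<F>_def by (intro image_eqI[of _ _ "{B}"]) auto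
  qed
  have F_gen: "sets borel = sigma_sets UNIV \<F>"
  proof (rule antisym)
    show "sets borel \<subseteq> sigma_sets UNIV \<F>"
      unfolding borel_eq_countable_basis[OF \<B>] by (simp, rule sigma_sets_mono'[OF BF])
    show "sigma_sets UNIV \<F> \<subseteq> sets borel"
      using sets.sigma_sets_subset[of \<F> borel] F_open by auto
  qed
  have "AE x in N. \<forall>B\<in>\<F>. emeasure (P x) B = emeasure (K x) B"
    unfolding AE_ball_countable[OF F_count]
  proof
    fix B assume "B \<in> \<F>"
    then have [measurable]: "B \<in> sets borel" by (rule F_open)
    show "AE x in N. emeasure (P x) B = emeasure (K x) B"
      using measurable_emeasure_kernel[OF measurable_prob_algebraD[OF P] \<open>B \<in> sets borel\<close>]
        measurable_emeasure_kernel[OF measurable_prob_algebraD[OF K] \<open>B \<in> sets borel\<close>]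
      by (intro N.density_unique_finite_measure) (auto intro!: eq)
  qed
  then show ?thesis
  proof (rule AE_mp, intro AE_I2 impI)
    fix x assume x: "x \<in> space N" and eqB: "\<forall>B\<in>\<F>. emeasure (P x) B = emeasure (K x) B"
    have "P x \<in> space (prob_algebra borel)" "K x \<in> space (prob_algebra borel)"
      using measurable_space[OF P x] measurable_space[OF K x] by auto
    then have PK: "prob_space (P x)" "sets (P x) = sets borel" "prob_space (K x)" "sets (K x) = sets borel"
      by (auto simp: space_prob_algebra)
    interpret Px: prob_space "P x" by fact
    show "P x = K x"
    proof (rule measure_eqI_generator_eq[OF F_Int, where \<Omega> = UNIV and A = "\<lambda>_. UNIV"])
      show "emeasure (P x) X = emeasure (K x) X" if "X \<in> \<F>" for X using eqB that by blast
      show "range (\<lambda>_::nat. UNIV) \<subseteq> \<F>"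
        unfolding \<F>_def by (auto intro!: image_eqI[of _ _ "{}"])
    qed (use PK F_gen in auto)
  qed
qed

lemma prod_mono_ennreal:
  fixes f g :: "'i \<Rightarrow> ennreal"
  assumes "\<And>i. i \<in> I \<Longrightarrow> f i \<le> g i"
  shows "prod f I \<le> prod g I"
  using assms by (induction I rule: infinite_finite_induct) (auto intro: mult_mono)

lemma C_S_norm_sum:
  fixes x :: "nat \<Rightarrow> 'a::real_normed_vector"
  assumes I: "finite I"
  shows "(norm (\<Sum>i\<in>I. c i *\<^sub>R x i))\<^sup>2 \<le> (\<Sum>i\<in>I. \<bar>c i\<bar>) * (\<Sum>i\<in>I. \<bar>c i\<bar> * (norm (x i))\<^sup>2)"
proof -
  have "norm (\<Sum>i\<in>I. c i *\<^sub>R x i) \<le> (\<Sum>i\<in>I. norm (c i *\<^sub>R x i))"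
    by (rule norm_sum)
  also have "\<dots> = (\<Sum>i\<in>I. sqrt \<bar>c i\<bar> * (sqrt \<bar>c i\<bar> * norm (x i)))"
    by (intro sum.cong refl) (simp add: mult.assoc[symmetric])
  finally have "(norm (\<Sum>i\<in>I. c i *\<^sub>R x i))\<^sup>2 \<le> (\<Sum>i\<in>I. sqrt \<bar>c i\<bar> * (sqrt \<bar>c i\<bar> * norm (x i)))\<^sup>2"
    by (intro power_mono) auto
  also have "\<dots> \<le> (\<Sum>i\<in>I. (sqrt \<bar>c i\<bar>)\<^sup>2) * (\<Sum>i\<in>I. (sqrt \<bar>c i\<bar> * norm (x i))\<^sup>2)"
    by (rule Cauchy_Schwarz_ineq_sum)
  finally show ?thesis by (simp add: power_mult_distrib)
qed

section \<open>Exponential moments of the noise energy\<close>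

context noise
begin

text \<open>Chosen so that \<tau> (2 a 0)^2 = 1/4, the largest exponent allowed in
  \<open>nn_integral_exp_sq_le\<close>; 2 a 0 bounds the sum of the |a i|.\<close>

definition \<tau> :: real where "\<tau> = 1 / (16 * (a 0)\<^sup>2)"
text \<open>By \<open>nn_integral_exp_sq_le\<close>, exp (4 \<kappa> \<theta>) bounds the moment of
  exp (\<theta> |x|^2).\<close>

definition \<kappa> :: real where "\<kappa> = sqrt 2 ^ CARD('d) - 1"

lemma \<tau>_pos: "0 < \<tau>" using a_0_pos by (simp add: \<tau>_def)

lemma \<kappa>_nonneg: "0 \<le> \<kappa>"
  using one_le_power[of "sqrt 2" "CARD('d)"] by (simp add: \<kappa>_def)

lemma exp_moment_gauss_vec:
  assumes S: "finite S" and C: "\<And>s. s \<in> S \<Longrightarrow> 0 \<le> C s \<and> C s \<le> 1/4"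
  shows "(\<integral>\<^sup>+z. ennreal (exp (\<Sum>s\<in>S. C s * (norm (z s))\<^sup>2)) \<partial>(gauss_vec S :: ('i \<Rightarrow> real ^ 'd) measure)) \<le> ennreal (exp (4 * \<kappa> * (\<Sum>s\<in>S. C s)))"
proof -
  interpret P: product_sigma_finite "\<lambda>_::'i. std_gaussian :: (real ^ 'd) measure" by standard
  have "(\<integral>\<^sup>+z. ennreal (exp (\<Sum>s\<in>S. C s * (norm (z s))\<^sup>2)) \<partial>(gauss_vec S :: ('i \<Rightarrow> real ^ 'd) measure)) =
    (\<integral>\<^sup>+z. (\<Prod>s\<in>S. ennreal (exp (C s * (norm (z s))\<^sup>2))) \<partial>(gauss_vec S :: ('i \<Rightarrow> real ^ 'd) measure))"
    using S by (intro nn_integral_cong) (simp add: exp_sum prod_ennreal)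
  also have "\<dots> = (\<Prod>s\<in>S. \<integral>\<^sup>+x. ennreal (exp (C s * (norm x)\<^sup>2)) \<partial>(std_gaussian :: (real ^ 'd) measure))"
    by (rule P.product_nn_integral_prod[OF S]) simp
  also have "\<dots> \<le> (\<Prod>s\<in>S. ennreal (exp (4 * C s * \<kappa>)))"
    unfolding \<kappa>_def using C by (intro prod_mono_ennreal nn_integral_exp_sq_le) auto
  also have "\<dots> = ennreal (exp (4 * \<kappa> * (\<Sum>s\<in>S. C s)))"
    using S by (simp add: prod_ennreal exp_sum[symmetric] sum_distrib_left sum_distrib_right mult_ac)
  finally show ?thesis .
qed

text \<open>Although the noises are strongly dependent, Cauchy-Schwarz with weights |a i| bounds
  each squared noise by 2 a 0 times a weighted sum of squared innovations, which are independent.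
  The coefficient of one innovation adds up to at most 1/4, and all coefficients together to at most
  a quarter of the total weight.\<close>

lemma exp_moment_trunc:
  fixes w :: "int \<Rightarrow> real"
  assumes T: "finite T" and w: "\<And>t. t \<in> T \<Longrightarrow> 0 \<le> w t \<and> w t \<le> 1"
  shows "(\<integral>\<^sup>+\<omega>. ennreal (exp (\<tau> * (\<Sum>t\<in>T. w t * (norm (\<Sum>i<m. a i *\<^sub>R \<xi> (t - int i) \<omega>))\<^sup>2))) \<partial>M) \<le> ennreal (exp (\<kappa> * (\<Sum>t\<in>T. w t)))"
proof -
  let ?x = "\<lambda>t \<omega>. (norm (\<Sum>i<m. a i *\<^sub>R \<xi> (t - int i) \<omega>))\<^sup>2"
  define A where "A = 2 * a 0"
  have A: "0 < A" using a_0_pos by (simp add: A_def)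
  have aA: "(\<Sum>i<m. \<bar>a i\<bar>) \<le> A" unfolding A_def by (rule a_abs_sum') simp
  define S where "S = (\<lambda>(t, i). t - int i) ` (T \<times> {..<m})"
  have S: "finite S" using T by (simp add: S_def)
  \<comment> \<open>The coefficient collected by the innovation at time s over all times t and lags
    i with t - i = s.\<close>
  define C where "C s = \<tau> * (A * (\<Sum>t\<in>T. \<Sum>i<m. if t - int i = s then w t * \<bar>a i\<bar> else 0))" for s
  have sumC: "(\<Sum>s\<in>S. C s * f s) = \<tau> * (A * (\<Sum>t\<in>T. w t * (\<Sum>i<m. \<bar>a i\<bar> * f (t - int i))))" for f
  proof -
    have "(\<Sum>s\<in>S. C s * f s) = \<tau> * (A * (\<Sum>s\<in>S. \<Sum>t\<in>T. \<Sum>i<m. if t - int i = s then w t * \<bar>a i\<bar> * f s else 0))"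
      unfolding C_def sum_distrib_left sum_distrib_right by (intro sum.cong refl) auto
    also have "(\<Sum>s\<in>S. \<Sum>t\<in>T. \<Sum>i<m. if t - int i = s then w t * \<bar>a i\<bar> * f s else 0) =
       (\<Sum>t\<in>T. \<Sum>s\<in>S. \<Sum>i<m. if t - int i = s then w t * \<bar>a i\<bar> * f s else 0)"
      by (rule sum.swap)
    also have "\<dots> = (\<Sum>t\<in>T. \<Sum>i<m. \<Sum>s\<in>S. if t - int i = s then w t * \<bar>a i\<bar> * f s else 0)"
      by (intro sum.cong refl sum.swap)
    also have "\<dots> = (\<Sum>t\<in>T. \<Sum>i<m. w t * \<bar>a i\<bar> * f (t - int i))"
      using S by (intro sum.cong refl) (auto simp: S_def)
    finally show ?thesis by (simp add: sum_distrib_left mult.assoc)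
  qed
  have C: "0 \<le> C s \<and> C s \<le> 1/4" for s
  proof
    show "0 \<le> C s" unfolding C_def using \<tau>_pos A w
      by (intro mult_nonneg_nonneg sum_nonneg) auto
    have "(\<Sum>t\<in>T. \<Sum>i<m. if t - int i = s then w t * \<bar>a i\<bar> else 0) = (\<Sum>i<m. \<Sum>t\<in>T. if t - int i = s then w t * \<bar>a i\<bar> else 0)"
      by (rule sum.swap)
    also have "\<dots> \<le> (\<Sum>i<m. \<bar>a i\<bar>)"
    proof (rule sum_mono)
      fix i
      have "(\<Sum>t\<in>T. if t - int i = s then w t * \<bar>a i\<bar> else 0) = (\<Sum>t\<in>T. if t = s + int i then w t * \<bar>a i\<bar> else 0)"
        by (intro sum.cong) auto
      also have "\<dots> \<le> \<bar>a i\<bar>"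
        using T w[of "s + int i"] mult_right_mono[of "w (s + int i)" 1 "\<bar>a i\<bar>"] by (auto simp: sum.delta)
      finally show "(\<Sum>t\<in>T. if t - int i = s then w t * \<bar>a i\<bar> else 0) \<le> \<bar>a i\<bar>" .
    qed
    also note aA
    finally have "C s \<le> \<tau> * (A * A)"
      unfolding C_def using \<tau>_pos A by (intro mult_left_mono) auto
    also have "\<dots> = 1/4" using a_0_pos by (simp add: \<tau>_def A_def power2_eq_square)
    finally show "C s \<le> 1/4" .
  qed
  have "(\<integral>\<^sup>+\<omega>. ennreal (exp (\<tau> * (\<Sum>t\<in>T. w t * ?x t \<omega>))) \<partial>M) \<le>
     (\<integral>\<^sup>+\<omega>. ennreal (exp (\<Sum>s\<in>S. C s * (norm ((\<lambda>s\<in>S. \<xi> s \<omega>) s))\<^sup>2)) \<partial>M)"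
  proof (intro nn_integral_mono ennreal_leI)
    fix \<omega>
    have "\<tau> * (\<Sum>t\<in>T. w t * ?x t \<omega>) \<le> \<tau> * (\<Sum>t\<in>T. w t * (A * (\<Sum>i<m. \<bar>a i\<bar> * (norm (\<xi> (t - int i) \<omega>))\<^sup>2)))"
    proof (intro mult_left_mono sum_mono)
      fix t
      have "?x t \<omega> \<le> (\<Sum>i<m. \<bar>a i\<bar>) * (\<Sum>i<m. \<bar>a i\<bar> * (norm (\<xi> (t - int i) \<omega>))\<^sup>2)"
        by (rule C_S_norm_sum) simp
      also have "\<dots> \<le> A * (\<Sum>i<m. \<bar>a i\<bar> * (norm (\<xi> (t - int i) \<omega>))\<^sup>2)"
        by (intro mult_right_mono aA sum_nonneg) auto
      finally show "?x t \<omega> \<le> A * (\<Sum>i<m. \<bar>a i\<bar> * (norm (\<xi> (t - int i) \<omega>))\<^sup>2)" .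
    qed (use w \<tau>_pos in auto)
    also have "\<dots> = (\<Sum>s\<in>S. C s * (norm (\<xi> s \<omega>))\<^sup>2)"
      unfolding sumC by (simp add: sum_distrib_left mult_ac)
    finally show "exp (\<tau> * (\<Sum>t\<in>T. w t * ?x t \<omega>)) \<le> exp (\<Sum>s\<in>S. C s * (norm ((\<lambda>s\<in>S. \<xi> s \<omega>) s))\<^sup>2)"
      by simp
  qed
  also have "\<dots> = (\<integral>\<^sup>+z. ennreal (exp (\<Sum>s\<in>S. C s * (norm (z s))\<^sup>2)) \<partial>distr M (PiM S (\<lambda>_. borel)) (\<lambda>\<omega>. \<lambda>s\<in>S. \<xi> s \<omega>))"
    by (rule nn_integral_distr[symmetric]) (intro measurable_restrict, simp_all)
  also have "distr M (PiM S (\<lambda>_. borel)) (\<lambda>\<omega>. \<lambda>s\<in>S. \<xi> s \<omega>) = gauss_vec S"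
    using distr_\<xi>_family[of id S] by simp
  also have "(\<integral>\<^sup>+z. ennreal (exp (\<Sum>s\<in>S. C s * (norm (z s :: real ^ 'd))\<^sup>2)) \<partial>gauss_vec S) \<le> ennreal (exp (4 * \<kappa> * (\<Sum>s\<in>S. C s)))"
    by (rule exp_moment_gauss_vec[OF S]) (rule C)
  also have "\<dots> \<le> ennreal (exp (\<kappa> * (\<Sum>t\<in>T. w t)))"
  proof (intro ennreal_leI iffD2[OF exp_le_cancel_iff])
    have "(\<Sum>s\<in>S. C s) = \<tau> * (A * (\<Sum>t\<in>T. w t * (\<Sum>i<m. \<bar>a i\<bar>)))"
      using sumC[of "\<lambda>_. 1"] by simp
    also have "\<dots> \<le> \<tau> * (A * (\<Sum>t\<in>T. w t * A))"
      using aA \<tau>_pos A w by (intro mult_left_mono sum_mono) auto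
    also have "\<dots> = (\<tau> * (A * A)) * (\<Sum>t\<in>T. w t)"
      by (simp add: sum_distrib_right[symmetric])
    also have "\<tau> * (A * A) = 1/4" using a_0_pos by (simp add: \<tau>_def A_def power2_eq_square)
    finally have "4 * (\<Sum>s\<in>S. C s) \<le> (\<Sum>t\<in>T. w t)" by simp
    then show "4 * \<kappa> * (\<Sum>s\<in>S. C s) \<le> \<kappa> * (\<Sum>t\<in>T. w t)"
      using \<kappa>_nonneg mult_left_mono by fastforce
  qed
  finally show ?thesis .
qed

lemma exp_moment:
  fixes w :: "int \<Rightarrow> real"
  assumes T: "finite T" and w: "\<And>t. t \<in> T \<Longrightarrow> 0 \<le> w t \<and> w t \<le> 1"
  shows "(\<integral>\<^sup>+\<omega>. ennreal (exp (\<tau> * (\<Sum>t\<in>T. w t * (norm (\<Delta> t \<omega>))\<^sup>2))) \<partial>M) \<le> ennreal (exp (\<kappa> * (\<Sum>t\<in>T. w t)))"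
proof -
  have "AE \<omega> in M. \<forall>t\<in>T. (\<lambda>k. a k *\<^sub>R \<xi> (t - int k) \<omega>) sums \<Delta> t \<omega>"
    using T by (intro AE_finite_allI \<Delta>_sums)
  then have lim: "AE \<omega> in M. ennreal (exp (\<tau> * (\<Sum>t\<in>T. w t * (norm (\<Delta> t \<omega>))\<^sup>2))) =
      liminf (\<lambda>m. ennreal (exp (\<tau> * (\<Sum>t\<in>T. w t * (norm (\<Sum>i<m. a i *\<^sub>R \<xi> (t - int i) \<omega>))\<^sup>2))))"
  proof eventually_elim
    case (elim \<omega>)
    have "(\<lambda>m. \<Sum>i<m. a i *\<^sub>R \<xi> (t - int i) \<omega>) \<longlonglongrightarrow> \<Delta> t \<omega>" if "t \<in> T" for t
      using elim that by (auto simp: sums_def)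
    then have "(\<lambda>m. ennreal (exp (\<tau> * (\<Sum>t\<in>T. w t * (norm (\<Sum>i<m. a i *\<^sub>R \<xi> (t - int i) \<omega>))\<^sup>2)))) \<longlonglongrightarrow>
      ennreal (exp (\<tau> * (\<Sum>t\<in>T. w t * (norm (\<Delta> t \<omega>))\<^sup>2)))"
      by (intro tendsto_ennrealI tendsto_exp tendsto_mult tendsto_const tendsto_sum tendsto_power tendsto_norm)
    then show ?case by (intro lim_imp_Liminf[symmetric]) auto
  qed
  have "(\<integral>\<^sup>+\<omega>. ennreal (exp (\<tau> * (\<Sum>t\<in>T. w t * (norm (\<Delta> t \<omega>))\<^sup>2))) \<partial>M) =
     (\<integral>\<^sup>+\<omega>. liminf (\<lambda>m. ennreal (exp (\<tau> * (\<Sum>t\<in>T. w t * (norm (\<Sum>i<m. a i *\<^sub>R \<xi> (t - int i) \<omega>))\<^sup>2)))) \<partial>M)"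
    by (rule nn_integral_cong_AE[OF lim])
  also have "\<dots> \<le> liminf (\<lambda>m. \<integral>\<^sup>+\<omega>. ennreal (exp (\<tau> * (\<Sum>t\<in>T. w t * (norm (\<Sum>i<m. a i *\<^sub>R \<xi> (t - int i) \<omega>))\<^sup>2))) \<partial>M)"
    by (rule nn_integral_liminf) measurable
  also have "\<dots> \<le> ennreal (exp (\<kappa> * (\<Sum>t\<in>T. w t)))"
    by (rule Liminf_le) (use exp_moment_trunc[OF T w] in auto)
  finally show ?thesis .
qed

section \<open>The conditional law of the noise\<close>

text \<open>An explicit Gaussian version of the conditional law; every other version agrees with it
  outside a null set of pasts (\<open>noise_kernel_AE\<close>).\<close>

definition kernel :: "'d seq \<Rightarrow> (real ^ 'd) measure" where
  "kernel w = distr std_gaussian borel (\<lambda>u. predictor w + a 0 *\<^sub>R u)"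

lemma kernel_meas[measurable]: "kernel \<in> seq_space \<rightarrow>\<^sub>M prob_algebra borel"
proof -
  have "(\<lambda>_. std_gaussian :: (real ^ 'd) measure) \<in> seq_space \<rightarrow>\<^sub>M prob_algebra std_gaussian"
    by (rule measurable_const) (simp add: space_prob_algebra prob_space_std_gaussian)
  then show ?thesis
    unfolding kernel_def[abs_def] by (rule measurable_distr_prob_space2) measurable
qed

lemma joint_law_AE:
  assumes [measurable]: "Measurable.pred (seq_space \<Otimes>\<^sub>M seq_space) (\<lambda>z. Pr (fst z) (snd z))"
    and "AE \<omega> in M. Pr (past \<Delta> 0 \<omega>) (\<lambda>i. \<xi> (1 + int i) \<omega>)"
  shows "AE z in past_law M \<Delta> \<Otimes>\<^sub>M gauss_vec UNIV. Pr (fst z) (snd z)"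
proof -
  note m[measurable] = past_future_meas[of 0]
  show ?thesis
    unfolding joint_law[of 0, symmetric] by (subst AE_distr_iff[OF m]) (use assms in auto)
qed

lemma noise_kernel_AE:
  assumes "noise_kernel M \<Delta> P"
  shows "AE w in past_law M \<Delta>. P w = kernel w"
proof (rule kernel_AE_eqI[OF prob_space_past_law])
  have P[measurable]: "P \<in> seq_space \<rightarrow>\<^sub>M prob_algebra borel" and
    P_eq: "\<And>A B. A \<in> sets seq_space \<Longrightarrow> B \<in> sets borel \<Longrightarrow> emeasure M {\<omega> \<in> space M. past \<Delta> 0 \<omega> \<in> A \<and> \<Delta> 1 \<omega> \<in> B} = (\<integral>\<^sup>+x\<in>A. emeasure (P x) B \<partial>past_law M \<Delta>)"
    using assms unfolding noise_kernel_def regular_cond_law_def past_law_def by auto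
  show "P \<in> past_law M \<Delta> \<rightarrow>\<^sub>M prob_algebra borel" "kernel \<in> past_law M \<Delta> \<rightarrow>\<^sub>M prob_algebra borel"
    by measurable
  fix A B assume "A \<in> sets (past_law M \<Delta>)" and B[measurable]: "B \<in> sets (borel :: (real ^ 'd) measure)"
  then have A[measurable]: "A \<in> sets seq_space" by (simp add: sets_past_law)
  interpret PL: prob_space "past_law M \<Delta>" by (rule prob_space_past_law)
  interpret G: sequence_space "std_gaussian :: (real ^ 'd) measure" by standard
  interpret PG: pair_sigma_finite "past_law M \<Delta>" "gauss_vec UNIV :: 'd seq measure" ..
  note m[measurable] = past_future_meas[of 0]
  define f where "f z = (indicator A (fst z) * indicator B (predictor (fst z) + a 0 *\<^sub>R snd z 0) :: ennreal)" for z :: "'d seq \<times> ('d seq)"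
  have f[measurable]: "f \<in> borel_measurable (seq_space \<Otimes>\<^sub>M seq_space)"
    unfolding f_def by measurable
  have f': "f \<in> borel_measurable (past_law M \<Delta> \<Otimes>\<^sub>M gauss_vec UNIV)"
    by (simp add: measurable_cong_sets[OF sets_pair_measure_cong[OF sets_past_law sets_gauss_vec] refl])
  have "(\<integral>\<^sup>+x. emeasure (P x) B * indicator A x \<partial>past_law M \<Delta>) = emeasure M {\<omega> \<in> space M. past \<Delta> 0 \<omega> \<in> A \<and> \<Delta> 1 \<omega> \<in> B}"
    using P_eq[OF A B] by simp
  also have "\<dots> = (\<integral>\<^sup>+\<omega>. indicator {\<omega> \<in> space M. past \<Delta> 0 \<omega> \<in> A \<and> \<Delta> 1 \<omega> \<in> B} \<omega> \<partial>M)"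
    by (rule nn_integral_indicator[symmetric]) measurable
  also have "\<dots> = (\<integral>\<^sup>+\<omega>. f (past \<Delta> 0 \<omega>, \<lambda>i. \<xi> (0 + 1 + int i) \<omega>) \<partial>M)"
  proof (rule nn_integral_cong_AE)
    show "AE \<omega> in M. indicator {\<omega> \<in> space M. past \<Delta> 0 \<omega> \<in> A \<and> \<Delta> 1 \<omega> \<in> B} \<omega> = f (past \<Delta> 0 \<omega>, \<lambda>i. \<xi> (0 + 1 + int i) \<omega>)"
      using predictor_past AE_space
    proof eventually_elim
      case (elim \<omega>)
      from elim(1)[rule_format, of 0] show ?case using elim(2) by (simp add: f_def indicator_def)
    qed
  qed
  also have "\<dots> = (\<integral>\<^sup>+z. f z \<partial>(past_law M \<Delta> \<Otimes>\<^sub>M gauss_vec UNIV))"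
    unfolding joint_law[of 0, symmetric] by (rule nn_integral_distr[symmetric]) measurable
  also have "\<dots> = (\<integral>\<^sup>+w. \<integral>\<^sup>+e. f (w, e) \<partial>gauss_vec UNIV \<partial>past_law M \<Delta>)"
    by (rule nn_integral_fst_prob[OF prob_space_gauss_vec f', symmetric])
  also have "\<dots> = (\<integral>\<^sup>+w. emeasure (kernel w) B * indicator A w \<partial>past_law M \<Delta>)"
  proof (intro nn_integral_cong)
    fix w :: "'d seq"
    have g[measurable]: "(\<lambda>u. indicator A w * indicator B (predictor w + a 0 *\<^sub>R u) :: ennreal) \<in> borel_measurable std_gaussian"
      by measurable
    have "(\<integral>\<^sup>+e. f (w, e) \<partial>gauss_vec UNIV) = (\<integral>\<^sup>+u. indicator A w * indicator B (predictor w + a 0 *\<^sub>R u) \<partial>distr (gauss_vec UNIV) std_gaussian (\<lambda>e :: 'd seq. e 0))"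
      unfolding f_def by (subst nn_integral_distr) auto
    also have "distr (gauss_vec UNIV) std_gaussian (\<lambda>e :: 'd seq. e 0) = (std_gaussian :: (real ^ 'd) measure)"
      by (rule G.PiM_component) simp
    also have "(\<integral>\<^sup>+u. indicator A w * indicator B (predictor w + a 0 *\<^sub>R u) \<partial>std_gaussian) = indicator A w * (\<integral>\<^sup>+u. indicator B (predictor w + a 0 *\<^sub>R u) \<partial>std_gaussian)"
      by (rule nn_integral_cmult) measurable
    also have "(\<integral>\<^sup>+u. indicator B (predictor w + a 0 *\<^sub>R u) \<partial>std_gaussian) = (\<integral>\<^sup>+u. indicator B u \<partial>kernel w)"
      unfolding kernel_def by (rule nn_integral_distr[symmetric]) measurable
    also have "\<dots> = emeasure (kernel w) B"
      by (rule nn_integral_indicator) (simp add: kernel_def)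
    finally show "(\<integral>\<^sup>+e. f (w, e) \<partial>gauss_vec UNIV) = emeasure (kernel w) B * indicator A w"
      by (simp add: mult.commute)
  qed
  finally show "(\<integral>\<^sup>+x. emeasure (P x) B * indicator A x \<partial>past_law M \<Delta>) = (\<integral>\<^sup>+x. emeasure (kernel x) B * indicator A x \<partial>past_law M \<Delta>)" .
qed

end

subsection \<open>A probabilistic representation of the chain\<close>

definition hist :: "(nat \<Rightarrow> 'a) \<Rightarrow> (nat \<Rightarrow> 'a) \<Rightarrow> nat \<Rightarrow> nat \<Rightarrow> 'a" where
  "hist w r n = (\<lambda>k. if k < n then r (n - 1 - k) else w (k - n))"

lemma hist_0[simp]: "hist w r 0 = w"
  by (simp add: hist_def)

lemma hist_Suc: "hist w r (Suc n) = case_nat (r n) (hist w r n)"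
  by (auto simp: hist_def fun_eq_iff split: nat.split)

lemma hist_cong: "(\<And>k. k < n \<Longrightarrow> r k = r' k) \<Longrightarrow> hist w r n = hist w r' n"
  by (auto simp: hist_def fun_eq_iff)

lemma measurable_hist[measurable (raw)]:
  assumes w[measurable]: "w \<in> N \<rightarrow>\<^sub>M PiM UNIV (\<lambda>_. borel)" and [measurable]: "\<And>k. (\<lambda>z. r z k) \<in> borel_measurable N"
  shows "(\<lambda>z. hist (w z) (r z) n) \<in> N \<rightarrow>\<^sub>M PiM UNIV (\<lambda>_. borel)"
  unfolding hist_def
proof (rule measurable_PiM_single')
  fix i :: nat
  show "(\<lambda>z. if i < n then r z (n - 1 - i) else w z (i - n)) \<in> borel_measurable N"
    by (cases "i < n") auto
qed auto

abbreviation path_space :: "(('d::finite) state \<times> 'd seq) measure" where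
  "path_space \<equiv> state_space \<Otimes>\<^sub>M seq_space"

context noise
begin

lemma measurable_response[measurable (raw)]:
  assumes [measurable]: "w \<in> N \<rightarrow>\<^sub>M seq_space" "e \<in> N \<rightarrow>\<^sub>M seq_space"
  shows "(\<lambda>z. response (w z) (e z) k) \<in> borel_measurable N"
  unfolding response_def by measurable

lemma response_cong: "(\<And>i. i \<le> k \<Longrightarrow> e i = e' i) \<Longrightarrow> response w e k = response w e' k"
  by (simp add: response_def)

text \<open>An almost sure identity on the original space, carried by \<open>joint_law\<close> to
  the product space, where the future innovations are independent of the past by
  construction.\<close>

lemma response_innovation:
  "AE z in past_law M \<Delta> \<Otimes>\<^sub>M gauss_vec UNIV. \<forall>n. response (fst z) (snd z) n =
     predictor (hist (fst z) (response (fst z) (snd z)) n) + a 0 *\<^sub>R snd z n"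
proof (rule joint_law_AE)
  show "Measurable.pred (seq_space \<Otimes>\<^sub>M seq_space) (\<lambda>z. \<forall>n. response (fst z) (snd z) n = predictor (hist (fst z) (response (fst z) (snd z)) n) + a 0 *\<^sub>R snd z n)"
    by measurable
  show "AE \<omega> in M. \<forall>n. response (past \<Delta> 0 \<omega>) (\<lambda>i. \<xi> (1 + int i) \<omega>) n =
     predictor (hist (past \<Delta> 0 \<omega>) (response (past \<Delta> 0 \<omega>) (\<lambda>i. \<xi> (1 + int i) \<omega>)) n) + a 0 *\<^sub>R \<xi> (1 + int n) \<omega>"
    using response_past predictor_past
  proof (eventually_elim, intro allI)
    fix \<omega> n
    assume elim: "\<forall>t k. response (past \<Delta> t \<omega>) (\<lambda>i. \<xi> (t + 1 + int i) \<omega>) k = \<Delta> (t + 1 + int k) \<omega>"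
      "\<forall>t. \<Delta> (t + 1) \<omega> = predictor (past \<Delta> t \<omega>) + a 0 *\<^sub>R \<xi> (t + 1) \<omega>"
    from elim(1)[rule_format, of 0]
    have r: "response (past \<Delta> 0 \<omega>) (\<lambda>i. \<xi> (1 + int i) \<omega>) k = \<Delta> (1 + int k) \<omega>" for k by simp
    then have "hist (past \<Delta> 0 \<omega>) (response (past \<Delta> 0 \<omega>) (\<lambda>i. \<xi> (1 + int i) \<omega>)) n = past \<Delta> (int n) \<omega>"
      by (auto simp: hist_def past_def fun_eq_iff of_nat_diff algebra_simps)
    then show "response (past \<Delta> 0 \<omega>) (\<lambda>i. \<xi> (1 + int i) \<omega>) n =
     predictor (hist (past \<Delta> 0 \<omega>) (response (past \<Delta> 0 \<omega>) (\<lambda>i. \<xi> (1 + int i) \<omega>)) n) + a 0 *\<^sub>R \<xi> (1 + int n) \<omega>"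
      using elim(2)[rule_format, of "int n"] by (simp add: r add.commute)
  qed
qed

text \<open>Stationarity: the past seen at time n has the law of the past at time 0. Hence an
  exceptional null set for the kernel P is avoided at every time.\<close>

lemma hist_law:
  "distr (past_law M \<Delta> \<Otimes>\<^sub>M gauss_vec UNIV) seq_space (\<lambda>z. hist (fst z) (response (fst z) (snd z)) n) = past_law M \<Delta>"
proof -
  note m = past_future_meas[of 0]
  have h: "(\<lambda>z. hist (fst z) (response (fst z) (snd z)) n) \<in> seq_space \<Otimes>\<^sub>M seq_space \<rightarrow>\<^sub>M seq_space"
    by measurable
  have "distr (past_law M \<Delta> \<Otimes>\<^sub>M gauss_vec UNIV) seq_space (\<lambda>z. hist (fst z) (response (fst z) (snd z)) n) =
    distr M seq_space ((\<lambda>z. hist (fst z) (response (fst z) (snd z)) n) \<circ> (\<lambda>\<omega>. (past \<Delta> 0 \<omega>, \<lambda>i. \<xi> (0 + 1 + int i) \<omega>)))"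
    unfolding joint_law[of 0, symmetric] by (rule distr_distr[OF h m])
  also have "\<dots> = distr M seq_space (past \<Delta> (int n))"
  proof (rule distr_cong_AE)
    show "AE \<omega> in M. ((\<lambda>z. hist (fst z) (response (fst z) (snd z)) n) \<circ> (\<lambda>\<omega>. (past \<Delta> 0 \<omega>, \<lambda>i. \<xi> (0 + 1 + int i) \<omega>))) \<omega> = past \<Delta> (int n) \<omega>"
      using response_past
    proof eventually_elim
      case (elim \<omega>)
      from elim[rule_format, of 0]
      have r: "response (past \<Delta> 0 \<omega>) (\<lambda>i. \<xi> (1 + int i) \<omega>) k = \<Delta> (1 + int k) \<omega>" for k by simp
      then show ?case
        by (auto simp: hist_def past_def fun_eq_iff of_nat_diff algebra_simps)
    qed
    show "(\<lambda>z. hist (fst z) (response (fst z) (snd z)) n) \<circ> (\<lambda>\<omega>. (past \<Delta> 0 \<omega>, \<lambda>i. \<xi> (0 + 1 + int i) \<omega>)) \<in> M \<rightarrow>\<^sub>M seq_space"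
      by (rule measurable_comp[OF m h])
  qed auto
  also have "\<dots> = past_law M \<Delta>" by (rule past_law_eq)
  finally show ?thesis .
qed

end

locale dynamics = noise h H M \<xi> \<Delta>
  for h H :: real and M :: "'w measure" and \<xi> \<Delta> :: "int \<Rightarrow> 'w \<Rightarrow> real ^ 'd::finite" +
  fixes P :: "'d seq \<Rightarrow> (real ^ 'd) measure" and F :: "(real ^ 'd) \<times> (real ^ 'd) \<Rightarrow> real ^ 'd"
  assumes nk: "noise_kernel M \<Delta> P" and F_borel[measurable]: "F \<in> borel_measurable borel"
begin

abbreviation "PW \<equiv> past_law M \<Delta>"
abbreviation "Q \<equiv> Q_kernel F P"

text \<open>
  A point of \<open>Om \<mu>\<close> is a couple \<open>(X\<^sub>0, past)\<close> with the future innovations; \<open>noise_path z k\<close> is \<open>\<Delta>\<^sub>k\<^sub>+\<^sub>1\<close>,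
  which drives the step from \<open>X\<^sub>k\<close> to \<open>X\<^sub>k\<^sub>+\<^sub>1\<close>.
\<close>

definition noise_path :: "'d state \<times> ('d seq) \<Rightarrow> 'd seq" where
  "noise_path z = response (snd (fst z)) (snd z)"

definition proc :: "nat \<Rightarrow> 'd state \<times> ('d seq) \<Rightarrow> 'd state" where
  "proc n z = (traj F (fst (fst z)) (noise_path z) n, hist (snd (fst z)) (noise_path z) n)"

definition Om :: "'d state measure \<Rightarrow> ('d state \<times> ('d seq)) measure" where
  "Om \<mu> = \<mu> \<Otimes>\<^sub>M gauss_vec UNIV"

lemma measurable_noise_path[measurable]:
  "(\<lambda>z. noise_path z k) \<in> borel_measurable path_space"
  unfolding noise_path_def by measurable

lemma measurable_proc[measurable]: "proc n \<in> path_space \<rightarrow>\<^sub>M state_space"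
proof -
  have 1: "(\<lambda>z. fst (fst z)) \<in> borel_measurable (path_space :: ('d state \<times> 'd seq) measure)"
    by (rule measurable_compose[OF measurable_fst measurable_fst])
  have 2: "(\<lambda>z. snd (fst z)) \<in> (path_space :: ('d state \<times> 'd seq) measure) \<rightarrow>\<^sub>M seq_space"
    by (rule measurable_compose[OF measurable_fst measurable_snd])
  show ?thesis
    unfolding proc_def
    by (rule measurable_Pair[OF measurable_traj[OF F_borel 1 measurable_noise_path] measurable_hist[OF 2 measurable_noise_path]])
qed

lemma noise_path_cong: "(\<And>i. i \<le> k \<Longrightarrow> e i = e' i) \<Longrightarrow> noise_path (x, e) k = noise_path (x, e') k"
  unfolding noise_path_def fst_conv snd_conv by (rule response_cong)

lemma proc_cong: "(\<And>i. i < n \<Longrightarrow> e i = e' i) \<Longrightarrow> proc n (x, e) = proc n (x, e')"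
proof -
  assume "\<And>i. i < n \<Longrightarrow> e i = e' i"
  then have "noise_path (x, e) k = noise_path (x, e') k" if "k < n" for k
    using that by (intro noise_path_cong) auto
  then show ?thesis
    unfolding proc_def by (auto intro!: traj_cong hist_cong)
qed

lemma proc_Suc: "proc (Suc n) z = phi F (proc n z) (noise_path z n)"
  by (simp add: proc_def phi_def snoc_past_def hist_Suc)

lemma measurable_phi[measurable (raw)]:
  assumes [measurable]: "f \<in> N \<rightarrow>\<^sub>M state_space" "g \<in> borel_measurable N"
  shows "(\<lambda>x. phi F (f x) (g x)) \<in> N \<rightarrow>\<^sub>M state_space"
  unfolding phi_def snoc_past_def
proof (intro measurable_Pair)
  show "(\<lambda>x. case_nat (g x) (snd (f x))) \<in> N \<rightarrow>\<^sub>M seq_space"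
  proof (rule measurable_PiM_single')
    fix i show "(\<lambda>x. case_nat (g x) (snd (f x)) i) \<in> borel_measurable N"
      by (cases i) auto
  qed auto
qed measurable

lemma P_meas[measurable]: "P \<in> seq_space \<rightarrow>\<^sub>M prob_algebra borel"
  using nk by (auto simp: noise_kernel_def regular_cond_law_def)

lemma Q_meas[measurable]: "Q \<in> state_space \<rightarrow>\<^sub>M prob_algebra state_space"
  unfolding Q_kernel_def[abs_def]
proof (rule measurable_distr_prob_space2[where M = borel])
  show "(\<lambda>x. P (snd x)) \<in> state_space \<rightarrow>\<^sub>M prob_algebra borel"
    by (rule measurable_compose[OF measurable_snd P_meas])
  have "(\<lambda>v. phi F (fst v) (snd v)) \<in> state_space \<Otimes>\<^sub>M borel \<rightarrow>\<^sub>M state_space"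
    by (rule measurable_phi[OF measurable_fst measurable_snd])
  then show "(\<lambda>(z, y). phi F z y) \<in> state_space \<Otimes>\<^sub>M borel \<rightarrow>\<^sub>M state_space"
    by (simp add: case_prod_beta')
qed

lemma Q_kernel_eq:
  assumes "P (snd z) = kernel (snd z)" and [measurable]: "f \<in> borel_measurable state_space"
  shows "(\<integral>\<^sup>+y. f y \<partial>Q z) = (\<integral>\<^sup>+u. f (phi F z (predictor (snd z) + a 0 *\<^sub>R u)) \<partial>std_gaussian)"
proof -
  have [measurable]: "phi F z \<in> borel \<rightarrow>\<^sub>M state_space"
    using measurable_phi[of "\<lambda>_. z" borel "\<lambda>x. x"] by (simp add: space_pair_measure space_PiM)
  show ?thesis
    unfolding Q_kernel_def assms(1) kernel_def
    by (subst nn_integral_distr, simp, simp, subst nn_integral_distr) auto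
qed

context
  fixes \<mu> :: "'d state measure" assumes \<mu>: "initial_distribution PW \<mu>"
begin

lemma prob_\<mu>: "prob_space \<mu>" and sets_\<mu>[measurable_cong]: "sets \<mu> = sets state_space"
  and snd_\<mu>: "distr \<mu> seq_space snd = PW"
  using \<mu> by (auto simp: initial_distribution_def)

lemma sets_Om[measurable_cong]: "sets (Om \<mu>) = sets path_space"
  unfolding Om_def by (rule sets_pair_measure_cong[OF sets_\<mu> sets_gauss_vec])

lemma measurable_Om: "measurable (Om \<mu>) N = measurable path_space N"
  and measurable_initial: "measurable \<mu> N' = measurable state_space N'"
  by (intro measurable_cong_sets sets_Om sets_\<mu> refl)+

lemma prob_Om: "prob_space (Om \<mu>)"
proof -
  interpret pair_prob_space \<mu> "gauss_vec UNIV :: 'd seq measure"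
    by (intro pair_prob_space.intro pair_sigma_finite.intro prob_space_imp_sigma_finite prob_space_gauss_vec prob_\<mu>)
  show ?thesis unfolding Om_def by (rule prob_space_axioms)
qed

lemma Om_noise: "distr (Om \<mu>) (seq_space \<Otimes>\<^sub>M seq_space) (\<lambda>z. (snd (fst z), snd z)) = PW \<Otimes>\<^sub>M gauss_vec UNIV"
proof -
  have s: "snd \<in> \<mu> \<rightarrow>\<^sub>M (seq_space :: 'd seq measure)"
    by measurable
  have i: "(\<lambda>x. x) \<in> (gauss_vec UNIV :: 'd seq measure) \<rightarrow>\<^sub>M seq_space"
    by measurable
  have g: "distr (gauss_vec UNIV) seq_space (\<lambda>x. x) = (gauss_vec UNIV :: 'd seq measure)"
    by (rule distr_id2) (rule sets_gauss_vec[symmetric])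
  have "distr \<mu> seq_space snd \<Otimes>\<^sub>M distr (gauss_vec UNIV) seq_space (\<lambda>x. x) =
    distr (\<mu> \<Otimes>\<^sub>M gauss_vec UNIV) (seq_space \<Otimes>\<^sub>M seq_space) (\<lambda>(x, y). (snd x, y :: 'd seq))"
    by (rule pair_measure_distr[OF s i]) (simp add: g prob_space_imp_sigma_finite prob_space_gauss_vec)
  then show ?thesis
    unfolding g snd_\<mu> Om_def by (simp add: case_prod_beta')
qed

lemma Om_AE:
  assumes "AE z in PW \<Otimes>\<^sub>M gauss_vec UNIV. Pr (fst z) (snd z)"
  shows "AE z in Om \<mu>. Pr (snd (fst z)) (snd z)"
proof -
  have m: "(\<lambda>z. (snd (fst z), snd z)) \<in> Om \<mu> \<rightarrow>\<^sub>M seq_space \<Otimes>\<^sub>M seq_space"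
    by measurable
  show ?thesis
    using AE_distrD[OF m, of "\<lambda>z. Pr (fst z) (snd z)"] assms unfolding Om_noise by simp
qed

lemma proc_past_law: "distr (Om \<mu>) seq_space (\<lambda>z. snd (proc n z)) = PW"
proof -
  have "distr (distr (Om \<mu>) (seq_space \<Otimes>\<^sub>M seq_space) (\<lambda>z. (snd (fst z), snd z))) seq_space (\<lambda>z. hist (fst z) (response (fst z) (snd z)) n)
    = distr (Om \<mu>) seq_space ((\<lambda>z. hist (fst z) (response (fst z) (snd z)) n) \<circ> (\<lambda>z. (snd (fst z), snd z)))"
    by (rule distr_distr) measurable
  then show ?thesis
    unfolding Om_noise hist_law by (simp add: proc_def noise_path_def comp_def)
qed

lemma proc_kernel: "AE z in Om \<mu>. P (snd (proc n z)) = kernel (snd (proc n z))"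
proof -
  have m: "(\<lambda>z. snd (proc n z)) \<in> Om \<mu> \<rightarrow>\<^sub>M seq_space" by measurable
  show ?thesis
    using AE_distrD[OF m, of "\<lambda>w. P w = kernel w"] noise_kernel_AE[OF nk] unfolding proc_past_law by simp
qed

text \<open>The noise of step n is the prediction from the current past plus a 0 times the
  innovation n, while the history up to time n depends on the innovations below n. Integrating that
  innovation out gives the Gaussian kernel, which equals P almost surely at the current
  past.\<close>

lemma proc_Markov:
  assumes f[measurable]: "f \<in> borel_measurable (PiM {0..<Suc n} (\<lambda>_. state_space) \<Otimes>\<^sub>M state_space)"
  shows "(\<integral>\<^sup>+z. f (\<lambda>i\<in>{0..<Suc n}. proc i z, proc (Suc n) z) \<partial>Om \<mu>) =
     (\<integral>\<^sup>+z. \<integral>\<^sup>+y. f (\<lambda>i\<in>{0..<Suc n}. proc i z, y) \<partial>Q (proc n z) \<partial>Om \<mu>)"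
proof -
  define R where "R z = (\<lambda>i\<in>{0..<Suc n}. proc i z)" for z
  have R[measurable]: "R \<in> path_space \<rightarrow>\<^sub>M PiM {0..<Suc n} (\<lambda>_. state_space)"
    unfolding R_def by (intro measurable_restrict) measurable
  have R_cong: "R (x, e) = R (x, e')" if "\<And>i. i < n \<Longrightarrow> e i = e' i" for x e e'
    using that unfolding R_def by (auto intro!: restrict_ext proc_cong)
  define G where "G z u = f (R z, phi F (proc n z) (predictor (snd (proc n z)) + a 0 *\<^sub>R u))" for z u
  have G[measurable]: "(\<lambda>v. G (fst v) (snd v)) \<in> borel_measurable (path_space \<Otimes>\<^sub>M borel)"
    unfolding G_def by measurable
  have Gn[measurable]: "(\<lambda>z. G z (snd z n)) \<in> borel_measurable path_space"
    by (rule measurable_compose[OF _ G, where f="\<lambda>z. (z, snd z n)", simplified]) measurable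
  have "(\<integral>\<^sup>+z. f (R z, proc (Suc n) z) \<partial>Om \<mu>) = (\<integral>\<^sup>+z. G z (snd z n) \<partial>Om \<mu>)"
  proof (rule nn_integral_cong_AE)
    show "AE z in Om \<mu>. f (R z, proc (Suc n) z) = G z (snd z n)"
      using Om_AE[OF response_innovation]
    proof eventually_elim
      case (elim z)
      from elim[rule_format, of n] show ?case
        unfolding G_def proc_Suc by (simp add: proc_def noise_path_def)
    qed
  qed
  also have "\<dots> = (\<integral>\<^sup>+x. \<integral>\<^sup>+e. G (x, e) (e n) \<partial>gauss_vec UNIV \<partial>\<mu>)"
    using Gn unfolding measurable_cong_sets[OF sets_Om[symmetric] refl] Om_def
    by (subst nn_integral_fst_prob[OF prob_space_gauss_vec, symmetric]) auto
  also have "\<dots> = (\<integral>\<^sup>+x. \<integral>\<^sup>+e. \<integral>\<^sup>+u. G (x, e) u \<partial>std_gaussian \<partial>gauss_vec UNIV \<partial>\<mu>)"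
  proof (rule nn_integral_cong)
    fix x assume "x \<in> space \<mu>"
    have [measurable]: "(\<lambda>v. G (x, fst v) (snd v)) \<in> borel_measurable (seq_space \<Otimes>\<^sub>M borel)"
      by (rule measurable_compose[OF _ G, where f="\<lambda>v. ((x, fst v), snd v)", simplified])
         (auto simp: space_pair_measure space_PiM)
    have "(\<integral>\<^sup>+e. (\<lambda>v. G (x, fst v) (snd v)) (e, e n) \<partial>gauss_vec UNIV) =
      (\<integral>\<^sup>+e. \<integral>\<^sup>+u. (\<lambda>v. G (x, fst v) (snd v)) (e, u) \<partial>std_gaussian \<partial>gauss_vec UNIV)"
    proof (rule nn_integral_fresh_coordinate)
      fix e e' :: "'d seq" and u assume e: "\<And>i. i < n \<Longrightarrow> e i = e' i"
      show "(\<lambda>v. G (x, fst v) (snd v)) (e, u) = (\<lambda>v. G (x, fst v) (snd v)) (e', u)"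
        using R_cong[OF e] proc_cong[OF e] by (simp add: G_def)
    qed measurable
    then show "(\<integral>\<^sup>+e. G (x, e) (e n) \<partial>gauss_vec UNIV) = (\<integral>\<^sup>+e. \<integral>\<^sup>+u. G (x, e) u \<partial>std_gaussian \<partial>gauss_vec UNIV)"
      by simp
  qed
  also have "\<dots> = (\<integral>\<^sup>+z. \<integral>\<^sup>+u. G z u \<partial>std_gaussian \<partial>Om \<mu>)"
    unfolding Om_def by (subst nn_integral_fst_prob[OF prob_space_gauss_vec, symmetric]) auto
  also have "\<dots> = (\<integral>\<^sup>+z. \<integral>\<^sup>+y. f (R z, y) \<partial>Q (proc n z) \<partial>Om \<mu>)"
  proof (rule nn_integral_cong_AE)
    show "AE z in Om \<mu>. (\<integral>\<^sup>+u. G z u \<partial>std_gaussian) = (\<integral>\<^sup>+y. f (R z, y) \<partial>Q (proc n z))"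
      using proc_kernel[of n] AE_space
    proof eventually_elim
      case (elim z)
      then have "R z \<in> space (PiM {0..<Suc n} (\<lambda>_. state_space))"
        using measurable_space[OF R, of z] sets_eq_imp_space_eq[OF sets_Om] by simp
      then have [measurable]: "(\<lambda>y. f (R z, y)) \<in> borel_measurable state_space"
        by (intro measurable_compose[OF measurable_Pair1' f])
      show ?case unfolding G_def by (rule Q_kernel_eq[OF elim(1), symmetric]) measurable
    qed
  qed
  finally show ?thesis unfolding R_def .
qed

definition law_at :: "nat \<Rightarrow> 'd state measure" where
  "law_at n = distr (Om \<mu>) state_space (proc n)"

lemma law_at_initial: "initial_distribution PW (law_at n)"
proof -
  have "distr (law_at n) seq_space snd = distr (Om \<mu>) seq_space (\<lambda>z. snd (proc n z))"
    unfolding law_at_def by (subst distr_distr) (auto simp: comp_def)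
  moreover have "proc n \<in> Om \<mu> \<rightarrow>\<^sub>M state_space" by measurable
  ultimately show ?thesis
    unfolding initial_distribution_def
    using prob_space.prob_space_distr[OF prob_Om, of "proc n" state_space] by (simp add: proc_past_law law_at_def)
qed

lemma law_at_0: "law_at 0 = \<mu>"
proof -
  interpret G: prob_space "gauss_vec UNIV :: 'd seq measure" by (rule prob_space_gauss_vec)
  have "law_at 0 = distr (Om \<mu>) state_space fst"
    unfolding law_at_def by (intro distr_cong) (auto simp: proc_def)
  also have "\<dots> = distr (\<mu> \<Otimes>\<^sub>M (gauss_vec UNIV :: 'd seq measure)) \<mu> fst"
    unfolding Om_def by (intro distr_cong refl sets_\<mu>[symmetric])
  also have "\<dots> = \<mu>"
    by (rule G.distr_pair_fst)
  finally show ?thesis .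
qed

lemma law_at_Suc: "law_at (Suc n) = law_at n \<bind> Q"
proof (rule measure_eqI)
  have ne: "space (law_at n) \<noteq> {}"
    using law_at_initial[of n] by (auto simp: initial_distribution_def dest: prob_space.not_empty)
  have Qs: "Q \<in> law_at n \<rightarrow>\<^sub>M subprob_algebra state_space"
    unfolding law_at_def by (simp add: measurable_prob_algebraD)
  show "sets (law_at (Suc n)) = sets (law_at n \<bind> Q)"
    by (subst sets_bind[OF sets_kernel[OF Qs] ne]) (auto simp: law_at_def)
  fix B assume "B \<in> sets (law_at (Suc n))"
  then have B[measurable]: "B \<in> sets state_space" by (simp add: law_at_def)
  have "emeasure (law_at (Suc n)) B = (\<integral>\<^sup>+y. indicator B y \<partial>law_at (Suc n))"
    by (rule nn_integral_indicator[symmetric]) (simp add: law_at_def)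
  also have "\<dots> = (\<integral>\<^sup>+z. indicator B (proc (Suc n) z) \<partial>Om \<mu>)"
    unfolding law_at_def by (rule nn_integral_distr) measurable
  also have "\<dots> = (\<integral>\<^sup>+z. \<integral>\<^sup>+y. indicator B y \<partial>Q (proc n z) \<partial>Om \<mu>)"
    using proc_Markov[of "\<lambda>v. indicator B (snd v)" n] by simp
  also have "\<dots> = (\<integral>\<^sup>+z. emeasure (Q (proc n z)) B \<partial>Om \<mu>)"
    by (intro nn_integral_cong nn_integral_indicator) (simp add: Q_kernel_def)
  also have "\<dots> = (\<integral>\<^sup>+x. emeasure (Q x) B \<partial>law_at n)"
    unfolding law_at_def
    by (rule nn_integral_distr[symmetric]) (use measurable_emeasure_kernel[OF measurable_prob_algebraD[OF Q_meas] B] in auto)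
  also have "\<dots> = emeasure (law_at n \<bind> Q) B"
    by (rule emeasure_bind[symmetric, OF ne Qs B])
  finally show "emeasure (law_at (Suc n)) B = emeasure (law_at n \<bind> Q) B" .
qed

lemma chain_law_shift:
  "chain_law state_space (law_at m) Q = distr (Om \<mu>) (PiM UNIV (\<lambda>_. state_space)) (\<lambda>z n. proc (m + n) z)"
proof (rule chain_law_eqI[OF prob_Om Q_meas])
  show "distr (Om \<mu>) state_space (proc (m + 0)) = law_at m" by (simp add: law_at_def)
  show "proc (m + n) \<in> Om \<mu> \<rightarrow>\<^sub>M state_space" for n by measurable
  fix n and f :: "(nat \<Rightarrow> 'd state) \<times> 'd state \<Rightarrow> ennreal"
  assume f[measurable]: "f \<in> borel_measurable (PiM {0..<Suc n} (\<lambda>_. state_space) \<Otimes>\<^sub>M state_space)"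
  define S where "S x = (\<lambda>i\<in>{0..<Suc n}. x (m + i))" for x :: "nat \<Rightarrow> 'd state"
  have [measurable]: "S \<in> PiM {0..<Suc (m + n)} (\<lambda>_. state_space) \<rightarrow>\<^sub>M PiM {0..<Suc n} (\<lambda>_. state_space)"
    unfolding S_def by (intro measurable_restrict measurable_component_singleton) auto
  have S: "S (\<lambda>i\<in>{0..<Suc (m + n)}. proc i z) = (\<lambda>i\<in>{0..<Suc n}. proc (m + i) z)" for z
    by (auto simp: S_def fun_eq_iff)
  show "(\<integral>\<^sup>+z. f (\<lambda>i\<in>{0..<Suc n}. proc (m + i) z, proc (m + Suc n) z) \<partial>Om \<mu>) =
     (\<integral>\<^sup>+z. \<integral>\<^sup>+y. f (\<lambda>i\<in>{0..<Suc n}. proc (m + i) z, y) \<partial>Q (proc (m + n) z) \<partial>Om \<mu>)"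
    using proc_Markov[of "\<lambda>v. f (S (fst v), snd v)" "m + n"] by (simp add: S)
qed

lemma shifted_trajectory_law:
  "shifted_law m (trajectory_law Q \<mu>) = distr (Om \<mu>) seq_space (\<lambda>z k. traj F (fst (fst z)) (noise_path z) (m + k))"
  and trajectory_law_at: "trajectory_law Q (law_at m) = shifted_law m (trajectory_law Q \<mu>)"
proof -
  have T: "trajectory_law Q (law_at n) = distr (Om \<mu>) seq_space (\<lambda>z k. traj F (fst (fst z)) (noise_path z) (n + k))" for n
  proof -
    have [measurable]: "(\<lambda>z k. fst (z k)) \<in> PiM UNIV (\<lambda>_. state_space) \<rightarrow>\<^sub>M (seq_space :: 'd seq measure)"
      by (rule measurable_PiM_single') auto
    have [measurable]: "(\<lambda>z k. proc (n + k) z) \<in> Om \<mu> \<rightarrow>\<^sub>M PiM UNIV (\<lambda>_. state_space)"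
      by (rule measurable_PiM_single') (auto simp: space_pair_measure space_PiM)
    have "trajectory_law Q (law_at n) = distr (Om \<mu>) seq_space ((\<lambda>z k. fst (z k)) \<circ> (\<lambda>z k. proc (n + k) z))"
      unfolding trajectory_law_def chain_law_shift by (rule distr_distr) measurable
    then show ?thesis
      by (simp add: comp_def proc_def)
  qed
  have [measurable]: "(\<lambda>z k. traj F (fst (fst z)) (noise_path z) k) \<in> Om \<mu> \<rightarrow>\<^sub>M seq_space"
    by (rule measurable_PiM_single') auto
  have [measurable]: "(\<lambda>x k. x (m + k)) \<in> seq_space \<rightarrow>\<^sub>M (seq_space :: 'd seq measure)"
    by (rule measurable_PiM_single') auto
  show S: "shifted_law m (trajectory_law Q \<mu>) = distr (Om \<mu>) seq_space (\<lambda>z k. traj F (fst (fst z)) (noise_path z) (m + k))"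
    unfolding shifted_law_def T[of 0, unfolded law_at_0] by (subst distr_distr) (auto simp: comp_def)
  show "trajectory_law Q (law_at m) = shifted_law m (trajectory_law Q \<mu>)"
    unfolding S T ..
qed

end

lemma law_at_invariant:
  assumes "invariant_distribution PW Q \<mu>"
  shows "law_at \<mu> n = \<mu>"
proof -
  have i: "initial_distribution PW \<mu>" and b: "\<mu> \<bind> Q = \<mu>"
    using assms by (auto simp: invariant_distribution_def)
  show ?thesis
    by (induction n) (simp_all add: law_at_0[OF i] law_at_Suc[OF i] b)
qed

end

subsection \<open>Loss of memory\<close>

lemma measurable_shift_mix:
  fixes \<eta> :: "'a \<Rightarrow> nat \<Rightarrow> real ^ 'd::finite" and \<zeta> :: "'a \<Rightarrow> nat \<Rightarrow> real ^ 'd"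
  assumes [measurable]: "\<eta> \<in> N \<rightarrow>\<^sub>M PiM UNIV (\<lambda>_. borel)" and \<zeta>: "\<zeta> \<in> N \<rightarrow>\<^sub>M PiM {..<J} (\<lambda>_. borel)"
  shows "(\<lambda>x k. \<eta> x k + \<sigma> *\<^sub>R (\<Sum>j<J. B k j *\<^sub>R \<zeta> x j)) \<in> N \<rightarrow>\<^sub>M PiM UNIV (\<lambda>_. borel)"
proof (rule measurable_PiM_single')
  fix k
  have "(\<lambda>x. \<Sum>j<J. B k j *\<^sub>R \<zeta> x j) \<in> borel_measurable N"
    by (intro borel_measurable_sum borel_measurable_scaleR borel_measurable_const
        measurable_compose[OF \<zeta> measurable_component_singleton]) auto
  then show "(\<lambda>x. \<eta> x k + \<sigma> *\<^sub>R (\<Sum>j<J. B k j *\<^sub>R \<zeta> x j)) \<in> borel_measurable N"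
    by measurable
qed auto

lemma sum_blocks: "(\<Sum>t<J * L. f t) = (\<Sum>j<J. \<Sum>k<L. f (j * L + k))" for f :: "nat \<Rightarrow> real"
proof -
  have "(\<Sum>t = j * L..<j * L + L. f t) = (\<Sum>k<L. f (j * L + k))" for j
    by (rule sum.reindex_bij_witness[where i="\<lambda>k. j * L + k" and j="\<lambda>t. t - j * L"]) auto
  then show ?thesis
    by (simp add: sum.nat_group[symmetric])
qed

text \<open>The finite-dimensional splitting embedded in sequences: the environment is extended by 0
  beyond N, which functions of the first N innovations cannot detect. The restriction to such
  functions is the reason for working with local events below.\<close>

lemma gaussian_split_UNIV:
  fixes B :: "nat \<Rightarrow> nat \<Rightarrow> real" and N J :: nat and \<sigma> :: real
  assumes B: "\<And>k j. 0 \<le> B k j" and \<sigma>: "0 \<le> \<sigma>"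
    and dom: "\<And>p. p < J \<Longrightarrow> \<sigma>\<^sup>2 * (\<Sum>q<J. \<Sum>k<N. B k p * B k q) \<le> 1"
  obtains E :: "('d::finite) seq measure"
  where "prob_space E" "sets E = sets (PiM UNIV (\<lambda>_. borel))"
    "\<And>f. \<lbrakk>f \<in> borel_measurable (PiM UNIV (\<lambda>_. borel)); \<And>e e'. (\<And>k. k < N \<Longrightarrow> e k = e' k) \<Longrightarrow> f e = f e'\<rbrakk> \<Longrightarrow>
       (\<integral>\<^sup>+e. f e \<partial>gauss_vec UNIV) = (\<integral>\<^sup>+\<eta>. \<integral>\<^sup>+\<zeta>. f (\<lambda>k. \<eta> k + \<sigma> *\<^sub>R (\<Sum>j<J. B k j *\<^sub>R \<zeta> j)) \<partial>gauss_vec {..<J} \<partial>E)"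
proof (rule gaussian_split[OF B \<sigma> dom])
  fix E0 :: "'d seq measure"
  assume E0: "prob_space E0" and sets_E0[measurable_cong]: "sets E0 = sets (PiM {..<N} (\<lambda>_. borel))"
    and split: "distr (E0 \<Otimes>\<^sub>M gauss_vec {..<J}) (PiM {..<N} (\<lambda>_. borel))
       (\<lambda>z. \<lambda>k\<in>{..<N}. fst z k + \<sigma> *\<^sub>R (\<Sum>j<J. B k j *\<^sub>R snd z j)) = gauss_vec {..<N}"
  define ext :: "'d seq \<Rightarrow> nat \<Rightarrow> real ^ 'd" where "ext y = (\<lambda>k. if k < N then y k else 0)" for y
  have ext[measurable]: "ext \<in> PiM {..<N} (\<lambda>_. borel) \<rightarrow>\<^sub>M PiM UNIV (\<lambda>_. borel)"
  proof (rule measurable_PiM_single')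
    fix k show "(\<lambda>y. ext y k) \<in> borel_measurable (PiM {..<N} (\<lambda>_. borel))"
      by (cases "k < N") (auto simp: ext_def)
  qed auto
  interpret G: product_prob_space "\<lambda>_::nat. std_gaussian :: (real ^ 'd) measure" UNIV by standard
  have restr: "distr (gauss_vec UNIV) (gauss_vec {..<N}) (\<lambda>e. restrict e {..<N}) = (gauss_vec {..<N} :: 'd seq measure)"
    using G.distr_PiM_restrict_finite[of "{..<N}"] by simp
  show thesis
  proof (rule that)
    show "prob_space (distr E0 (PiM UNIV (\<lambda>_. borel)) ext)"
      by (rule prob_space.prob_space_distr[OF E0]) measurable
    show "sets (distr E0 (PiM UNIV (\<lambda>_. borel)) ext) = sets (PiM UNIV (\<lambda>_. borel))" by simp
    fix f :: "'d seq \<Rightarrow> ennreal"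
    assume f[measurable]: "f \<in> borel_measurable (PiM UNIV (\<lambda>_. borel))" and local: "\<And>e e'. (\<And>k. k < N \<Longrightarrow> e k = e' k) \<Longrightarrow> f e = f e'"
    have "(\<integral>\<^sup>+e. f e \<partial>gauss_vec UNIV) = (\<integral>\<^sup>+e. f (ext (restrict e {..<N})) \<partial>gauss_vec UNIV)"
      by (intro nn_integral_cong local) (auto simp: ext_def)
    also have "\<dots> = (\<integral>\<^sup>+y. f (ext y) \<partial>distr (gauss_vec UNIV) (gauss_vec {..<N}) (\<lambda>e. restrict e {..<N}))"
    proof (rule nn_integral_distr[symmetric])
      show "(\<lambda>e. restrict e {..<N}) \<in> gauss_vec UNIV \<rightarrow>\<^sub>M (gauss_vec {..<N} :: 'd seq measure)"
        by (rule measurable_restrict_subset) simp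
      have "(\<lambda>y. f (ext y)) \<in> borel_measurable (gauss_vec {..<N})" by measurable
      then show "(\<lambda>y. f (ext y)) \<in> borel_measurable (distr (gauss_vec UNIV) (gauss_vec {..<N}) (\<lambda>e. restrict e {..<N}))"
        by simp
    qed
    also have "\<dots> = (\<integral>\<^sup>+y. f (ext y) \<partial>gauss_vec {..<N})" unfolding restr ..
    also have "\<dots> = (\<integral>\<^sup>+z. f (ext (\<lambda>k\<in>{..<N}. fst z k + \<sigma> *\<^sub>R (\<Sum>j<J. B k j *\<^sub>R snd z j))) \<partial>(E0 \<Otimes>\<^sub>M gauss_vec {..<J}))"
      unfolding split[symmetric] by (rule nn_integral_distr) measurable
    also have "\<dots> = (\<integral>\<^sup>+\<eta>. \<integral>\<^sup>+\<zeta>. f (ext (\<lambda>k\<in>{..<N}. \<eta> k + \<sigma> *\<^sub>R (\<Sum>j<J. B k j *\<^sub>R \<zeta> j))) \<partial>gauss_vec {..<J} \<partial>E0)"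
      by (subst nn_integral_fst_prob[OF prob_space_gauss_vec, symmetric]) auto
    also have "\<dots> = (\<integral>\<^sup>+\<eta>. \<integral>\<^sup>+\<zeta>. f (\<lambda>k. ext \<eta> k + \<sigma> *\<^sub>R (\<Sum>j<J. B k j *\<^sub>R \<zeta> j)) \<partial>gauss_vec {..<J} \<partial>E0)"
      by (intro nn_integral_cong local) (auto simp: ext_def)
    also have "\<dots> = (\<integral>\<^sup>+\<eta>. \<integral>\<^sup>+\<zeta>. f (\<lambda>k. \<eta> k + \<sigma> *\<^sub>R (\<Sum>j<J. B k j *\<^sub>R \<zeta> j)) \<partial>gauss_vec {..<J} \<partial>distr E0 (PiM UNIV (\<lambda>_. borel)) ext)"
    proof (rule nn_integral_distr[symmetric])
      interpret J: prob_space "gauss_vec {..<J} :: 'd seq measure" by (rule prob_space_gauss_vec)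
      have "(\<lambda>z. f (\<lambda>k. fst z k + \<sigma> *\<^sub>R (\<Sum>j<J. B k j *\<^sub>R snd z j))) \<in> borel_measurable (PiM UNIV (\<lambda>_. borel) \<Otimes>\<^sub>M gauss_vec {..<J})"
        by (intro measurable_compose[OF measurable_shift_mix f]) measurable
      then have "(\<lambda>\<eta>. \<integral>\<^sup>+\<zeta>. f (\<lambda>k. \<eta> k + \<sigma> *\<^sub>R (\<Sum>j<J. B k j *\<^sub>R \<zeta> j)) \<partial>gauss_vec {..<J}) \<in> borel_measurable (PiM UNIV (\<lambda>_. borel))"
        by (intro J.borel_measurable_nn_integral) (simp add: case_prod_beta')
      then show "(\<lambda>\<eta>. \<integral>\<^sup>+\<zeta>. f (\<lambda>k. \<eta> k + \<sigma> *\<^sub>R (\<Sum>j<J. B k j *\<^sub>R \<zeta> j)) \<partial>gauss_vec {..<J}) \<in> borel_measurable (distr E0 (PiM UNIV (\<lambda>_. borel)) ext)"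
        by simp
    qed measurable
    finally show "(\<integral>\<^sup>+e. f e \<partial>gauss_vec UNIV) = (\<integral>\<^sup>+\<eta>. \<integral>\<^sup>+\<zeta>. f (\<lambda>k. \<eta> k + \<sigma> *\<^sub>R (\<Sum>j<J. B k j *\<^sub>R \<zeta> j)) \<partial>gauss_vec {..<J} \<partial>distr E0 (PiM UNIV (\<lambda>_. borel)) ext)" .
  qed
qed

section \<open>Almost orthogonality of the shifted columns\<close>

context rough
begin

text \<open>
  A perturbation of the innovations along column \<open>j\<close> moves the noise at the single time \<open>j L + L - 1\<close>.
\<close>

definition site :: "nat \<Rightarrow> nat \<Rightarrow> nat \<Rightarrow> real" where
  "site L k j = (if j * L + L - 1 \<le> k then b (k - (j * L + L - 1)) else 0)"

lemma site_nonneg: "0 \<le> site L k j"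
  by (simp add: site_def b_nonneg)

lemma a_site_conv: "(\<Sum>i\<le>k. a (k - i) * site L i j) = (if k = j * L + L - 1 then 1 else 0)"
proof (cases "j * L + L - 1 \<le> k")
  case True
  let ?s = "j * L + L - 1"
  have "(\<Sum>i\<le>k. a (k - i) * site L i j) = (\<Sum>i\<in>{?s..k}. a (k - i) * b (i - ?s))"
    by (rule sum.mono_neutral_cong_right) (auto simp: site_def)
  also have "\<dots> = (\<Sum>i\<le>k - ?s. b i * a (k - ?s - i))"
    by (rule sum.reindex_bij_witness[where i="\<lambda>i. i + ?s" and j="\<lambda>i. i - ?s"]) (use True in auto)
  also have "\<dots> = (if k = ?s then 1 else 0)"
    using True unfolding b_a_conv by auto
  finally show ?thesis .
next
  case False
  then show ?thesis by (auto simp: site_def intro!: sum.neutral)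
qed

text \<open>The columns are copies of \<open>b\<close> shifted by multiples of L. Their squared
  norms are at most C, and by Cauchy-Schwarz and \<open>b_sq_tail\<close> two different columns have
  inner product at most C L^(-H/2). For J \<le> L^(H/2) a row of the Gram matrix sums to at most 2
  C, so \<sigma> is the same for all L, J and N.\<close>

lemma site_gram:
  obtains \<sigma> where "0 < \<sigma>" "\<And>L J N p. \<lbrakk>0 < L; real J \<le> real L powr (H / 2); p < J\<rbrakk> \<Longrightarrow>
     \<sigma>\<^sup>2 * (\<Sum>q<J. \<Sum>k<N. site L k p * site L k q) \<le> 1"
proof -
  obtain C where C: "0 < C" "\<And>r K. (\<Sum>k<K. (b (k + r))\<^sup>2) \<le> C * (real r + 1) powr (- H)"
    using b_sq_tail by blast
  have col: "(\<Sum>k<N. (site L k q)\<^sup>2) \<le> C" for N L q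
  proof -
    let ?s = "q * L + L - 1"
    have "(\<Sum>k<N. (site L k q)\<^sup>2) = (\<Sum>k\<in>{?s..<N}. (b (k - ?s))\<^sup>2)"
      by (rule sum.mono_neutral_cong_right) (auto simp: site_def)
    also have "\<dots> = (\<Sum>k<N - ?s. (b (k + 0))\<^sup>2)"
      by (rule sum.reindex_bij_witness[where i="\<lambda>i. i + ?s" and j="\<lambda>i. i - ?s"]) auto
    also have "\<dots> \<le> C" using C(2)[where r=0 and K="N - ?s"] by simp
    finally show ?thesis .
  qed
  have off: "(\<Sum>k<N. site L k p * site L k q) \<le> C * real L powr (- (H / 2))" if "p < q" "0 < L" for p q L N
  proof -
    let ?s = "q * L + L - 1" and ?t = "p * L + L - 1"
    define r where "r = ?s - ?t"
    have "Suc p * L \<le> q * L" using that by (intro mult_le_mono1) auto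
    then have r: "?s = ?t + r" "L \<le> r" using that by (auto simp: r_def)
    have "(\<Sum>k<N. site L k p * site L k q) = (\<Sum>k\<in>{?s..<N}. b (k - ?t) * b (k - ?s))"
      by (rule sum.mono_neutral_cong_right) (use r in \<open>auto simp: site_def\<close>)
    also have "\<dots> = (\<Sum>k<N - ?s. b (k + r) * b (k + 0))"
      by (rule sum.reindex_bij_witness[where i="\<lambda>i. i + ?s" and j="\<lambda>i. i - ?s"]) (use r in auto)
    finally have eq: "(\<Sum>k<N. site L k p * site L k q) = (\<Sum>k<N - ?s. b (k + r) * b (k + 0))" .
    have "(\<Sum>k<N - ?s. b (k + r) * b (k + 0))\<^sup>2 \<le> (\<Sum>k<N - ?s. (b (k + r))\<^sup>2) * (\<Sum>k<N - ?s. (b (k + 0))\<^sup>2)"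
      by (rule Cauchy_Schwarz_ineq_sum)
    also have "\<dots> \<le> (C * (real r + 1) powr (- H)) * C"
      using C(2)[where r=r and K="N - ?s"] C(2)[where r=0 and K="N - ?s"] C(1) by (intro mult_mono) (auto intro: sum_nonneg)
    also have "\<dots> \<le> (C * real L powr (- H)) * C"
      using that r(2) C(1) H_pos by (intro mult_right_mono mult_left_mono powr_mono2') auto
    also have "\<dots> = (C * real L powr (- (H / 2)))\<^sup>2"
      by (simp add: power2_eq_square powr_add[symmetric] algebra_simps)
    finally show ?thesis
      unfolding eq by (rule power2_le_imp_le) (use C in auto)
  qed
  show thesis
  proof (rule that)
    show "0 < sqrt (1 / (2 * C))" using C by simp
    fix L J N p :: nat assume L: "0 < L" and J: "real J \<le> real L powr (H / 2)" and p: "p < J"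
    have "(\<Sum>k<N. site L k p * site L k q) \<le> (if q = p then C else 0) + C * real L powr (- (H / 2))" for q
    proof (cases p q rule: linorder_cases)
      case less then show ?thesis using off[OF less L] by simp
    next
      case equal then show ?thesis using col[where N=N and L=L and q=p] C by (auto simp: power2_eq_square add_increasing2)
    next
      case greater then show ?thesis using off[OF greater L] by (simp add: mult.commute)
    qed
    then have "(\<Sum>q<J. \<Sum>k<N. site L k p * site L k q) \<le> (\<Sum>q<J. (if q = p then C else 0) + C * real L powr (- (H / 2)))"
      by (intro sum_mono)
    also have "\<dots> = C + C * (real J * real L powr (- (H / 2)))"
      using p by (simp add: sum.distrib)
    also have "\<dots> \<le> C + C * (real L powr (H / 2) * real L powr (- (H / 2)))"
      using C J by (intro add_left_mono mult_left_mono mult_right_mono) auto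
    also have "\<dots> = 2 * C" using L by (simp add: powr_add[symmetric])
    finally show "(sqrt (1 / (2 * C)))\<^sup>2 * (\<Sum>q<J. \<Sum>k<N. site L k p * site L k q) \<le> 1"
      using C by (simp add: field_simps)
  qed
qed

end

section \<open>Energy of the environment\<close>

locale model = dynamics h H M \<xi> \<Delta> P F + drift F V g C1
  for h H :: real and M :: "'w measure" and \<xi> \<Delta> :: "int \<Rightarrow> 'w \<Rightarrow> real ^ 'd::finite"
    and P :: "'d seq \<Rightarrow> (real ^ 'd) measure" and F :: "(real ^ 'd) \<times> (real ^ 'd) \<Rightarrow> real ^ 'd"
    and V :: "real ^ 'd \<Rightarrow> real" and g C1 :: real
begin

abbreviation mix :: "real \<Rightarrow> nat \<Rightarrow> nat \<Rightarrow> 'd seq \<Rightarrow> 'd seq \<Rightarrow> 'd seq" where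
  "mix \<sigma> L J \<eta> \<zeta> \<equiv> \<lambda>k. \<eta> k + \<sigma> *\<^sub>R (\<Sum>j<J. site L k j *\<^sub>R \<zeta> j)"

lemma response_site:
  assumes L: "0 < L"
  shows "response w (mix \<sigma> L J \<eta> \<zeta>) = perturb \<sigma> L J (response w \<eta>) \<zeta>"
proof
  fix k
  have k: "k = j * L + L - 1 \<longleftrightarrow> k mod L = L - 1 \<and> k div L = j" for j
  proof
    assume "k = j * L + L - 1"
    then have "k = j * L + (L - 1)" using L by simp
    moreover have "(j * L + (L - 1)) mod L = L - 1" "(j * L + (L - 1)) div L = j"
      using L by (simp_all only: mod_mult_self3 div_mult_self3 mod_less div_less diff_less zero_less_one)
    ultimately show "k mod L = L - 1 \<and> k div L = j" by simp
  next
    assume "k mod L = L - 1 \<and> k div L = j"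
    then show "k = j * L + L - 1" using div_mult_mod_eq[of k L] L by auto
  qed
  have "(\<Sum>i\<le>k. a (k - i) *\<^sub>R (\<sigma> *\<^sub>R (\<Sum>j<J. site L i j *\<^sub>R \<zeta> j))) = (\<Sum>i\<le>k. \<Sum>j<J. (a (k - i) * site L i j) *\<^sub>R (\<sigma> *\<^sub>R \<zeta> j))"
    by (simp add: scaleR_sum_right mult.commute mult.left_commute)
  also have "\<dots> = (\<Sum>j<J. (\<Sum>i\<le>k. a (k - i) * site L i j) *\<^sub>R (\<sigma> *\<^sub>R \<zeta> j))"
    by (subst sum.swap) (simp add: scaleR_sum_left sum_distrib_right)
  also have "\<dots> = (\<Sum>j<J. if j = k div L then (if k mod L = L - 1 then \<sigma> *\<^sub>R \<zeta> (k div L) else 0) else 0)"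
    by (intro sum.cong refl) (unfold a_site_conv k, auto)
  also have "\<dots> = (if k mod L = L - 1 \<and> k div L < J then \<sigma> *\<^sub>R \<zeta> (k div L) else 0)"
    by (subst sum.delta) auto
  finally show "response w (mix \<sigma> L J \<eta> \<zeta>) k = perturb \<sigma> L J (response w \<eta>) \<zeta> k"
    by (simp add: response_def perturb_def scaleR_add_right sum.distrib)
qed

text \<open>The shift touches only the last noise of the block, whose weight is 1. The inequality
  goes from the true noise back to the environment, because exponential moments are known for the
  former.\<close>

lemma energy_perturb:
  assumes L: "0 < L" and j: "j < J"
  shows "energy L (\<lambda>k. r (j * L + k)) \<le> 2 * energy L (\<lambda>k. perturb \<sigma> L J r \<zeta> (j * L + k)) + 2 * \<sigma>\<^sup>2 * (norm (\<zeta> j))\<^sup>2"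
proof -
  let ?p = "perturb \<sigma> L J r \<zeta>"
  have *: "(norm (r (j * L + (L - 1 - k))))\<^sup>2 \<le> 2 * (norm (?p (j * L + (L - 1 - k))))\<^sup>2 + (if k = 0 then 2 * \<sigma>\<^sup>2 * (norm (\<zeta> j))\<^sup>2 else 0)"
    if "k < L" for k
  proof -
    define t where "t = j * L + (L - 1 - k)"
    have t: "t mod L = L - 1 - k" "t div L = j" using L by (auto simp: t_def)
    have sq: "(norm (x - y))\<^sup>2 \<le> 2 * (norm x)\<^sup>2 + 2 * (norm y)\<^sup>2" for x y :: "real ^ 'd"
    proof -
      have "(norm (x - y))\<^sup>2 \<le> (norm x + norm y)\<^sup>2" by (intro power_mono norm_triangle_ineq4) auto
      also have "\<dots> \<le> 2 * (norm x)\<^sup>2 + 2 * (norm y)\<^sup>2" using sum_squares_bound[of "norm x" "norm y"] by (simp add: power2_sum)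
      finally show ?thesis .
    qed
    show ?thesis
    proof (cases "k = 0")
      case True
      then have "?p t = r t + \<sigma> *\<^sub>R \<zeta> j" using t j by (simp add: perturb_def)
      then have "r t = ?p t - \<sigma> *\<^sub>R \<zeta> j" by simp
      then show ?thesis using sq[of "?p t" "\<sigma> *\<^sub>R \<zeta> j"] True unfolding t_def[symmetric] by (simp add: power_mult_distrib)
    next
      case False
      then have "?p t = r t" using t that by (auto simp: perturb_def)
      then show ?thesis using False unfolding t_def[symmetric] by simp
    qed
  qed
  have "energy L (\<lambda>k. r (j * L + k)) \<le> (\<Sum>k<L. g ^ k * (2 * (norm (?p (j * L + (L - 1 - k))))\<^sup>2 + (if k = 0 then 2 * \<sigma>\<^sup>2 * (norm (\<zeta> j))\<^sup>2 else 0)))"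
    unfolding energy_def using g * by (intro sum_mono mult_left_mono) auto
  also have "\<dots> = 2 * energy L (\<lambda>k. ?p (j * L + k)) + (\<Sum>k<L. if k = 0 then 2 * \<sigma>\<^sup>2 * (norm (\<zeta> j))\<^sup>2 else 0)"
    unfolding energy_def sum_distrib_left sum.distrib[symmetric] by (intro sum.cong refl) (auto simp: algebra_simps)
  also have "(\<Sum>k<L. if k = 0 then 2 * \<sigma>\<^sup>2 * (norm (\<zeta> j))\<^sup>2 else 0) = 2 * \<sigma>\<^sup>2 * (norm (\<zeta> j))\<^sup>2"
    using L by (subst sum.delta) auto
  finally show ?thesis .
qed

definition blocks_energy :: "nat \<Rightarrow> nat \<Rightarrow> ('d seq) \<Rightarrow> real" where
  "blocks_energy L J r = (\<Sum>j<J. energy L (\<lambda>k. r (j * L + k)))"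

text \<open>Rewritten as one sum over time with weights in [0, 1], the form that
  \<open>exp_moment\<close> accepts.\<close>

lemma blocks_energy_eq: "blocks_energy L J r = (\<Sum>t<J * L. g ^ (L - 1 - t mod L) * (norm (r t))\<^sup>2)"
proof -
  have "energy L (\<lambda>k. r (j * L + k)) = (\<Sum>k<L. g ^ (L - 1 - (j * L + k) mod L) * (norm (r (j * L + k)))\<^sup>2)" for j
    unfolding energy_def by (subst sum.nat_diff_reindex[symmetric]) (auto intro!: sum.cong)
  then show ?thesis
    unfolding blocks_energy_def sum_blocks by simp
qed

lemma blocks_energy_meas[measurable (raw)]:
  assumes [measurable]: "\<And>k. (\<lambda>z. r z k) \<in> borel_measurable N"
  shows "(\<lambda>z. blocks_energy L J (r z)) \<in> borel_measurable N"
  unfolding blocks_energy_eq by measurable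

lemma blocks_energy_cong: "(\<And>t. t < J * L \<Longrightarrow> r t = r' t) \<Longrightarrow> blocks_energy L J r = blocks_energy L J r'"
  unfolding blocks_energy_eq by (intro sum.cong refl) auto

lemma weights_le: "(\<Sum>t<J * L. g ^ (L - 1 - t mod L)) \<le> real J / (1 - g)"
proof -
  have "(\<Sum>k<L. g ^ k) = (\<Sum>k<L. g ^ (L - 1 - (j * L + k) mod L))" for j
    by (subst sum.nat_diff_reindex[symmetric]) (auto intro!: sum.cong)
  then have "(\<Sum>t<J * L. g ^ (L - 1 - t mod L)) = (\<Sum>j<J. \<Sum>k<L. g ^ k)"
    unfolding sum_blocks by simp
  also have "\<dots> \<le> (\<Sum>j<J. 1 / (1 - g))"
    by (intro sum_mono sum_powers_le)
  finally show ?thesis by simp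
qed

lemma noise_energy_moment:
  assumes "0 \<le> \<theta>" "\<theta> \<le> \<tau>"
  shows "(\<integral>\<^sup>+w. \<integral>\<^sup>+e. ennreal (exp (\<theta> * blocks_energy L J (response w e))) \<partial>gauss_vec UNIV \<partial>PW) \<le> ennreal (exp (\<kappa> * (real J / (1 - g))))"
proof -
  note m[measurable] = past_future_meas[of 0]
  let ?w = "\<lambda>t. g ^ (L - 1 - t mod L)"
  let ?T = "(\<lambda>t. 1 + int t) ` {..<J * L}"
  let ?s = "\<lambda>\<omega>. \<Sum>t\<in>?T. ?w (nat (t - 1)) * (norm (\<Delta> t \<omega>))\<^sup>2"
  have "(\<integral>\<^sup>+w. \<integral>\<^sup>+e. ennreal (exp (\<theta> * blocks_energy L J (response w e))) \<partial>gauss_vec UNIV \<partial>PW)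
    = (\<integral>\<^sup>+z. ennreal (exp (\<theta> * blocks_energy L J (response (fst z) (snd z)))) \<partial>(PW \<Otimes>\<^sub>M gauss_vec UNIV))"
    by (subst nn_integral_fst_prob[OF prob_space_gauss_vec, symmetric]) auto
  also have "\<dots> = (\<integral>\<^sup>+\<omega>. ennreal (exp (\<theta> * blocks_energy L J (response (past \<Delta> 0 \<omega>) (\<lambda>i. \<xi> (0 + 1 + int i) \<omega>)))) \<partial>M)"
    unfolding joint_law[of 0, symmetric] by (subst nn_integral_distr[OF m]) auto
  also have "\<dots> \<le> (\<integral>\<^sup>+\<omega>. ennreal (exp (\<tau> * ?s \<omega>)) \<partial>M)"
  proof (rule nn_integral_mono_AE)
    show "AE \<omega> in M. ennreal (exp (\<theta> * blocks_energy L J (response (past \<Delta> 0 \<omega>) (\<lambda>i. \<xi> (0 + 1 + int i) \<omega>))))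
      \<le> ennreal (exp (\<tau> * ?s \<omega>))"
      using response_past
    proof eventually_elim
      case (elim \<omega>)
      have "blocks_energy L J (response (past \<Delta> 0 \<omega>) (\<lambda>i. \<xi> (0 + 1 + int i) \<omega>)) = ?s \<omega>"
        using elim[rule_format, of 0] by (simp add: blocks_energy_eq sum.reindex inj_on_def)
      moreover have "0 \<le> ?s \<omega>"
        using g by (intro sum_nonneg) auto
      ultimately show ?case
        using assms by (intro ennreal_leI) (auto intro: mult_right_mono)
    qed
  qed
  also have "\<dots> \<le> ennreal (exp (\<kappa> * (\<Sum>t\<in>?T. ?w (nat (t - 1)))))"
    by (rule exp_moment) (use g in \<open>auto intro: power_le_one\<close>)
  also have "\<dots> \<le> ennreal (exp (\<kappa> * (real J / (1 - g))))"
    using mult_left_mono[OF weights_le[where J=J and L=L] \<kappa>_nonneg] by (intro ennreal_leI) (simp add: sum.reindex inj_on_def)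
  finally show ?thesis .
qed

text \<open>The energy of the environment is at most twice that of the true noise plus a multiple of
  the squared shifts, for every value of the shifts, so the inequality may be averaged over them.
  The true noise and the shifts are dependent; the arithmetic-geometric mean inequality separates
  their exponentials. The factor 4 on \<theta> is 2 from each of these two steps.\<close>

lemma environment_energy_moment:
  fixes E :: "'d seq measure"
  assumes E: "prob_space E" and sets_E[measurable_cong]: "sets E = sets seq_space"
    and split: "\<And>f. \<lbrakk>f \<in> borel_measurable seq_space; \<And>e e'. (\<And>k. k < N \<Longrightarrow> e k = e' k) \<Longrightarrow> f e = f e'\<rbrakk> \<Longrightarrow>
       (\<integral>\<^sup>+e. f e \<partial>gauss_vec UNIV) = (\<integral>\<^sup>+\<eta>. \<integral>\<^sup>+\<zeta>. f (mix \<sigma> L J \<eta> \<zeta>) \<partial>gauss_vec {..<J} \<partial>E)"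
    and N: "J * L \<le> N" and L: "0 < L" and \<theta>: "0 \<le> \<theta>" "4 * \<theta> \<le> \<tau>" "4 * \<theta> * \<sigma>\<^sup>2 \<le> 1/4"
  shows "(\<integral>\<^sup>+w. \<integral>\<^sup>+\<eta>. ennreal (exp (\<theta> * blocks_energy L J (response w \<eta>))) \<partial>E \<partial>PW) \<le> ennreal (exp (\<kappa> * (real J / (1 - g))))"
proof -
  interpret E: prob_space E by fact
  interpret G: prob_space "gauss_vec {..<J} :: 'd seq measure" by (rule prob_space_gauss_vec)
  interpret W: prob_space PW by (rule prob_space_past_law)
  let ?c = "ennreal (exp (\<kappa> * (real J / (1 - g))))"
  define f where "f w e = ennreal (exp (4 * \<theta> * blocks_energy L J (response w e)))" for w e
  define q where "q = (\<lambda>\<zeta> :: 'd seq. ennreal (exp (\<Sum>j\<in>{..<J}. 4 * \<theta> * \<sigma>\<^sup>2 * (norm (\<zeta> j))\<^sup>2)))"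
  let ?q = "\<integral>\<^sup>+\<zeta>. q \<zeta> \<partial>gauss_vec {..<J}"
  have f[measurable]: "(\<lambda>z. f (fst z) (snd z)) \<in> borel_measurable (seq_space \<Otimes>\<^sub>M seq_space)"
    unfolding f_def by measurable
  have f'[measurable]: "(\<lambda>x. f (u x) (v x)) \<in> borel_measurable N'" if "u \<in> N' \<rightarrow>\<^sub>M seq_space" "v \<in> N' \<rightarrow>\<^sub>M seq_space" for u v and N' :: "'z measure"
    using measurable_compose[OF measurable_Pair[OF that] f] by simp
  have q[measurable]: "q \<in> borel_measurable (PiM {..<J} (\<lambda>_. borel))"
    unfolding q_def by measurable
  have am_gm: "exp (x / 2) * exp (y / 2) \<le> (exp x + exp y) / 2" for x y :: real
    using sum_squares_bound[of "exp (x / 2)" "exp (y / 2)"] by (simp add: power2_eq_square mult.assoc exp_add[symmetric])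
  have q_le: "?q \<le> ?c"
  proof -
    have "?q \<le> ennreal (exp (4 * \<kappa> * (\<Sum>j\<in>{..<J}. 4 * \<theta> * \<sigma>\<^sup>2)))"
      unfolding q_def by (rule exp_moment_gauss_vec) (use \<theta> in auto)
    also have "\<dots> \<le> ?c"
    proof (intro ennreal_leI iffD2[OF exp_le_cancel_iff])
      have "4 * \<kappa> * (\<Sum>j\<in>{..<J}. 4 * \<theta> * \<sigma>\<^sup>2) = \<kappa> * (real J * (4 * (4 * \<theta> * \<sigma>\<^sup>2)))" by (simp add: algebra_simps)
      also have "\<dots> \<le> \<kappa> * (real J * (1 / (1 - g)))"
        using \<theta> g \<kappa>_nonneg by (intro mult_left_mono) (auto simp: field_simps intro: order_trans[of _ 1])
      finally show "4 * \<kappa> * (\<Sum>j\<in>{..<J}. 4 * \<theta> * \<sigma>\<^sup>2) \<le> \<kappa> * (real J / (1 - g))" by simp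
    qed
    finally show ?thesis .
  qed
  have pt: "ennreal (exp (\<theta> * blocks_energy L J (response w \<eta>))) \<le>
    (f w (mix \<sigma> L J \<eta> \<zeta>) + q \<zeta>) / 2" for w \<eta> \<zeta>
  proof -
    let ?r = "response w \<eta>" and ?p = "perturb \<sigma> L J (response w \<eta>) \<zeta>"
    have "blocks_energy L J ?r \<le> (\<Sum>j<J. 2 * energy L (\<lambda>k. ?p (j * L + k)) + 2 * \<sigma>\<^sup>2 * (norm (\<zeta> j))\<^sup>2)"
      unfolding blocks_energy_def by (intro sum_mono energy_perturb L) auto
    also have "\<dots> = 2 * blocks_energy L J ?p + (\<Sum>j<J. 2 * \<sigma>\<^sup>2 * (norm (\<zeta> j))\<^sup>2)"
      by (simp add: blocks_energy_def sum.distrib sum_distrib_left)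
    finally have "\<theta> * blocks_energy L J ?r \<le> \<theta> * (2 * blocks_energy L J ?p + (\<Sum>j<J. 2 * \<sigma>\<^sup>2 * (norm (\<zeta> j))\<^sup>2))"
      using \<theta> by (intro mult_left_mono)
    also have "\<dots> = (4 * \<theta> * blocks_energy L J ?p) / 2 + (\<Sum>j\<in>{..<J}. 4 * \<theta> * \<sigma>\<^sup>2 * (norm (\<zeta> j))\<^sup>2) / 2"
      by (simp add: algebra_simps sum_distrib_left sum_divide_distrib)
    finally have "exp (\<theta> * blocks_energy L J ?r) \<le> exp ((4 * \<theta> * blocks_energy L J ?p) / 2) * exp ((\<Sum>j\<in>{..<J}. 4 * \<theta> * \<sigma>\<^sup>2 * (norm (\<zeta> j))\<^sup>2) / 2)"
      by (simp add: exp_add[symmetric])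
    also have "\<dots> \<le> (exp (4 * \<theta> * blocks_energy L J ?p) + exp (\<Sum>j\<in>{..<J}. 4 * \<theta> * \<sigma>\<^sup>2 * (norm (\<zeta> j))\<^sup>2)) / 2"
      by (rule am_gm)
    finally have "ennreal (exp (\<theta> * blocks_energy L J ?r)) \<le> ennreal ((exp (4 * \<theta> * blocks_energy L J ?p) + exp (\<Sum>j\<in>{..<J}. 4 * \<theta> * \<sigma>\<^sup>2 * (norm (\<zeta> j))\<^sup>2)) / 2)"
      by (rule ennreal_leI)
    also have "\<dots> = (f w (mix \<sigma> L J \<eta> \<zeta>) + q \<zeta>) / 2"
      unfolding f_def q_def response_site[OF L] by (simp add: divide_ennreal[symmetric] ennreal_plus)
    finally show ?thesis .
  qed
  have "(\<integral>\<^sup>+w. \<integral>\<^sup>+\<eta>. ennreal (exp (\<theta> * blocks_energy L J (response w \<eta>))) \<partial>E \<partial>PW) \<le>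
    (\<integral>\<^sup>+w. \<integral>\<^sup>+\<eta>. \<integral>\<^sup>+\<zeta>. (f w (mix \<sigma> L J \<eta> \<zeta>) + q \<zeta>) / 2 \<partial>gauss_vec {..<J} \<partial>E \<partial>PW)"
    \<comment> \<open>The left-hand side does not involve the shifts, so it is below the average of
      the pointwise bound over them.\<close>
    by (intro nn_integral_mono G.nn_integral_ge_const AE_I2 pt)
  also have "\<dots> = (\<integral>\<^sup>+w. ((\<integral>\<^sup>+e. f w e \<partial>gauss_vec UNIV) + ?q) / 2 \<partial>PW)"
  proof (rule nn_integral_cong)
    fix w :: "'d seq"
    have [simp]: "w \<in> space seq_space" by (simp add: space_PiM)
    have f2[measurable]: "(\<lambda>z. f w (\<lambda>k. fst z k + \<sigma> *\<^sub>R (\<Sum>j<J. site L k j *\<^sub>R snd z j))) \<in> borel_measurable (E \<Otimes>\<^sub>M gauss_vec {..<J})"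
      by (intro f' measurable_shift_mix) measurable
    have f3[measurable]: "(\<lambda>\<zeta>. f w (mix \<sigma> L J \<eta> \<zeta>)) \<in> borel_measurable (gauss_vec {..<J})" for \<eta>
      by (intro f' measurable_shift_mix) (auto simp: space_PiM)
    have f4: "(\<lambda>\<eta>. \<integral>\<^sup>+\<zeta>. f w (mix \<sigma> L J \<eta> \<zeta>) \<partial>gauss_vec {..<J}) \<in> borel_measurable E"
      using f2 by (intro G.borel_measurable_nn_integral) (simp add: case_prod_beta')
    have "(\<integral>\<^sup>+\<zeta>. (f w (mix \<sigma> L J \<eta> \<zeta>) + q \<zeta>) / 2 \<partial>gauss_vec {..<J}) =
      ((\<integral>\<^sup>+\<zeta>. f w (mix \<sigma> L J \<eta> \<zeta>) \<partial>gauss_vec {..<J}) + ?q) / 2" for \<eta>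
      by (subst nn_integral_divide) (simp_all add: nn_integral_add)
    then have "(\<integral>\<^sup>+\<eta>. \<integral>\<^sup>+\<zeta>. (f w (mix \<sigma> L J \<eta> \<zeta>) + q \<zeta>) / 2 \<partial>gauss_vec {..<J} \<partial>E) =
      ((\<integral>\<^sup>+\<eta>. \<integral>\<^sup>+\<zeta>. f w (mix \<sigma> L J \<eta> \<zeta>) \<partial>gauss_vec {..<J} \<partial>E) + ?q) / 2"
      using f4 by (simp add: nn_integral_divide nn_integral_add E.emeasure_space_1)
    also have "(\<integral>\<^sup>+\<eta>. \<integral>\<^sup>+\<zeta>. f w (mix \<sigma> L J \<eta> \<zeta>) \<partial>gauss_vec {..<J} \<partial>E) = (\<integral>\<^sup>+e. f w e \<partial>gauss_vec UNIV)"
    proof (rule split[symmetric])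
      show "f w \<in> borel_measurable seq_space"
        by (rule f') auto
      fix e e' :: "'d seq" assume "\<And>k. k < N \<Longrightarrow> e k = e' k"
      then have "blocks_energy L J (response w e) = blocks_energy L J (response w e')"
        using N by (intro blocks_energy_cong response_cong) auto
      then show "f w e = f w e'" by (simp add: f_def)
    qed
    finally show "(\<integral>\<^sup>+\<eta>. \<integral>\<^sup>+\<zeta>. (f w (mix \<sigma> L J \<eta> \<zeta>) + q \<zeta>) / 2 \<partial>gauss_vec {..<J} \<partial>E) =
      ((\<integral>\<^sup>+e. f w e \<partial>gauss_vec UNIV) + ?q) / 2" .
  qed
  also have "\<dots> = ((\<integral>\<^sup>+w. \<integral>\<^sup>+e. f w e \<partial>gauss_vec UNIV \<partial>PW) + ?q) / 2"
  proof -
    interpret U: prob_space "gauss_vec UNIV :: 'd seq measure" by (rule prob_space_gauss_vec)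
    have "(\<lambda>w. \<integral>\<^sup>+e. f w e \<partial>gauss_vec UNIV) \<in> borel_measurable PW"
      by (intro U.borel_measurable_nn_integral) (use f in \<open>simp add: case_prod_beta'\<close>)
    then show ?thesis
      by (simp add: nn_integral_divide nn_integral_add W.emeasure_space_1)
  qed
  also have "\<dots> \<le> (?c + ?c) / 2"
    using noise_energy_moment[of "4 * \<theta>" L J] \<theta> q_le unfolding f_def by (intro divide_right_mono_ennreal add_mono) auto
  also have "\<dots> = ?c" using divide_ennreal[of "2 * exp (\<kappa> * (real J / (1 - g)))" 2] by (simp add: ennreal_plus[symmetric] del: ennreal_plus)
  finally show ?thesis .
qed

section \<open>Comparison of two starting points\<close>

text \<open>The position at time n followed by the noises after time n. The starting point is the
  argument x instead of the one contained in z, so that two trajectories can be compared in the same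
  noise.\<close>

definition obs :: "real ^ 'd \<Rightarrow> nat \<Rightarrow> 'd state \<times> ('d seq) \<Rightarrow> 'd seq" where
  "obs x n z = case_nat (traj F x (noise_path z) n) (\<lambda>k. noise_path z (n + k))"

lemma measurable_case_nat_seq:
  assumes "y \<in> borel_measurable N" "\<And>k. (\<lambda>z. v z k) \<in> borel_measurable N"
  shows "(\<lambda>z. case_nat (y z) (v z)) \<in> N \<rightarrow>\<^sub>M (seq_space :: 'd seq measure)"
proof (rule measurable_PiM_single')
  fix i show "(\<lambda>z. case_nat (y z) (v z) i) \<in> borel_measurable N"
    using assms by (cases i) auto
qed auto

lemma measurable_obs:
  assumes "y \<in> borel_measurable N" and z: "z \<in> N \<rightarrow>\<^sub>M path_space"
  shows "(\<lambda>x. obs (y x) n (z x)) \<in> N \<rightarrow>\<^sub>M seq_space"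
proof -
  have "(\<lambda>x. noise_path (z x) k) \<in> borel_measurable N" for k
    by (rule measurable_compose[OF z measurable_noise_path])
  then show ?thesis
    unfolding obs_def by (intro measurable_case_nat_seq measurable_traj F_meas assms(1))
qed

text \<open>Both starting points see the same past and environment. If the energy S of the
  environment satisfies \<epsilon> S \<le> J / 4, the J contractions give exp (- \<beta> J / 2).
  Otherwise the difference is at most 1 \<le> exp (\<theta> S - K J), and the mean of this is at
  most exp (- J). The constants do not depend on p, the number of noises observed.\<close>

lemma coupling:
  obtains c D where "0 < c" "0 < D"
    "\<And>\<mu> J L n p A s s'. \<lbrakk>initial_distribution PW \<mu>; 0 < L; real J \<le> real L powr (H / 2); J * L \<le> n;
      A \<in> sets seq_space; \<And>y y'. (\<And>k. k \<le> p \<Longrightarrow> y k = y' k) \<Longrightarrow> y \<in> A \<longleftrightarrow> y' \<in> A;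
      s \<in> borel_measurable borel; s' \<in> borel_measurable borel\<rbrakk> \<Longrightarrow>
      (\<integral>\<^sup>+z. indicator A (obs (s (fst (fst z))) n z) \<partial>Om \<mu>) \<le>
      (\<integral>\<^sup>+z. indicator A (obs (s' (fst (fst z))) n z) \<partial>Om \<mu>)
        + ennreal (D * exp (- c * real J)) * (1 + (\<integral>\<^sup>+z. ennreal (V (s (fst z)) + V (s' (fst z))) \<partial>\<mu>))"
proof -
  obtain \<sigma> where \<sigma>: "0 < \<sigma>" and gram: "\<And>L J N p. \<lbrakk>0 < L; real J \<le> real L powr (H / 2); p < J\<rbrakk> \<Longrightarrow>
     \<sigma>\<^sup>2 * (\<Sum>q<J. \<Sum>k<N. site L k p * site L k q) \<le> 1"
    by (rule site_gram[OF that])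
  \<comment> \<open>The two constraints of \<open>environment_energy_moment\<close>.\<close>
  define \<theta> where "\<theta> = min (\<tau> / 4) (1 / (16 * \<sigma>\<^sup>2))"
  have \<theta>: "0 < \<theta>" "4 * \<theta> \<le> \<tau>" "4 * \<theta> * \<sigma>\<^sup>2 \<le> 1/4"
    using \<tau>_pos \<sigma> by (auto simp: \<theta>_def min_def field_simps)
  \<comment> \<open>One more than the exponential rate \<kappa> / (1 - g) of the energy moment, so
    that exp (- J) remains.\<close>
  define K where "K = \<kappa> / (1 - g) + 1"
  have K: "1 \<le> K" using \<kappa>_nonneg g by (simp add: K_def)
  \<comment> \<open>The bound 1/4 makes \<epsilon> (J + S) - J \<le> - J / 2 in ordinary
    environments; the other bound makes \<theta> S \<ge> K J in exceptional ones.\<close>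
  define \<epsilon> where "\<epsilon> = min (1/4) (\<theta> / (4 * K))"
  have \<epsilon>: "0 < \<epsilon>" "\<epsilon> \<le> 1/4" "K \<le> \<theta> / (4 * \<epsilon>)"
    using \<theta> K by (auto simp: \<epsilon>_def min_def field_simps)
  show thesis
  proof (rule iterated_contraction[OF \<sigma> \<epsilon>(1)], goal_cases)
  case (1 \<beta>)
  note \<beta> = 1(1) and contr = 1(2)[folded blocks_energy_def]
  \<comment> \<open>The slower of the two rates, exp (- J) for exceptional environments and exp (-
    \<beta> J / 2) for ordinary ones.\<close>
  define c where "c = min 1 (\<beta> / 2)"
  show thesis
  proof (rule that)
    \<comment> \<open>The constant D = 3 + \<beta> absorbs 1 from the exceptional environments and 2
      + \<beta> (V x + V y) from the weight of the contraction.\<close>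
    show "0 < c" "0 < 3 + \<beta>" using \<beta> by (auto simp: c_def)
    fix \<mu> J L n p A and s s' :: "real ^ 'd \<Rightarrow> real ^ 'd"
    assume \<mu>: "initial_distribution PW \<mu>" and L: "0 < L" and J: "real J \<le> real L powr (H / 2)" and n: "J * L \<le> n"
      and A[measurable]: "A \<in> sets (seq_space :: 'd seq measure)" and A_local: "\<And>y y'. (\<And>k. k \<le> p \<Longrightarrow> y k = y' k) \<Longrightarrow> y \<in> A \<longleftrightarrow> y' \<in> A"
      and s[measurable]: "s \<in> borel_measurable borel" "s' \<in> borel_measurable borel"
    note sets_\<mu>[OF \<mu>, measurable_cong]
    interpret \<mu>: prob_space \<mu> by (rule prob_\<mu>[OF \<mu>])
    interpret G: prob_space "gauss_vec {..<J} :: 'd seq measure" by (rule prob_space_gauss_vec)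
    define f :: "real ^ 'd \<Rightarrow> 'd seq \<Rightarrow> ('d seq) \<Rightarrow> ennreal" where
      "f x w e = indicator A (obs x n ((x, w), e))" for x w e
    have f_meas: "(\<lambda>z. f (u z) (v z) (e z)) \<in> borel_measurable N"
      if [measurable]: "u \<in> borel_measurable N" "v \<in> N \<rightarrow>\<^sub>M seq_space" "e \<in> N \<rightarrow>\<^sub>M seq_space" for u v e and N :: "'z measure"
      unfolding f_def by (intro measurable_compose[OF measurable_obs borel_measurable_indicator[OF A]]) measurable
    have obs_cong: "obs x n ((x', w), e) = obs x n ((x'', w), e)" for x x' x'' w e
      by (simp add: obs_def noise_path_def)
    \<comment> \<open>Coordinates of \<open>obs\<close> up to p involve the noises below n + p, and
      these depend on the innovations below n + p only: this is the dimension N of the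
      splitting.\<close>
    have f_local: "f x w e = f x w e'" if e: "\<And>k. k < n + p \<Longrightarrow> e k = e' k" for x w e e'
    proof -
      have r: "response w e k = response w e' k" if "k < n + p" for k
        using that by (intro response_cong e) auto
      have "traj F x (response w e) n = traj F x (response w e') n"
        by (intro traj_cong r) auto
      then have "obs x n ((x, w), e) k = obs x n ((x, w), e') k" if "k \<le> p" for k
        using that r unfolding obs_def noise_path_def by (cases k) auto
      then have "obs x n ((x, w), e) \<in> A \<longleftrightarrow> obs x n ((x, w), e') \<in> A"
        by (rule A_local)
      then show ?thesis by (simp add: f_def indicator_def)
    qed
    show "(\<integral>\<^sup>+z. indicator A (obs (s (fst (fst z))) n z) \<partial>Om \<mu>) \<le>
      (\<integral>\<^sup>+z. indicator A (obs (s' (fst (fst z))) n z) \<partial>Om \<mu>) + ennreal ((3 + \<beta>) * exp (- c * real J)) * (1 + (\<integral>\<^sup>+z. ennreal (V (s (fst z)) + V (s' (fst z))) \<partial>\<mu>))"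
    proof (rule gaussian_split_UNIV[OF site_nonneg less_imp_le[OF \<sigma>] gram[OF L J], where N="n + p"])
    fix E :: "'d seq measure"
    assume E: "prob_space E" and sets_E[measurable_cong]: "sets E = sets seq_space"
      and split: "\<And>f. \<lbrakk>f \<in> borel_measurable seq_space; \<And>e e'. (\<And>k. k < n + p \<Longrightarrow> e k = e' k) \<Longrightarrow> f e = f e'\<rbrakk> \<Longrightarrow>
       (\<integral>\<^sup>+e. f e \<partial>gauss_vec UNIV) = (\<integral>\<^sup>+\<eta>. \<integral>\<^sup>+\<zeta>. f (mix \<sigma> L J \<eta> \<zeta>) \<partial>gauss_vec {..<J} \<partial>E)"
    interpret E: prob_space E by fact
    define e1 where "e1 w \<eta> = ennreal (exp (\<theta> * blocks_energy L J (response w \<eta>)))" for w \<eta>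
    let ?I = "\<integral>\<^sup>+z. \<integral>\<^sup>+\<eta>. e1 (snd z) \<eta> \<partial>E \<partial>\<mu>"
    define d where "d = ennreal (exp (- (K * real J)))"
    define v where "v x y = ennreal (exp (- (\<beta> / 2 * real J)) * (2 + \<beta> * V x + \<beta> * V y))" for x y
    have e1_meas: "(\<lambda>z. e1 (fst z) (snd z)) \<in> borel_measurable (seq_space \<Otimes>\<^sub>M seq_space)"
      unfolding e1_def by measurable
    have pt: "(\<integral>\<^sup>+\<zeta>. f x w (mix \<sigma> L J \<eta> \<zeta>) \<partial>gauss_vec {..<J}) \<le> (\<integral>\<^sup>+\<zeta>. f y w (mix \<sigma> L J \<eta> \<zeta>) \<partial>gauss_vec {..<J}) + (e1 w \<eta> * d + v x y)" for x y w \<eta>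
    proof -
      let ?r = "response w \<eta>"
      \<comment> \<open>From time J L on, the noise carries no shift. With the environment frozen,
        the event is therefore one about the position at time J L alone.\<close>
      define B where "B = {u. case_nat (traj F u (\<lambda>k. ?r (J * L + k)) (n - J * L)) (\<lambda>k. ?r (n + k)) \<in> A}"
      have "(\<lambda>u. case_nat (traj F u (\<lambda>k. ?r (J * L + k)) (n - J * L)) (\<lambda>k. ?r (n + k))) \<in> borel \<rightarrow>\<^sub>M (seq_space :: 'd seq measure)"
        by (intro measurable_case_nat_seq measurable_traj F_meas) auto
      then have B: "B \<in> sets borel"
        using measurable_sets[OF _ A] unfolding B_def by (simp add: vimage_def space_PiM)
      have fB: "f x w (mix \<sigma> L J \<eta> \<zeta>) = ennreal (indicator B (traj F x (perturb \<sigma> L J ?r \<zeta>) (J * L)))" for x \<zeta>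
      proof -
        let ?p = "perturb \<sigma> L J ?r \<zeta>"
        have late: "?p (J * L + k) = ?r (J * L + k)" for k
          using L by (simp add: perturb_def)
        then have late': "?p (n + k) = ?r (n + k)" for k
          using late[of "n - J * L + k"] n by simp
        have "traj F x ?p n = traj F (traj F x ?p (J * L)) (\<lambda>k. ?r (J * L + k)) (n - J * L)"
          using traj_add[of F x ?p "J * L" "n - J * L"] n by (simp add: late)
        then have "obs x n ((x, w), mix \<sigma> L J \<eta> \<zeta>) = case_nat (traj F (traj F x ?p (J * L)) (\<lambda>k. ?r (J * L + k)) (n - J * L)) (\<lambda>k. ?r (n + k))"
          unfolding obs_def noise_path_def by (simp add: response_site[OF L] late')
        then show ?thesis
          by (simp add: f_def B_def indicator_def)
      qed
      define I where "I x = (\<integral>\<zeta>. indicator B (traj F x (perturb \<sigma> L J ?r \<zeta>) (J * L)) \<partial>gauss_vec {..<J} :: real)" for x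
      have mI: "(\<lambda>\<zeta>. indicator B (traj F x (perturb \<sigma> L J ?r \<zeta>) (J * L)) :: real) \<in> borel_measurable (gauss_vec {..<J})" for x
        by (intro measurable_compose[OF measurable_traj borel_measurable_indicator[OF B]] F_meas) (auto intro: measurable_perturb)
      have I: "(\<integral>\<^sup>+\<zeta>. f x w (mix \<sigma> L J \<eta> \<zeta>) \<partial>gauss_vec {..<J}) = ennreal (I x)" for x
        unfolding fB I_def
        by (rule nn_integral_eq_integral[OF G.integrable_const_bound[where B=1]]) (use mI in auto)
      have I01: "0 \<le> I x" "I x \<le> 1" for x
        unfolding I_def using G.integral_le_const[OF G.integrable_const_bound[where B=1, OF _ mI]] by auto
      define S where "S = blocks_energy L J ?r"
      have "I x \<le> I y + (exp (\<theta> * S) * exp (- (K * real J)) + exp (- (\<beta> / 2 * real J)) * (2 + \<beta> * V x + \<beta> * V y))"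
      \<comment> \<open>An ordinary environment uses the contraction, an exceptional one only that
        probabilities lie in [0, 1].\<close>
      proof (cases "\<epsilon> * S \<le> real J / 4")
        case True
        have "\<epsilon> * (real J + S) - real J \<le> - (real J / 2)"
          using True mult_right_mono[OF \<epsilon>(2), of "real J"] by (simp add: algebra_simps)
        then have "\<beta> * (\<epsilon> * (real J + S) - real J) \<le> \<beta> * - (real J / 2)"
          using \<beta> by (intro mult_left_mono) auto
        then have "exp (\<beta> * (\<epsilon> * (real J + S) - real J)) * (2 + \<beta> * V x + \<beta> * V y) \<le> exp (- (\<beta> / 2 * real J)) * (2 + \<beta> * V x + \<beta> * V y)"
          using \<beta> V_nonneg by (intro mult_right_mono add_nonneg_nonneg) auto
        moreover have "\<bar>I x - I y\<bar> \<le> exp (\<beta> * (\<epsilon> * (real J + S) - real J)) * (2 + \<beta> * V x + \<beta> * V y)"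
          unfolding I_def S_def by (rule contr[OF L]) (use B in auto)
        moreover have "0 \<le> exp (\<theta> * S) * exp (- (K * real J))" by simp
        ultimately show ?thesis by linarith
      next
        case False
        have "K * real J \<le> \<theta> / (4 * \<epsilon>) * real J"
          by (intro mult_right_mono \<epsilon>) auto
        also have "\<dots> = \<theta> / \<epsilon> * (real J / 4)" by simp
        also have "\<dots> \<le> \<theta> / \<epsilon> * (\<epsilon> * S)"
          using False \<theta> \<epsilon> by (intro mult_left_mono) auto
        also have "\<dots> = \<theta> * S" using \<epsilon> by simp
        finally have "1 \<le> exp (\<theta> * S) * exp (- (K * real J))"
          by (simp add: exp_add[symmetric])
        moreover have "0 \<le> exp (- (\<beta> / 2 * real J)) * (2 + \<beta> * V x + \<beta> * V y)"
          using \<beta> V_nonneg by (intro mult_nonneg_nonneg add_nonneg_nonneg) auto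
        ultimately show ?thesis using I01(2)[of x] I01(1)[of y] by linarith
      qed
      then have "ennreal (I x) \<le> ennreal (I y + (exp (\<theta> * S) * exp (- (K * real J)) + exp (- (\<beta> / 2 * real J)) * (2 + \<beta> * V x + \<beta> * V y)))"
        by (rule ennreal_leI)
      also have "\<dots> = ennreal (I y) + (e1 w \<eta> * d + v x y)"
        unfolding e1_def d_def v_def S_def[symmetric] using I01 \<beta> V_nonneg
        by (subst ennreal_plus, simp, simp, subst ennreal_plus) (auto simp: ennreal_mult)
      finally show ?thesis unfolding I .
    qed
    have st: "(\<integral>\<^sup>+e. f x w e \<partial>gauss_vec UNIV) \<le> (\<integral>\<^sup>+e. f y w e \<partial>gauss_vec UNIV) + ((\<integral>\<^sup>+\<eta>. e1 w \<eta> \<partial>E) * d + v x y)" for x y w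
    proof -
      have [simp]: "w \<in> space seq_space" by (simp add: space_PiM)
      have sp: "(\<integral>\<^sup>+e. f x w e \<partial>gauss_vec UNIV) = (\<integral>\<^sup>+\<eta>. \<integral>\<^sup>+\<zeta>. f x w (mix \<sigma> L J \<eta> \<zeta>) \<partial>gauss_vec {..<J} \<partial>E)" for x
        by (intro split f_meas f_local) auto
      have m1: "(\<lambda>\<eta>. \<integral>\<^sup>+\<zeta>. f y w (mix \<sigma> L J \<eta> \<zeta>) \<partial>gauss_vec {..<J}) \<in> borel_measurable E"
      proof (intro G.borel_measurable_nn_integral)
        have "(\<lambda>z. f y w (mix \<sigma> L J (fst z) (snd z))) \<in> borel_measurable (E \<Otimes>\<^sub>M gauss_vec {..<J})"
          by (intro f_meas measurable_shift_mix) measurable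
        then show "(\<lambda>(\<eta>, \<zeta>). f y w (mix \<sigma> L J \<eta> \<zeta>)) \<in> borel_measurable (E \<Otimes>\<^sub>M gauss_vec {..<J})"
          by (simp add: case_prod_beta')
      qed
      have m2[measurable]: "e1 w \<in> borel_measurable E"
        unfolding e1_def by measurable
      have "(\<integral>\<^sup>+e. f x w e \<partial>gauss_vec UNIV) \<le> (\<integral>\<^sup>+\<eta>. (\<integral>\<^sup>+\<zeta>. f y w (mix \<sigma> L J \<eta> \<zeta>) \<partial>gauss_vec {..<J}) + (e1 w \<eta> * d + v x y) \<partial>E)"
        unfolding sp by (intro nn_integral_mono pt)
      also have "\<dots> = (\<integral>\<^sup>+e. f y w e \<partial>gauss_vec UNIV) + ((\<integral>\<^sup>+\<eta>. e1 w \<eta> \<partial>E) * d + v x y)"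
        unfolding sp using m1 by (simp add: nn_integral_add nn_integral_multc E.emeasure_space_1)
      finally show ?thesis .
    qed
    interpret U: prob_space "gauss_vec UNIV :: 'd seq measure" by (rule prob_space_gauss_vec)
    have Om: "(\<integral>\<^sup>+z. indicator A (obs (q (fst (fst z))) n z) \<partial>Om \<mu>) = (\<integral>\<^sup>+z. \<integral>\<^sup>+e. f (q (fst z)) (snd z) e \<partial>gauss_vec UNIV \<partial>\<mu>)"
      and mm: "(\<lambda>z. \<integral>\<^sup>+e. f (q (fst z)) (snd z) e \<partial>gauss_vec UNIV) \<in> borel_measurable \<mu>"
      if [measurable]: "q \<in> borel_measurable borel" for q
    proof -
      have m: "(\<lambda>z. f (q (fst (fst z))) (snd (fst z)) (snd z)) \<in> borel_measurable (\<mu> \<Otimes>\<^sub>M gauss_vec UNIV)"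
      proof -
        have "(\<lambda>z. f (q (fst (fst z))) (snd (fst z)) (snd z)) \<in> borel_measurable path_space"
          by (rule f_meas) measurable
        then show ?thesis
          by (simp add: measurable_Om[OF \<mu>, unfolded Om_def])
      qed
      have eq: "indicator A (obs (q (fst (fst z))) n z) = f (q (fst (fst z))) (snd (fst z)) (snd z)" for z
        using obs_cong[of "q (fst (fst z))" "fst (fst z)" "snd (fst z)" "snd z" "q (fst (fst z))"] by (simp add: f_def)
      show "(\<integral>\<^sup>+z. indicator A (obs (q (fst (fst z))) n z) \<partial>Om \<mu>) = (\<integral>\<^sup>+z. \<integral>\<^sup>+e. f (q (fst z)) (snd z) e \<partial>gauss_vec UNIV \<partial>\<mu>)"
        unfolding Om_def eq using nn_integral_fst_prob[OF prob_space_gauss_vec m] by simp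
      show "(\<lambda>z. \<integral>\<^sup>+e. f (q (fst z)) (snd z) e \<partial>gauss_vec UNIV) \<in> borel_measurable \<mu>"
        using m by (intro U.borel_measurable_nn_integral) (simp add: case_prod_beta')
    qed
    have e_meas: "(\<lambda>w. \<integral>\<^sup>+\<eta>. e1 w \<eta> \<partial>E) \<in> borel_measurable seq_space"
      using e1_meas by (intro E.borel_measurable_nn_integral) (simp add: case_prod_beta')
    have e_mu: "(\<lambda>z. \<integral>\<^sup>+\<eta>. e1 (snd z) \<eta> \<partial>E) \<in> borel_measurable \<mu>"
      unfolding measurable_initial[OF \<mu>] by (rule measurable_compose[OF measurable_snd e_meas])
    have snd_mu[measurable]: "snd \<in> \<mu> \<rightarrow>\<^sub>M seq_space" and fst_mu[measurable]: "fst \<in> borel_measurable \<mu>"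
      unfolding measurable_initial[OF \<mu>] by measurable
    have v_mu[measurable]: "(\<lambda>z. v (s (fst z)) (s' (fst z))) \<in> borel_measurable \<mu>"
      unfolding v_def measurable_initial[OF \<mu>] by measurable
    let ?W = "\<integral>\<^sup>+z. ennreal (V (s (fst z)) + V (s' (fst z))) \<partial>\<mu>"
    have "(\<integral>\<^sup>+z. indicator A (obs (s (fst (fst z))) n z) \<partial>Om \<mu>) \<le>
      (\<integral>\<^sup>+z. (\<integral>\<^sup>+e. f (s' (fst z)) (snd z) e \<partial>gauss_vec UNIV) + ((\<integral>\<^sup>+\<eta>. e1 (snd z) \<eta> \<partial>E) * d + v (s (fst z)) (s' (fst z))) \<partial>\<mu>)"
      unfolding Om[OF s(1)] by (intro nn_integral_mono st)
    also have "\<dots> = (\<integral>\<^sup>+z. indicator A (obs (s' (fst (fst z))) n z) \<partial>Om \<mu>) +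
       (?I * d + (\<integral>\<^sup>+z. v (s (fst z)) (s' (fst z)) \<partial>\<mu>))"
      unfolding Om[OF s(2)] using mm[OF s(2)] e_mu by (simp add: nn_integral_add nn_integral_multc)
    also have "\<dots> \<le> (\<integral>\<^sup>+z. indicator A (obs (s' (fst (fst z))) n z) \<partial>Om \<mu>) + ennreal ((3 + \<beta>) * exp (- c * real J)) * (1 + ?W)"
    proof (rule add_left_mono)
      have "?I = (\<integral>\<^sup>+w. \<integral>\<^sup>+\<eta>. e1 w \<eta> \<partial>E \<partial>PW)"
        unfolding snd_\<mu>[OF \<mu>, symmetric] using e_meas by (subst nn_integral_distr[OF snd_mu]) auto
      also have "\<dots> \<le> ennreal (exp (\<kappa> * (real J / (1 - g))))"
        unfolding e1_def by (rule environment_energy_moment[OF E sets_E, where N="n + p" and \<sigma>=\<sigma>]) (fact split, use n L \<theta> in simp_all)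
      finally have "?I * d \<le> ennreal (exp (\<kappa> * (real J / (1 - g)))) * d"
        by (rule mult_right_mono) simp
      also have "\<dots> = ennreal (exp (- real J))"
        unfolding d_def K_def by (simp add: ennreal_mult[symmetric] exp_add[symmetric] algebra_simps)
      also have "\<dots> \<le> ennreal (exp (- c * real J))"
        using mult_right_mono[of c 1 "real J"] by (intro ennreal_leI) (simp add: c_def)
      finally have 1: "?I * d \<le> ennreal (exp (- c * real J))" .
      have cJ: "exp (- (\<beta> / 2 * real J)) \<le> exp (- c * real J)"
        using mult_right_mono[of c "\<beta> / 2" "real J"] by (simp add: c_def)
      have "v x y \<le> ennreal (exp (- c * real J)) * (2 + ennreal \<beta> * ennreal (V x + V y))" for x y
      proof -
        have "v x y \<le> ennreal (exp (- c * real J) * (2 + \<beta> * (V x + V y)))"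
          unfolding v_def using cJ \<beta> V_nonneg by (intro ennreal_leI) (auto simp: algebra_simps intro!: add_mono mult_left_mono mult_right_mono)
        also have "\<dots> = ennreal (exp (- c * real J)) * (2 + ennreal \<beta> * ennreal (V x + V y))"
          using \<beta> V_nonneg by (simp add: ennreal_mult)
        finally show ?thesis .
      qed
      then have "(\<integral>\<^sup>+z. v (s (fst z)) (s' (fst z)) \<partial>\<mu>) \<le> (\<integral>\<^sup>+z. ennreal (exp (- c * real J)) * (2 + ennreal \<beta> * ennreal (V (s (fst z)) + V (s' (fst z)))) \<partial>\<mu>)"
        by (intro nn_integral_mono)
      also have "\<dots> = ennreal (exp (- c * real J)) * (2 + ennreal \<beta> * ?W)"
        by (simp add: nn_integral_cmult nn_integral_add \<mu>.emeasure_space_1)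
      finally have 2: "(\<integral>\<^sup>+z. v (s (fst z)) (s' (fst z)) \<partial>\<mu>) \<le> ennreal (exp (- c * real J)) * (2 + ennreal \<beta> * ?W)" .
      have "?I * d + (\<integral>\<^sup>+z. v (s (fst z)) (s' (fst z)) \<partial>\<mu>) \<le> ennreal (exp (- c * real J)) * 1 + ennreal (exp (- c * real J)) * (2 + ennreal \<beta> * ?W)"
        using 1 2 by (intro add_mono) auto
      also have "\<dots> = ennreal (exp (- c * real J)) * (3 + ennreal \<beta> * ?W)"
        unfolding distrib_left[symmetric] add.assoc[symmetric] by simp
      also have "\<dots> \<le> ennreal (exp (- c * real J)) * (ennreal (3 + \<beta>) * (1 + ?W))"
      proof (rule mult_left_mono)
        have "3 + ennreal \<beta> * ?W \<le> ennreal (3 + \<beta>) * 1 + ennreal (3 + \<beta>) * ?W"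
        proof (intro add_mono mult_right_mono)
          have "ennreal 3 \<le> ennreal (3 + \<beta>)" using \<beta> by (intro ennreal_leI) auto
          then show "3 \<le> ennreal (3 + \<beta>) * 1" by simp
          show "ennreal \<beta> \<le> ennreal (3 + \<beta>)" using \<beta> by (intro ennreal_leI) auto
        qed simp
        then show "3 + ennreal \<beta> * ?W \<le> ennreal (3 + \<beta>) * (1 + ?W)"
          by (simp add: distrib_left)
      qed simp
      finally show "?I * d + (\<integral>\<^sup>+z. v (s (fst z)) (s' (fst z)) \<partial>\<mu>) \<le> ennreal ((3 + \<beta>) * exp (- c * real J)) * (1 + ?W)"
        using \<beta> by (simp add: ennreal_mult mult.assoc[symmetric] mult.commute)
    qed
    finally show "(\<integral>\<^sup>+z. indicator A (obs (s (fst (fst z))) n z) \<partial>Om \<mu>) \<le>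
      (\<integral>\<^sup>+z. indicator A (obs (s' (fst (fst z))) n z) \<partial>Om \<mu>) + ennreal ((3 + \<beta>) * exp (- c * real J)) * (1 + ?W)" .
    qed
  qed
  qed
qed

end

subsection \<open>Forgetting in total variation\<close>

definition local_set :: "nat \<Rightarrow> (nat \<Rightarrow> 'a::topological_space) set \<Rightarrow> bool" where
  "local_set p A \<longleftrightarrow> A \<in> sets (PiM UNIV (\<lambda>_. borel)) \<and> (\<forall>y y'. (\<forall>k\<le>p. y k = y' k) \<longrightarrow> (y \<in> A \<longleftrightarrow> y' \<in> A))"

lemma local_set_sets[measurable_dest]: "local_set p A \<Longrightarrow> A \<in> sets (PiM UNIV (\<lambda>_. borel))"
  by (simp add: local_set_def)

lemma local_set_mono: "local_set p A \<Longrightarrow> p \<le> q \<Longrightarrow> local_set q A"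
  unfolding local_set_def by (meson order_trans)

lemma local_setD: "local_set p A \<Longrightarrow> (\<And>k. k \<le> p \<Longrightarrow> y k = y' k) \<Longrightarrow> y \<in> A \<longleftrightarrow> y' \<in> A"
  unfolding local_set_def by blast

lemma local_set_UN:
  fixes B :: "'i \<Rightarrow> (nat \<Rightarrow> 'a::topological_space) set"
  assumes "\<And>i. i \<in> I \<Longrightarrow> local_set (p i) (B i)" "finite I"
  shows "local_set (Max (insert 0 (p ` I))) (\<Union>i\<in>I. B i)"
proof -
  let ?q = "Max (insert 0 (p ` I))"
  have l: "local_set ?q (B i)" if "i \<in> I" for i
    using assms that by (intro local_set_mono[OF assms(1)]) auto
  show ?thesis
    unfolding local_set_def
  proof (intro conjI allI impI)
    show "(\<Union>i\<in>I. B i) \<in> sets (PiM UNIV (\<lambda>_. borel))"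
      using assms local_set_sets[OF l] by (intro sets.finite_UN) auto
    fix y y' :: "nat \<Rightarrow> 'a" assume "\<forall>k\<le>?q. y k = y' k"
    then have "y \<in> B i \<longleftrightarrow> y' \<in> B i" if "i \<in> I" for i
      using local_setD[OF l[OF that]] by blast
    then show "y \<in> (\<Union>i\<in>I. B i) \<longleftrightarrow> y' \<in> (\<Union>i\<in>I. B i)" by auto
  qed
qed

text \<open>Induction over the generation of the product \<sigma>-algebra, with one approximant for
  both measures at once. A countable union is cut at n so that at most \<epsilon> / 2 of mass is
  lost, and each of its n members is approximated within \<epsilon> / (2 (n + 1)). Inequalities with
  an additive constant thus extend from local events to all events.\<close>

lemma local_sets_dense:
  fixes A :: "(nat \<Rightarrow> 'a::topological_space) set"
  assumes \<mu>: "finite_measure \<mu>" and \<nu>: "finite_measure \<nu>"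
    and sets: "sets \<mu> = sets (PiM UNIV (\<lambda>_. borel))" "sets \<nu> = sets (PiM UNIV (\<lambda>_. borel))"
    and A: "A \<in> sets (PiM UNIV (\<lambda>_. borel))" and \<epsilon>: "0 < \<epsilon>"
  shows "\<exists>p B. local_set p B \<and> measure \<mu> (sym_diff A B) + measure \<nu> (sym_diff A B) < \<epsilon>"
proof -
  interpret \<mu>: finite_measure \<mu> by fact
  interpret \<nu>: finite_measure \<nu> by fact
  have "A \<in> sigma_sets (\<Pi>\<^sub>E i\<in>UNIV. space (borel :: 'a measure)) {{f\<in>\<Pi>\<^sub>E i\<in>UNIV. space borel. f i \<in> A} | i A. i \<in> UNIV \<and> A \<in> sets (borel :: 'a measure)}"
    using A unfolding sets_PiM_single by simp
  then show ?thesis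
    using \<epsilon>
  proof (induction arbitrary: \<epsilon>)
    case (Basic X)
    then obtain i Y where X: "X = {f. f i \<in> Y}" and Y: "Y \<in> sets (borel :: 'a measure)" by auto
    have "local_set i X"
      unfolding local_set_def X using measurable_sets[OF measurable_component_singleton[of i UNIV "\<lambda>_. borel :: 'a measure"] Y]
      by (auto simp: vimage_def space_PiM)
    then show ?case using Basic by (intro exI[of _ i] exI[of _ X]) simp
  next
    case Empty
    then show ?case by (intro exI[of _ 0] exI[of _ "{}"]) (simp add: local_set_def)
  next
    case (Compl X)
    then obtain p B where B: "local_set p B" "measure \<mu> (sym_diff X B) + measure \<nu> (sym_diff X B) < \<epsilon>" by blast
    have "local_set p (UNIV - B)"
      using B(1) sets.compl_sets[OF local_set_sets[OF B(1)]] by (auto simp: local_set_def space_PiM)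
    moreover have "sym_diff ((\<Pi>\<^sub>E i\<in>UNIV. space borel) - X) (UNIV - B) = sym_diff X B" by auto
    ultimately show ?case using B(2) by (intro exI[of _ p] exI[of _ "UNIV - B"]) simp
  next
    case (Union X)
    have X: "X i \<in> sets (PiM UNIV (\<lambda>_. borel))" for i
      using Union(1)[of i] unfolding sets_PiM_single by simp
    have X'[simp]: "X i \<in> sets \<mu>" "X i \<in> sets \<nu>" for i
      using X sets by auto
    have inc: "incseq (\<lambda>n. \<Union>i<n. X i)"
      unfolding incseq_def by (intro allI impI UN_mono) auto
    have "(\<lambda>n. measure \<mu> (\<Union>i<n. X i) + measure \<nu> (\<Union>i<n. X i)) \<longlonglongrightarrow> measure \<mu> (\<Union>n. \<Union>i<n. X i) + measure \<nu> (\<Union>n. \<Union>i<n. X i)"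
      by (intro tendsto_add \<mu>.finite_Lim_measure_incseq \<nu>.finite_Lim_measure_incseq inc) (auto intro!: sets.finite_UN)
    also have "(\<Union>n. \<Union>i<n. X i) = (\<Union>i. X i)" by auto
    finally have "\<forall>\<^sub>F n in sequentially. measure \<mu> (\<Union>i. X i) + measure \<nu> (\<Union>i. X i) - \<epsilon> / 2 < measure \<mu> (\<Union>i<n. X i) + measure \<nu> (\<Union>i<n. X i)"
      using Union(3) by (intro order_tendstoD(1)) auto
    then obtain n where n: "measure \<mu> (\<Union>i. X i) + measure \<nu> (\<Union>i. X i) - \<epsilon> / 2 < measure \<mu> (\<Union>i<n. X i) + measure \<nu> (\<Union>i<n. X i)"
      by (auto simp: eventually_sequentially)
    have "\<forall>i. \<exists>p B. local_set p B \<and> measure \<mu> (sym_diff (X i) B) + measure \<nu> (sym_diff (X i) B) < \<epsilon> / (2 * real (Suc n))"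
      using Union(2,3) by simp
    then obtain p B where B: "\<And>i. local_set (p i) (B i)" "\<And>i. measure \<mu> (sym_diff (X i) (B i)) + measure \<nu> (sym_diff (X i) (B i)) < \<epsilon> / (2 * real (Suc n))"
      by metis
    have B'[simp]: "B i \<in> sets \<mu>" "B i \<in> sets \<nu>" for i
      using local_set_sets[OF B(1)] sets by auto
    have "\<exists>q. local_set q (\<Union>i<n. B i)"
      using local_set_UN[of "{..<n}" p B] B(1) by blast
    then obtain q where q: "local_set q (\<Union>i<n. B i)" by blast
    have bnd: "measure \<rho> (sym_diff (\<Union>i. X i) (\<Union>i<n. B i)) \<le> (measure \<rho> (\<Union>i. X i) - measure \<rho> (\<Union>i<n. X i)) + (\<Sum>i<n. measure \<rho> (sym_diff (X i) (B i)))"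
      if \<rho>: "finite_measure \<rho>" "sets \<rho> = sets (PiM UNIV (\<lambda>_. borel))" for \<rho> :: "(nat \<Rightarrow> 'a) measure"
    proof -
      interpret \<rho>: finite_measure \<rho> by fact
      have [simp]: "X i \<in> sets \<rho>" "B i \<in> sets \<rho>" for i
        using \<rho>(2) X local_set_sets[OF B(1)] by auto
      have "measure \<rho> (sym_diff (\<Union>i. X i) (\<Union>i<n. B i)) \<le> measure \<rho> (((\<Union>i. X i) - (\<Union>i<n. X i)) \<union> (\<Union>i<n. sym_diff (X i) (B i)))"
        by (intro \<rho>.finite_measure_mono) (auto intro!: sets.Un sets.Diff sets.finite_UN sets.countable_UN)
      also have "\<dots> \<le> measure \<rho> ((\<Union>i. X i) - (\<Union>i<n. X i)) + measure \<rho> (\<Union>i<n. sym_diff (X i) (B i))"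
        by (intro measure_Un_le) (auto intro!: sets.Un sets.Diff sets.finite_UN sets.countable_UN)
      also have "measure \<rho> ((\<Union>i. X i) - (\<Union>i<n. X i)) = measure \<rho> (\<Union>i. X i) - measure \<rho> (\<Union>i<n. X i)"
        by (intro \<rho>.finite_measure_Diff) (auto intro!: sets.finite_UN sets.countable_UN)
      also have "measure \<rho> (\<Union>i<n. sym_diff (X i) (B i)) \<le> (\<Sum>i<n. measure \<rho> (sym_diff (X i) (B i)))"
        by (intro \<rho>.finite_measure_subadditive_finite) (auto intro!: sets.Un sets.Diff)
      finally show ?thesis by simp
    qed
    have "measure \<mu> (sym_diff (\<Union>i. X i) (\<Union>i<n. B i)) + measure \<nu> (sym_diff (\<Union>i. X i) (\<Union>i<n. B i)) \<le>
      (measure \<mu> (\<Union>i. X i) - measure \<mu> (\<Union>i<n. X i)) + (measure \<nu> (\<Union>i. X i) - measure \<nu> (\<Union>i<n. X i))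
        + (\<Sum>i<n. measure \<mu> (sym_diff (X i) (B i)) + measure \<nu> (sym_diff (X i) (B i)))"
      using bnd[OF \<mu> sets(1)] bnd[OF \<nu> sets(2)] by (simp add: sum.distrib)
    also have "\<dots> \<le> (measure \<mu> (\<Union>i. X i) - measure \<mu> (\<Union>i<n. X i)) + (measure \<nu> (\<Union>i. X i) - measure \<nu> (\<Union>i<n. X i))
        + (\<Sum>i<n. \<epsilon> / (2 * real (Suc n)))"
      by (intro add_left_mono sum_mono less_imp_le B(2))
    also have "\<dots> < \<epsilon> / 2 + real n * (\<epsilon> / (2 * real (Suc n)))"
      using n by simp
    also have "\<dots> \<le> \<epsilon>"
      using Union(3) by (simp add: field_simps)
    finally show ?case using q by blast
  qed
qed

lemma measure_le_from_local:
  fixes A :: "(nat \<Rightarrow> 'a::topological_space) set"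
  assumes \<mu>: "finite_measure \<mu>" and \<nu>: "finite_measure \<nu>"
    and sets: "sets \<mu> = sets (PiM UNIV (\<lambda>_. borel))" "sets \<nu> = sets (PiM UNIV (\<lambda>_. borel))"
    and le: "\<And>p B. local_set p B \<Longrightarrow> measure \<mu> B \<le> measure \<nu> B + c"
    and A: "A \<in> sets (PiM UNIV (\<lambda>_. borel))"
  shows "measure \<mu> A \<le> measure \<nu> A + c"
proof (rule field_le_epsilon)
  fix \<epsilon> :: real assume "0 < \<epsilon>"
  then obtain p B where B: "local_set p B" "measure \<mu> (sym_diff A B) + measure \<nu> (sym_diff A B) < \<epsilon>"
    using local_sets_dense[OF \<mu> \<nu> sets A] by blast
  have near: "measure \<rho> C \<le> measure \<rho> D + measure \<rho> (sym_diff C D)"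
    if \<rho>: "finite_measure \<rho>" "C \<in> sets \<rho>" "D \<in> sets \<rho>" for \<rho> :: "(nat \<Rightarrow> 'a) measure" and C D
  proof -
    interpret \<rho>: finite_measure \<rho> by fact
    have "measure \<rho> C \<le> measure \<rho> (D \<union> sym_diff C D)"
      using that by (intro \<rho>.finite_measure_mono) auto
    also have "\<dots> \<le> measure \<rho> D + measure \<rho> (sym_diff C D)"
      using that by (intro measure_Un_le) auto
    finally show ?thesis .
  qed
  have s: "A \<in> sets \<mu>" "B \<in> sets \<mu>" "A \<in> sets \<nu>" "B \<in> sets \<nu>"
    using A local_set_sets[OF B(1)] sets by auto
  have "sym_diff B A = sym_diff A B" by auto
  then show "measure \<mu> A \<le> measure \<nu> A + c + \<epsilon>"
    using near[OF \<mu> s(1,2)] near[OF \<nu> s(4,3)] le[OF B(1)] B(2) by simp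
qed

lemma measure_eq_from_local:
  fixes \<mu> \<nu> :: "(nat \<Rightarrow> 'a::topological_space) measure"
  assumes \<mu>: "finite_measure \<mu>" and \<nu>: "finite_measure \<nu>"
    and sets: "sets \<mu> = sets (PiM UNIV (\<lambda>_. borel))" "sets \<nu> = sets (PiM UNIV (\<lambda>_. borel))"
    and eq: "\<And>p B. local_set p B \<Longrightarrow> measure \<mu> B = measure \<nu> B"
  shows "\<mu> = \<nu>"
proof (rule measure_eqI)
  fix A assume "A \<in> sets \<mu>"
  then have A: "A \<in> sets (PiM UNIV (\<lambda>_. borel))" using sets by simp
  have "measure \<mu> A = measure \<nu> A"
    using measure_le_from_local[OF \<mu> \<nu> sets, of 0, OF _ A] measure_le_from_local[OF \<nu> \<mu> sets(2,1), of 0, OF _ A] eq by auto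
  then show "emeasure \<mu> A = emeasure \<nu> A"
    by (simp add: finite_measure.emeasure_eq_measure[OF \<mu>] finite_measure.emeasure_eq_measure[OF \<nu>])
qed (simp add: sets)

text \<open>With k so large that q k \<ge> 1, the number n is at most a constant times the k-th
  power of c n^q, and x^k exp (- x) is bounded along this sequence.\<close>

lemma exp_powr_bound:
  fixes c q :: real
  assumes c: "0 < c" and q: "0 < q"
  obtains K where "0 < K" "\<And>n. n \<ge> 1 \<Longrightarrow> exp (- c * real n powr q) \<le> K / real n"
proof -
  define k where "k = nat \<lceil>1 / q\<rceil>"
  have k: "1 \<le> q * real k"
  proof -
    have "1 / q \<le> real k" unfolding k_def by linarith
    then show ?thesis using q by (simp add: field_simps)
  qed
  have "filterlim (\<lambda>n. c * real n powr q) at_top sequentially"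
    by (intro filterlim_tendsto_pos_mult_at_top[OF tendsto_const c] filterlim_compose[OF real_powr_at_top[OF q] filterlim_real_sequentially])
  then have "(\<lambda>n. (c * real n powr q) ^ k / exp (c * real n powr q)) \<longlonglongrightarrow> 0"
    by (rule filterlim_compose[OF tendsto_power_div_exp_0])
  then have "Bseq (\<lambda>n. (c * real n powr q) ^ k / exp (c * real n powr q))"
    by (intro convergent_imp_Bseq convergentI)
  then obtain B where B: "0 < B" "\<And>n. norm ((c * real n powr q) ^ k / exp (c * real n powr q)) \<le> B"
    by (rule BseqE) blast
  show thesis
  proof (rule that)
    show "0 < B / c ^ k" using B c by simp
    fix n :: nat assume n: "n \<ge> 1"
    have "real n powr 1 \<le> real n powr (q * real k)"
      using n k by (intro powr_mono) auto
    also have "\<dots> = (real n powr q) ^ k"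
      using n by (simp add: powr_powr[symmetric] powr_realpow)
    finally have "real n * c ^ k \<le> (c * real n powr q) ^ k"
      using n c by (simp add: power_mult_distrib mult.commute)
    then have "real n * c ^ k * exp (- c * real n powr q) \<le> (c * real n powr q) ^ k / exp (c * real n powr q)"
      by (simp add: exp_minus field_simps mult_right_mono)
    also have "\<dots> \<le> B" using order_trans[OF abs_ge_self B(2)[of n, unfolded real_norm_def]] .
    finally show "exp (- c * real n powr q) \<le> B / c ^ k / real n"
      using n c by (simp add: field_simps)
  qed
qed

section \<open>Rate of forgetting\<close>

context model
begin

definition obs_law :: "'d state measure \<Rightarrow> nat \<Rightarrow> 'd seq measure" where
  "obs_law \<mu> n = distr (Om \<mu>) seq_space (\<lambda>z. obs (fst (fst z)) n z)"

text \<open>The chain started at 0 with the stationary past. By \<open>ref_law_eq\<close> this is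
  the same law whatever the initial distribution, because all of them share the marginal on pasts;
  any two can be compared through it.\<close>

definition ref_law :: "nat \<Rightarrow> 'd seq measure" where
  "ref_law n = distr (PW \<Otimes>\<^sub>M gauss_vec UNIV) seq_space (\<lambda>v. obs 0 n ((0, fst v), snd v))"

definition V_mean :: "'d state measure \<Rightarrow> ennreal" where
  "V_mean \<mu> = (\<integral>\<^sup>+z. ennreal (V (fst z)) \<partial>\<mu>)"

lemma measurable_obs_fst[measurable]:
  "(\<lambda>z. obs (fst (fst z)) n z) \<in> path_space \<rightarrow>\<^sub>M seq_space"
  by (intro measurable_obs) measurable

lemma measurable_obs_0[measurable]:
  "obs 0 n \<in> path_space \<rightarrow>\<^sub>M seq_space"
  by (intro measurable_obs) measurable

lemma obs_start_irrelevant: "obs x n ((y, w), e) = obs x n ((y', w), e)"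
  by (simp add: obs_def noise_path_def)

lemma ref_law_eq:
  assumes \<mu>: "initial_distribution PW \<mu>"
  shows "distr (Om \<mu>) seq_space (obs 0 n) = ref_law n"
proof -
  have m: "(\<lambda>z. (snd (fst z), snd z)) \<in> Om \<mu> \<rightarrow>\<^sub>M seq_space \<Otimes>\<^sub>M seq_space"
    unfolding measurable_Om[OF \<mu>] by measurable
  have m2: "(\<lambda>v. obs 0 n ((0, fst v), snd v)) \<in> seq_space \<Otimes>\<^sub>M seq_space \<rightarrow>\<^sub>M (seq_space :: 'd seq measure)"
    by (intro measurable_obs) measurable
  have "ref_law n = distr (Om \<mu>) seq_space ((\<lambda>v. obs 0 n ((0, fst v), snd v)) \<circ> (\<lambda>z. (snd (fst z), snd z)))"
    unfolding ref_law_def Om_noise[OF \<mu>, symmetric] by (rule distr_distr[OF m2 m])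
  also have "(\<lambda>v. obs 0 n ((0, fst v), snd v)) \<circ> (\<lambda>z. (snd (fst z), snd z)) = obs 0 n"
    using obs_start_irrelevant[of 0 n 0] by (auto simp: fun_eq_iff comp_def)
  finally show ?thesis ..
qed

text \<open>\<open>coupling\<close> is applied in both directions, with the starting maps identity
  and constant 0 over the same past, and J and L are chosen as functions of n. A stretched
  exponential rate in n is weakened to 1 / n.\<close>

lemma forgetting:
  obtains C where "0 < C" "\<And>\<mu> n A. \<lbrakk>initial_distribution PW \<mu>; V_mean \<mu> < \<infinity>; n \<ge> 1; A \<in> sets seq_space\<rbrakk> \<Longrightarrow>
     \<bar>measure (obs_law \<mu> n) A - measure (ref_law n) A\<bar> \<le> C * (1 + enn2real (V_mean \<mu>)) / real n"
proof -
  show thesis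
  proof (rule coupling, goal_cases)
  case (1 c D)
  note c = 1(1) and D = 1(2) and cpl = 1(3)
  obtain K where K: "0 < K" "\<And>n. n \<ge> 1 \<Longrightarrow> exp (- c * real n powr (H / 4)) \<le> K / real n"
    using exp_powr_bound[of c "H / 4"] c H_pos by auto
  \<comment> \<open>The summand 8 covers n < 8, where no block is used (J = 0); exp c pays for
    rounding J down.\<close>
  define K' where "K' = exp c * K + 8"
  have blocks: "\<exists>J L. 0 < L \<and> real J \<le> real L powr (H / 2) \<and> J * L \<le> n \<and> exp (- c * real J) \<le> K' / real n" if n: "n \<ge> 1" for n
  proof (cases "n < 8")
    case True
    have "real n \<le> K'" using True K by (simp add: K'_def add_increasing)
    then show ?thesis
      using n by (intro exI[of _ 0] exI[of _ 1]) (auto simp: field_simps)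
  next
    case False
    \<comment> \<open>With L about n^(1/2), the condition J \<le> L^(H/2) of
      \<open>site_gram\<close> leads to the exponent H / 4.\<close>
    define J where "J = nat \<lfloor>real n powr (H / 4)\<rfloor>"
    define L where "L = nat \<lceil>real n powr (1/2)\<rceil>"
    have J: "real J \<le> real n powr (H / 4)" "real n powr (H / 4) - 1 \<le> real J" unfolding J_def by auto
    have L: "real n powr (1/2) \<le> real L" "real L \<le> real n powr (1/2) + 1" proof -
      have "0 \<le> \<lceil>real n powr (1/2)\<rceil>" by (simp add: order_trans[OF _ powr_ge_zero, of "-1"] less_le_trans[OF _ powr_ge_zero])
      then have "real L = of_int \<lceil>real n powr (1/2)\<rceil>" unfolding L_def by simp
      then show "real n powr (1/2) \<le> real L" "real L \<le> real n powr (1/2) + 1" by linarith+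
    qed
    have n1: "1 \<le> real n powr (1/2)" using n by (intro ge_one_powr_ge_zero) auto
    have "0 < L" using L n1 by (cases L) auto
    moreover have "real J \<le> real L powr (H / 2)"
    proof -
      have "real n powr (H / 4) = (real n powr (1/2)) powr (H / 2)" by (simp add: powr_powr)
      also have "\<dots> \<le> real L powr (H / 2)" using L H_pos by (intro powr_mono2) auto
      finally show ?thesis using J by simp
    qed
    \<comment> \<open>From H < 1/2 follows n^(H/4) \<le> n^(1/8), and L \<le> 2 n^(1/2); the factor
      2 is at most n^(3/8) as soon as n \<ge> 8.\<close>
    moreover have "J * L \<le> n"
    proof -
      have "real J * real L \<le> real n powr (H / 4) * (real n powr (1/2) + 1)"
        using J L by (intro mult_mono) auto
      also have "\<dots> \<le> real n powr (1/8) * (2 * real n powr (1/2))"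
        using n1 n H_less by (intro mult_mono powr_mono) auto
      also have "\<dots> = 2 * real n powr (5/8)" by (simp add: powr_add[symmetric])
      also have "\<dots> \<le> real n powr (3/8) * real n powr (5/8)"
      proof (rule mult_right_mono)
        have "(2::real) = 2 powr 1" by simp
        also have "\<dots> \<le> 2 powr (3 * (3/8))" by (intro powr_mono) auto
        also have "\<dots> = (2 powr 3) powr (3/8 :: real)" by (simp only: powr_powr)
        also have "(2::real) powr 3 = 8" by (simp add: powr_numeral)
        also have "8 powr (3/8) \<le> real n powr (3/8)" using False by (intro powr_mono2) auto
        finally show "2 \<le> real n powr (3/8)" .
      qed simp
      also have "\<dots> = real n" using n by (simp add: powr_add[symmetric])
      finally show ?thesis by (simp flip: of_nat_mult)
    qed
    moreover have "exp (- c * real J) \<le> K' / real n"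
    proof -
      have "- c * real J \<le> c + - c * real n powr (H / 4)"
        using mult_left_mono[OF J(2), of c] c by (simp add: algebra_simps)
      then have "exp (- c * real J) \<le> exp c * exp (- c * real n powr (H / 4))"
        by (simp add: exp_add[symmetric])
      also have "\<dots> \<le> exp c * (K / real n)" using K(2)[OF n] by (intro mult_left_mono) auto
      also have "\<dots> \<le> K' / real n" using n by (simp add: K'_def field_simps)
      finally show ?thesis .
    qed
    ultimately show ?thesis by blast
  qed
  have K': "0 < K'" using K by (simp add: K'_def add_pos_pos)
  show thesis
  proof (rule that)
    show "0 < D * K' * (1 + V 0)" using D K' V_pos[of 0] by simp
    fix \<mu> A and n :: nat assume \<mu>: "initial_distribution PW \<mu>" and R: "V_mean \<mu> < \<infinity>" and n: "n \<ge> 1" and A: "A \<in> sets (seq_space :: 'd seq measure)"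
    have mO[measurable]: "(\<lambda>z. obs (fst (fst z)) n z) \<in> Om \<mu> \<rightarrow>\<^sub>M seq_space" "obs 0 n \<in> Om \<mu> \<rightarrow>\<^sub>M seq_space"
      unfolding measurable_Om[OF \<mu>] by (rule measurable_obs_fst, rule measurable_obs_0)
    interpret \<mu>: prob_space \<mu> by (rule prob_\<mu>[OF \<mu>])
    interpret Om: prob_space "Om \<mu>" by (rule prob_Om[OF \<mu>])
    obtain J L where JL: "0 < L" "real J \<le> real L powr (H / 2)" "J * L \<le> n" "exp (- c * real J) \<le> K' / real n"
      using blocks[OF n] by blast
    define R where "R = enn2real (V_mean \<mu>)"
    have R_eq: "V_mean \<mu> = ennreal R" and R_nonneg: "0 \<le> R"
      using R by (auto simp: R_def less_top)
    have Vm: "(\<lambda>z. ennreal (V (fst z))) \<in> borel_measurable \<mu>"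
      unfolding measurable_initial[OF \<mu>] by measurable
    have sumV: "(\<integral>\<^sup>+z. ennreal (V (fst z) + V 0) \<partial>\<mu>) = ennreal (R + V 0)"
    proof -
      have "(\<integral>\<^sup>+z. ennreal (V (fst z) + V 0) \<partial>\<mu>) = (\<integral>\<^sup>+z. ennreal (V (fst z)) + ennreal (V 0) \<partial>\<mu>)"
        using V_nonneg by (intro nn_integral_cong) simp
      also have "\<dots> = V_mean \<mu> + ennreal (V 0)"
        unfolding V_mean_def using Vm by (subst nn_integral_add) (auto simp: \<mu>.emeasure_space_1)
      finally show ?thesis using R_nonneg V_nonneg by (simp add: R_eq)
    qed
    define \<delta> where "\<delta> = D * K' * (1 + V 0) * (1 + R) / real n"
    have \<delta>: "ennreal (D * exp (- c * real J)) * (1 + ennreal (R + V 0)) \<le> ennreal \<delta>" "0 \<le> \<delta>"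
    proof -
      have "ennreal (D * exp (- c * real J)) * (1 + ennreal (R + V 0)) = ennreal (D * exp (- c * real J) * (1 + (R + V 0)))"
        using D R_nonneg V_nonneg[of 0] by (simp add: ennreal_mult ennreal_plus[symmetric] del: ennreal_plus flip: ennreal_1)
      also have "D * exp (- c * real J) * (1 + (R + V 0)) \<le> D * (K' / real n) * ((1 + V 0) * (1 + R))"
      proof (rule mult_mono)
        show "1 + (R + V 0) \<le> (1 + V 0) * (1 + R)" using R_nonneg V_nonneg[of 0] by (simp add: algebra_simps)
        show "D * exp (- c * real J) \<le> D * (K' / real n)" using JL(4) D by (intro mult_left_mono) auto
      qed (use D R_nonneg V_nonneg[of 0] K' in auto)
      also have "\<dots> = \<delta>" by (simp add: \<delta>_def)
      finally show "ennreal (D * exp (- c * real J)) * (1 + ennreal (R + V 0)) \<le> ennreal \<delta>"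
        by (simp add: ennreal_leI)
      show "0 \<le> \<delta>" unfolding \<delta>_def using D K' R_nonneg V_nonneg[of 0] by simp
    qed
    interpret O: prob_space "obs_law \<mu> n"
      unfolding obs_law_def by (rule Om.prob_space_distr[OF mO(1)])
    interpret R: prob_space "ref_law n"
      unfolding ref_law_eq[OF \<mu>, symmetric] by (rule Om.prob_space_distr[OF mO(2)])
    have eO: "emeasure (obs_law \<mu> n) B = (\<integral>\<^sup>+z. indicator B (obs (fst (fst z)) n z) \<partial>Om \<mu>)"
      and eR: "emeasure (ref_law n) B = (\<integral>\<^sup>+z. indicator B (obs 0 n z) \<partial>Om \<mu>)" if [measurable]: "B \<in> sets seq_space" for B
    proof -
      have "emeasure (obs_law \<mu> n) B = (\<integral>\<^sup>+y. indicator B y \<partial>obs_law \<mu> n)"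
        by (rule nn_integral_indicator[symmetric]) (simp add: obs_law_def)
      also have "\<dots> = (\<integral>\<^sup>+z. indicator B (obs (fst (fst z)) n z) \<partial>Om \<mu>)"
        unfolding obs_law_def by (rule nn_integral_distr[OF mO(1)]) simp
      finally show "emeasure (obs_law \<mu> n) B = (\<integral>\<^sup>+z. indicator B (obs (fst (fst z)) n z) \<partial>Om \<mu>)" .
      have "emeasure (ref_law n) B = (\<integral>\<^sup>+y. indicator B y \<partial>ref_law n)"
        by (rule nn_integral_indicator[symmetric]) (simp add: ref_law_def)
      also have "\<dots> = (\<integral>\<^sup>+z. indicator B (obs 0 n z) \<partial>Om \<mu>)"
        unfolding ref_law_eq[OF \<mu>, symmetric] by (rule nn_integral_distr[OF mO(2)]) simp
      finally show "emeasure (ref_law n) B = (\<integral>\<^sup>+z. indicator B (obs 0 n z) \<partial>Om \<mu>)" .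
    qed
    have loc: "measure (obs_law \<mu> n) B \<le> measure (ref_law n) B + \<delta>" "measure (ref_law n) B \<le> measure (obs_law \<mu> n) B + \<delta>" if B: "local_set p B" for p B
    proof -
      note Bs = local_set_sets[OF B]
      have "emeasure (obs_law \<mu> n) B \<le> emeasure (ref_law n) B + ennreal \<delta>"
      proof -
        have "(\<integral>\<^sup>+z. indicator B (obs (fst (fst z)) n z) \<partial>Om \<mu>) \<le> (\<integral>\<^sup>+z. indicator B (obs 0 n z) \<partial>Om \<mu>) + ennreal (D * exp (- c * real J)) * (1 + (\<integral>\<^sup>+z. ennreal (V (fst z) + V 0) \<partial>\<mu>))"
          by (rule cpl[of \<mu> L J n B p "\<lambda>x. x" "\<lambda>_. 0", OF \<mu> JL(1,2,3) Bs]) (rule local_setD[OF B], simp_all)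
        also have "\<dots> \<le> (\<integral>\<^sup>+z. indicator B (obs 0 n z) \<partial>Om \<mu>) + ennreal \<delta>"
          using \<delta>(1) by (intro add_left_mono) (simp add: sumV add.commute[of "V 0"])
        finally show ?thesis unfolding eO[OF Bs] eR[OF Bs] .
      qed
      then show "measure (obs_law \<mu> n) B \<le> measure (ref_law n) B + \<delta>"
        using \<delta>(2) by (simp add: O.emeasure_eq_measure R.emeasure_eq_measure flip: ennreal_plus)
      have "emeasure (ref_law n) B \<le> emeasure (obs_law \<mu> n) B + ennreal \<delta>"
      proof -
        have "(\<integral>\<^sup>+z. indicator B (obs 0 n z) \<partial>Om \<mu>) \<le> (\<integral>\<^sup>+z. indicator B (obs (fst (fst z)) n z) \<partial>Om \<mu>) + ennreal (D * exp (- c * real J)) * (1 + (\<integral>\<^sup>+z. ennreal (V 0 + V (fst z)) \<partial>\<mu>))"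
          by (rule cpl[of \<mu> L J n B p "\<lambda>_. 0" "\<lambda>x. x", OF \<mu> JL(1,2,3) Bs]) (rule local_setD[OF B], simp_all)
        also have "\<dots> \<le> (\<integral>\<^sup>+z. indicator B (obs (fst (fst z)) n z) \<partial>Om \<mu>) + ennreal \<delta>"
          using \<delta>(1) by (intro add_left_mono) (simp add: sumV add.commute[of "V 0"])
        finally show ?thesis unfolding eO[OF Bs] eR[OF Bs] .
      qed
      then show "measure (ref_law n) B \<le> measure (obs_law \<mu> n) B + \<delta>"
        using \<delta>(2) by (simp add: O.emeasure_eq_measure R.emeasure_eq_measure flip: ennreal_plus)
    qed
    have s: "sets (obs_law \<mu> n) = sets seq_space" "sets (ref_law n) = sets seq_space"
      by (simp_all add: obs_law_def ref_law_def)
    have "measure (obs_law \<mu> n) A \<le> measure (ref_law n) A + \<delta>" "measure (ref_law n) A \<le> measure (obs_law \<mu> n) A + \<delta>"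
      using measure_le_from_local[OF O.finite_measure_axioms R.finite_measure_axioms s loc(1) A]
        measure_le_from_local[OF R.finite_measure_axioms O.finite_measure_axioms s(2,1) loc(2) A] by auto
    then show "\<bar>measure (obs_law \<mu> n) A - measure (ref_law n) A\<bar> \<le> D * K' * (1 + V 0) * (1 + enn2real (V_mean \<mu>)) / real n"
      unfolding \<delta>_def R_def by linarith
  qed
  qed
qed

section \<open>Moments of V along the chain\<close>

text \<open>The exponential moment at a single time dominates the norm, by x \<le> exp (\<tau> x^2)
  + 1 / \<tau>. Stationarity makes the bound uniform in the time and in the initial
  distribution.\<close>

lemma noise_path_moment:
  obtains c where "0 < c" "\<And>\<mu> k. initial_distribution PW \<mu> \<Longrightarrow> (\<integral>\<^sup>+z. ennreal (norm (noise_path z k)) \<partial>Om \<mu>) \<le> ennreal c"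
proof (rule that)
  let ?c = "exp \<kappa> + 1 / \<tau>"
  show "0 < ?c" using \<tau>_pos by (simp add: add_pos_pos)
  fix \<mu> k assume \<mu>: "initial_distribution PW \<mu>"
  have mO: "(\<lambda>z. (snd (fst z), snd z)) \<in> Om \<mu> \<rightarrow>\<^sub>M seq_space \<Otimes>\<^sub>M seq_space"
    unfolding measurable_Om[OF \<mu>] by measurable
  note mM = past_future_meas[of 0]
  have le: "x \<le> exp (\<tau> * x\<^sup>2) + 1 / \<tau>" for x
  proof -
    have "0 \<le> \<tau> * (x - 1 / (2 * \<tau>))\<^sup>2" using \<tau>_pos by simp
    also have "\<tau> * (x - 1 / (2 * \<tau>))\<^sup>2 = \<tau> * x\<^sup>2 - x + 1 / (4 * \<tau>)"
      using \<tau>_pos by (simp add: power2_eq_square field_simps)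
    finally have "x \<le> \<tau> * x\<^sup>2 + 1 / (4 * \<tau>)" by simp
    also have "\<dots> \<le> exp (\<tau> * x\<^sup>2) + 1 / \<tau>"
    proof (rule add_mono)
      show "\<tau> * x\<^sup>2 \<le> exp (\<tau> * x\<^sup>2)" by (rule order_trans[OF _ exp_ge_add_one_self]) simp
      show "1 / (4 * \<tau>) \<le> 1 / \<tau>" using \<tau>_pos by (simp add: field_simps)
    qed
    finally show ?thesis .
  qed
  have "(\<integral>\<^sup>+z. ennreal (norm (noise_path z k)) \<partial>Om \<mu>) = (\<integral>\<^sup>+v. ennreal (norm (response (fst v) (snd v) k)) \<partial>(PW \<Otimes>\<^sub>M gauss_vec UNIV))"
    unfolding Om_noise[OF \<mu>, symmetric] noise_path_def by (subst nn_integral_distr[OF mO]) auto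
  also have "\<dots> = (\<integral>\<^sup>+\<omega>. ennreal (norm (response (past \<Delta> 0 \<omega>) (\<lambda>i. \<xi> (0 + 1 + int i) \<omega>) k)) \<partial>M)"
    unfolding joint_law[of 0, symmetric] by (subst nn_integral_distr[OF mM]) auto
  also have "\<dots> \<le> (\<integral>\<^sup>+\<omega>. ennreal (exp (\<tau> * (\<Sum>t\<in>{1 + int k}. 1 * (norm (\<Delta> t \<omega>))\<^sup>2))) + ennreal (1 / \<tau>) \<partial>M)"
    using response_past
  proof (intro nn_integral_mono_AE, eventually_elim)
    case (elim \<omega>)
    have "response (past \<Delta> 0 \<omega>) (\<lambda>i. \<xi> (0 + 1 + int i) \<omega>) k = \<Delta> (1 + int k) \<omega>"
      using elim(2)[rule_format, of 0 k] by simp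
    then show ?case
      using le[of "norm (\<Delta> (1 + int k) \<omega>)"] \<tau>_pos by (simp flip: ennreal_plus)
  qed
  also have "\<dots> = (\<integral>\<^sup>+\<omega>. ennreal (exp (\<tau> * (\<Sum>t\<in>{1 + int k}. 1 * (norm (\<Delta> t \<omega>))\<^sup>2))) \<partial>M) + ennreal (1 / \<tau>)"
    by (subst nn_integral_add) (auto simp: emeasure_space_1)
  also have "\<dots> \<le> ennreal (exp (\<kappa> * (\<Sum>t\<in>{1 + int k}. 1))) + ennreal (1 / \<tau>)"
    by (intro add_right_mono exp_moment) auto
  also have "\<dots> = ennreal ?c" using \<tau>_pos by simp
  finally show "(\<integral>\<^sup>+z. ennreal (norm (noise_path z k)) \<partial>Om \<mu>) \<le> ennreal ?c" .
qed

lemma law_at_integral: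
  assumes \<mu>: "initial_distribution PW \<mu>" and f: "f \<in> borel_measurable state_space"
  shows "(\<integral>\<^sup>+z. f z \<partial>law_at \<mu> n) = (\<integral>\<^sup>+z. f (proc n z) \<partial>Om \<mu>)"
proof -
  have "proc n \<in> Om \<mu> \<rightarrow>\<^sub>M state_space"
    unfolding measurable_Om[OF \<mu>] by (rule measurable_proc)
  then show ?thesis
    unfolding law_at_def[OF \<mu>] using f by (intro nn_integral_distr) auto
qed

lemma Om_integral_fst:
  assumes \<mu>: "initial_distribution PW \<mu>" and f: "f \<in> borel_measurable state_space"
  shows "(\<integral>\<^sup>+z. f (fst z) \<partial>Om \<mu>) = (\<integral>\<^sup>+z. f z \<partial>\<mu>)"
  using law_at_integral[OF \<mu> f, of 0] by (simp add: law_at_0[OF \<mu>] proc_def)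

text \<open>A pathwise bound instead of one on expectations, since V will be truncated before its
  integrability is known. The remainder W does not see the starting point, so its mean is bounded
  uniformly in the initial distribution.\<close>

lemma V_bound:
  obtains W R where "0 < R" "\<And>n. W n \<in> borel_measurable path_space" "\<And>n z. 0 \<le> W n z"
    "\<And>n z. V (fst (proc n z)) \<le> g ^ n * V (fst (fst z)) + W n z"
    "\<And>\<mu> n. initial_distribution PW \<mu> \<Longrightarrow> (\<integral>\<^sup>+z. ennreal (W n z) \<partial>Om \<mu>) \<le> ennreal R"
proof -
  obtain c where c: "0 < c" "\<And>\<mu> k. initial_distribution PW \<mu> \<Longrightarrow> (\<integral>\<^sup>+z. ennreal (norm (noise_path z k)) \<partial>Om \<mu>) \<le> ennreal c"
    by (rule noise_path_moment) blast
  define W where "W n z = C1 * (\<Sum>k<n. g ^ k * (1 + norm (noise_path z (n - 1 - k))))" for n z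
  show thesis
  proof (rule that[of "C1 * (1 + c) / (1 - g)" W])
    show "0 < C1 * (1 + c) / (1 - g)" using C1 c g by simp
    show "W n \<in> borel_measurable path_space" for n
      unfolding W_def by measurable
    show "0 \<le> W n z" for n z
      unfolding W_def using C1 g by (auto intro!: mult_nonneg_nonneg sum_nonneg add_nonneg_nonneg)
    show "V (fst (proc n z)) \<le> g ^ n * V (fst (fst z)) + W n z" for n z
      unfolding W_def proc_def fst_conv by (rule V_traj)
    fix \<mu> n assume \<mu>: "initial_distribution PW \<mu>"
    interpret Om: prob_space "Om \<mu>" by (rule prob_Om[OF \<mu>])
    have [measurable]: "(\<lambda>z. noise_path z k) \<in> borel_measurable (Om \<mu>)" for k
      unfolding measurable_Om[OF \<mu>] by measurable
    have "(\<integral>\<^sup>+z. ennreal (W n z) \<partial>Om \<mu>) = (\<integral>\<^sup>+z. (\<Sum>k<n. ennreal (C1 * g ^ k) * (1 + ennreal (norm (noise_path z (n - 1 - k))))) \<partial>Om \<mu>)"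
    proof (rule nn_integral_cong)
      fix z
      have "W n z = (\<Sum>k<n. C1 * g ^ k * (1 + norm (noise_path z (n - 1 - k))))"
        unfolding W_def by (simp add: sum_distrib_left mult.assoc)
      also have "ennreal \<dots> = (\<Sum>k<n. ennreal (C1 * g ^ k * (1 + norm (noise_path z (n - 1 - k)))))"
        using C1 g by (intro sum_ennreal[symmetric]) auto
      also have "\<dots> = (\<Sum>k<n. ennreal (C1 * g ^ k) * (1 + ennreal (norm (noise_path z (n - 1 - k)))))"
        using C1 g by (intro sum.cong refl) (simp add: ennreal_mult)
      finally show "ennreal (W n z) = (\<Sum>k<n. ennreal (C1 * g ^ k) * (1 + ennreal (norm (noise_path z (n - 1 - k)))))" .
    qed
    also have "\<dots> = (\<Sum>k<n. ennreal (C1 * g ^ k) * (1 + (\<integral>\<^sup>+z. ennreal (norm (noise_path z (n - 1 - k))) \<partial>Om \<mu>)))"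
      by (simp add: nn_integral_sum nn_integral_cmult nn_integral_add Om.emeasure_space_1)
    also have "\<dots> \<le> (\<Sum>k<n. ennreal (C1 * g ^ k) * (1 + ennreal c))"
      by (intro sum_mono mult_left_mono add_left_mono c(2)[OF \<mu>]) auto
    also have "\<dots> = (\<Sum>k<n. ennreal (C1 * g ^ k * (1 + c)))"
      using C1 g c by (intro sum.cong refl) (simp add: ennreal_mult)
    also have "\<dots> = ennreal (\<Sum>k<n. C1 * g ^ k * (1 + c))"
      using C1 g c by (intro sum_ennreal) auto
    also have "\<dots> \<le> ennreal (C1 * (1 + c) / (1 - g))"
    proof (rule ennreal_leI)
      have "(\<Sum>k<n. C1 * g ^ k * (1 + c)) = C1 * (1 + c) * (\<Sum>k<n. g ^ k)"
        by (simp add: sum_distrib_left mult.commute mult.left_commute)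
      also have "\<dots> \<le> C1 * (1 + c) * (1 / (1 - g))"
        using C1 c by (intro mult_left_mono sum_powers_le) auto
      finally show "(\<Sum>k<n. C1 * g ^ k * (1 + c)) \<le> C1 * (1 + c) / (1 - g)" by simp
    qed
    finally show "(\<integral>\<^sup>+z. ennreal (W n z) \<partial>Om \<mu>) \<le> ennreal (C1 * (1 + c) / (1 - g))" .
  qed
qed

text \<open>For an invariant distribution V is not integrable a priori. Invariance allows the
  truncation of V at N to be computed at time n, where it is at most the truncation of g^n V (X_0)
  plus W; the first part vanishes as n grows, and then N tends to infinity.\<close>

lemma V_mean_law_at:
  obtains R where "0 < R" "\<And>\<mu> n. initial_distribution PW \<mu> \<Longrightarrow> V_mean (law_at \<mu> n) \<le> V_mean \<mu> + ennreal R"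
    "\<And>\<mu>. invariant_distribution PW Q \<mu> \<Longrightarrow> V_mean \<mu> \<le> ennreal R"
proof -
  show thesis
  proof (rule V_bound, goal_cases)
  case (1 W R)
  note R = 1(1) and W[measurable] = 1(2) and W0 = 1(3) and VW = 1(4) and WR = 1(5)
  have W_Om: "(\<lambda>z. ennreal (W n z)) \<in> borel_measurable (Om \<mu>)" if "initial_distribution PW \<mu>" for \<mu> n
    unfolding measurable_Om[OF that] by measurable
  have fst_Om: "(\<lambda>z. f (fst z)) \<in> borel_measurable (Om \<mu>)" if "initial_distribution PW \<mu>" and [measurable]: "f \<in> borel_measurable state_space" for \<mu> and f :: "'d state \<Rightarrow> ennreal"
    unfolding measurable_Om[OF that(1)] by measurable
  have Vm[measurable]: "(\<lambda>z. ennreal (V (fst z))) \<in> borel_measurable state_space" by measurable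
  show thesis
  proof (rule that[OF R])
    fix \<mu> n assume \<mu>: "initial_distribution PW \<mu>"
    have "V_mean (law_at \<mu> n) = (\<integral>\<^sup>+z. ennreal (V (fst (proc n z))) \<partial>Om \<mu>)"
      unfolding V_mean_def by (rule law_at_integral[OF \<mu> Vm])
    also have "\<dots> \<le> (\<integral>\<^sup>+z. ennreal (V (fst (fst z))) + ennreal (W n z) \<partial>Om \<mu>)"
    proof (intro nn_integral_mono)
      fix z :: "'d state \<times> ('d seq)"
      have "g ^ n * V (fst (fst z)) \<le> 1 * V (fst (fst z))"
        using g V_nonneg by (intro mult_right_mono power_le_one) auto
      then have "V (fst (proc n z)) \<le> V (fst (fst z)) + W n z" using VW[of n z] by linarith
      then show "ennreal (V (fst (proc n z))) \<le> ennreal (V (fst (fst z))) + ennreal (W n z)"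
        using V_nonneg W0 by (simp flip: ennreal_plus)
    qed
    also have "\<dots> = (\<integral>\<^sup>+z. ennreal (V (fst (fst z))) \<partial>Om \<mu>) + (\<integral>\<^sup>+z. ennreal (W n z) \<partial>Om \<mu>)"
      using fst_Om[OF \<mu> Vm] W_Om[OF \<mu>] by (rule nn_integral_add)
    also have "\<dots> \<le> V_mean \<mu> + ennreal R"
      unfolding V_mean_def Om_integral_fst[OF \<mu> Vm] by (intro add_left_mono WR \<mu>)
    finally show "V_mean (law_at \<mu> n) \<le> V_mean \<mu> + ennreal R" .
  next
    fix \<mu> assume inv: "invariant_distribution PW Q \<mu>"
    then have \<mu>: "initial_distribution PW \<mu>" by (simp add: invariant_distribution_def)
    interpret \<mu>: prob_space \<mu> by (rule prob_\<mu>[OF \<mu>])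
    \<comment> \<open>Bounded convergence applies at fixed N, with R independent of N.\<close>
    have trunc: "(\<integral>\<^sup>+z. ennreal (min (V (fst z)) (real N)) \<partial>\<mu>) \<le> ennreal R" for N
    proof (rule LIMSEQ_le_const)
      let ?f = "\<lambda>n z. ennreal (min (g ^ n * V (fst z)) (real N))"
      have fm[measurable]: "?f n \<in> borel_measurable state_space" for n by measurable
      have fm': "?f n \<in> borel_measurable \<mu>" for n
        unfolding measurable_initial[OF \<mu>] by measurable
      have "(\<lambda>n. \<integral>\<^sup>+z. ?f n z \<partial>\<mu>) \<longlonglongrightarrow> (\<integral>\<^sup>+z. 0 \<partial>\<mu>)"
      proof (rule nn_integral_dominated_convergence)
        show "AE z in \<mu>. (\<lambda>n. ?f n z) \<longlonglongrightarrow> 0"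
        proof (rule AE_I2)
          fix z
          have "(\<lambda>n. min (g ^ n * V (fst z)) (real N)) \<longlonglongrightarrow> min (0 * V (fst z)) (real N)"
            using g by (intro tendsto_intros) auto
          then show "(\<lambda>n. ?f n z) \<longlonglongrightarrow> 0"
            using tendsto_ennrealI by fastforce
        qed
        show "AE z in \<mu>. ?f n z \<le> ennreal (real N)" for n by (auto intro!: ennreal_leI)
        show "(\<integral>\<^sup>+z. ennreal (real N) \<partial>\<mu>) < \<infinity>" by (simp add: \<mu>.emeasure_space_1)
      qed (use fm' in auto)
      then show "(\<lambda>n. (\<integral>\<^sup>+z. ?f n z \<partial>\<mu>) + ennreal R) \<longlonglongrightarrow> ennreal R"
        using tendsto_add[of "\<lambda>n. \<integral>\<^sup>+z. ?f n z \<partial>\<mu>" 0 sequentially "\<lambda>_. ennreal R" "ennreal R"] by simp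
      have "(\<integral>\<^sup>+z. ennreal (min (V (fst z)) (real N)) \<partial>\<mu>) \<le> (\<integral>\<^sup>+z. ?f n z \<partial>\<mu>) + ennreal R" for n
      proof -
        have "(\<integral>\<^sup>+z. ennreal (min (V (fst z)) (real N)) \<partial>\<mu>) = (\<integral>\<^sup>+z. ennreal (min (V (fst (proc n z))) (real N)) \<partial>Om \<mu>)"
          using law_at_integral[OF \<mu>, of "\<lambda>z. ennreal (min (V (fst z)) (real N))" n] unfolding law_at_invariant[OF inv] by simp
        also have "\<dots> \<le> (\<integral>\<^sup>+z. ?f n (fst z) + ennreal (W n z) \<partial>Om \<mu>)"
        proof (intro nn_integral_mono)
          fix z :: "'d state \<times> ('d seq)"
          have "min (V (fst (proc n z))) (real N) \<le> min (g ^ n * V (fst (fst z))) (real N) + W n z"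
            using VW[of n z] W0[of n z] by linarith
          moreover have "0 \<le> min (g ^ n * V (fst (fst z))) (real N)" using g V_nonneg by simp
          ultimately show "ennreal (min (V (fst (proc n z))) (real N)) \<le> ?f n (fst z) + ennreal (W n z)"
            using W0[of n z] by (simp flip: ennreal_plus)
        qed
        also have "\<dots> = (\<integral>\<^sup>+z. ?f n (fst z) \<partial>Om \<mu>) + (\<integral>\<^sup>+z. ennreal (W n z) \<partial>Om \<mu>)"
          using fst_Om[OF \<mu> fm] W_Om[OF \<mu>] by (rule nn_integral_add)
        also have "\<dots> \<le> (\<integral>\<^sup>+z. ?f n z \<partial>\<mu>) + ennreal R"
          unfolding Om_integral_fst[OF \<mu> fm] by (intro add_left_mono WR \<mu>)
        finally show ?thesis .
      qed
      then show "\<exists>N'. \<forall>n\<ge>N'. (\<integral>\<^sup>+z. ennreal (min (V (fst z)) (real N)) \<partial>\<mu>) \<le> (\<integral>\<^sup>+z. ?f n z \<partial>\<mu>) + ennreal R" by blast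
    qed
    have "V_mean \<mu> \<le> liminf (\<lambda>N. \<integral>\<^sup>+z. ennreal (min (V (fst z)) (real N)) \<partial>\<mu>)"
    proof -
      have "V_mean \<mu> = (\<integral>\<^sup>+z. liminf (\<lambda>N. ennreal (min (V (fst z)) (real N))) \<partial>\<mu>)"
        unfolding V_mean_def
      proof (rule nn_integral_cong)
        fix z
        have "\<forall>\<^sub>F N in sequentially. ennreal (min (V (fst z)) (real N)) = ennreal (V (fst z))"
          using eventually_ge_at_top[of "nat \<lceil>V (fst z)\<rceil>"] by eventually_elim (intro arg_cong[where f=ennreal], linarith)
        then have "(\<lambda>N. ennreal (min (V (fst z)) (real N))) \<longlonglongrightarrow> ennreal (V (fst z))"
          by (rule tendsto_eventually)
        then show "ennreal (V (fst z)) = liminf (\<lambda>N. ennreal (min (V (fst z)) (real N)))"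
          by (intro lim_imp_Liminf[symmetric]) auto
      qed
      also have "\<dots> \<le> liminf (\<lambda>N. \<integral>\<^sup>+z. ennreal (min (V (fst z)) (real N)) \<partial>\<mu>)"
        by (rule nn_integral_liminf) (unfold measurable_initial[OF \<mu>], measurable)
      finally show ?thesis .
    qed
    also have "\<dots> \<le> ennreal R"
      using trunc by (intro order_trans[OF Liminf_le_Limsup Limsup_bounded]) auto
    finally show "V_mean \<mu> \<le> ennreal R" .
  qed
  qed
qed

lemma shifted_law_obs:
  assumes \<mu>: "initial_distribution PW \<mu>"
  shows "shifted_law n (trajectory_law Q \<mu>) = distr (obs_law \<mu> n) seq_space (\<lambda>y k. traj F (y 0) (\<lambda>i. y (Suc i)) k)"
proof -
  have m: "(\<lambda>z. obs (fst (fst z)) n z) \<in> Om \<mu> \<rightarrow>\<^sub>M seq_space"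
    unfolding measurable_Om[OF \<mu>] by (rule measurable_obs_fst)
  have t: "(\<lambda>y k. traj F (y 0) (\<lambda>i. y (Suc i)) k) \<in> seq_space \<rightarrow>\<^sub>M (seq_space :: 'd seq measure)"
    by (rule measurable_PiM_single') (auto intro!: measurable_traj F_meas)
  show ?thesis
    unfolding shifted_trajectory_law[OF \<mu>] obs_law_def distr_distr[OF t m]
    by (simp add: obs_def comp_def traj_add)
qed

lemma tv_dist_shifted_law:
  obtains C where "0 < C" "\<And>\<mu> \<nu> n. \<lbrakk>initial_distribution PW \<mu>; initial_distribution PW \<nu>; V_mean \<mu> < \<infinity>; V_mean \<nu> < \<infinity>; n \<ge> 1\<rbrakk> \<Longrightarrow>
     tv_dist (shifted_law n (trajectory_law Q \<mu>)) (shifted_law n (trajectory_law Q \<nu>)) \<le> C * (2 + enn2real (V_mean \<mu>) + enn2real (V_mean \<nu>)) / real n"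
proof -
  show thesis
  proof (rule forgetting, goal_cases)
  case (1 C)
  note C = 1(1) and forget = 1(2)
  let ?t = "\<lambda>y k. traj F (y 0) (\<lambda>i. y (Suc i)) k"
  have t: "?t \<in> seq_space \<rightarrow>\<^sub>M (seq_space :: 'd seq measure)"
    by (rule measurable_PiM_single') (auto intro!: measurable_traj F_meas)
  show thesis
  proof (rule that[OF C])
    fix \<mu> \<nu> and n :: nat
    assume \<mu>: "initial_distribution PW \<mu>" and \<nu>: "initial_distribution PW \<nu>" and V: "V_mean \<mu> < \<infinity>" "V_mean \<nu> < \<infinity>" and n: "n \<ge> 1"
    show "tv_dist (shifted_law n (trajectory_law Q \<mu>)) (shifted_law n (trajectory_law Q \<nu>)) \<le> C * (2 + enn2real (V_mean \<mu>) + enn2real (V_mean \<nu>)) / real n"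
      unfolding tv_dist_def
    proof (rule cSUP_least)
      fix A assume "A \<in> sets (shifted_law n (trajectory_law Q \<mu>))"
      then have A: "A \<in> sets (seq_space :: 'd seq measure)" by (simp add: shifted_law_def)
      have B: "?t -` A \<in> sets (seq_space :: 'd seq measure)"
        using measurable_sets[OF t A] by (simp add: space_PiM)
      have eq: "measure (shifted_law n (trajectory_law Q \<mu>)) A = measure (obs_law \<mu> n) (?t -` A)" if "initial_distribution PW \<mu>" for \<mu>
        unfolding shifted_law_obs[OF that]
        by (subst measure_distr) (use t A in \<open>auto simp: obs_law_def space_PiM\<close>)
      show "\<bar>measure (shifted_law n (trajectory_law Q \<mu>)) A - measure (shifted_law n (trajectory_law Q \<nu>)) A\<bar>
        \<le> C * (2 + enn2real (V_mean \<mu>) + enn2real (V_mean \<nu>)) / real n"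
        unfolding eq[OF \<mu>] eq[OF \<nu>]
      proof -
        have "C * (2 + enn2real (V_mean \<mu>) + enn2real (V_mean \<nu>)) / real n =
          C * (1 + enn2real (V_mean \<mu>)) / real n + C * (1 + enn2real (V_mean \<nu>)) / real n"
          by (simp add: add_divide_distrib[symmetric] algebra_simps)
        then show "\<bar>measure (obs_law \<mu> n) (?t -` A) - measure (obs_law \<nu> n) (?t -` A)\<bar>
          \<le> C * (2 + enn2real (V_mean \<mu>) + enn2real (V_mean \<nu>)) / real n"
          using forget[OF \<mu> V(1) n B] forget[OF \<nu> V(2) n B] by linarith
      qed
    qed auto
  qed
  qed
qed

end

subsection \<open>Existence of an invariant distribution\<close>

text \<open>The Cauchy bound \<delta> m does not depend on the set, which gives countable additivity
  of the limit: on a sequence A i decreasing to the empty set, the limit is at most N m (A i) +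
  \<delta> m, with m fixed first.\<close>

lemma setwise_limit:
  fixes N :: "nat \<Rightarrow> 'a measure"
  assumes prob: "\<And>m. prob_space (N m)" and sets: "\<And>m. sets (N m) = sets S"
    and \<delta>: "\<delta> \<longlonglongrightarrow> 0" and close: "\<And>m j A. A \<in> sets S \<Longrightarrow> \<bar>measure (N m) A - measure (N (m + j)) A\<bar> \<le> \<delta> m"
  shows "\<exists>L. prob_space L \<and> sets L = sets S \<and> (\<forall>A\<in>sets S. (\<lambda>m. measure (N m) A) \<longlonglongrightarrow> measure L A)"
proof -
  have sp: "space (N m) = space S" for m by (rule sets_eq_imp_space_eq[OF sets])
  have N: "finite_measure (N m)" for m using prob by (simp add: prob_space_def)
  define l where "l A = lim (\<lambda>m. measure (N m) A)" for A
  have conv: "(\<lambda>m. measure (N m) A) \<longlonglongrightarrow> l A" if A: "A \<in> sets S" for A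
  proof -
    have "Cauchy (\<lambda>m. measure (N m) A)"
    proof (rule metric_CauchyI)
      fix e :: real assume "0 < e"
      then have "\<forall>\<^sub>F m in sequentially. \<delta> m < e / 2" by (intro order_tendstoD(2)[OF \<delta>]) auto
      then obtain m0 where m0: "\<delta> m0 < e / 2" by (auto simp: eventually_sequentially)
      have near: "\<bar>measure (N m0) A - measure (N m) A\<bar> < e / 2" if "m \<ge> m0" for m
        using close[OF A, of m0 "m - m0"] that m0 by simp
      show "\<exists>M. \<forall>m\<ge>M. \<forall>n\<ge>M. dist (measure (N m) A) (measure (N n) A) < e"
      proof (intro exI allI impI)
        fix m n assume "m0 \<le> m" "m0 \<le> n"
        then show "dist (measure (N m) A) (measure (N n) A) < e"
          using near[of m] near[of n] unfolding dist_real_def by linarith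
      qed
    qed
    then show ?thesis unfolding l_def by (simp add: Cauchy_convergent_iff convergent_LIMSEQ_iff)
  qed
  have l_near: "\<bar>measure (N m) A - l A\<bar> \<le> \<delta> m" if A: "A \<in> sets S" for m A
  proof (rule LIMSEQ_le_const2)
    show "(\<lambda>j. \<bar>measure (N m) A - measure (N (m + j)) A\<bar>) \<longlonglongrightarrow> \<bar>measure (N m) A - l A\<bar>"
      using LIMSEQ_ignore_initial_segment[OF conv[OF A], of m] by (intro tendsto_intros) (simp add: add.commute)
    show "\<exists>N'. \<forall>j\<ge>N'. \<bar>measure (N m) A - measure (N (m + j)) A\<bar> \<le> \<delta> m" using close[OF A] by blast
  qed
  have l_nonneg: "0 \<le> l A" if "A \<in> sets S" for A
    by (rule LIMSEQ_le_const[OF conv[OF that]]) auto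
  have l_add: "l (A \<union> B) = l A + l B" if "A \<in> sets S" "B \<in> sets S" "A \<inter> B = {}" for A B
  proof (rule LIMSEQ_unique)
    show "(\<lambda>m. measure (N m) (A \<union> B)) \<longlonglongrightarrow> l (A \<union> B)" using that by (intro conv) auto
    have "measure (N m) (A \<union> B) = measure (N m) A + measure (N m) B" for m
      using that sets by (intro finite_measure.finite_measure_Union[OF N]) auto
    then show "(\<lambda>m. measure (N m) (A \<union> B)) \<longlonglongrightarrow> l A + l B"
      using that by (auto intro!: tendsto_add conv)
  qed
  define L where "L = measure_of (space S) (sets S) (\<lambda>A. ennreal (l A))"
  have em: "emeasure L A = ennreal (l A)" if "A \<in> sets S" for A
    unfolding L_def
  proof (rule emeasure_measure_of_sigma[OF sets.sigma_algebra_axioms _ _ that])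
    have l0: "l {} = 0" using conv[of "{}"] by (simp add: LIMSEQ_const_iff)
    show pos: "positive (sets S) (\<lambda>A. ennreal (l A))" by (simp add: positive_def l0)
    show "countably_additive (sets S) (\<lambda>A. ennreal (l A))"
    proof (rule sets.empty_continuous_imp_countably_additive[OF pos])
      show "additive (sets S) (\<lambda>A. ennreal (l A))"
        unfolding additive_def using l_add l_nonneg by (simp flip: ennreal_plus)
      fix A :: "nat \<Rightarrow> 'a set" assume A: "range A \<subseteq> sets S" "decseq A" "(\<Inter>i. A i) = {}"
      have "(\<lambda>i. l (A i)) \<longlonglongrightarrow> 0"
      proof (rule LIMSEQ_I)
        fix e :: real assume e: "0 < e"
        then have "\<forall>\<^sub>F m in sequentially. \<delta> m < e / 2" by (intro order_tendstoD(2)[OF \<delta>]) auto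
        then obtain m where m: "\<delta> m < e / 2" by (auto simp: eventually_sequentially)
        have "(\<lambda>i. measure (N m) (A i)) \<longlonglongrightarrow> measure (N m) (\<Inter>i. A i)"
          using A sets by (intro finite_measure.finite_Lim_measure_decseq[OF N]) auto
        then have "\<forall>\<^sub>F i in sequentially. measure (N m) (A i) < e / 2"
          using A(3) e by (intro order_tendstoD(2)) auto
        then obtain i0 where i0: "\<And>i. i \<ge> i0 \<Longrightarrow> measure (N m) (A i) < e / 2" by (auto simp: eventually_sequentially)
        show "\<exists>i0. \<forall>i\<ge>i0. norm (l (A i) - 0) < e"
        proof (intro exI allI impI)
          fix i assume "i0 \<le> i"
          then show "norm (l (A i) - 0) < e"
            using i0[of i] m l_near[of "A i" m] l_nonneg[of "A i"] A(1) by (auto simp: image_subset_iff)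
        qed
      qed
      then show "(\<lambda>i. ennreal (l (A i))) \<longlonglongrightarrow> 0"
        using tendsto_ennrealI by fastforce
    qed auto
  qed
  have sL: "sets L = sets S" "space L = space S" unfolding L_def by (simp_all add: sets.space_closed space_measure_of_conv sets.sigma_sets_eq)
  have "l (space S) = 1"
    by (rule LIMSEQ_unique[OF conv]) (use prob_space.prob_space[OF prob] in \<open>auto simp: sp\<close>)
  then have "prob_space L" by (intro prob_spaceI) (simp add: sL em)
  moreover have "measure L A = l A" if "A \<in> sets S" for A
    using em[OF that] l_nonneg[OF that] by (simp add: measure_def)
  ultimately show ?thesis using sL conv by (intro exI[of _ L]) auto
qed

text \<open>The Cauchy rate depends on the number of coordinates, so setwise limits are taken on
  each finite set of coordinates. They inherit consistency, and Kolmogorov's theorem on Polish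
  spaces joins them.\<close>

lemma projective_limit_of_laws:
  fixes N :: "nat \<Rightarrow> (nat \<Rightarrow> 'a::polish_space) measure"
  assumes prob: "\<And>m. prob_space (N m)" and sets: "\<And>m. sets (N m) = sets (PiM UNIV (\<lambda>_. borel))"
    and \<delta>: "\<And>p. \<delta> p \<longlonglongrightarrow> 0"
    and close: "\<And>p m j B. local_set p B \<Longrightarrow> \<bar>measure (N m) B - measure (N (m + j)) B\<bar> \<le> \<delta> p m"
  obtains L where "prob_space L" "sets L = sets (PiM UNIV (\<lambda>_. borel))" "\<And>p B. local_set p B \<Longrightarrow> (\<lambda>m. measure (N m) B) \<longlonglongrightarrow> measure L B"
proof -
  define R where "R J m = distr (N m) (PiM J (\<lambda>_. borel)) (\<lambda>y. restrict y J)" for J :: "nat set" and m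
  have restr: "(\<lambda>y. restrict y J) \<in> N m \<rightarrow>\<^sub>M PiM J (\<lambda>_. borel)" for J m
    unfolding measurable_cong_sets[OF sets refl] by (rule measurable_restrict_subset) simp
  have space_N: "space (N m) = UNIV" for m
    using sets_eq_imp_space_eq[OF sets] by (simp add: space_PiM)
  have loc: "local_set (Max (insert 0 J)) ((\<lambda>y. restrict y J) -` A)" if "finite J" "A \<in> sets (PiM J (\<lambda>_. borel :: 'a measure))" for J A
    unfolding local_set_def
  proof (intro conjI allI impI)
    have "(\<lambda>y. restrict y J) \<in> PiM UNIV (\<lambda>_. borel) \<rightarrow>\<^sub>M PiM J (\<lambda>_. borel :: 'a measure)"
      by (rule measurable_restrict_subset) simp
    from measurable_sets[OF this that(2)] show "(\<lambda>y. restrict y J) -` A \<in> sets (PiM UNIV (\<lambda>_. borel))"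
      by (simp add: space_PiM)
    fix y y' :: "nat \<Rightarrow> 'a" assume "\<forall>k\<le>Max (insert 0 J). y k = y' k"
    then have "restrict y J = restrict y' J" using that(1) by (intro restrict_ext) auto
    then show "y \<in> (\<lambda>y. restrict y J) -` A \<longleftrightarrow> y' \<in> (\<lambda>y. restrict y J) -` A" by simp
  qed
  have mR: "measure (R J m) A = measure (N m) ((\<lambda>y. restrict y J) -` A)" if "A \<in> sets (PiM J (\<lambda>_. borel))" for J m A
    unfolding R_def by (subst measure_distr[OF restr]) (use that in \<open>auto simp: space_N\<close>)
  have probR: "prob_space (R J m)" for J m
    unfolding R_def by (rule prob_space.prob_space_distr[OF prob restr])
  have "\<exists>L. prob_space L \<and> sets L = sets (PiM J (\<lambda>_. borel)) \<and> (\<forall>A\<in>sets (PiM J (\<lambda>_. borel)). (\<lambda>m. measure (R J m) A) \<longlonglongrightarrow> measure L A)"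
    if J: "finite J" for J
  proof (rule setwise_limit[OF probR _ \<delta>])
    fix m j A assume A: "A \<in> sets (PiM J (\<lambda>_. borel :: 'a measure))"
    show "\<bar>measure (R J m) A - measure (R J (m + j)) A\<bar> \<le> \<delta> (Max (insert 0 J)) m"
      unfolding mR[OF A] by (rule close[OF loc[OF J A]])
  qed (simp add: R_def)
  then obtain PL where PL: "\<And>J. finite J \<Longrightarrow> prob_space (PL J)" "\<And>J. finite J \<Longrightarrow> sets (PL J) = sets (PiM J (\<lambda>_. borel))"
    "\<And>J A. finite J \<Longrightarrow> A \<in> sets (PiM J (\<lambda>_. borel)) \<Longrightarrow> (\<lambda>m. measure (R J m) A) \<longlonglongrightarrow> measure (PL J) A"
    by metis
  interpret polish_projective UNIV PL
  proof (intro polish_projective.intro projective_family.intro)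
    fix J H :: "nat set" assume JH: "J \<subseteq> H" "finite H"
    then have J: "finite J" by (rule finite_subset)
    interpret J: prob_space "PL J" by (rule PL(1)[OF J])
    interpret H: prob_space "PL H" by (rule PL(1)[OF JH(2)])
    have r: "(\<lambda>f. restrict f J) \<in> PiM H (\<lambda>_. borel) \<rightarrow>\<^sub>M PiM J (\<lambda>_. borel :: 'a measure)"
      by (rule measurable_restrict_subset[OF JH(1)])
    then have r': "(\<lambda>f. restrict f J) \<in> PL H \<rightarrow>\<^sub>M PiM J (\<lambda>_. borel :: 'a measure)"
      unfolding measurable_cong_sets[OF PL(2)[OF JH(2)] refl] .
    interpret D: prob_space "distr (PL H) (PiM J (\<lambda>_. borel)) (\<lambda>f. restrict f J)"
      by (rule H.prob_space_distr[OF r'])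
    show "PL J = distr (PL H) (PiM J (\<lambda>_. borel)) (\<lambda>f. restrict f J)"
    proof (rule measure_eqI)
      fix A assume "A \<in> sets (PL J)"
      then have A: "A \<in> sets (PiM J (\<lambda>_. borel))" by (simp add: PL(2)[OF J])
      let ?A = "(\<lambda>f. restrict f J) -` A \<inter> space (PiM H (\<lambda>_. borel))"
      have A': "?A \<in> sets (PiM H (\<lambda>_. borel))" by (rule measurable_sets[OF r A])
      have "measure (R H m) ?A = measure (R J m) A" for m
      proof -
        have "restrict (restrict y H) J = restrict y J" for y :: "nat \<Rightarrow> 'a"
          using JH by (simp add: Int_absorb1)
        then have "(\<lambda>y. restrict y H) -` ?A = (\<lambda>y. restrict y J) -` A"
          by (auto simp: space_PiM)
        then show ?thesis unfolding mR[OF A] mR[OF A'] by simp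
      qed
      then have "measure (PL J) A = measure (PL H) ?A"
        using LIMSEQ_unique[OF PL(3)[OF J A]] PL(3)[OF JH(2) A'] by simp
      also have "\<dots> = measure (distr (PL H) (PiM J (\<lambda>_. borel)) (\<lambda>f. restrict f J)) A"
        by (subst measure_distr[OF r' A]) (simp add: sets_eq_imp_space_eq[OF PL(2)[OF JH(2)]])
      finally show "emeasure (PL J) A = emeasure (distr (PL H) (PiM J (\<lambda>_. borel)) (\<lambda>f. restrict f J)) A"
        by (simp add: J.emeasure_eq_measure D.emeasure_eq_measure)
    qed (simp add: PL(2)[OF J])
  qed (rule PL(1))
  show thesis
  proof (rule that)
    show "prob_space lim" by (rule P.prob_space_axioms)
    show "sets lim = sets (PiM UNIV (\<lambda>_. borel))" by simp
    fix p B assume B: "local_set p (B :: (nat \<Rightarrow> 'a) set)"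
    \<comment> \<open>The value beyond p is arbitrary, since B does not see it.\<close>
    define ext where "ext x = (\<lambda>k. if k \<le> p then x k else undefined)" for x :: "nat \<Rightarrow> 'a"
    have ext: "ext \<in> PiM {..p} (\<lambda>_. borel) \<rightarrow>\<^sub>M PiM UNIV (\<lambda>_. borel)"
    proof (rule measurable_PiM_single')
      fix k show "(\<lambda>x. ext x k) \<in> borel_measurable (PiM {..p} (\<lambda>_. borel))"
        by (cases "k \<le> p") (auto simp: ext_def)
    qed auto
    let ?A = "ext -` B \<inter> space (PiM {..p} (\<lambda>_. borel))"
    have A: "?A \<in> sets (PiM {..p} (\<lambda>_. borel))"
      by (rule measurable_sets[OF ext local_set_sets[OF B]])
    have eq: "(\<lambda>y. restrict y {..p}) -` ?A = B"
    proof -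
      have "ext (restrict y {..p}) \<in> B \<longleftrightarrow> y \<in> B" for y
        by (rule local_setD[OF B]) (simp add: ext_def)
      then show ?thesis by (auto simp: space_PiM)
    qed
    then have "prod_emb UNIV (\<lambda>_. borel) {..p} ?A = B"
      by (simp add: prod_emb_def)
    then have "measure lim B = measure (PL {..p}) ?A"
      using measure_lim_emb[of "{..p}" ?A] A by simp
    moreover have "measure (R {..p} m) ?A = measure (N m) B" for m
      unfolding mR[OF A] eq ..
    ultimately show "(\<lambda>m. measure (N m) B) \<longlonglongrightarrow> measure lim B"
      using PL(3)[OF _ A] by simp
  qed
qed

section \<open>The limit of the chain started at rest\<close>

context model
begin

text \<open>A state as one sequence, position first and the past moved up by one index, so that
  local events and projective limits apply to states.\<close>

definition enc :: "'d state \<Rightarrow> 'd seq" where "enc z = case_nat (fst z) (snd z)"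
definition dec :: "'d seq \<Rightarrow> 'd state" where "dec y = (y 0, \<lambda>k. y (Suc k))"

lemma enc_dec[simp]: "enc (dec y) = y" and dec_enc[simp]: "dec (enc z) = z"
  by (auto simp: enc_def dec_def fun_eq_iff split: nat.split)

lemma enc_meas[measurable]: "enc \<in> state_space \<rightarrow>\<^sub>M seq_space"
  unfolding enc_def by (intro measurable_case_nat_seq) measurable

lemma dec_meas[measurable]: "dec \<in> seq_space \<rightarrow>\<^sub>M state_space"
  unfolding dec_def by (intro measurable_Pair measurable_PiM_single') auto

lemma law_at_add:
  assumes \<mu>: "initial_distribution PW \<mu>"
  shows "law_at (law_at \<mu> j) m = law_at \<mu> (j + m)"
  using law_at_initial[OF \<mu>, of j]
  by (induction m) (simp_all add: law_at_0 law_at_Suc law_at_Suc[OF \<mu>])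

text \<open>Up to index \<open>p\<close>, the state at time \<open>n + p\<close> is read off \<open>X\<^sub>n\<close> and the noise after \<open>n\<close>.\<close>

definition window :: "nat \<Rightarrow> 'd seq \<Rightarrow> 'd seq" where
  "window p y = case_nat (traj F (y 0) (\<lambda>i. y (Suc i)) p) (\<lambda>k. if k < p then y (p - k) else 0)"

lemma window_meas[measurable]: "window p \<in> seq_space \<rightarrow>\<^sub>M seq_space"
  unfolding window_def
proof (intro measurable_case_nat_seq measurable_traj F_meas)
  show "(\<lambda>z. if k < p then z (p - k) else 0) \<in> borel_measurable (seq_space :: 'd seq measure)" for k
    by (cases "k < p") auto
qed auto

lemma enc_proc_window: "k \<le> p \<Longrightarrow> enc (proc (n + p) z) k = window p (obs (fst (fst z)) n z) k"
proof (cases k)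
  case (Suc i)
  assume "k \<le> p"
  with Suc obtain d where "p = Suc i + d" by (auto simp: le_iff_add)
  with Suc show ?thesis by (simp add: enc_def proc_def window_def obs_def hist_def)
qed (simp add: enc_def proc_def window_def obs_def traj_add)

lemma enc_law_window:
  assumes \<mu>: "initial_distribution PW \<mu>" and B: "local_set p B"
  shows "measure (distr (law_at \<mu> (n + p)) seq_space enc) B = measure (obs_law \<mu> n) (window p -` B)"
proof -
  note Bs = local_set_sets[OF B]
  have m1: "proc (n + p) \<in> Om \<mu> \<rightarrow>\<^sub>M state_space" and m2: "(\<lambda>z. obs (fst (fst z)) n z) \<in> Om \<mu> \<rightarrow>\<^sub>M seq_space"
    unfolding measurable_Om[OF \<mu>] by (rule measurable_proc, rule measurable_obs_fst)
  have W: "window p -` B \<in> sets (seq_space :: 'd seq measure)"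
    using measurable_sets[OF window_meas Bs] by (simp add: space_PiM)
  have iff: "enc (proc (n + p) z) \<in> B \<longleftrightarrow> window p (obs (fst (fst z)) n z) \<in> B" for z
    by (rule local_setD[OF B]) (rule enc_proc_window)
  have "measure (distr (law_at \<mu> (n + p)) seq_space enc) B = measure (Om \<mu>) ((\<lambda>z. enc (proc (n + p) z)) -` B \<inter> space (Om \<mu>))"
    unfolding law_at_def[OF \<mu>] distr_distr[OF enc_meas m1] by (subst measure_distr[OF measurable_comp[OF m1 enc_meas] Bs]) (simp add: comp_def)
  also have "\<dots> = measure (Om \<mu>) ((\<lambda>z. obs (fst (fst z)) n z) -` (window p -` B) \<inter> space (Om \<mu>))"
    using iff by (intro arg_cong[where f="measure (Om \<mu>)"]) auto
  also have "\<dots> = measure (obs_law \<mu> n) (window p -` B)"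
    unfolding obs_law_def by (rule measure_distr[OF m2 W, symmetric])
  finally show ?thesis .
qed

text \<open>A start at which V is trivially integrable; it supplies the sequence of laws whose limit
  is the invariant distribution.\<close>

definition rest :: "'d state measure" where
  "rest = distr PW state_space (\<lambda>w. (0, w))"

lemma rest_initial: "initial_distribution PW rest" and rest_V: "V_mean rest = ennreal (V 0)"
proof -
  interpret W: prob_space PW by (rule prob_space_past_law)
  have m: "(\<lambda>w. (0, w)) \<in> PW \<rightarrow>\<^sub>M (state_space :: 'd state measure)" by measurable
  have "distr PW seq_space (\<lambda>x. x) = PW" by (rule distr_id2) (rule sets_past_law[symmetric])
  then show "initial_distribution PW rest"
    unfolding initial_distribution_def rest_def
    using W.prob_space_distr[OF m] by (simp add: distr_distr[OF measurable_snd m] comp_def)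
  show "V_mean rest = ennreal (V 0)"
    unfolding V_mean_def rest_def by (subst nn_integral_distr[OF m]) (auto simp: W.emeasure_space_1)
qed

text \<open>The law at time m + j is that at time m from the initial law reached after j steps. Both
  initial laws have V-mean at most V 0 + R, and on p coordinates the state at time m is a function
  of \<open>obs\<close> at time m - p, so the two laws differ by at most twice the forgetting bound
  at m - p.\<close>

lemma limit_law:
  obtains L \<delta> where "prob_space L" "sets L = sets (seq_space :: 'd seq measure)" "\<And>p. \<delta> p \<longlonglongrightarrow> 0"
    "\<And>p m B. local_set p B \<Longrightarrow> \<bar>measure (distr (law_at rest m) seq_space enc) B - measure L B\<bar> \<le> \<delta> p m"
proof -
  show thesis
  proof (rule forgetting, goal_cases)
  case (1 C)
  note C = 1(1) and forget = 1(2)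
  show thesis
  proof (rule V_mean_law_at, goal_cases)
  case (1 R)
  note R = 1(1) and VR = 1(2)
  define N where "N m = distr (law_at rest m) seq_space enc" for m
  define K where "K = 1 + V 0 + R"
  \<comment> \<open>For m \<le> p the window reaches back before time 1, where forgetting says
    nothing; the trivial bound 1 is used.\<close>
  define \<delta> where "\<delta> p m = (if p < m then 2 * C * K / real (m - p) else 1)" for p m
  note ini = law_at_initial[OF rest_initial]
  have VK: "1 + enn2real (V_mean (law_at rest j)) \<le> K" "V_mean (law_at rest j) < \<infinity>" for j
  proof -
    have "V_mean (law_at rest j) \<le> ennreal (V 0 + R)"
      using VR[OF rest_initial, of j] R V_nonneg by (simp add: rest_V)
    then show "1 + enn2real (V_mean (law_at rest j)) \<le> K" "V_mean (law_at rest j) < \<infinity>"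
      using R V_nonneg[of 0] by (auto simp: K_def enn2real_leI intro: le_less_trans)
  qed
  have probN: "prob_space (N m)" for m
  proof -
    have "enc \<in> law_at rest m \<rightarrow>\<^sub>M seq_space"
      unfolding measurable_initial[OF ini] by (rule enc_meas)
    then show ?thesis unfolding N_def by (rule prob_space.prob_space_distr[OF prob_\<mu>[OF ini]])
  qed
  have setsN: "sets (N m) = sets seq_space" for m by (simp add: N_def)
  have lim: "\<delta> p \<longlonglongrightarrow> 0" for p
  proof (rule LIMSEQ_offset)
    have "(\<lambda>m. 2 * C * K / real (Suc m)) \<longlonglongrightarrow> 0"
      by (rule LIMSEQ_Suc) (rule lim_const_over_n)
    then show "(\<lambda>m. \<delta> p (m + Suc p)) \<longlonglongrightarrow> 0" by (simp add: \<delta>_def)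
  qed
  have close: "\<bar>measure (N m) B - measure (N (m + j)) B\<bar> \<le> \<delta> p m" if B: "local_set p B" for p m j B
  proof (cases "p < m")
    case True
    define n where "n = m - p"
    have n: "m = n + p" "n \<ge> 1" using True by (auto simp: n_def)
    have W: "window p -` B \<in> sets (seq_space :: 'd seq measure)"
      using measurable_sets[OF window_meas local_set_sets[OF B]] by (simp add: space_PiM)
    have N: "measure (N (m + j)) B = measure (obs_law (law_at rest j) n) (window p -` B)" for j
      using enc_law_window[OF ini B, of j n] by (simp add: N_def law_at_add[OF rest_initial] n add.commute)
    have f: "\<bar>measure (N (m + j)) B - measure (ref_law n) (window p -` B)\<bar> \<le> C * K / real n" for j
    proof -
      have "\<bar>measure (N (m + j)) B - measure (ref_law n) (window p -` B)\<bar> \<le> C * (1 + enn2real (V_mean (law_at rest j))) / real n"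
        unfolding N by (rule forget[OF ini VK(2) n(2) W])
      also have "\<dots> \<le> C * K / real n"
        using VK(1)[of j] C by (intro divide_right_mono mult_left_mono) auto
      finally show ?thesis .
    qed
    show ?thesis using f[of 0] f[of j] True by (simp add: \<delta>_def n_def)
  next
    case False
    have "measure (N i) B \<le> 1" "0 \<le> measure (N i) B" for i
      by (simp_all add: prob_space.prob_le_1[OF probN])
    from this[of m] this[of "m + j"] False show ?thesis
      unfolding \<delta>_def by (simp only: if_False)
  qed
  obtain L where L: "prob_space L" "sets L = sets (seq_space :: 'd seq measure)" "\<And>p B. local_set p B \<Longrightarrow> (\<lambda>m. measure (N m) B) \<longlonglongrightarrow> measure L B"
    by (rule projective_limit_of_laws[OF probN setsN lim close, OF _ that])
  show thesis
  proof (rule that[OF L(1,2) lim])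
    fix p m and B :: "'d seq set" assume B: "local_set p B"
    have "\<bar>measure (N m) B - measure L B\<bar> \<le> \<delta> p m"
    proof (rule LIMSEQ_le_const2)
      show "(\<lambda>j. \<bar>measure (N m) B - measure (N (m + j)) B\<bar>) \<longlonglongrightarrow> \<bar>measure (N m) B - measure L B\<bar>"
        using LIMSEQ_ignore_initial_segment[OF L(3)[OF B], of m] by (intro tendsto_intros) (simp add: add.commute)
      show "\<exists>N'. \<forall>j\<ge>N'. \<bar>measure (N m) B - measure (N (m + j)) B\<bar> \<le> \<delta> p m" using close[OF B] by blast
    qed
    then show "\<bar>measure (distr (law_at rest m) seq_space enc) B - measure L B\<bar> \<le> \<delta> p m" by (simp add: N_def)
  qed
  qed
  qed
qed

section \<open>Continuity of the one-step law in total variation\<close>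

definition gauss_density :: "real ^ 'd \<Rightarrow> real" where
  "gauss_density x = (2 * pi) powr (- real CARD('d) / 2) * exp (- (norm x)\<^sup>2 / 2)"

lemma gauss_density_nonneg: "0 \<le> gauss_density x"
  by (simp add: gauss_density_def)

lemma continuous_gauss_density: "continuous_on UNIV gauss_density"
  unfolding gauss_density_def by (intro continuous_intros) auto

lemma gauss_density_meas[measurable]: "gauss_density \<in> borel_measurable borel"
  by (rule borel_measurable_continuous_onI[OF continuous_gauss_density])

lemma nn_integral_gauss_shift:
  assumes [measurable]: "f \<in> borel_measurable borel"
  shows "(\<integral>\<^sup>+u. f (c + u) \<partial>std_gaussian) = (\<integral>\<^sup>+u. f u * ennreal (gauss_density (u - c)) \<partial>lborel)"
proof -
  have "(\<integral>\<^sup>+u. f (c + u) \<partial>std_gaussian) = (\<integral>\<^sup>+u. f (c + u) * ennreal (gauss_density ((c + u) - c)) \<partial>lborel)"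
    unfolding std_gaussian_def gauss_density_def[symmetric] by (subst nn_integral_density) (auto simp: mult.commute)
  also have "\<dots> = (\<integral>\<^sup>+u. f u * ennreal (gauss_density (u - c)) \<partial>distr lborel borel ((+) c))"
    by (rule nn_integral_distr[symmetric]) measurable
  finally show ?thesis unfolding lborel_distr_plus .
qed

lemma predictor_lim: "AE w in PW. (\<lambda>j. approx_predictor j w) \<longlonglongrightarrow> predictor w"
proof -
  have "AE w in PW. Cauchy (\<lambda>j. approx_predictor j w)"
    unfolding past_law_def
  proof (subst AE_distr_iff)
    show "{w \<in> space seq_space. Cauchy (\<lambda>j. approx_predictor j w)} \<in> sets seq_space"
      by (rule sets_Collect_Cauchy) measurable
    show "AE \<omega> in M. Cauchy (\<lambda>j. approx_predictor j (past \<Delta> 0 \<omega>))"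
      using approx_predictor_lim[of 0] by eventually_elim (rule LIMSEQ_imp_Cauchy)
  qed simp
  then show ?thesis
    by eventually_elim (simp add: predictor_def Cauchy_convergent_iff convergent_LIMSEQ_iff)
qed

abbreviation kernel_mean :: "('d seq \<Rightarrow> real ^ 'd) \<Rightarrow> ('d state \<times> (real ^ 'd) \<Rightarrow> ennreal) \<Rightarrow> 'd state measure \<Rightarrow> ennreal" where
  "kernel_mean D f \<mu> \<equiv> \<integral>\<^sup>+z. \<integral>\<^sup>+u. f (z, D (snd z) + a 0 *\<^sub>R u) \<partial>std_gaussian \<partial>\<mu>"

text \<open>The densities of Gaussians with converging means converge pointwise, and Scheffe's lemma
  turns this into convergence in mean over past and noise jointly. The error is the same for all
  \<mu>, which share the marginal on pasts, and for all f bounded by 1, so it can be applied along a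
  whole sequence of laws.\<close>

lemma predictor_approximation:
  obtains \<eta> where "\<eta> \<longlonglongrightarrow> 0" "\<And>j. 0 \<le> \<eta> j"
    "\<And>\<mu> j f. \<lbrakk>initial_distribution PW \<mu>; f \<in> borel_measurable (state_space \<Otimes>\<^sub>M borel); \<And>z. f z \<le> 1\<rbrakk> \<Longrightarrow>
      kernel_mean predictor f \<mu> \<le>
      kernel_mean (approx_predictor j) f \<mu> + ennreal (\<eta> j) \<and>
      kernel_mean (approx_predictor j) f \<mu> \<le>
      kernel_mean predictor f \<mu> + ennreal (\<eta> j)"
proof -
  interpret W: prob_space PW by (rule prob_space_past_law)
  \<comment> \<open>The displacement of the mean in units of the conditional standard deviation; it
    moves the standard Gaussian density.\<close>
  define c where "c j w = (1 / a 0) *\<^sub>R (approx_predictor j w - predictor w)" for j w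
  have c_meas[measurable]: "c j \<in> borel_measurable seq_space" for j
    unfolding c_def by measurable
  have c_eq: "approx_predictor j w + a 0 *\<^sub>R u = predictor w + a 0 *\<^sub>R (c j w + u)" for j w u
    using a_0_pos by (simp add: c_def scaleR_add_right)
  define k where "k j v = gauss_density (snd v - c j (fst v))" for j v
  define k0 :: "'d seq \<times> (real ^ 'd) \<Rightarrow> real" where "k0 v = gauss_density (snd v)" for v
  have k_meas[measurable]: "k j \<in> borel_measurable (PW \<Otimes>\<^sub>M lborel)" "k0 \<in> borel_measurable (PW \<Otimes>\<^sub>M lborel)" for j
    unfolding k_def k0_def by measurable
  have one: "(\<integral>\<^sup>+u. ennreal (gauss_density (u - x)) \<partial>lborel) = 1" for x
  proof -
    have "emeasure (std_gaussian :: (real ^ 'd) measure) (space std_gaussian) = 1" by (rule std_gaussian.emeasure_space_1)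
    then show ?thesis using nn_integral_gauss_shift[of "\<lambda>_. 1" x] by simp
  qed
  have fst_l: "(\<integral>\<^sup>+w. \<integral>\<^sup>+u. f (w, u) \<partial>lborel \<partial>PW) = (\<integral>\<^sup>+v. f v \<partial>(PW \<Otimes>\<^sub>M lborel))"
    if "f \<in> borel_measurable (PW \<Otimes>\<^sub>M lborel)" for f
    by (rule lborel.nn_integral_fst[OF that])
  have int: "(\<integral>\<^sup>+v. ennreal (k j v) \<partial>(PW \<Otimes>\<^sub>M lborel)) = 1" "(\<integral>\<^sup>+v. ennreal (k0 v) \<partial>(PW \<Otimes>\<^sub>M lborel)) = 1" for j
    using one[of "0"] by (subst fst_l[symmetric]; simp add: k_def k0_def one W.emeasure_space_1)+
  have norm_k: "norm (k j v) = k j v" "norm (k0 v) = k0 v" for j v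
    by (simp_all add: k_def k0_def gauss_density_nonneg)
  define h where "h j = (\<integral>\<^sup>+v. ennreal (norm (k j v - k0 v)) \<partial>(PW \<Otimes>\<^sub>M lborel))" for j
  \<comment> \<open>All densities have total integral 1, so the condition on the limsup holds with
    equality.\<close>
  have h_lim: "h \<longlonglongrightarrow> 0"
    unfolding h_def
  proof (rule Scheffe_lemma1)
    show "integrable (PW \<Otimes>\<^sub>M lborel) (k j)" "integrable (PW \<Otimes>\<^sub>M lborel) k0" for j
      using int by (auto intro!: integrableI_bounded simp: norm_k simp del: real_norm_def)
    have "AE v in PW \<Otimes>\<^sub>M (lborel :: (real ^ 'd) measure). (\<lambda>j. approx_predictor j (fst v)) \<longlonglongrightarrow> predictor (fst v)"
    proof -
      interpret pair_sigma_finite PW "lborel :: (real ^ 'd) measure"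
        by (intro pair_sigma_finite.intro W.sigma_finite_measure_axioms lborel.sigma_finite_measure_axioms)
      obtain N where N: "{w \<in> space PW. \<not> (\<lambda>j. approx_predictor j w) \<longlonglongrightarrow> predictor w} \<subseteq> N" "emeasure PW N = 0" "N \<in> sets PW"
        by (rule AE_E[OF predictor_lim])
      note N(3)[measurable]
      have "AE w in PW. w \<notin> N" using N by (intro AE_not_in) auto
      then have "AE v in PW \<Otimes>\<^sub>M (lborel :: (real ^ 'd) measure). fst v \<notin> N"
      proof (intro AE_pair_measure)
        have "{v \<in> space (PW \<Otimes>\<^sub>M (lborel :: (real ^ 'd) measure)). fst v \<notin> N} = (space PW - N) \<times> space lborel"
          by (auto simp: space_pair_measure)
        also have "\<dots> \<in> sets (PW \<Otimes>\<^sub>M lborel)" using N(3) by (intro pair_measureI) auto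
        finally show "{v \<in> space (PW \<Otimes>\<^sub>M (lborel :: (real ^ 'd) measure)). fst v \<notin> N} \<in> sets (PW \<Otimes>\<^sub>M lborel)" .
      qed auto
      then show ?thesis
        using AE_space[of "PW \<Otimes>\<^sub>M (lborel :: (real ^ 'd) measure)"]
      proof eventually_elim
        case (elim v)
        then show ?case using N(1) by (auto simp: space_pair_measure)
      qed
    qed
    then show "AE v in PW \<Otimes>\<^sub>M lborel. (\<lambda>j. k j v) \<longlonglongrightarrow> k0 v"
    proof eventually_elim
      case (elim v)
      have "(\<lambda>j. snd v - (1 / a 0) *\<^sub>R (approx_predictor j (fst v) - predictor (fst v))) \<longlonglongrightarrow> snd v - (1 / a 0) *\<^sub>R (predictor (fst v) - predictor (fst v))"
        by (intro tendsto_intros elim)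
      then have "(\<lambda>j. gauss_density (snd v - c j (fst v))) \<longlonglongrightarrow> gauss_density (snd v)"
        unfolding c_def using continuous_on_tendsto_compose[OF continuous_gauss_density] by fastforce
      then show ?case by (simp add: k_def k0_def)
    qed
    show "limsup (\<lambda>j. \<integral>\<^sup>+v. ennreal (norm (k j v)) \<partial>(PW \<Otimes>\<^sub>M lborel)) \<le> (\<integral>\<^sup>+v. ennreal (norm (k0 v)) \<partial>(PW \<Otimes>\<^sub>M lborel))"
      unfolding norm_k int by (simp add: Limsup_const)
  qed
  have h_fin: "h j < \<infinity>" for j
  proof -
    have "h j \<le> (\<integral>\<^sup>+v. ennreal (k j v) + ennreal (k0 v) \<partial>(PW \<Otimes>\<^sub>M lborel))"
      unfolding h_def
    proof (intro nn_integral_mono)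
      fix v
      have "0 \<le> k j v" "0 \<le> k0 v" by (simp_all add: k_def k0_def gauss_density_nonneg)
      then show "ennreal (norm (k j v - k0 v)) \<le> ennreal (k j v) + ennreal (k0 v)"
        by (simp flip: ennreal_plus)
    qed
    also have "\<dots> = 2" using int by (simp add: nn_integral_add)
    finally show ?thesis by (rule le_less_trans) simp
  qed
  show thesis
  proof (rule that[of "\<lambda>j. enn2real (h j)"])
    show "(\<lambda>j. enn2real (h j)) \<longlonglongrightarrow> 0"
      using tendsto_enn2real[OF h_lim[folded ennreal_0]] by simp
    show "0 \<le> enn2real (h j)" for j by simp
    fix \<mu> j and f :: "'d state \<times> (real ^ 'd) \<Rightarrow> ennreal"
    assume \<mu>: "initial_distribution PW \<mu>" and f[measurable]: "f \<in> borel_measurable (state_space \<Otimes>\<^sub>M borel)" and f1: "\<And>z. f z \<le> 1"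
    define e where "e w = (\<integral>\<^sup>+u. ennreal (norm (k j (w, u) - k0 (w, u))) \<partial>lborel)" for w
    have snd_mu: "snd \<in> \<mu> \<rightarrow>\<^sub>M seq_space"
      unfolding measurable_initial[OF \<mu>] by measurable
    have e_meas[measurable]: "e \<in> borel_measurable seq_space"
      unfolding e_def k_def k0_def by measurable
    have e_int: "(\<integral>\<^sup>+z. e (snd z) \<partial>\<mu>) = ennreal (enn2real (h j))"
    proof -
      have "(\<integral>\<^sup>+z. e (snd z) \<partial>\<mu>) = (\<integral>\<^sup>+w. e w \<partial>PW)"
        unfolding snd_\<mu>[OF \<mu>, symmetric] by (rule nn_integral_distr[OF snd_mu, symmetric]) simp
      also have "\<dots> = h j" unfolding e_def h_def by (rule fst_l) measurable
      finally show ?thesis using h_fin[of j] by simp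
    qed
    define x where "x z = (\<integral>\<^sup>+u. f (z, predictor (snd z) + a 0 *\<^sub>R u) \<partial>std_gaussian)" for z
    define y where "y z = (\<integral>\<^sup>+u. f (z, approx_predictor j (snd z) + a 0 *\<^sub>R u) \<partial>std_gaussian)" for z
    have xy_meas: "x \<in> borel_measurable \<mu>" "y \<in> borel_measurable \<mu>"
    proof -
      have "(\<lambda>z. \<integral>\<^sup>+u. f (z, p (snd z) + a 0 *\<^sub>R u) \<partial>std_gaussian) \<in> borel_measurable state_space"
        if [measurable]: "p \<in> borel_measurable seq_space" for p :: "'d seq \<Rightarrow> real ^ 'd"
      proof (rule std_gaussian.borel_measurable_nn_integral)
        have "(\<lambda>v. p (snd (fst v)) + a 0 *\<^sub>R snd v) \<in> borel_measurable ((state_space :: 'd state measure) \<Otimes>\<^sub>M std_gaussian)"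
        proof -
          have "snd \<in> (state_space :: 'd state measure) \<Otimes>\<^sub>M std_gaussian \<rightarrow>\<^sub>M (borel :: (real ^ 'd) measure)"
            using measurable_snd[of "state_space :: 'd state measure" "std_gaussian :: (real ^ 'd) measure"]
            unfolding measurable_cong_sets[OF refl sets_std_gaussian] .
          then show ?thesis
            by (intro borel_measurable_add borel_measurable_scaleR borel_measurable_const
                measurable_compose[OF measurable_compose[OF measurable_fst measurable_snd] that])
        qed
        from measurable_compose[OF measurable_Pair[OF measurable_fst this] f]
        show "(\<lambda>(z, u). f (z, p (snd z) + a 0 *\<^sub>R u)) \<in> borel_measurable (state_space \<Otimes>\<^sub>M std_gaussian)"
          by (simp add: case_prod_beta')
      qed
      then show "x \<in> borel_measurable \<mu>" "y \<in> borel_measurable \<mu>"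
        unfolding measurable_initial[OF \<mu>] x_def y_def by simp_all
    qed
    have xy: "x z \<le> y z + e (snd z) \<and> y z \<le> x z + e (snd z)" for z
    proof -
      define G where "G v = f (z, predictor (snd z) + a 0 *\<^sub>R v)" for v
      have [simp]: "z \<in> space state_space" by (simp add: space_pair_measure space_PiM)
      have G[measurable]: "G \<in> borel_measurable borel" unfolding G_def by measurable
      have x: "x z = (\<integral>\<^sup>+u. G u * ennreal (k0 (snd z, u)) \<partial>lborel)"
        using nn_integral_gauss_shift[OF G, of 0] by (simp add: x_def G_def k0_def)
      have y: "y z = (\<integral>\<^sup>+u. G u * ennreal (k j (snd z, u)) \<partial>lborel)"
        using nn_integral_gauss_shift[OF G, of "c j (snd z)"] by (simp add: y_def G_def k_def c_eq)
      have km[measurable]: "(\<lambda>u. k j (snd z, u)) \<in> borel_measurable borel" "(\<lambda>u. k0 (snd z, u)) \<in> borel_measurable borel"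
        unfolding k_def k0_def by simp_all
      have *: "(\<integral>\<^sup>+u. G u * ennreal (p u) \<partial>lborel) \<le> (\<integral>\<^sup>+u. G u * ennreal (q u) \<partial>lborel) + (\<integral>\<^sup>+u. ennreal (norm (p u - q u)) \<partial>lborel)"
        if [measurable]: "p \<in> borel_measurable borel" "q \<in> borel_measurable borel" and q: "\<And>u. 0 \<le> q u" for p q
      proof -
        have "(\<integral>\<^sup>+u. G u * ennreal (p u) \<partial>lborel) \<le> (\<integral>\<^sup>+u. G u * ennreal (q u) + ennreal (norm (p u - q u)) \<partial>lborel)"
        proof (intro nn_integral_mono)
          fix u
          have "ennreal (p u) \<le> ennreal (q u) + ennreal (norm (p u - q u))"
            using q[of u] by (simp flip: ennreal_plus)
          then have "G u * ennreal (p u) \<le> G u * (ennreal (q u) + ennreal (norm (p u - q u)))"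
            by (rule mult_left_mono) simp
          also have "\<dots> \<le> G u * ennreal (q u) + 1 * ennreal (norm (p u - q u))"
            unfolding distrib_left using f1 by (intro add_left_mono mult_right_mono) (auto simp: G_def)
          finally show "G u * ennreal (p u) \<le> G u * ennreal (q u) + ennreal (norm (p u - q u))" by simp
        qed
        also have "\<dots> = (\<integral>\<^sup>+u. G u * ennreal (q u) \<partial>lborel) + (\<integral>\<^sup>+u. ennreal (norm (p u - q u)) \<partial>lborel)"
          by (rule nn_integral_add) measurable
        finally show ?thesis .
      qed
      show ?thesis
        unfolding x y e_def using *[OF km(2,1)] *[OF km] gauss_density_nonneg
        by (auto simp: k_def k0_def norm_minus_commute simp del: real_norm_def)
    qed
    have m2: "(\<lambda>z. e (snd z)) \<in> borel_measurable \<mu>" by (rule measurable_compose[OF snd_mu e_meas])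
    have "(\<integral>\<^sup>+z. x z \<partial>\<mu>) \<le> (\<integral>\<^sup>+z. y z + e (snd z) \<partial>\<mu>)" "(\<integral>\<^sup>+z. y z \<partial>\<mu>) \<le> (\<integral>\<^sup>+z. x z + e (snd z) \<partial>\<mu>)"
      using xy by (auto intro!: nn_integral_mono)
    then show "kernel_mean predictor f \<mu> \<le>
      kernel_mean (approx_predictor j) f \<mu> + ennreal (enn2real (h j)) \<and>
      kernel_mean (approx_predictor j) f \<mu> \<le>
      kernel_mean predictor f \<mu> + ennreal (enn2real (h j))"
      unfolding x_def[symmetric] y_def[symmetric] e_int[symmetric] nn_integral_add[OF xy_meas(1) m2] nn_integral_add[OF xy_meas(2) m2] by simp
  qed
qed

definition step :: "'d seq set \<Rightarrow> 'd state \<times> (real ^ 'd) \<Rightarrow> ennreal" where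
  "step B v = indicator B (enc (phi F (fst v) (snd v)))"

lemma step_meas[measurable]:
  assumes "B \<in> sets seq_space"
  shows "step B \<in> borel_measurable (state_space \<Otimes>\<^sub>M borel)"
  unfolding step_def
  by (intro measurable_compose[OF measurable_compose[OF measurable_phi[OF measurable_fst measurable_snd] enc_meas] borel_measurable_indicator[OF assms]])

lemma law_at_1:
  assumes \<mu>: "initial_distribution PW \<mu>" and B: "B \<in> sets seq_space"
  shows "emeasure (distr (law_at \<mu> 1) seq_space enc) B = kernel_mean predictor (step B) \<mu>"
proof -
  interpret \<mu>: prob_space \<mu> by (rule prob_\<mu>[OF \<mu>])
  have Q\<mu>: "Q \<in> \<mu> \<rightarrow>\<^sub>M subprob_algebra state_space"
    unfolding measurable_initial[OF \<mu>] by (rule measurable_prob_algebraD[OF Q_meas])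
  have m: "enc \<in> law_at \<mu> 1 \<rightarrow>\<^sub>M seq_space"
    unfolding measurable_initial[OF law_at_initial[OF \<mu>]] by (rule enc_meas)
  have sp: "space (law_at \<mu> 1) = UNIV"
    using sets_eq_imp_space_eq[OF sets_\<mu>[OF law_at_initial[OF \<mu>]]] by (simp add: space_pair_measure space_PiM)
  have E: "enc -` B \<in> sets state_space"
    using measurable_sets[OF enc_meas B] by (simp add: space_pair_measure space_PiM)
  have "emeasure (distr (law_at \<mu> 1) seq_space enc) B = emeasure (\<mu> \<bind> Q) (enc -` B)"
    unfolding emeasure_distr[OF m B] sp using law_at_Suc[OF \<mu>, of 0] by (simp add: law_at_0[OF \<mu>])
  also have "\<dots> = (\<integral>\<^sup>+z. emeasure (Q z) (enc -` B) \<partial>\<mu>)"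
    by (rule emeasure_bind[OF \<mu>.not_empty Q\<mu> E])
  also have "\<dots> = kernel_mean predictor (step B) \<mu>"
  proof (rule nn_integral_cong_AE)
    have snd_mu: "snd \<in> \<mu> \<rightarrow>\<^sub>M seq_space"
      unfolding measurable_initial[OF \<mu>] by measurable
    have "AE z in \<mu>. P (snd z) = kernel (snd z)"
      by (rule AE_distrD[OF snd_mu, of "\<lambda>w. P w = kernel w", unfolded snd_\<mu>[OF \<mu>], OF noise_kernel_AE[OF nk]])
    then show "AE z in \<mu>. emeasure (Q z) (enc -` B) = (\<integral>\<^sup>+u. step B (z, predictor (snd z) + a 0 *\<^sub>R u) \<partial>std_gaussian)"
    proof eventually_elim
      case (elim z)
      have "emeasure (Q z) (enc -` B) = (\<integral>\<^sup>+y. indicator (enc -` B) y \<partial>Q z)"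
        using E by (intro nn_integral_indicator[symmetric]) (simp add: Q_kernel_def)
      also have "\<dots> = (\<integral>\<^sup>+u. indicator (enc -` B) (phi F z (predictor (snd z) + a 0 *\<^sub>R u)) \<partial>std_gaussian)"
        using E by (intro Q_kernel_eq[OF elim]) simp
      finally show ?case by (simp add: step_def indicator_def)
    qed
  qed
  finally show ?thesis .
qed

text \<open>The truncated predictor reads coordinates 1 to \<open>subseq_b j\<close> of the encoded
  state, and the shifted past reads coordinates below p. The exact predictor depends on the whole
  past and would not give a local event; this is the purpose of the truncation.\<close>

lemma approx_step_local:
  assumes B: "local_set p B"
  shows "local_set (max p (subseq_b j)) {y. enc (phi F (dec y) (approx_predictor j (snd (dec y)) + u')) \<in> B}"
  unfolding local_set_def
proof (intro conjI allI impI)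
  have "(\<lambda>y. enc (phi F (dec y) (approx_predictor j (snd (dec y)) + u'))) \<in> seq_space \<rightarrow>\<^sub>M (seq_space :: 'd seq measure)"
  proof (rule measurable_compose[OF measurable_phi[OF dec_meas] enc_meas])
    show "(\<lambda>y. approx_predictor j (snd (dec y)) + u') \<in> borel_measurable seq_space"
      by (intro borel_measurable_add borel_measurable_const
          measurable_compose[OF measurable_compose[OF dec_meas measurable_snd] approx_predictor_meas])
  qed
  from measurable_sets[OF this local_set_sets[OF B]]
  show "{y. enc (phi F (dec y) (approx_predictor j (snd (dec y)) + u')) \<in> B} \<in> sets (seq_space :: 'd seq measure)"
    by (simp add: vimage_def space_PiM)
  fix y y' :: "'d seq" assume eq: "\<forall>k\<le>max p (subseq_b j). y k = y' k"
  have D: "approx_predictor j (snd (dec y)) = approx_predictor j (snd (dec y'))"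
    unfolding approx_predictor_def dec_def using eq by (auto intro!: sum.cong)
  have "enc (phi F (dec y) v) k = enc (phi F (dec y') v) k" if "k \<le> p" for k v
    using that eq by (auto simp: enc_def dec_def phi_def snoc_past_def split: nat.split)
  then show "y \<in> {y. enc (phi F (dec y) (approx_predictor j (snd (dec y)) + u')) \<in> B} \<longleftrightarrow> y' \<in> {y. enc (phi F (dec y) (approx_predictor j (snd (dec y)) + u')) \<in> B}"
    unfolding mem_Collect_eq D by (rule local_setD[OF B])
qed

text \<open>By Fubini the Gaussian variable u is frozen first. For fixed u the event after one step
  is a local event before it, where the two laws are close.\<close>

lemma approx_step_close:
  assumes \<mu>: "initial_distribution PW \<mu>" and \<nu>: "initial_distribution PW \<nu>" and B: "local_set p B"
    and close: "\<And>C. local_set (max p (subseq_b j)) C \<Longrightarrow> measure (distr \<mu> seq_space enc) C \<le> measure (distr \<nu> seq_space enc) C + \<delta>"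
    and \<delta>: "0 \<le> \<delta>"
  shows "kernel_mean (approx_predictor j) (step B) \<mu> \<le>
    kernel_mean (approx_predictor j) (step B) \<nu> + ennreal \<delta>"
proof -
  let ?f = "\<lambda>z u. step B (z, approx_predictor j (snd z) + a 0 *\<^sub>R u)"
  let ?C = "\<lambda>u. {y. enc (phi F (dec y) (approx_predictor j (snd (dec y)) + a 0 *\<^sub>R u)) \<in> B}"
  have C: "local_set (max p (subseq_b j)) (?C u)" for u by (rule approx_step_local[OF B])
  have swap: "(\<integral>\<^sup>+z. \<integral>\<^sup>+u. ?f z u \<partial>std_gaussian \<partial>\<rho>) = (\<integral>\<^sup>+u. emeasure (distr \<rho> seq_space enc) (?C u) \<partial>std_gaussian)"
    and meas: "(\<lambda>u. emeasure (distr \<rho> seq_space enc) (?C u)) \<in> borel_measurable std_gaussian"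
    and prob: "prob_space (distr \<rho> seq_space enc)"
    if \<rho>: "initial_distribution PW \<rho>" for \<rho>
  proof -
    interpret \<rho>: prob_space \<rho> by (rule prob_\<mu>[OF \<rho>])
    interpret pair_sigma_finite \<rho> "std_gaussian :: (real ^ 'd) measure"
      by (intro pair_sigma_finite.intro \<rho>.sigma_finite_measure_axioms std_gaussian.sigma_finite_measure_axioms)
    have m: "enc \<in> \<rho> \<rightarrow>\<^sub>M seq_space"
      unfolding measurable_initial[OF \<rho>] by (rule enc_meas)
    show "prob_space (distr \<rho> seq_space enc)" by (rule \<rho>.prob_space_distr[OF m])
    have sets_pair: "sets (\<rho> \<Otimes>\<^sub>M std_gaussian) = sets (state_space \<Otimes>\<^sub>M (borel :: (real ^ 'd) measure))"
      by (rule sets_pair_measure_cong[OF sets_\<mu>[OF \<rho>] sets_std_gaussian])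
    have "(\<lambda>v. approx_predictor j (snd (fst v)) + a 0 *\<^sub>R snd v) \<in> borel_measurable (state_space \<Otimes>\<^sub>M (borel :: (real ^ 'd) measure))"
      by (intro borel_measurable_add borel_measurable_scaleR borel_measurable_const measurable_snd
          measurable_compose[OF measurable_compose[OF measurable_fst measurable_snd] approx_predictor_meas])
    from measurable_compose[OF measurable_Pair[OF measurable_fst this] step_meas[OF local_set_sets[OF B]]]
    have f: "(\<lambda>v. ?f (fst v) (snd v)) \<in> borel_measurable (\<rho> \<Otimes>\<^sub>M std_gaussian)"
      unfolding measurable_cong_sets[OF sets_pair refl] by simp
    have em: "(\<integral>\<^sup>+z. ?f z u \<partial>\<rho>) = emeasure (distr \<rho> seq_space enc) (?C u)" for u
    proof -
      have "(\<integral>\<^sup>+z. ?f z u \<partial>\<rho>) = (\<integral>\<^sup>+z. indicator (?C u) (enc z) \<partial>\<rho>)"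
        by (intro nn_integral_cong) (simp add: step_def indicator_def)
      also have "\<dots> = (\<integral>\<^sup>+y. indicator (?C u) y \<partial>distr \<rho> seq_space enc)"
        using local_set_sets[OF C] by (intro nn_integral_distr[OF m, symmetric]) simp
      also have "\<dots> = emeasure (distr \<rho> seq_space enc) (?C u)"
        using local_set_sets[OF C] by (intro nn_integral_indicator) simp
      finally show ?thesis .
    qed
    show "(\<integral>\<^sup>+z. \<integral>\<^sup>+u. ?f z u \<partial>std_gaussian \<partial>\<rho>) = (\<integral>\<^sup>+u. emeasure (distr \<rho> seq_space enc) (?C u) \<partial>std_gaussian)"
      unfolding em[symmetric] using Fubini[OF f] by simp
    have "(\<lambda>u. \<integral>\<^sup>+z. ?f z u \<partial>\<rho>) \<in> borel_measurable std_gaussian"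
    proof (rule \<rho>.borel_measurable_nn_integral)
      have "(\<lambda>x. (\<lambda>v. ?f (fst v) (snd v)) (snd x, fst x)) \<in> borel_measurable (std_gaussian \<Otimes>\<^sub>M \<rho>)"
        by (rule measurable_compose[OF measurable_Pair[OF measurable_snd measurable_fst] f])
      then show "(\<lambda>(u, z). ?f z u) \<in> borel_measurable (std_gaussian \<Otimes>\<^sub>M \<rho>)"
        by (simp add: case_prod_beta')
    qed
    then show "(\<lambda>u. emeasure (distr \<rho> seq_space enc) (?C u)) \<in> borel_measurable std_gaussian"
      unfolding em .
  qed
  interpret a: prob_space "distr \<mu> seq_space enc" by (rule prob[OF \<mu>])
  interpret b: prob_space "distr \<nu> seq_space enc" by (rule prob[OF \<nu>])
  have "(\<integral>\<^sup>+z. \<integral>\<^sup>+u. ?f z u \<partial>std_gaussian \<partial>\<mu>) \<le> (\<integral>\<^sup>+u. emeasure (distr \<nu> seq_space enc) (?C u) + ennreal \<delta> \<partial>(std_gaussian :: (real ^ 'd) measure))"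
    unfolding swap[OF \<mu>] using close[OF C] \<delta>
    by (intro nn_integral_mono) (simp add: a.emeasure_eq_measure b.emeasure_eq_measure flip: ennreal_plus)
  also have "\<dots> = (\<integral>\<^sup>+z. \<integral>\<^sup>+u. ?f z u \<partial>std_gaussian \<partial>\<nu>) + ennreal \<delta>"
  proof -
    have "emeasure (std_gaussian :: (real ^ 'd) measure) (space std_gaussian) = 1" by (rule std_gaussian.emeasure_space_1)
    then show ?thesis unfolding swap[OF \<nu>] by (subst nn_integral_add[OF meas[OF \<nu>]]) auto
  qed
  finally show ?thesis .
qed

text \<open>One step from the limit \<mu> is compared with one step from the law \<nu> m at time m,
  which yields \<nu> (m + 1) and hence again the limit. The true predictor is replaced by a
  truncated one on both sides, at the price 2 \<eta> j.\<close>

lemma invariant_exists: "\<exists>\<mu>. invariant_distribution PW Q \<mu>"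
proof -
  obtain L \<delta> where L: "prob_space L" and sets_L: "sets L = sets (seq_space :: 'd seq measure)" and \<delta>: "\<And>p. \<delta> p \<longlonglongrightarrow> 0"
    and close: "\<And>p m B. local_set p B \<Longrightarrow> \<bar>measure (distr (law_at rest m) seq_space enc) B - measure L B\<bar> \<le> \<delta> p m"
    by (rule limit_law[OF that])
  interpret L: prob_space L by fact
  interpret W: prob_space PW by (rule prob_space_past_law)
  define \<nu> where "\<nu> m = law_at rest m" for m
  have \<nu>: "initial_distribution PW (\<nu> m)" for m
    unfolding \<nu>_def by (rule law_at_initial[OF rest_initial])
  define \<mu> where "\<mu> = distr L state_space dec"
  have dec_L: "dec \<in> L \<rightarrow>\<^sub>M state_space"
    unfolding measurable_cong_sets[OF sets_L refl] by (rule dec_meas)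
  have enc_\<mu>: "distr \<mu> seq_space enc = L"
    unfolding \<mu>_def distr_distr[OF enc_meas dec_L] by (simp add: comp_def distr_id2 sets_L)
  have lim: "(\<lambda>m. measure (distr (\<nu> m) seq_space enc) B) \<longlonglongrightarrow> measure L B" if B: "local_set p B" for p B
  proof (rule LIM_zero_cancel, rule Lim_null_comparison[OF _ \<delta>])
    show "\<forall>\<^sub>F m in sequentially. norm (measure (distr (\<nu> m) seq_space enc) B - measure L B) \<le> \<delta> p m"
      using close[OF B] by (simp add: \<nu>_def)
  qed
  have tl: "(\<lambda>y k. y (Suc k)) \<in> seq_space \<rightarrow>\<^sub>M (seq_space :: 'd seq measure)"
    by (rule measurable_PiM_single') auto
  \<comment> \<open>The marginal on pasts is the same for every \<nu> m and survives in the
    limit.\<close>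
  have \<mu>_initial: "initial_distribution PW \<mu>"
  proof -
    have "distr L seq_space (\<lambda>y k. y (Suc k)) = PW"
    proof (rule measure_eq_from_local)
      show "finite_measure PW" by (rule W.finite_measure_axioms)
      have tl_L: "(\<lambda>y k. y (Suc k)) \<in> L \<rightarrow>\<^sub>M seq_space"
        unfolding measurable_cong_sets[OF sets_L refl] by (rule tl)
      show "finite_measure (distr L seq_space (\<lambda>y k. y (Suc k)))"
        using L.prob_space_distr[OF tl_L] by (simp add: prob_space_def)
      fix p B assume B: "local_set p (B :: 'd seq set)"
      note Bs = local_set_sets[OF B]
      have B': "local_set (Suc p) ((\<lambda>y k. y (Suc k)) -` B)"
        unfolding local_set_def
      proof (intro conjI allI impI)
        show "(\<lambda>y k. y (Suc k)) -` B \<in> sets (seq_space :: 'd seq measure)"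
          using measurable_sets[OF tl Bs] by (simp add: space_PiM)
        fix y y' :: "'d seq" assume "\<forall>k\<le>Suc p. y k = y' k"
        then have "(\<lambda>k. y (Suc k)) \<in> B \<longleftrightarrow> (\<lambda>k. y' (Suc k)) \<in> B" by (intro local_setD[OF B]) auto
        then show "y \<in> (\<lambda>y k. y (Suc k)) -` B \<longleftrightarrow> y' \<in> (\<lambda>y k. y (Suc k)) -` B" by simp
      qed
      have "measure (distr (\<nu> m) seq_space enc) ((\<lambda>y k. y (Suc k)) -` B) = measure PW B" for m
      proof -
        have m1: "enc \<in> \<nu> m \<rightarrow>\<^sub>M seq_space" and m2: "snd \<in> \<nu> m \<rightarrow>\<^sub>M seq_space"
          unfolding measurable_initial[OF \<nu>] by (rule enc_meas, rule measurable_snd)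
        have "measure (distr (\<nu> m) seq_space enc) ((\<lambda>y k. y (Suc k)) -` B) = measure (\<nu> m) (enc -` ((\<lambda>y k. y (Suc k)) -` B) \<inter> space (\<nu> m))"
          by (rule measure_distr[OF m1 local_set_sets[OF B']])
        also have "enc -` ((\<lambda>y k. y (Suc k)) -` B) = snd -` B" by (auto simp: enc_def)
        also have "measure (\<nu> m) (snd -` B \<inter> space (\<nu> m)) = measure (distr (\<nu> m) seq_space snd) B"
          by (rule measure_distr[OF m2 Bs, symmetric])
        finally show ?thesis unfolding snd_\<mu>[OF \<nu>] .
      qed
      then have "measure L ((\<lambda>y k. y (Suc k)) -` B) = measure PW B"
        using LIMSEQ_unique[OF lim[OF B']] by simp
      moreover have "space L = UNIV" using sets_eq_imp_space_eq[OF sets_L] by (simp add: space_PiM)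
      ultimately show "measure (distr L seq_space (\<lambda>y k. y (Suc k))) B = measure PW B"
        by (subst measure_distr[OF tl_L Bs]) simp
    qed (simp_all add: sets_past_law)
    moreover have "distr \<mu> seq_space snd = distr L seq_space (\<lambda>y k. y (Suc k))"
      unfolding \<mu>_def distr_distr[OF measurable_snd dec_L] by (simp add: comp_def dec_def)
    ultimately show ?thesis
      unfolding initial_distribution_def \<mu>_def using L.prob_space_distr[OF dec_L] by simp
  qed
  show ?thesis
  proof (rule predictor_approximation, goal_cases)
  case (1 \<eta>)
  note \<eta> = 1(1) and \<eta>0 = 1(2) and approx = 1(3)
  have prob_enc: "prob_space (distr \<rho> seq_space enc)" if "initial_distribution PW \<rho>" for \<rho>
  proof -
    have "enc \<in> \<rho> \<rightarrow>\<^sub>M seq_space"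
      unfolding measurable_initial[OF that] by (rule enc_meas)
    then show ?thesis by (rule prob_space.prob_space_distr[OF prob_\<mu>[OF that]])
  qed
  have "distr (law_at \<mu> 1) seq_space enc = L"
  proof (rule measure_eq_from_local)
    interpret X: prob_space "distr (law_at \<mu> 1) seq_space enc"
      by (rule prob_enc[OF law_at_initial[OF \<mu>_initial]])
    show "finite_measure (distr (law_at \<mu> 1) seq_space enc)" by (rule X.finite_measure_axioms)
    show "finite_measure L" by (rule L.finite_measure_axioms)
    fix p B assume B: "local_set p (B :: 'd seq set)"
    note Bs = local_set_sets[OF B]
    have step1: "step B v \<le> 1" for v by (simp add: step_def indicator_def)
    \<comment> \<open>Each law pays \<eta> j for the truncation of its predictor; d is the distance
      of the laws on the coordinates read by the truncated step.\<close>
    have N: "measure (distr (law_at \<rho> 1) seq_space enc) B \<le> measure (distr (law_at \<rho>' 1) seq_space enc) B + (2 * \<eta> j + d)"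
      if \<rho>: "initial_distribution PW \<rho>" "initial_distribution PW \<rho>'" and d: "0 \<le> d"
        and cl: "\<And>C. local_set (max p (subseq_b j)) C \<Longrightarrow> measure (distr \<rho> seq_space enc) C \<le> measure (distr \<rho>' seq_space enc) C + d" for \<rho> \<rho>' j d
    proof -
      interpret r: prob_space "distr (law_at \<rho> 1) seq_space enc" by (rule prob_enc[OF law_at_initial[OF \<rho>(1)]])
      interpret r': prob_space "distr (law_at \<rho>' 1) seq_space enc" by (rule prob_enc[OF law_at_initial[OF \<rho>(2)]])
      let ?T = "\<lambda>\<rho>. \<integral>\<^sup>+z. \<integral>\<^sup>+u. step B (z, approx_predictor j (snd z) + a 0 *\<^sub>R u) \<partial>std_gaussian \<partial>\<rho>"
      have "emeasure (distr (law_at \<rho> 1) seq_space enc) B \<le> ?T \<rho> + ennreal (\<eta> j)"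
        unfolding law_at_1[OF \<rho>(1) Bs] using approx[OF \<rho>(1) step_meas[OF Bs] step1, of j] by blast
      also have "\<dots> \<le> (?T \<rho>' + ennreal d) + ennreal (\<eta> j)"
        by (intro add_right_mono approx_step_close[OF \<rho> B cl d])
      also have "\<dots> \<le> ((emeasure (distr (law_at \<rho>' 1) seq_space enc) B + ennreal (\<eta> j)) + ennreal d) + ennreal (\<eta> j)"
        unfolding law_at_1[OF \<rho>(2) Bs] using approx[OF \<rho>(2) step_meas[OF Bs] step1, of j] by (intro add_right_mono) blast
      also have "\<dots> = ennreal (measure (distr (law_at \<rho>' 1) seq_space enc) B + (2 * \<eta> j + d))"
        using d \<eta>0[of j] by (simp add: r'.emeasure_eq_measure algebra_simps del: One_nat_def flip: ennreal_plus)
      finally show ?thesis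
        unfolding r.emeasure_eq_measure by (subst (asm) ennreal_le_iff) (use d \<eta>0[of j] in auto)
    qed
    have \<nu>_Suc: "law_at (\<nu> m) 1 = \<nu> (Suc m)" for m
      unfolding \<nu>_def law_at_add[OF rest_initial] by simp
    have lim': "(\<lambda>m. measure (distr (law_at (\<nu> m) 1) seq_space enc) B) \<longlonglongrightarrow> measure L B"
      unfolding \<nu>_Suc by (rule LIMSEQ_Suc[OF lim[OF B]])
    have cl: "\<bar>measure (distr (\<nu> m) seq_space enc) C - measure (distr \<mu> seq_space enc) C\<bar> \<le> \<delta> q m" if "local_set q C" for q C m
      unfolding enc_\<mu> \<nu>_def by (rule close[OF that])
    have \<delta>0: "0 \<le> \<delta> q m" for q m
      using close[of q "{}" m] by (simp add: local_set_def)
    let ?x = "measure (distr (law_at \<mu> 1) seq_space enc) B"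
    \<comment> \<open>The window depends on j, so m tends to infinity at fixed j and j only
      afterwards.\<close>
    have up: "?x \<le> measure L B + 2 * \<eta> j" and dn: "measure L B \<le> ?x + 2 * \<eta> j" for j
    proof -
      let ?q = "max p (subseq_b j)"
      have cl': "measure (distr (\<nu> m) seq_space enc) C \<le> measure (distr \<mu> seq_space enc) C + \<delta> ?q m"
        "measure (distr \<mu> seq_space enc) C \<le> measure (distr (\<nu> m) seq_space enc) C + \<delta> ?q m" if "local_set ?q C" for C m
        using cl[OF that, of m] by (simp_all add: abs_le_iff)
      have "?x \<le> measure (distr (law_at (\<nu> m) 1) seq_space enc) B + (2 * \<eta> j + \<delta> ?q m)"
        and "measure (distr (law_at (\<nu> m) 1) seq_space enc) B \<le> ?x + (2 * \<eta> j + \<delta> ?q m)" for m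
        by (rule N[OF \<mu>_initial \<nu> \<delta>0 cl'(2)], assumption, rule N[OF \<nu> \<mu>_initial \<delta>0 cl'(1)], assumption)
      moreover have "(\<lambda>m. measure (distr (law_at (\<nu> m) 1) seq_space enc) B + (2 * \<eta> j + \<delta> ?q m)) \<longlonglongrightarrow> measure L B + (2 * \<eta> j + 0)"
        and "(\<lambda>m. ?x + (2 * \<eta> j + \<delta> ?q m)) \<longlonglongrightarrow> ?x + (2 * \<eta> j + 0)"
        by (intro tendsto_intros lim' \<delta>)+
      ultimately show "?x \<le> measure L B + 2 * \<eta> j" "measure L B \<le> ?x + 2 * \<eta> j"
        using LIMSEQ_le_const[of _ "measure L B + (2 * \<eta> j + 0)" ?x] LIMSEQ_le[OF lim', of _ "?x + (2 * \<eta> j + 0)"] by auto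
    qed
    have \<eta>2: "(\<lambda>j. x + 2 * \<eta> j) \<longlonglongrightarrow> x" for x
      using tendsto_add[OF tendsto_const tendsto_mult_right_zero[OF \<eta>]] by force
    show "?x = measure L B"
      using LIMSEQ_le_const[OF \<eta>2[of "measure L B"]] LIMSEQ_le_const[OF \<eta>2[of ?x]] up dn by (intro antisym) blast+
  qed (simp_all add: sets_L)
  then have "distr (distr (law_at \<mu> 1) seq_space enc) state_space dec = \<mu>" by (simp add: \<mu>_def)
  moreover have "enc \<in> law_at \<mu> 1 \<rightarrow>\<^sub>M seq_space"
    unfolding measurable_initial[OF law_at_initial[OF \<mu>_initial]] by (rule enc_meas)
  ultimately have "law_at \<mu> 1 = \<mu>"
    by (simp add: distr_distr[OF dec_meas] comp_def distr_id2 sets_\<mu>[OF law_at_initial[OF \<mu>_initial]])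
  then have "\<mu> \<bind> Q = \<mu>" by (simp add: law_at_Suc[OF \<mu>_initial] law_at_0[OF \<mu>_initial])
  with \<mu>_initial show ?thesis by (auto simp: invariant_distribution_def)
  qed
qed

section \<open>Uniqueness and convergence\<close>

lemma invariant_shift:
  assumes "invariant_distribution PW Q \<mu>"
  shows "shifted_law n (trajectory_law Q \<mu>) = trajectory_law Q \<mu>"
  using assms trajectory_law_at[of \<mu> n] by (simp add: law_at_invariant invariant_distribution_def)

text \<open>Invariant distributions integrate V, and their trajectory laws are unchanged by shifts.
  The distance between two such laws is therefore at most C / n for every n, that is 0.\<close>

lemma invariant_unique_convergence:
  obtains \<mu>s where "invariant_distribution PW Q \<mu>s"
    "\<And>\<nu>. invariant_distribution PW Q \<nu> \<Longrightarrow> trajectory_law Q \<nu> = trajectory_law Q \<mu>s"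
    "\<And>\<mu>. \<lbrakk>initial_distribution PW \<mu>; V_mean \<mu> < \<infinity>\<rbrakk> \<Longrightarrow>
       \<exists>C>0. \<forall>n\<ge>1. tv_dist (shifted_law n (trajectory_law Q \<mu>)) (trajectory_law Q \<mu>s) \<le> C / real n"
proof -
  obtain \<mu>s where s: "invariant_distribution PW Q \<mu>s" using invariant_exists by blast
  show thesis
  proof (rule V_mean_law_at, goal_cases)
  case (1 R)
  note R = 1(1) and VR = 1(3)
  show thesis
  proof (rule tv_dist_shifted_law, goal_cases)
  case (1 C)
  note C = 1(1) and tv = 1(2)
  have ini: "initial_distribution PW \<nu>" "V_mean \<nu> < \<infinity>" if "invariant_distribution PW Q \<nu>" for \<nu>
    using that VR[OF that] by (auto simp: invariant_distribution_def intro: le_less_trans)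
  have conv: "\<exists>C>0. \<forall>n\<ge>1. tv_dist (shifted_law n (trajectory_law Q \<mu>)) (trajectory_law Q \<mu>s) \<le> C / real n"
    if "initial_distribution PW \<mu>" "V_mean \<mu> < \<infinity>" for \<mu>
    using tv[OF that(1) ini(1)[OF s] that(2) ini(2)[OF s]] C invariant_shift[OF s]
    by (intro exI[of _ "C * (2 + enn2real (V_mean \<mu>) + enn2real (V_mean \<mu>s))"]) (auto intro!: mult_pos_pos add_pos_nonneg)
  show thesis
  proof (rule that[OF s _ conv])
    fix \<nu> assume \<nu>: "invariant_distribution PW Q \<nu>"
    obtain C where C: "\<And>n. n \<ge> 1 \<Longrightarrow> tv_dist (trajectory_law Q \<nu>) (trajectory_law Q \<mu>s) \<le> C / real n"
      using conv[OF ini[OF \<nu>]] invariant_shift[OF \<nu>] by auto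
    have "(\<lambda>n. C / real n) \<longlonglongrightarrow> 0" by (rule lim_const_over_n)
    then have tv0: "tv_dist (trajectory_law Q \<nu>) (trajectory_law Q \<mu>s) \<le> 0"
      by (rule LIMSEQ_le_const) (use C in blast)
    have prob: "prob_space (trajectory_law Q \<rho>)" if "invariant_distribution PW Q \<rho>" for \<rho>
    proof -
      have \<rho>: "initial_distribution PW \<rho>" using ini[OF that] by simp
      have "(\<lambda>z k. traj F (fst (fst z)) (noise_path z) (0 + k)) \<in> Om \<rho> \<rightarrow>\<^sub>M seq_space"
        unfolding measurable_Om[OF \<rho>]
      proof (rule measurable_PiM_single')
        fix k show "(\<lambda>z. traj F (fst (fst z)) (noise_path z) (0 + k)) \<in> borel_measurable path_space"
          by (intro measurable_traj F_meas measurable_noise_path measurable_compose[OF measurable_fst measurable_fst])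
      qed auto
      then show ?thesis
        using prob_space.prob_space_distr[OF prob_Om[OF \<rho>]] shifted_trajectory_law[OF \<rho>, of 0]
        by (simp add: invariant_shift[OF that])
    qed
    interpret a: prob_space "trajectory_law Q \<nu>" by (rule prob[OF \<nu>])
    interpret b: prob_space "trajectory_law Q \<mu>s" by (rule prob[OF s])
    show "trajectory_law Q \<nu> = trajectory_law Q \<mu>s"
    proof (rule measure_eqI)
      show "sets (trajectory_law Q \<nu>) = sets (trajectory_law Q \<mu>s)" by (simp add: trajectory_law_def)
      fix A assume A: "A \<in> sets (trajectory_law Q \<nu>)"
      have "\<bar>measure (trajectory_law Q \<nu>) A - measure (trajectory_law Q \<mu>s) A\<bar> \<le> tv_dist (trajectory_law Q \<nu>) (trajectory_law Q \<mu>s)"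
        unfolding tv_dist_def
      proof (rule cSUP_upper[OF A])
        show "bdd_above ((\<lambda>A. \<bar>measure (trajectory_law Q \<nu>) A - measure (trajectory_law Q \<mu>s) A\<bar>) ` sets (trajectory_law Q \<nu>))"
        proof (rule bdd_aboveI2)
          fix A
          show "\<bar>measure (trajectory_law Q \<nu>) A - measure (trajectory_law Q \<mu>s) A\<bar> \<le> 1"
            using a.prob_le_1[of A] b.prob_le_1[of A] measure_nonneg[of "trajectory_law Q \<nu>" A] measure_nonneg[of "trajectory_law Q \<mu>s" A]
            unfolding abs_le_iff by linarith
        qed
      qed
      then show "emeasure (trajectory_law Q \<nu>) A = emeasure (trajectory_law Q \<mu>s) A"
        using tv0 by (simp add: a.emeasure_eq_measure b.emeasure_eq_measure)
    qed
  qed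
  qed
  qed
qed

end

subsection \<open>The theorem\<close>

lemma v_H_le: "0 < H \<Longrightarrow> v_H H \<le> 1"
proof -
  assume "0 < H"
  then have "H * (1 - 2 * H) \<le> 1 / 4 * 1" if "H \<le> 1/4"
    using that by (intro mult_mono) auto
  then show ?thesis by (auto simp: v_H_def)
qed

theorem proposition2p3:
  fixes h H :: real
  assumes "h > 0" and "0 < H" and "H < 1/2"
  shows
    "(\<exists>C>0. \<forall>k. \<bar>b_coeff h H k\<bar> \<le> C * (real k + 1) powr (- (H + 1/2))) \<and>
     v_H H = v_exp (H + 1/2) (3/2 - H) \<and>
     (\<forall>(M :: 'w measure) (\<xi> :: int \<Rightarrow> 'w \<Rightarrow> real ^ 'd) \<Delta> P F V.
        prob_space M \<and> iid_std_gaussian M \<xi> \<and> moving_average M (a_coeff h H) \<xi> \<Delta> \<and>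
        noise_kernel M \<Delta> P \<and> continuous_on UNIV F \<and> hyp_H1 F V \<and> hyp_H2 F \<longrightarrow>
        (\<exists>\<mu>\<^sub>s. invariant_distribution (past_law M \<Delta>) (Q_kernel F P) \<mu>\<^sub>s \<and>
           (\<forall>\<nu>. invariant_distribution (past_law M \<Delta>) (Q_kernel F P) \<nu> \<longrightarrow>
              trajectory_law (Q_kernel F P) \<nu> = trajectory_law (Q_kernel F P) \<mu>\<^sub>s) \<and>
           (\<forall>\<mu>\<^sub>0. initial_distribution (past_law M \<Delta>) \<mu>\<^sub>0 \<and>
              (\<integral>\<^sup>+x. ennreal (V x) \<partial>distr \<mu>\<^sub>0 borel fst) < \<infinity> \<longrightarrow>
              (\<forall>\<epsilon>>0. \<exists>C>0. \<forall>n\<ge>1.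
                 tv_dist (shifted_law n (trajectory_law (Q_kernel F P) \<mu>\<^sub>0))
                         (trajectory_law (Q_kernel F P) \<mu>\<^sub>s)
                 \<le> C * real n powr (- (v_H H - \<epsilon>))))))"
proof (intro conjI allI impI)
  show "\<exists>C>0. \<forall>k. \<bar>b_coeff h H k\<bar> \<le> C * (real k + 1) powr (- (H + 1/2))"
    using assms by (intro rough.b_coeff_bound rough.intro)
  show "v_H H = v_exp (H + 1/2) (3/2 - H)"
    using assms(2,3) by (rule v_H_eq_v_exp)
  fix M :: "'w measure" and \<xi> :: "int \<Rightarrow> 'w \<Rightarrow> real ^ 'd" and \<Delta> P
    and F :: "(real ^ 'd) \<times> (real ^ 'd) \<Rightarrow> real ^ 'd" and V :: "real ^ 'd \<Rightarrow> real"
  assume asm: "prob_space M \<and> iid_std_gaussian M \<xi> \<and> moving_average M (a_coeff h H) \<xi> \<Delta> \<and>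
        noise_kernel M \<Delta> P \<and> continuous_on UNIV F \<and> hyp_H1 F V \<and> hyp_H2 F"
  then obtain g C1 where H1: "continuous_on UNIV V" "\<And>x. 0 < V x" "filterlim V at_top at_infinity"
    "0 < g" "g < 1" "0 < C1" "\<And>x w. V (F (x, w)) \<le> g * V x + C1 * (1 + norm w)"
    unfolding hyp_H1_def by blast
  interpret model h H M \<xi> \<Delta> P F V g C1
    using asm H1 assms
    by (intro model.intro dynamics.intro dynamics_axioms.intro noise.intro noise_axioms.intro rough.intro drift.intro borel_measurable_continuous_onI) auto
  obtain \<mu>s where \<mu>s: "invariant_distribution PW Q \<mu>s"
    "\<And>\<nu>. invariant_distribution PW Q \<nu> \<Longrightarrow> trajectory_law Q \<nu> = trajectory_law Q \<mu>s"
    "\<And>\<mu>. \<lbrakk>initial_distribution PW \<mu>; V_mean \<mu> < \<infinity>\<rbrakk> \<Longrightarrow>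
       \<exists>C>0. \<forall>n\<ge>1. tv_dist (shifted_law n (trajectory_law Q \<mu>)) (trajectory_law Q \<mu>s) \<le> C / real n"
    by (rule invariant_unique_convergence[OF that])
  have conv: "\<exists>C>0. \<forall>n\<ge>1. tv_dist (shifted_law n (trajectory_law Q \<mu>)) (trajectory_law Q \<mu>s) \<le> C * real n powr (- (v_H H - \<epsilon>))"
    if \<mu>: "initial_distribution PW \<mu>" and V: "(\<integral>\<^sup>+x. ennreal (V x) \<partial>distr \<mu> borel fst) < \<infinity>" and \<epsilon>: "0 < \<epsilon>" for \<mu> \<epsilon>
  proof -
    have "fst \<in> \<mu> \<rightarrow>\<^sub>M (borel :: (real ^ 'd) measure)"
      unfolding measurable_initial[OF \<mu>] by measurable
    then have "V_mean \<mu> < \<infinity>"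
      using V unfolding V_mean_def by (subst (asm) nn_integral_distr) auto
    then obtain C where C: "0 < C" "\<And>n. n \<ge> 1 \<Longrightarrow> tv_dist (shifted_law n (trajectory_law Q \<mu>)) (trajectory_law Q \<mu>s) \<le> C / real n"
      using \<mu>s(3)[OF \<mu>] by blast
    \<comment> \<open>The exponent v_H - \<epsilon> is below 1, so the rate 1 / n is enough for
      every \<epsilon>, with the same constant.\<close>
    have "C / real n \<le> C * real n powr (- (v_H H - \<epsilon>))" if "n \<ge> 1" for n
    proof -
      have "C / real n = C * real n powr (- 1)" using that by (simp add: powr_minus divide_inverse)
      also have "\<dots> \<le> C * real n powr (- (v_H H - \<epsilon>))"
        using C that v_H_le[OF assms(2)] \<epsilon> by (intro mult_left_mono powr_mono) auto
      finally show ?thesis .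
    qed
    then show ?thesis using C by (intro exI[of _ C]) (auto intro: order_trans)
  qed
  show "\<exists>\<mu>\<^sub>s. invariant_distribution (past_law M \<Delta>) (Q_kernel F P) \<mu>\<^sub>s \<and>
           (\<forall>\<nu>. invariant_distribution (past_law M \<Delta>) (Q_kernel F P) \<nu> \<longrightarrow>
              trajectory_law (Q_kernel F P) \<nu> = trajectory_law (Q_kernel F P) \<mu>\<^sub>s) \<and>
           (\<forall>\<mu>\<^sub>0. initial_distribution (past_law M \<Delta>) \<mu>\<^sub>0 \<and>
              (\<integral>\<^sup>+x. ennreal (V x) \<partial>distr \<mu>\<^sub>0 borel fst) < \<infinity> \<longrightarrow>
              (\<forall>\<epsilon>>0. \<exists>C>0. \<forall>n\<ge>1.
                 tv_dist (shifted_law n (trajectory_law (Q_kernel F P) \<mu>\<^sub>0))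
                         (trajectory_law (Q_kernel F P) \<mu>\<^sub>s)
                 \<le> C * real n powr (- (v_H H - \<epsilon>))))"
    using \<mu>s(1,2) conv by (intro exI[of _ \<mu>s]) blast
qed

end
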